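(* For every real $x\ge 0$, \[ \pi(x) < \frac{x}{W(x)} = e^{W(x)}, \] where at $x=0$ the right-hand side is understood as $e^{W(0)}=1$.
   Context: $\pi(x)$ denotes the number of primes $\le x$. $W=W_0$ denotes the principal real branch of the Lambert $W$ function, i.e. the unique real solution $w\ge -1$ of $w e^{w}=x$, defined for $x\ge -1/e$; for $x>0$ one has $x/W(x)=e^{W(x)}$ by the defining equation. *)

theory Defs
  imports "HOL-Analysis.Analysis" "HOL-Computational_Algebra.Primes"
begin

definition primes_pi :: "real \<Rightarrow> nat" where
  "primes_pi x = card {p :: nat. prime p \<and> real p \<le> x}"

lemma finite_primes_le: "finite {p :: nat. prime p \<and> real p \<le> x}"
proof (rule finite_subset)
  show "{p :: nat. prime p \<and> real p \<le> x} \<subseteq> {..nat \<lfloor>x\<rfloor>}"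
    by (auto simp: le_nat_floor)
qed simp

text \<open>
  Principal real branch. The description is only meaningful for \<open>x \<ge> - exp (- 1)\<close>;
  for smaller \<open>x\<close> there is no such \<open>w\<close> and the value is unspecified.
\<close>
definition lambert_W :: "real \<Rightarrow> real" where
  "lambert_W x = (THE w. w \<ge> - 1 \<and> w * exp w = x)"

lemma lambert_W_ex1:
  fixes x :: real
  assumes "x \<ge> - exp (- 1)"
  shows "\<exists>!w. w \<ge> - 1 \<and> w * exp w = x"
proof -
  define f :: "real \<Rightarrow> real" where "f = (\<lambda>w. w * exp w)"
  have mono: "f a < f b" if "- 1 \<le> a" "a < b" for a b
  proof (rule DERIV_pos_imp_increasing_open[OF that(2)])
    fix w assume "a < w" "w < b"
    have "(f has_real_derivative (1 + w) * exp w) (at w)"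
      unfolding f_def by (rule derivative_eq_intros refl | simp add: algebra_simps)+
    moreover have "(1 + w) * exp w > 0"
      using \<open>- 1 \<le> a\<close> \<open>a < w\<close> by (intro mult_pos_pos) auto
    ultimately show "\<exists>y. (f has_real_derivative y) (at w) \<and> y > 0" by blast
  next
    show "continuous_on {a..b} f" unfolding f_def by (intro continuous_intros)
  qed
  define M where "M = max 0 x"
  have "M * 1 \<le> M * exp M" by (rule mult_left_mono) (auto simp: M_def)
  then have "x \<le> f M" by (auto simp: f_def M_def)
  moreover have "f (- 1) \<le> x" using assms by (simp add: f_def)
  moreover have "continuous_on {- 1..M} f" unfolding f_def by (intro continuous_intros)
  ultimately obtain w where "w \<ge> - 1" "f w = x"
    using IVT'[of f "- 1" x M] by (force simp: M_def)
  moreover have "v = w" if "v \<ge> - 1" "f v = x" for v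
    using mono[of v w] mono[of w v] that \<open>w \<ge> - 1\<close> \<open>f w = x\<close>
    by (cases v w rule: linorder_cases) auto
  ultimately show ?thesis unfolding f_def by blast
qed

end

theory Submission
  imports Defs "HOL-Complex_Analysis.Complex_Analysis" "HOL-Real_Asymp.Real_Asymp" "HOL-Number_Theory.Prime_Powers"
begin

text \<open>
  Since \<open>w exp w\<close> is increasing, it suffices to find \<open>M \<ge> \<pi>(x)\<close> with \<open>M ln M < x\<close>; in this form it is Rosser's theorem
  \<open>p\<^sub>n > n ln n\<close>. Partial summation reduces it to \<open>\<psi>(x) \<le> (1 + \<epsilon>) x\<close> with \<open>\<epsilon>\<close> about \<open>(ln L - 1) / L\<close>, \<open>L = ln x\<close>.
  For \<open>9 \<le> L \<le> 24\<close> an elementary Chebyshev estimate with period 210 is good enough, and below that primes are counted.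

  For \<open>L \<ge> 24\<close>, let \<open>K\<close> be about \<open>(L / \<delta>)\<^sup>2\<close> and \<open>Z = K / L\<close>. The Taylor polynomial of \<open>- \<zeta>'/\<zeta>\<close> of degree \<open>K - 1\<close>, expanded at the
  real point \<open>Z\<close> and evaluated at 0, is \<open>\<Sum> \<Lambda>(n) P(Poisson(Z ln n) < K)\<close>; adding \<open>sqrt (2K) + 1\<close> times the next term turns
  the weights into a majorant of the indicator function of \<open>n \<le> x\<close>. On the other side a pole \<open>\<rho>\<close> contributes \<open>(q\<^sup>K - 1)/\<rho>\<close> with \<open>q = Z/(Z - \<rho>)\<close>, so no
  contour integral is needed, and \<open>\<bar>q\<bar>\<^sup>K\<close> decays like \<open>exp (L \<beta> - \<gamma>\<^sup>2 \<delta>\<^sup>2 / 2)\<close>. The partial fraction expansion of \<open>\<zeta>'/\<zeta>\<close> comes from the fact that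
  \<open>\<xi>\<close>, as a function of \<open>v = s (s - 1)\<close>, is an entire function of order less than one. Zeros are controlled by a zero-free
  region (the inequality \<open>3 + 4 cos + cos 2 \<ge> 0\<close> with Stechkin's trick, made explicit on a table of intervals) and by
  comparing the sum over zeros with \<open>Re (- \<zeta>'/\<zeta>)\<close> at one point \<open>a + i t\<close>.
\<close>

subsection \<open>The theta function\<close>

text \<open>The demand on \<psi> is an error of order ln L / L. If \<pi>(x) is at most
  \<open>M = x (1 + \<kappa>) / L\<close> with
  \<open>\<kappa> = \<epsilon> + 1.104 (1 + 3/L) / L\<close>, then \<open>M ln M < x\<close> follows
  from \<open>\<kappa> L < (1 + \<kappa>) (ln L - \<kappa>)\<close>. So a smoothing of width
  \<delta> may be paid for linearly; its price is about sqrt 2 \<delta> and comes from the extra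
  Taylor term at the pole. The difficulty lies at moderate \<open>L\<close>, where the low zeros are
  controlled only by the bound 11/2 for their heights, read off at \<open>s = 4\<close>, and by the
  zero-free region. Zeros are never summed to infinity. In the variable \<open>v\<close> growth is
  so slow that the exponential factor of the product over zeros vanishes in the limit: on any given
  disc the logarithmic derivative is a finite sum over zeros plus an error as small as desired.
  Every inequality is proved for such a finite family, and then the error is sent to 0. The
  functional equation is obtained in the same spirit: theta inversion is the limit of Polya's finite
  identity for sums of cos^(2m).\<close>

lemma sum_cis_multiples:
  assumes "l > 0"
  shows "(\<Sum>j<l. cis (2 * pi * real_of_int d * real j / real l)) = (if int l dvd d then of_nat l else 0)"
proof -
  define w where "w = cis (2 * pi * real_of_int d / real l)"
  have pw: "cis (2 * pi * real_of_int d * real j / real l) = w ^ j" for j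
    unfolding w_def Complex.DeMoivre by (rule arg_cong[where f = cis]) simp
  have wl: "w ^ l = 1"
    using assms by (simp add: w_def Complex.DeMoivre cis_multiple_2pi)
  have w1: "w = 1 \<longleftrightarrow> int l dvd d"
  proof
    assume "w = 1"
    then have "cos (2 * pi * real_of_int d / real l) = 1"
      by (simp add: w_def complex_eq_iff)
    then obtain x :: int where "2 * pi * real_of_int d / real l = real_of_int x * 2 * pi"
      using cos_one_2pi_int by auto
    then have "real_of_int d = real_of_int (x * int l)"
      using assms by (simp add: field_simps)
    then have "d = x * int l" by linarith
    then show "int l dvd d" by simp
  next
    assume "int l dvd d"
    then obtain x where "d = int l * x" by (rule dvdE)
    then have "2 * pi * real_of_int d / real l = 2 * pi * real_of_int x"
      using assms by simp
    then show "w = 1" unfolding w_def by (simp add: cis_multiple_2pi)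
  qed
  show ?thesis
  proof (cases "w = 1")
    case True
    then show ?thesis using w1 by (simp add: pw)
  next
    case False
    then have "(\<Sum>j<l. w ^ j) = 0"
      by (simp add: geometric_sum wl)
    then show ?thesis using w1 False by (simp add: pw)
  qed
qed

text \<open>Expanding \<open>(cis x + cis (-x))^(2m)\<close> binomially, the sum over
  \<open>j\<close> of each frequency is a root-of-unity filter; it keeps the indices congruent to
  \<open>m\<close> modulo \<open>l\<close>.\<close>

lemma sum_cos_power_even:
  assumes "l > 0"
  shows "(\<Sum>j<l. cos (pi * real j / real l) ^ (2*m)) =
         real l / 4 ^ m * (\<Sum>i\<le>2*m. if int l dvd int i - int m then real ((2*m) choose i) else 0)"
proof -
  have "complex_of_real (4 ^ m * (\<Sum>j<l. cos (pi * real j / real l) ^ (2*m))) =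
     (\<Sum>j<l. (2 * of_real (cos (pi * real j / real l))) ^ (2*m))"
    by (simp add: power_mult_distrib power_mult sum_distrib_left)
  also have "\<dots> = (\<Sum>j<l. \<Sum>i\<le>2*m. of_nat ((2*m) choose i) * cis (2 * pi * real_of_int (int i - int m) * real j / real l))"
  proof (rule sum.cong[OF refl])
    fix j
    let ?x = "pi * real j / real l"
    have "2 * complex_of_real (cos ?x) = cis ?x + cis (- ?x)"
      by (simp add: complex_eq_iff)
    then have "(2 * complex_of_real (cos ?x)) ^ (2*m) = (cis ?x + cis (- ?x)) ^ (2*m)" by simp
    also have "\<dots> = (\<Sum>i\<le>2*m. of_nat ((2*m) choose i) * cis ?x ^ i * cis (- ?x) ^ (2*m - i))"
      by (simp add: binomial_ring)
    also have "\<dots> = (\<Sum>i\<le>2*m. of_nat ((2*m) choose i) * cis (2 * pi * real_of_int (int i - int m) * real j / real l))"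
    proof (rule sum.cong[OF refl])
      fix i assume "i \<in> {..2*m}"
      then have "cis ?x ^ i * cis (- ?x) ^ (2*m - i) = cis (2 * pi * real_of_int (int i - int m) * real j / real l)"
        unfolding Complex.DeMoivre cis_mult
        by (intro arg_cong[where f = cis]) (simp add: of_nat_diff field_simps diff_divide_distrib)
      then show "of_nat ((2*m) choose i) * cis ?x ^ i * cis (- ?x) ^ (2*m - i) =
            of_nat ((2*m) choose i) * cis (2 * pi * real_of_int (int i - int m) * real j / real l)"
        by (simp only: mult.assoc)
    qed
    finally show "(2 * of_real (cos ?x)) ^ (2*m) = \<dots>" .
  qed
  also have "\<dots> = (\<Sum>i\<le>2*m. of_nat ((2*m) choose i) * (\<Sum>j<l. cis (2 * pi * real_of_int (int i - int m) * real j / real l)))"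
    by (subst sum.swap) (simp add: sum_distrib_left)
  also have "\<dots> = of_real (real l * (\<Sum>i\<le>2*m. if int l dvd int i - int m then real ((2*m) choose i) else 0))"
    unfolding sum_cis_multiples[OF assms] by (simp add: sum_distrib_left if_distrib mult_ac cong: if_cong)
  finally have "4 ^ m * (\<Sum>j<l. cos (pi * real j / real l) ^ (2*m)) =
      real l * (\<Sum>i\<le>2*m. if int l dvd int i - int m then real ((2*m) choose i) else 0)"
    by (simp only: of_real_eq_iff)
  then show ?thesis by (simp add: field_simps)
qed

lemma sum_cos_power_odd_modulus:
  "(\<Sum>j<2*a+1. cos (pi * real j / real (2*a+1)) ^ (2*m)) =
     1 + 2 * (\<Sum>j=1..a. cos (pi * real j / real (2*a+1)) ^ (2*m))"
proof -
  let ?f = "\<lambda>j. cos (pi * real j / real (2*a+1)) ^ (2*m)"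
  have "{..<2*a+1} = insert 0 ({1..a} \<union> {a+1..2*a})" by auto
  then have "(\<Sum>j<2*a+1. ?f j) = ?f 0 + (sum ?f {1..a} + sum ?f {a+1..2*a})"
    by (simp only:) (subst sum.insert; (subst sum.union_disjoint)?; auto)
  also have "sum ?f {a+1..2*a} = sum ?f {1..a}"
  proof (rule sum.reindex_bij_witness[of _ "\<lambda>j. 2*a+1-j" "\<lambda>j. 2*a+1-j"])
    fix j assume j: "j \<in> {a+1..2*a}"
    have "pi * real (2*a+1-j) / real (2*a+1) = pi - pi * real j / real (2*a+1)"
      using j by (simp add: of_nat_diff field_simps)
    then have "cos (pi * real (2*a+1-j) / real (2*a+1)) = - cos (pi * real j / real (2*a+1))"
      by (simp add: cos_diff)
    then show "?f (2*a+1-j) = ?f j" by simp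
  qed auto
  finally show ?thesis by simp
qed

lemma sum_binomial_multiples:
  assumes "l > 0"
  shows "(\<Sum>i\<le>2*m. if int l dvd int i - int m then real ((2*m) choose i) else 0) =
    real ((2*m) choose m) + 2 * (\<Sum>k=1..m. real ((2*m) choose (m + k*l)))"
proof -
  let ?g = "\<lambda>i. if int l dvd int i - int m then real ((2*m) choose i) else 0"
  have split: "{..2*m} = insert m ({..<m} \<union> {m<..2*m})" by auto
  have "(\<Sum>i\<le>2*m. ?g i) = ?g m + (sum ?g {..<m} + sum ?g {m<..2*m})"
    by (simp only: split) (subst sum.insert; (subst sum.union_disjoint)?; auto)
  also have "sum ?g {..<m} = sum ?g {m<..2*m}"
  proof (rule sum.reindex_bij_witness[of _ "\<lambda>i. 2*m-i" "\<lambda>i. 2*m-i"])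
    fix i assume i: "i \<in> {..<m}"
    have "int (2*m-i) - int m = - (int i - int m)" using i by (simp add: of_nat_diff)
    moreover have "(2*m) choose (2*m-i) = (2*m) choose i"
      using i by (simp add: binomial_symmetric[symmetric])
    ultimately show "?g (2*m-i) = ?g i" by (simp only: dvd_minus_iff)
  qed auto
  also have "sum ?g {m<..2*m} = (\<Sum>k=1..m. real ((2*m) choose (m + k*l)))"
  proof -
    have "(\<Sum>k=1..m. real ((2*m) choose (m + k*l))) = (\<Sum>k\<in>{k\<in>{1..m}. k*l \<le> m}. real ((2*m) choose (m + k*l)))"
      by (rule sum.mono_neutral_right) (auto simp: binomial_eq_0)
    also have "\<dots> = (\<Sum>i\<in>{i\<in>{m<..2*m}. int l dvd int i - int m}. real ((2*m) choose i))"
    proof (rule sum.reindex_bij_witness[of _ "\<lambda>i. (i - m) div l" "\<lambda>k. m + k*l"])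
      fix i assume i: "i \<in> {i \<in> {m<..2*m}. int l dvd int i - int m}"
      then have "int l dvd int (i - m)" by (simp add: of_nat_diff)
      then have d: "l dvd i - m" by presburger
      then show "m + (i - m) div l * l = i" using i by simp
      show "(i - m) div l \<in> {k \<in> {1..m}. k * l \<le> m}"
      proof -
        obtain q where q: "i - m = l * q" using d by (rule dvdE)
        have "q \<ge> 1" using q i by (cases q) auto
        moreover have "q \<le> l * q" using assms by simp
        moreover have "l * q \<le> m" using i q by auto
        ultimately have "q \<in> {1..m} \<and> q * l \<le> m"
          by (metis atLeastAtMost_iff le_trans mult.commute)
        moreover have "(i - m) div l = q" using q assms by simp
        ultimately show ?thesis by simp
      qed
    qed (use assms in auto)
    also have "\<dots> = sum ?g {m<..2*m}"
      by (subst sum.inter_filter) auto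
    finally show ?thesis by simp
  qed
  finally show ?thesis by simp
qed

text \<open>Both sides evaluate the sum of cos^(2m) over \<open>l = 2a+1\<close> equally spaced
  angles, once by symmetry and once through the surviving binomial coefficients. With
  \<open>m\<close> about \<open>\<tau> l^2\<close> the powers of the cosine tend to Gaussians in
  \<open>j\<close> and the binomial quotients to Gaussians in \<open>k\<close>, so two theta series
  arise as the limits of the two sides.\<close>

lemma polya_identity:
  "1 + 2 * (\<Sum>j=1..a. cos (pi * real j / real (2*a+1)) ^ (2*m)) =
   real (2*a+1) * real ((2*m) choose m) / 4 ^ m *
     (1 + 2 * (\<Sum>k=1..m. real ((2*m) choose (m + k*(2*a+1))) / real ((2*m) choose m)))"
proof -
  have pos: "real ((2*m) choose m) > 0" by simp
  have "1 + 2 * (\<Sum>j=1..a. cos (pi * real j / real (2*a+1)) ^ (2*m)) =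
     real (2*a+1) / 4 ^ m * (real ((2*m) choose m) + 2 * (\<Sum>k=1..m. real ((2*m) choose (m + k*(2*a+1)))))"
    by (subst sum_cos_power_odd_modulus[symmetric], subst sum_cos_power_even, simp,
        subst sum_binomial_multiples, simp, rule refl)
  also have "\<dots> = real (2*a+1) * real ((2*m) choose m) / 4 ^ m *
     (1 + 2 * (\<Sum>k=1..m. real ((2*m) choose (m + k*(2*a+1))) / real ((2*m) choose m)))"
    using pos by (simp add: sum_divide_distrib[symmetric] field_simps)
  finally show ?thesis .
qed

lemma binomial_ratio:
  assumes "d \<le> m"
  shows "real ((2*m) choose (m+d)) / real ((2*m) choose m) = (\<Prod>i=1..d. (real m - real i + 1) / (real m + real i))"
  using assms
proof (induction d)
  case (Suc d)
  have "(m + d + 1) * ((2*m) choose (m+d+1)) = (2*m - (m+d)) * ((2*m) choose (m+d))"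
    using binomial_absorb_comp[of "2*m" "m+d"] binomial_absorption[of "m+d" "2*m"]
    by (simp add: algebra_simps)
  then have "real (m + d + 1) * real ((2*m) choose (m+d+1)) = real (m - d) * real ((2*m) choose (m+d))"
    using Suc.prems by (metis (no_types, lifting) diff_diff_left mult_2 of_nat_mult add_diff_cancel_left')
  then have "real ((2*m) choose (m + Suc d)) = real ((2*m) choose (m+d)) * ((real m - real (Suc d) + 1) / (real m + real (Suc d)))"
    using Suc.prems by (simp add: field_simps of_nat_diff)
  then have "real ((2*m) choose (m + Suc d)) / real ((2*m) choose m) =
      real ((2*m) choose (m+d)) / real ((2*m) choose m) * ((real m - real (Suc d) + 1) / (real m + real (Suc d)))"
    by simp
  also have "real ((2*m) choose (m+d)) / real ((2*m) choose m) = (\<Prod>i=1..d. (real m - real i + 1) / (real m + real i))"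
    by (rule Suc.IH) (use Suc.prems in simp)
  finally show ?case by simp
qed simp

lemma sum_odd_real: "(\<Sum>i=Suc 0..d. 2 * real i - 1) = real d ^ 2"
  by (induction d) (simp_all add: power2_eq_square algebra_simps)

text \<open>Each factor is \<open>1 - (2i-1)/(m+i)\<close>, and the odd numbers up to
  \<open>2d-1\<close> sum to \<open>d^2\<close>. Replacing the denominator by \<open>m + d\<close>
  is harmless in the limit, where \<open>d\<close> is of order sqrt m.\<close>

lemma binomial_ratio_le:
  assumes "d \<le> m" "m > 0"
  shows "real ((2*m) choose (m+d)) / real ((2*m) choose m) \<le> exp (- (real d ^ 2 / (real m + real d)))"
proof -
  have "(\<Prod>i=1..d. (real m - real i + 1) / (real m + real i)) \<le> (\<Prod>i=1..d. exp (- ((2 * real i - 1) / (real m + real d))))"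
  proof (rule prod_mono, safe)
    fix i assume i: "i \<in> {1..d}"
    then show "0 \<le> (real m - real i + 1) / (real m + real i)" using assms by simp
    have "(real m - real i + 1) / (real m + real i) = 1 + (- ((2 * real i - 1) / (real m + real i)))"
      using assms by (simp add: field_simps)
    also have "\<dots> \<le> exp (- ((2 * real i - 1) / (real m + real i)))" by (rule exp_ge_add_one_self)
    also have "\<dots> \<le> exp (- ((2 * real i - 1) / (real m + real d)))"
      using i assms by (auto intro!: divide_left_mono mult_pos_pos)
    finally show "(real m - real i + 1) / (real m + real i) \<le> exp (- ((2 * real i - 1) / (real m + real d)))" .
  qed
  also have "\<dots> = exp (- (real d ^ 2 / (real m + real d)))"
    by (simp add: exp_sum[symmetric] sum_negf sum_divide_distrib[symmetric] sum_odd_real)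
  finally show ?thesis by (simp add: binomial_ratio assms)
qed

lemma binomial_ratio_ge:
  assumes "d < m"
  shows "real ((2*m) choose (m+d)) / real ((2*m) choose m) \<ge> exp (- (real d ^ 2 / (real m - real d)))"
proof -
  have "(\<Prod>i=1..d. exp (- ((2 * real i - 1) / (real m - real d)))) \<le> (\<Prod>i=1..d. (real m - real i + 1) / (real m + real i))"
  proof (rule prod_mono, safe)
    fix i assume i: "i \<in> {1..d}"
    have "(real m + real i) / (real m - real i + 1) = 1 + (2 * real i - 1) / (real m - real i + 1)"
      using assms i by (simp add: field_simps)
    also have "\<dots> \<le> exp ((2 * real i - 1) / (real m - real i + 1))" by (rule exp_ge_add_one_self)
    also have "\<dots> \<le> exp ((2 * real i - 1) / (real m - real d))"
      using i assms by (auto intro!: divide_left_mono mult_pos_pos)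
    finally have "inverse (exp ((2 * real i - 1) / (real m - real d))) \<le> inverse ((real m + real i) / (real m - real i + 1))"
      using assms i by (intro le_imp_inverse_le) (auto intro!: divide_pos_pos)
    then show "exp (- ((2 * real i - 1) / (real m - real d))) \<le> (real m - real i + 1) / (real m + real i)"
      by (simp add: exp_minus)
  qed auto
  also have "(\<Prod>i=1..d. exp (- ((2 * real i - 1) / (real m - real d)))) = exp (- (real d ^ 2 / (real m - real d)))"
    by (simp add: exp_sum[symmetric] sum_negf sum_divide_distrib[symmetric] sum_odd_real)
  finally show ?thesis using assms by (simp add: binomial_ratio)
qed

section \<open>Asymptotics of the central binomial coefficient from Wallis' product\<close>

lemma wallis_binomial:
  "(\<Prod>k=1..n. (4*real k^2) / (4*real k^2 - 1)) * (2 * real n + 1) * real ((2*n) choose n) ^ 2 = 16 ^ n"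
proof (induction n)
  case (Suc n)
  have "(Suc n) * ((2 * Suc n) choose (Suc n)) = 2 * (2*n+1) * ((2*n) choose n)"
  proof -
    have "Suc n * (Suc (2*n+1) choose (Suc n)) = Suc (2*n+1) * ((2*n+1) choose n)"
      using Suc_times_binomial_eq[of "2*n+1" n] by (simp add: mult.commute)
    moreover have "(Suc (2*n) - n) * (Suc (2*n) choose n) = Suc (2*n) * ((2*n) choose n)"
      using binomial_absorb_comp[of "Suc (2*n)" n] by simp
    ultimately show ?thesis by (simp add: algebra_simps)
  qed
  then have "real (Suc n) * real ((2 * Suc n) choose (Suc n)) = 2 * (2 * real n+1) * real ((2*n) choose n)"
    by (metis (mono_tags, lifting) of_nat_1 of_nat_add of_nat_mult of_nat_numeral)
  then have b: "real ((2 * Suc n) choose (Suc n)) = 2 * (2 * real n+1) * real ((2*n) choose n) / real (Suc n)"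
    by (simp add: field_simps)
  have "(\<Prod>k=1..Suc n. (4*real k^2) / (4*real k^2 - 1)) = (\<Prod>k=1..n. (4*real k^2) / (4*real k^2 - 1)) * (4 * real (Suc n)^2 / (4 * real (Suc n)^2 - 1))"
    by simp
  also have "4 * real (Suc n)^2 - 1 = (2 * real n + 1) * (2 * real n + 3)" by (simp add: power2_eq_square algebra_simps)
  finally have p: "(\<Prod>k=1..Suc n. (4*real k^2) / (4*real k^2 - 1)) = (\<Prod>k=1..n. (4*real k^2) / (4*real k^2 - 1)) * (4 * real (Suc n)^2 / ((2 * real n + 1) * (2 * real n + 3)))" .
  have nz: "2 * real n + 1 \<noteq> 0" "2 * real n + 3 \<noteq> 0" "real (Suc n) \<noteq> 0" by linarith+
  have "(\<Prod>k=1..Suc n. (4*real k^2) / (4*real k^2 - 1)) * (2 * real (Suc n) + 1) * real ((2*Suc n) choose Suc n) ^ 2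
     = 16 * ((\<Prod>k=1..n. (4*real k^2) / (4*real k^2 - 1)) * (2 * real n + 1) * real ((2*n) choose n) ^ 2)"
  proof -
    have "P * (4 * N^2 / (a * e)) * e * (2 * a * c / N)^2 = 16 * (P * a * c^2)"
      if "a \<noteq> 0" "e \<noteq> 0" "N \<noteq> 0" for P N a e c :: real
      using that by (simp add: power2_eq_square)
    from this[OF nz] show ?thesis unfolding p b by (simp add: add_ac)
  qed
  then show ?case using Suc by simp
qed simp

lemma central_binomial_limit:
  "(\<lambda>n. real ((2*n) choose n) * sqrt (real n) / 4 ^ n) \<longlonglongrightarrow> 1 / sqrt pi"
proof -
  let ?P = "\<lambda>n. \<Prod>k=1..n. (4*real k^2) / (4*real k^2 - 1)"
  have pos: "?P n > 0" for n
  proof (rule prod_pos)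
    fix k assume "k \<in> {1..n}"
    then have "1 \<le> real k ^ 2" by simp
    then show "(4*real k^2) / (4*real k^2 - 1) > 0" by (intro divide_pos_pos) linarith+
  qed
  have eq: "real ((2*n) choose n) * sqrt (real n) / 4 ^ n = sqrt (real n / (2 * real n + 1) / ?P n)" for n
  proof (rule real_sqrt_unique[symmetric])
    have *: "C^2 * N / S = N / T / P" if "P * T * C^2 = S" "P > 0" "T > 0" "S > 0" for P T C S N :: real
      using that by (auto simp: field_simps)
    have "(real ((2*n) choose n) * sqrt (real n) / 4 ^ n)^2 = real ((2*n) choose n)^2 * real n / 16^n"
    proof -
      have "((4::real) ^ n)^2 = 16 ^ n"
      proof -
        have "((4::real) ^ n)^2 = (4^2)^n" by (metis power_mult mult.commute)
        then show ?thesis by simp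
      qed
      then show ?thesis by (simp add: power_mult_distrib power_divide)
    qed
    also have "\<dots> = real n / (2 * real n + 1) / ?P n"
      by (rule *[OF wallis_binomial pos]) auto
    finally show "(real ((2*n) choose n) * sqrt (real n) / 4 ^ n)^2 = real n / (2 * real n + 1) / ?P n" .
  qed simp
  have "(\<lambda>n. sqrt (real n / (2 * real n + 1) / ?P n)) \<longlonglongrightarrow> sqrt (1 / 2 / (pi / 2))"
  proof (rule tendsto_real_sqrt[OF tendsto_divide[OF _ wallis]])
    show "(\<lambda>n. real n / (2 * real n + 1)) \<longlonglongrightarrow> 1/2" by real_asymp
  qed simp
  then show ?thesis by (simp add: eq real_sqrt_divide)
qed

text \<open>Jacobi's theta function, the sum of exp(- pi n^2 t) over all integers \<open>n\<close>,
  is \<open>1 + 2 * theta_tail t\<close>.\<close>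

definition theta_tail :: "real \<Rightarrow> real" where
  "theta_tail t = (\<Sum>n. exp (- (pi * real (Suc n) ^ 2 * t)))"

lemma sq_ge_self_nat: "real (Suc n) ^ 2 \<ge> real (Suc n)"
  by (simp add: power2_eq_square)

lemma summable_theta_tail:
  assumes "c > 0"
  shows "summable (\<lambda>n. exp (- (c * real (Suc n) ^ 2)))"
proof (rule summable_comparison_test')
  show "summable (\<lambda>n. exp (- c) ^ Suc n)"
    using assms by (subst summable_Suc_iff) (auto intro!: summable_geometric)
  fix n :: nat assume "n \<ge> 0"
  have "c * real (Suc n) \<le> c * real (Suc n) ^ 2"
    using assms sq_ge_self_nat[of n] by (intro mult_left_mono) auto
  then show "norm (exp (- (c * real (Suc n) ^ 2))) \<le> exp (- c) ^ Suc n"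
    by (simp add: exp_of_nat_mult[symmetric] mult.commute algebra_simps del: power_Suc of_nat_Suc)
qed

text \<open>The constant 1/8 is far from the sharp 1/2, but the bound only has to supply a summable
  majorant for Tannery's theorem.\<close>

lemma cos_le_exp:
  assumes "0 \<le> x" "x \<le> pi / 2"
  shows "cos x \<le> exp (- (x^2 / 8))"
proof -
  have "sin (x/2) \<ge> x / 4"
  proof (cases "x = 0")
    case False
    have "((\<lambda>t. sin t - t / 2) has_real_derivative (cos t - 1/2)) (at t)" for t
      by (auto intro!: derivative_eq_intros)
    moreover have "cos t - 1/2 \<ge> 0" if "0 \<le> t" "t \<le> x / 2" for t
    proof -
      have "t \<le> pi / 3" using that assms pi_gt_zero by linarith
      then have "cos (pi/3) \<le> cos t" using that by (intro cos_monotone_0_pi_le) auto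
      then show ?thesis by (simp add: cos_60)
    qed
    ultimately have "\<exists>y. ((\<lambda>t. sin t - t / 2) has_real_derivative y) (at t) \<and> 0 \<le> y" if "0 \<le> t" "t \<le> x / 2" for t
      using that by meson
    then have "sin 0 - 0 / 2 \<le> sin (x/2) - (x/2) / 2"
      using assms(1) by (intro DERIV_nonneg_imp_nondecreasing[of 0 "x/2" "\<lambda>t. sin t - t/2"]) linarith
    then show ?thesis by simp
  qed simp
  then have "(x/4)^2 \<le> sin (x/2) ^ 2" using assms by (intro power_mono) auto
  moreover have "cos x = 1 - 2 * sin (x/2) ^ 2"
    using cos_double_sin[of "x/2"] by simp
  ultimately have "cos x \<le> 1 + (- (x^2/8))" by (simp add: power_divide)
  also have "\<dots> \<le> exp (- (x^2/8))" by (rule exp_ge_add_one_self)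
  finally show ?thesis .
qed

section \<open>The limit of Polya's identity\<close>

context
  fixes \<tau> :: real
  assumes \<tau>: "\<tau> > 0"
begin

definition polya_m :: "nat \<Rightarrow> nat" where "polya_m a = nat \<lfloor>\<tau> * real (2*a+1)^2\<rfloor>"

lemma polya_m_le: "real (polya_m a) \<le> \<tau> * real (2*a+1)^2"
  using \<tau> unfolding polya_m_def by (intro of_nat_floor) auto

lemma polya_m_ge: "real (polya_m a) \<ge> \<tau> * real (2*a+1)^2 - 1"
  using \<tau> unfolding polya_m_def by linarith

lemma polya_m_ratio: "(\<lambda>a. real (polya_m a) / real (2*a+1)^2) \<longlonglongrightarrow> \<tau>"
proof (rule tendsto_sandwich)
  show "\<forall>\<^sub>F a in sequentially. \<tau> - 1 / real (2*a+1)^2 \<le> real (polya_m a) / real (2*a+1)^2"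
  proof (intro always_eventually allI)
    fix a
    have "real (2*a+1)^2 > 0" by simp
    moreover have "(\<tau> - 1 / l) * l = \<tau> * l - 1" if "l > 0" for l using that by (simp add: field_simps)
    ultimately show "\<tau> - 1 / real (2*a+1)^2 \<le> real (polya_m a) / real (2*a+1)^2"
      using polya_m_ge[of a] by (simp only: pos_le_divide_eq)
  qed
  show "\<forall>\<^sub>F a in sequentially. real (polya_m a) / real (2*a+1)^2 \<le> \<tau>"
    using polya_m_le by (intro always_eventually allI) (auto simp: field_simps)
  show "(\<lambda>a. \<tau> - 1 / real (2*a+1)^2) \<longlonglongrightarrow> \<tau>" by real_asymp
qed simp

lemma polya_m_at_top: "filterlim (\<lambda>a. real (polya_m a)) at_top sequentially"
proof (rule filterlim_at_top_mono)
  show "filterlim (\<lambda>a. \<tau> * real (2*a+1)^2 - 1) at_top sequentially"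
    using \<tau> by real_asymp
  show "\<forall>\<^sub>F a in sequentially. \<tau> * real (2*a+1)^2 - 1 \<le> real (polya_m a)"
    using polya_m_ge by (intro always_eventually allI)
qed

lemma polya_lhs:
  "(\<lambda>a. \<Sum>j=1..a. cos (pi * real j / real (2*a+1)) ^ (2 * polya_m a))
     \<longlonglongrightarrow> (\<Sum>j. exp (- (pi^2 * \<tau> * real (Suc j) ^ 2)))"
proof -
  let ?a = "\<lambda>j a. if Suc j \<le> a then cos (pi * real (Suc j) / real (2*a+1)) ^ (2 * polya_m a) else 0"
  have lim: "(\<lambda>a. ?a j a) \<longlonglongrightarrow> exp (- (pi^2 * \<tau> * real (Suc j) ^ 2))" for j
  proof -
    define c where "c = pi * real (Suc j)"
    have "c > 0" by (simp add: c_def)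
    have "(\<lambda>a. real (2*a+1)^2 * ln (cos (c / real (2*a+1)))) \<longlonglongrightarrow> - (c^2/2)"
      using \<open>c > 0\<close> unfolding power2_eq_square[of c] by real_asymp
    then have "(\<lambda>a. exp (2 * (real (polya_m a) / real (2*a+1)^2) * (real (2*a+1)^2 * ln (cos (c / real (2*a+1))))))
        \<longlonglongrightarrow> exp (2 * \<tau> * (- (c^2/2)))"
      by (intro tendsto_intros polya_m_ratio)
    moreover have "\<forall>\<^sub>F a in sequentially. exp (2 * (real (polya_m a) / real (2*a+1)^2) * (real (2*a+1)^2 * ln (cos (c / real (2*a+1)))))
       = ?a j a"
    proof -
      have "(\<lambda>a. cos (c / real (2*a+1))) \<longlonglongrightarrow> 1" by real_asymp
      then have "\<forall>\<^sub>F a in sequentially. cos (c / real (2*a+1)) > 0"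
        by (rule order_tendstoD) simp
      then show ?thesis using eventually_ge_at_top[of "Suc j"]
      proof eventually_elim
        case (elim a)
        have "real (2*a+1)^2 \<noteq> 0" by simp
        then have "2 * (real (polya_m a) / real (2*a+1)^2) * (real (2*a+1)^2 * ln (cos (c / real (2*a+1))))
          = real (2 * polya_m a) * ln (cos (c / real (2*a+1)))" by simp
        then have "exp (2 * (real (polya_m a) / real (2*a+1)^2) * (real (2*a+1)^2 * ln (cos (c / real (2*a+1)))))
          = cos (c / real (2*a+1)) ^ (2 * polya_m a)"
          using elim(1) by (simp only: exp_of_nat_mult exp_ln)
        then show ?case using elim(2) by (simp only: c_def if_True)
      qed
    qed
    ultimately have "(\<lambda>a. ?a j a) \<longlonglongrightarrow> exp (2 * \<tau> * (- (c^2/2)))"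
      by (rule Lim_transform_eventually)
    then show ?thesis by (simp add: c_def power_mult_distrib mult_ac)
  qed
  have bound: "\<forall>\<^sub>F (j, a) in at_top \<times>\<^sub>F sequentially. norm (?a j a) \<le> exp (- (pi^2 * \<tau> / 8 * real (Suc j) ^ 2))"
  proof -
    have "\<forall>\<^sub>F a in sequentially. \<tau> * real (2*a+1)^2 \<ge> 2"
      using \<tau> by real_asymp
    then have "\<forall>\<^sub>F a in sequentially. \<forall>j. norm (?a j a) \<le> exp (- (pi^2 * \<tau> / 8 * real (Suc j) ^ 2))"
    proof eventually_elim
      case (elim a)
      show ?case
      proof
        fix j
        let ?l = "real (2*a+1)"
        let ?x = "pi * real (Suc j) / ?l"
        show "norm (?a j a) \<le> exp (- (pi^2 * \<tau> / 8 * real (Suc j) ^ 2))"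
        proof (cases "Suc j \<le> a")
          case True
          have x: "0 \<le> ?x" "?x \<le> pi / 2"
          proof -
            have "pi * (2 * real (Suc j)) \<le> pi * ?l" using True by (intro mult_left_mono) auto
            then show "?x \<le> pi / 2" by (simp add: field_simps)
          qed simp
          have c0: "cos ?x \<ge> 0" using x by (intro cos_ge_zero) (use pi_gt_zero in linarith)+
          have "cos ?x ^ (2 * polya_m a) \<le> exp (- (?x^2/8)) ^ (2 * polya_m a)"
            using c0 cos_le_exp[OF x] by (intro power_mono)
          also have "\<dots> = exp (- (real (2 * polya_m a) * (?x^2/8)))"
            by (simp flip: exp_of_nat_mult)
          also have "\<dots> \<le> exp (- (pi^2 * \<tau> / 8 * real (Suc j) ^ 2))"
          proof -
            \<comment> \<open>Rounding down costs at most 1, which is at most half of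
              \<open>\<tau> l^2\<close> once \<open>\<tau> l^2 \<ge> 2\<close>.\<close>
            have "\<tau> * ?l^2 \<le> 2 * real (polya_m a)" using polya_m_ge[of a] elim by linarith
            then have "\<tau> * ?l^2 * (?x^2/8) \<le> real (2 * polya_m a) * (?x^2/8)"
              by (intro mult_right_mono) auto
            moreover have "\<tau> * l^2 * ((p * q / l)^2/8) = p^2 * \<tau> / 8 * q^2" if "l \<noteq> 0" for l p q :: real
              using that by (simp add: power_divide power_mult_distrib)
            then have "\<tau> * ?l^2 * (?x^2/8) = pi^2 * \<tau> / 8 * real (Suc j) ^ 2" by simp
            ultimately show ?thesis by (simp only: neg_le_iff_le exp_le_cancel_iff)
          qed
          finally show ?thesis using True c0 by simp
        qed simp
      qed
    qed
    from eventually_prodI[OF always_eventually[of "\<lambda>_. True", OF allI[OF TrueI]] this]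
    show ?thesis by eventually_elim (simp only: case_prod_unfold)
  qed
  have "(\<lambda>a. \<Sum>j. ?a j a) \<longlonglongrightarrow> (\<Sum>j. exp (- (pi^2 * \<tau> * real (Suc j) ^ 2)))"
    using tannerys_theorem[OF lim bound summable_theta_tail] \<tau> by simp
  moreover have "(\<Sum>j. ?a j a) = (\<Sum>j=1..a. cos (pi * real j / real (2*a+1)) ^ (2 * polya_m a))" for a
  proof -
    have "(\<Sum>j. ?a j a) = (\<Sum>j<a. ?a j a)" by (rule suminf_finite) auto
    also have "\<dots> = (\<Sum>j<a. cos (pi * real (Suc j) / real (2*a+1)) ^ (2 * polya_m a))"
      by (rule sum.cong) auto
    also have "\<dots> = (\<Sum>j=1..a. cos (pi * real j / real (2*a+1)) ^ (2 * polya_m a))"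
      by (rule sum.reindex_bij_witness[of _ "\<lambda>j. j - 1" Suc]) auto
    finally show ?thesis .
  qed
  ultimately show ?thesis by simp
qed

lemma polya_rhs:
  "(\<lambda>a. \<Sum>k=1..polya_m a. real ((2 * polya_m a) choose (polya_m a + k*(2*a+1))) / real ((2 * polya_m a) choose polya_m a))
     \<longlonglongrightarrow> (\<Sum>k. exp (- (1 / \<tau> * real (Suc k) ^ 2)))"
proof -
  let ?r = "\<lambda>k a. real ((2 * polya_m a) choose (polya_m a + k*(2*a+1))) / real ((2 * polya_m a) choose polya_m a)"
  have m0: "\<forall>\<^sub>F a in sequentially. polya_m a > 0"
    using filterlim_at_top_dense[THEN iffD1, OF polya_m_at_top, rule_format, of 0] by simp
  have lim: "(\<lambda>a. ?r (Suc k) a) \<longlonglongrightarrow> exp (- (1 / \<tau> * real (Suc k) ^ 2))" for k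
  proof (rule tendsto_sandwich)
    let ?d = "\<lambda>a. Suc k * (2*a+1)"
    have dm: "(\<lambda>a. real (?d a) / real (2*a+1)^2) \<longlonglongrightarrow> 0"
      by real_asymp
    have quot: "(\<lambda>a. exp (- (real (Suc k)^2 / (real (polya_m a) / real (2*a+1)^2 + c * (real (?d a) / real (2*a+1)^2)))))
         \<longlonglongrightarrow> exp (- (real (Suc k)^2 / (\<tau> + c * 0)))" for c
      using \<tau> by (intro tendsto_intros polya_m_ratio dm) auto
    have eq: "real (?d a)^2 / (real (polya_m a) + c * real (?d a)) =
        real (Suc k)^2 / (real (polya_m a) / real (2*a+1)^2 + c * (real (?d a) / real (2*a+1)^2))" for a c
    proof -
      have "real (polya_m a) / real (2*a+1)^2 + c * (real (?d a) / real (2*a+1)^2) = (real (polya_m a) + c * real (?d a)) / real (2*a+1)^2"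
        by (simp only: add_divide_distrib times_divide_eq_right)
      moreover have "real (?d a)^2 = real (Suc k)^2 * real (2*a+1)^2"
        by (simp only: of_nat_mult power_mult_distrib)
      moreover have "real (2*a+1)^2 \<noteq> 0" by simp
      ultimately show ?thesis by (simp only: divide_divide_eq_right times_divide_eq_left)
    qed
    have less: "\<forall>\<^sub>F a in sequentially. ?d a < polya_m a"
    proof -
      have "\<forall>\<^sub>F a in sequentially. real (Suc k * (2*a+1)) < \<tau> * real (2*a+1)^2 - 1"
        using \<tau> by real_asymp
      then show ?thesis
      proof eventually_elim
        case (elim a)
        then have "real (?d a) < real (polya_m a)" using polya_m_ge[of a] by linarith
        then show ?case by (simp only: of_nat_less_iff)
      qed
    qed
    show "\<forall>\<^sub>F a in sequentially. exp (- (real (?d a)^2 / (real (polya_m a) + (-1) * real (?d a)))) \<le> ?r (Suc k) a"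
      using less
    proof eventually_elim
      case (elim a)
      show ?case using binomial_ratio_ge[OF elim] by (simp only: diff_conv_add_uminus mult_minus1)
    qed
    show "\<forall>\<^sub>F a in sequentially. ?r (Suc k) a \<le> exp (- (real (?d a)^2 / (real (polya_m a) + 1 * real (?d a))))"
      using less
    proof eventually_elim
      case (elim a)
      show ?case using binomial_ratio_le[of "?d a" "polya_m a"] elim by simp
    qed
    show "(\<lambda>a. exp (- (real (?d a)^2 / (real (polya_m a) + (-1) * real (?d a))))) \<longlonglongrightarrow> exp (- (1 / \<tau> * real (Suc k) ^ 2))"
      unfolding eq using quot[of "-1"] by simp
    show "(\<lambda>a. exp (- (real (?d a)^2 / (real (polya_m a) + 1 * real (?d a))))) \<longlonglongrightarrow> exp (- (1 / \<tau> * real (Suc k) ^ 2))"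
      unfolding eq using quot[of 1] by simp
  qed
  have bound: "\<forall>\<^sub>F (k, a) in at_top \<times>\<^sub>F sequentially. norm (?r (Suc k) a) \<le> exp (- (1 / (2*\<tau>) * real (Suc k) ^ 2))"
  proof -
    from m0 have "\<forall>\<^sub>F a in sequentially. \<forall>k. norm (?r (Suc k) a) \<le> exp (- (1 / (2*\<tau>) * real (Suc k) ^ 2))"
    proof eventually_elim
      case (elim a)
      show ?case
      proof
        fix k
        let ?d = "Suc k * (2*a+1)"
        show "norm (?r (Suc k) a) \<le> exp (- (1 / (2*\<tau>) * real (Suc k) ^ 2))"
        proof (cases "?d \<le> polya_m a")
          case True
          have "?r (Suc k) a \<le> exp (- (real ?d ^ 2 / (real (polya_m a) + real ?d)))"
            using binomial_ratio_le[OF True elim] .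
          also have "\<dots> \<le> exp (- (1 / (2*\<tau>) * real (Suc k) ^ 2))"
          proof -
            have "real (polya_m a) + real ?d \<le> 2 * real (polya_m a)" using True by linarith
            also have "\<dots> \<le> 2 * \<tau> * real (2*a+1)^2" using polya_m_le[of a] by simp
            finally have "real ?d ^ 2 / (2 * \<tau> * real (2*a+1)^2) \<le> real ?d ^ 2 / (real (polya_m a) + real ?d)"
              using elim \<tau> by (intro divide_left_mono) (auto intro!: mult_pos_pos add_pos_nonneg)
            moreover have "real ?d ^ 2 / (2 * \<tau> * real (2*a+1)^2) = 1 / (2*\<tau>) * real (Suc k) ^ 2"
            proof -
              have "(q * l)^2 / (2 * \<tau> * l^2) = 1 / (2*\<tau>) * q^2" if "l \<noteq> 0" for q l :: real
                using that by (simp add: power_mult_distrib)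
              then show ?thesis unfolding of_nat_mult by simp
            qed
            ultimately show ?thesis by (simp only: neg_le_iff_le exp_le_cancel_iff)
          qed
          finally show ?thesis by simp
        next
          case False
          then have "(2 * polya_m a) choose (polya_m a + ?d) = 0" by (intro binomial_eq_0) linarith
          then show ?thesis by (simp only: of_nat_0 div_0 norm_zero exp_ge_zero)
        qed
      qed
    qed
    from eventually_prodI[OF always_eventually[of "\<lambda>_. True", OF allI[OF TrueI]] this]
    show ?thesis by eventually_elim (simp only: case_prod_unfold)
  qed
  have "(\<lambda>a. \<Sum>k. ?r (Suc k) a) \<longlonglongrightarrow> (\<Sum>k. exp (- (1 / \<tau> * real (Suc k) ^ 2)))"
    using tannerys_theorem[OF lim bound summable_theta_tail] \<tau> by simp
  moreover have "(\<Sum>k. ?r (Suc k) a) = (\<Sum>k=1..polya_m a. ?r k a)" for a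
  proof -
    have "(\<Sum>k. ?r (Suc k) a) = (\<Sum>k<polya_m a. ?r (Suc k) a)"
    proof (rule suminf_finite)
      fix k assume "k \<notin> {..<polya_m a}"
      then have "polya_m a < Suc k * (2*a+1)" by (simp add: algebra_simps)
      then have "(2 * polya_m a) choose (polya_m a + Suc k * (2*a+1)) = 0" by (intro binomial_eq_0) linarith
      then show "?r (Suc k) a = 0" by simp
    qed simp
    also have "\<dots> = (\<Sum>k=1..polya_m a. ?r k a)"
      by (rule sum.reindex_bij_witness[of _ "\<lambda>j. j - 1" Suc]) auto
    finally show ?thesis .
  qed
  ultimately show ?thesis by simp
qed

lemma polya_const:
  "(\<lambda>a. real (2*a+1) * real ((2 * polya_m a) choose polya_m a) / 4 ^ polya_m a) \<longlonglongrightarrow> 1 / sqrt (pi * \<tau>)"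
proof -
  have mt: "filterlim polya_m at_top sequentially"
    using polya_m_at_top by (simp add: filterlim_sequentially_iff_filterlim_real)
  have "(\<lambda>a. (real ((2 * polya_m a) choose polya_m a) * sqrt (real (polya_m a)) / 4 ^ polya_m a) /
            sqrt (real (polya_m a) / real (2*a+1)^2)) \<longlonglongrightarrow> (1 / sqrt pi) / sqrt \<tau>"
    using \<tau> by (intro tendsto_intros polya_m_ratio filterlim_compose[OF central_binomial_limit mt]) auto
  moreover have "\<forall>\<^sub>F a in sequentially. (real ((2 * polya_m a) choose polya_m a) * sqrt (real (polya_m a)) / 4 ^ polya_m a) /
            sqrt (real (polya_m a) / real (2*a+1)^2) = real (2*a+1) * real ((2 * polya_m a) choose polya_m a) / 4 ^ polya_m a"
  proof -
    have "\<forall>\<^sub>F a in sequentially. real (polya_m a) > 0"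
      using filterlim_at_top_dense[THEN iffD1, OF polya_m_at_top, rule_format, of 0] .
    then show ?thesis
      by eventually_elim (simp add: real_sqrt_divide del: of_nat_add of_nat_Suc)
  qed
  ultimately have "(\<lambda>a. real (2*a+1) * real ((2 * polya_m a) choose polya_m a) / 4 ^ polya_m a) \<longlonglongrightarrow> (1 / sqrt pi) / sqrt \<tau>"
    by (rule Lim_transform_eventually)
  then show ?thesis by (simp add: real_sqrt_mult)
qed

end

theorem theta_inversion:
  assumes "t > 0"
  shows "1 + 2 * theta_tail t = (1 + 2 * theta_tail (1 / t)) / sqrt t"
proof -
  \<comment> \<open>With this choice the exponents \<open>pi^2 * \<tau>\<close> and
    \<open>1 / \<tau>\<close> become \<open>pi * t\<close> and \<open>pi / t\<close>.\<close>
  define \<tau> where "\<tau> = t / pi"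
  have \<tau>: "\<tau> > 0" using assms by (simp add: \<tau>_def)
  have "(\<lambda>a. 1 + 2 * (\<Sum>j=1..a. cos (pi * real j / real (2*a+1)) ^ (2 * polya_m \<tau> a))) \<longlonglongrightarrow>
      1 + 2 * (\<Sum>j. exp (- (pi^2 * \<tau> * real (Suc j) ^ 2)))"
    by (intro tendsto_intros polya_lhs[OF \<tau>])
  moreover have "(\<lambda>a. 1 + 2 * (\<Sum>j=1..a. cos (pi * real j / real (2*a+1)) ^ (2 * polya_m \<tau> a))) \<longlonglongrightarrow>
      1 / sqrt (pi * \<tau>) * (1 + 2 * (\<Sum>k. exp (- (1 / \<tau> * real (Suc k) ^ 2))))"
    unfolding polya_identity by (intro tendsto_intros polya_rhs[OF \<tau>] polya_const[OF \<tau>])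
  ultimately have "1 + 2 * (\<Sum>j. exp (- (pi^2 * \<tau> * real (Suc j) ^ 2))) =
      1 / sqrt (pi * \<tau>) * (1 + 2 * (\<Sum>k. exp (- (1 / \<tau> * real (Suc k) ^ 2))))"
    by (rule LIMSEQ_unique)
  then show ?thesis
    by (simp add: \<tau>_def theta_tail_def power2_eq_square mult_ac)
qed

section \<open>The completed zeta function as an integral over theta\<close>

lemma Gamma_exp_integral:
  fixes z a :: real
  assumes "z > 0" "a > 0"
  shows "(\<integral>\<^sup>+y. ennreal (2 * exp (2 * z * y) * exp (- (a * exp (2 * y)))) \<partial>lborel) = ennreal (Gamma z * a powr (-z))"
proof -
  let ?f = "\<lambda>t. t powr (z - 1) / exp t"
  \<comment> \<open>On this logarithmic scale the inversion \<open>t -> 1/t\<close> of theta becomes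
    the reflection \<open>y -> -y\<close>.\<close>
  let ?g = "\<lambda>y. a * exp (2 * y)"
  have img: "?g ` UNIV = {0<..}"
  proof (intro equalityI subsetI)
    fix t :: real assume "t \<in> {0<..}"
    then have "t = ?g (ln (t / a) / 2)" using assms by simp
    then show "t \<in> range ?g" by blast
  qed (use assms in auto)
  have "(?f has_integral Gamma z) {0..}" by (rule Gamma_integral_real[OF assms(1)])
  then have I: "(?f has_integral Gamma z) {0<..}"
    by (subst (asm) has_integral_spike_set_eq[where T = "{0<..}"]) (auto intro: negligible_subset[of "{0}"])
  have "?f absolutely_integrable_on {0<..}"
    by (rule nonnegative_absolutely_integrable_1) (use I in auto)
  then have "?f absolutely_integrable_on (?g ` UNIV) \<and> integral (?g ` UNIV) ?f = Gamma z"
    unfolding img using I by (simp add: integral_unique)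
  then have "(\<lambda>y. \<bar>2 * a * exp (2 * y)\<bar> * ?f (?g y)) absolutely_integrable_on UNIV \<and>
             integral UNIV (\<lambda>y. \<bar>2 * a * exp (2 * y)\<bar> * ?f (?g y)) = Gamma z"
    by (subst has_absolute_integral_change_of_variables_1')
       (auto intro!: derivative_eq_intros simp: inj_on_def assms less_imp_neq[THEN not_sym])
  then have "((\<lambda>y. \<bar>2 * a * exp (2 * y)\<bar> * ?f (?g y)) has_integral Gamma z) UNIV"
    using set_lebesgue_integral_eq_integral(1) by (auto simp: has_integral_iff)
  then have "((\<lambda>y. a powr (-z) * (\<bar>2 * a * exp (2 * y)\<bar> * ?f (?g y))) has_integral a powr (-z) * Gamma z) UNIV"
    by (rule has_integral_mult_right)
  moreover have "a powr (-z) * (\<bar>2 * a * exp (2 * y)\<bar> * ?f (?g y)) = 2 * exp (2 * z * y) * exp (- (a * exp (2 * y)))" for y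
  proof -
    have "?g y powr (z - 1) = a powr (z - 1) * exp (2 * y * (z - 1))"
      using assms by (simp add: powr_mult exp_powr_real)
    moreover have "a powr (-z) * a * a powr (z - 1) = 1"
      using assms by (simp add: powr_diff powr_minus field_simps)
    moreover have "exp (2 * y) * exp (2 * y * (z - 1)) = exp (2 * z * y)"
      by (simp add: algebra_simps flip: exp_add)
    moreover have "p * (\<bar>2 * a * E\<bar> * (q * F / G)) = 2 * ((p * a * q) * (E * F)) * inverse G" if "E > 0" for p q E F G :: real
      using assms that by (simp add: divide_inverse)
    ultimately show ?thesis using assms by (simp add: exp_minus)
  qed
  ultimately have "((\<lambda>y. 2 * exp (2 * z * y) * exp (- (a * exp (2 * y)))) has_integral a powr (-z) * Gamma z) UNIV"
    by simp
  then show ?thesis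
    by (subst nn_integral_has_integral_lborel) (auto simp: mult.commute)
qed

lemma theta_tail_sums:
  assumes "t > 0"
  shows "(\<lambda>n. exp (- (pi * real (Suc n) ^ 2 * t))) sums theta_tail t"
  unfolding theta_tail_def using summable_theta_tail[of "pi * t"] assms
  by (intro summable_sums) (simp add: mult_ac)

lemma theta_tail_nonneg: "t > 0 \<Longrightarrow> theta_tail t \<ge> 0"
  by (rule sums_le[OF _ sums_zero theta_tail_sums]) auto

lemma measurable_theta_tail [measurable]: "theta_tail \<in> borel_measurable borel"
  unfolding theta_tail_def [abs_def] by measurable

definition zeta_real :: "real \<Rightarrow> real" where
  "zeta_real s = (\<Sum>n. real (Suc n) powr (-s))"

lemma zeta_real_sums:
  assumes "s > 1"
  shows "(\<lambda>n. real (Suc n) powr (-s)) sums zeta_real s"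
proof -
  have "summable (\<lambda>n. real n powr (-s))" using assms by (simp add: summable_real_powr_iff)
  then have "summable (\<lambda>n. real (Suc n) powr (-s))" by (subst summable_Suc_iff)
  then show ?thesis unfolding zeta_real_def by (rule summable_sums)
qed

definition Lambda_real :: "real \<Rightarrow> real" where
  "Lambda_real s = pi powr (-s/2) * Gamma (s/2) * zeta_real s"

text \<open>Termwise Gamma integrals. In \<open>ennreal\<close> Tonelli's theorem allows the
  interchange of sum and integral, and finiteness of the integral is a by-product.\<close>

lemma Lambda_real_integral:
  assumes "s > 1"
  shows "(\<integral>\<^sup>+y. ennreal (2 * exp (s * y) * theta_tail (exp (2 * y))) \<partial>lborel) = ennreal (Lambda_real s)"
proof -
  have "(\<integral>\<^sup>+y. ennreal (2 * exp (s * y) * theta_tail (exp (2 * y))) \<partial>lborel) =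
     (\<integral>\<^sup>+y. (\<Sum>n. ennreal (2 * exp (2 * (s/2) * y) * exp (- ((pi * real (Suc n) ^ 2) * exp (2 * y))))) \<partial>lborel)"
  proof (rule nn_integral_cong)
    fix y :: real
    have "(\<Sum>n. ennreal (2 * exp (s * y) * exp (- (pi * real (Suc n) ^ 2 * exp (2 * y))))) = ennreal (2 * exp (s * y) * theta_tail (exp (2 * y)))"
      by (intro suminf_ennreal_eq sums_mult theta_tail_sums) auto
    then show "ennreal (2 * exp (s * y) * theta_tail (exp (2 * y))) =
        (\<Sum>n. ennreal (2 * exp (2 * (s/2) * y) * exp (- ((pi * real (Suc n) ^ 2) * exp (2 * y)))))"
      by simp
  qed
  also have "\<dots> = (\<Sum>n. \<integral>\<^sup>+y. ennreal (2 * exp (2 * (s/2) * y) * exp (- ((pi * real (Suc n) ^ 2) * exp (2 * y)))) \<partial>lborel)"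
    by (rule nn_integral_suminf) measurable
  also have "\<dots> = (\<Sum>n. ennreal (Gamma (s/2) * (pi * real (Suc n) ^ 2) powr (-(s/2))))"
    using assms by (intro suminf_cong Gamma_exp_integral) (auto intro!: mult_pos_pos)
  also have "\<dots> = ennreal (Lambda_real s)"
  proof (rule suminf_ennreal_eq)
    have "(\<lambda>n. pi powr (-s/2) * Gamma (s/2) * real (Suc n) powr (-s)) sums Lambda_real s"
      unfolding Lambda_real_def by (intro sums_mult zeta_real_sums assms)
    moreover have "Gamma (s/2) * (pi * real (Suc n) ^ 2) powr (-(s/2)) = pi powr (-s/2) * Gamma (s/2) * real (Suc n) powr (-s)" for n
    proof -
      have "(real (Suc n) ^ 2) powr (-(s/2)) = real (Suc n) powr (-s)"
        by (simp add: powr_powr flip: powr_numeral)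
      then show ?thesis by (simp add: powr_mult)
    qed
    ultimately show "(\<lambda>n. Gamma (s/2) * (pi * real (Suc n) ^ 2) powr (-(s/2))) sums Lambda_real s"
      by (simp only:)
  qed (use assms Gamma_real_pos[of "s/2"] in simp)
  finally show ?thesis .
qed

text \<open>The kernel that remains after folding the line at 0. It is paired with cosh((s - 1/2)
  y), and the evenness of that factor in \<open>s - 1/2\<close> carries the symmetry
  \<open>s -> 1 - s\<close>.\<close>

definition xi_kernel :: "real \<Rightarrow> real" where
  "xi_kernel y = (if y > 0 then 4 * exp (y/2) * theta_tail (exp (2 * y)) else 0)"

lemma xi_kernel_nonneg: "xi_kernel y \<ge> 0"
  by (simp add: xi_kernel_def theta_tail_nonneg)

lemma measurable_xi_kernel [measurable]: "xi_kernel \<in> borel_measurable borel"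
  unfolding xi_kernel_def [abs_def] by measurable

lemma measurable_cosh_real [measurable]: "(cosh :: real \<Rightarrow> real) \<in> borel_measurable borel"
  by (intro borel_measurable_continuous_onI continuous_intros)

text \<open>Theta inversion is applied to the value at \<open>-y\<close>. The constant terms 1 of
  the two theta functions leave two pure exponentials, whose integral over the half-line is
  \<open>1/(s-1) - 1/s\<close>, the polar part; everything else is even in
  \<open>s - 1/2\<close>.\<close>

lemma theta_fold:
  assumes "y > 0"
  shows "2 * exp (s * y) * theta_tail (exp (2 * y)) + 2 * exp (s * (-y)) * theta_tail (exp (2 * (-y))) =
     (exp (-(s-1)*y) - exp (-s*y)) + xi_kernel y * cosh ((s - 1/2) * y)"
proof -
  have "1 + 2 * theta_tail (exp (-(2*y))) = (1 + 2 * theta_tail (exp (2*y))) / sqrt (exp (-(2*y)))"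
    using theta_inversion[of "exp (-(2*y))"] by (simp add: exp_minus field_simps)
  also have "sqrt (exp (-(2*y))) = exp (-y)"
    by (rule real_sqrt_unique) (simp_all add: power2_eq_square flip: exp_add)
  finally have "2 * theta_tail (exp (-(2*y))) = (1 + 2 * theta_tail (exp (2*y))) * exp y - 1"
    by (simp add: exp_minus field_simps)
  then have "2 * exp (s * (-y)) * theta_tail (exp (2 * (-y))) = exp (-s*y) * ((1 + 2 * theta_tail (exp (2*y))) * exp y - 1)"
    by (simp add: mult_ac)
  moreover have "exp (-s*y) * exp y = exp (-(s-1)*y)" by (simp add: algebra_simps flip: exp_add)
  moreover have "exp (y/2) * exp ((s-1/2)*y) = exp (s*y)" "exp (y/2) * exp (-((s-1/2)*y)) = exp (-(s-1)*y)"
    by (simp_all add: algebra_simps flip: exp_add)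
  moreover have "xi_kernel y * cosh ((s-1/2)*y) = 2 * theta_tail (exp (2*y)) * (exp (y/2) * exp ((s-1/2)*y) + exp (y/2) * exp (-((s-1/2)*y)))"
    using assms by (simp add: xi_kernel_def cosh_def algebra_simps)
  ultimately show ?thesis by (simp add: algebra_simps)
qed

lemma exp_diff_integral:
  assumes "s > 1"
  shows "(\<integral>\<^sup>+y. ennreal (indicator {0<..} y * (exp (-(s-1)*y) - exp (-s*y))) \<partial>lborel) = ennreal (1/(s-1) - 1/s)"
proof (rule nn_integral_has_integral_lborel)
  have "((\<lambda>y. exp (-(s-1)*y) - exp (-s*y)) has_integral (exp (-(s-1)*0)/(s-1) - exp (-s*0)/s)) {0..}"
    using assms by (intro has_integral_diff has_integral_exp_minus_to_infinity) auto
  then have "((\<lambda>y. exp (-(s-1)*y) - exp (-s*y)) has_integral (1/(s-1) - 1/s)) {0<..}"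
    by (subst (asm) has_integral_spike_set_eq[where T = "{0<..}"]) (auto intro: negligible_subset[of "{0}"])
  then have "((\<lambda>y. if y \<in> {0<..} then exp (-(s-1)*y) - exp (-s*y) else 0) has_integral (1/(s-1) - 1/s)) UNIV"
    by (simp only: has_integral_restrict_UNIV)
  then show "((\<lambda>y. indicator {0<..} y * (exp (-(s-1)*y) - exp (-s*y))) has_integral (1/(s-1) - 1/s)) UNIV"
    by (rule has_integral_eq[rotated]) (auto simp: indicator_def)
  show "0 \<le> indicator {0<..} y * (exp (-(s-1)*y) - exp (-s*y))" for y :: real
    using assms by (auto simp: indicator_def algebra_simps)
qed measurable

lemma Lambda_real_fold:
  assumes "s > 1"
  shows "ennreal (Lambda_real s) = ennreal (1/(s-1) - 1/s) + (\<integral>\<^sup>+y. ennreal (xi_kernel y * cosh ((s - 1/2) * y)) \<partial>lborel)"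
proof -
  let ?h = "\<lambda>y. ennreal (2 * exp (s * y) * theta_tail (exp (2 * y)))"
  have "ennreal (Lambda_real s) = (\<integral>\<^sup>+y. ?h y \<partial>lborel)"
    by (rule Lambda_real_integral[OF assms, symmetric])
  also have "\<dots> = (\<integral>\<^sup>+y. ?h y * indicator {0<..} y + ?h y * indicator {..<0} y \<partial>lborel)"
    by (intro nn_integral_cong_AE, use AE_lborel_singleton[of "0::real"] in eventually_elim) (auto simp: indicator_def)
  also have "\<dots> = (\<integral>\<^sup>+y. ?h y * indicator {0<..} y \<partial>lborel) + (\<integral>\<^sup>+y. ?h y * indicator {..<0} y \<partial>lborel)"
    by (rule nn_integral_add) measurable
  also have "(\<integral>\<^sup>+y. ?h y * indicator {..<0} y \<partial>lborel) = (\<integral>\<^sup>+y. ?h (-y) * indicator {0<..} y \<partial>lborel)"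
    by (subst nn_integral_real_affine[where c = "-1" and t = 0]) (auto intro!: nn_integral_cong simp: indicator_def)
  also have "(\<integral>\<^sup>+y. ?h y * indicator {0<..} y \<partial>lborel) + (\<integral>\<^sup>+y. ?h (-y) * indicator {0<..} y \<partial>lborel)
      = (\<integral>\<^sup>+y. (?h y + ?h (-y)) * indicator {0<..} y \<partial>lborel)"
    by (subst nn_integral_add[symmetric]) (auto simp: distrib_right)
  also have "\<dots> = (\<integral>\<^sup>+y. ennreal (indicator {0<..} y * (exp (-(s-1)*y) - exp (-s*y))) + ennreal (xi_kernel y * cosh ((s - 1/2) * y)) \<partial>lborel)"
  proof (rule nn_integral_cong)
    fix y :: real
    show "(?h y + ?h (-y)) * indicator {0<..} y = ennreal (indicator {0<..} y * (exp (-(s-1)*y) - exp (-s*y))) + ennreal (xi_kernel y * cosh ((s - 1/2) * y))"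
    proof (cases "y > 0")
      case True
      have "?h y + ?h (-y) = ennreal (2 * exp (s * y) * theta_tail (exp (2 * y)) + 2 * exp (s * (-y)) * theta_tail (exp (2 * (-y))))"
        by (rule ennreal_plus[symmetric]) (auto simp: theta_tail_nonneg)
      also have "\<dots> = ennreal (exp (-(s-1)*y) - exp (-s*y)) + ennreal (xi_kernel y * cosh ((s - 1/2) * y))"
        unfolding theta_fold[OF True] using True
        by (intro ennreal_plus) (auto simp: xi_kernel_nonneg algebra_simps intro!: mult_nonneg_nonneg cosh_real_nonneg)
      finally show ?thesis using True by simp
    qed (simp add: xi_kernel_def)
  qed
  also have "\<dots> = (\<integral>\<^sup>+y. ennreal (indicator {0<..} y * (exp (-(s-1)*y) - exp (-s*y))) \<partial>lborel) + (\<integral>\<^sup>+y. ennreal (xi_kernel y * cosh ((s - 1/2) * y)) \<partial>lborel)"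
    by (rule nn_integral_add) measurable
  finally show ?thesis by (simp only: exp_diff_integral[OF assms])
qed

text \<open>Taylor coefficients of \<open>Lambda(s) - 1/(s (s-1))\<close> in powers of
  \<open>(s - 1/2)^2\<close>. They are moments of a nonnegative kernel, hence nonnegative, so that
  real arguments later dominate the complex ones of the same modulus.\<close>

definition xi_coeff :: "nat \<Rightarrow> real" where
  "xi_coeff n = enn2real (\<integral>\<^sup>+y. ennreal (xi_kernel y * (y^(2*n) / fact (2*n))) \<partial>lborel)"

lemma xi_coeff_nonneg: "xi_coeff n \<ge> 0"
  by (simp add: xi_coeff_def)

lemma cosh_even_series: "(\<lambda>n. x^(2*n) / fact (2*n)) sums cosh (x::real)"
proof -
  have "(\<lambda>n. (\<lambda>n. if even n then x ^ n /\<^sub>R fact n else 0) (2*n)) sums cosh x"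
    by (subst sums_mono_reindex) (use cosh_converges[of x] in \<open>auto simp: strict_mono_def elim!: evenE\<close>)
  then show ?thesis by (simp add: divide_inverse mult.commute)
qed

lemma xi_kernel_cosh_integral:
  "(\<integral>\<^sup>+y. ennreal (xi_kernel y * cosh (x * y)) \<partial>lborel) =
   (\<Sum>n. (\<integral>\<^sup>+y. ennreal (xi_kernel y * (y^(2*n) / fact (2*n))) \<partial>lborel) * ennreal (x^(2*n)))"
proof -
  have "ennreal (xi_kernel y * cosh (x * y)) = (\<Sum>n. ennreal (xi_kernel y * (y^(2*n) / fact (2*n))) * ennreal (x^(2*n)))" for y
  proof -
    have "(\<lambda>n. xi_kernel y * ((x*y)^(2*n) / fact (2*n))) sums (xi_kernel y * cosh (x * y))"
      by (intro sums_mult cosh_even_series)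
    then have "(\<Sum>n. ennreal (xi_kernel y * ((x*y)^(2*n) / fact (2*n)))) = ennreal (xi_kernel y * cosh (x * y))"
      by (intro suminf_ennreal_eq mult_nonneg_nonneg xi_kernel_nonneg divide_nonneg_nonneg zero_le_even_power') auto
    moreover have "ennreal (xi_kernel y * ((x*y)^(2*n) / fact (2*n))) = ennreal (xi_kernel y * (y^(2*n) / fact (2*n))) * ennreal (x^(2*n))" for n
    proof -
      have "0 \<le> xi_kernel y * (y^(2*n) / fact (2*n))"
        by (intro mult_nonneg_nonneg xi_kernel_nonneg divide_nonneg_nonneg zero_le_even_power') auto
      moreover have "0 \<le> x^(2*n)" by (rule zero_le_even_power')
      ultimately show ?thesis by (subst ennreal_mult[symmetric]) (auto simp: power_mult_distrib mult_ac)
    qed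
    ultimately show ?thesis by simp
  qed
  then show ?thesis
    by (simp only:) (subst nn_integral_suminf, measurable, simp add: nn_integral_multc)
qed

theorem xi_coeff_sums:
  assumes "s > 1"
  shows "(\<lambda>n. xi_coeff n * (s - 1/2)^(2*n)) sums (Lambda_real s - 1 / (s * (s-1)))"
proof -
  let ?C = "\<lambda>n. \<integral>\<^sup>+y. ennreal (xi_kernel y * (y^(2*n) / fact (2*n))) \<partial>lborel"
  define A where "A = (\<integral>\<^sup>+y. ennreal (xi_kernel y * cosh ((s - 1/2) * y)) \<partial>lborel)"
  have A: "ennreal (Lambda_real s) = ennreal (1/(s-1) - 1/s) + A"
    unfolding A_def by (rule Lambda_real_fold[OF assms])
  then have fin: "A \<noteq> top" by (metis ennreal_add_eq_top ennreal_neq_top)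
  have As: "A = (\<Sum>n. ?C n * ennreal ((s-1/2)^(2*n)))"
    unfolding A_def by (rule xi_kernel_cosh_integral)
  have pos: "(s-1/2)^(2*n) > 0" for n using assms by simp
  \<comment> \<open>\<open>enn2real\<close> would turn an infinite moment into 0. Finiteness holds
    because one term of the series is at most its finite total \<open>A\<close>.\<close>
  have C: "?C n = ennreal (xi_coeff n)" for n
  proof -
    have "?C n * ennreal ((s-1/2)^(2*n)) \<le> A"
      unfolding As using sum_le_suminf[of "\<lambda>n. ?C n * ennreal ((s-1/2)^(2*n))" "{n}"] by (simp add: summableI)
    then have "?C n * ennreal ((s-1/2)^(2*n)) \<noteq> top" using fin neq_top_trans by blast
    then have "?C n \<noteq> top" using pos[of n] assms by (auto simp: ennreal_mult_eq_top_iff)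
    then show ?thesis by (simp add: xi_coeff_def ennreal_enn2real_if)
  qed
  have As': "A = (\<Sum>n. ennreal (xi_coeff n * (s-1/2)^(2*n)))"
    unfolding As C by (simp add: ennreal_mult xi_coeff_nonneg)
  have sm: "summable (\<lambda>n. xi_coeff n * (s-1/2)^(2*n))"
    by (rule summable_suminf_not_top) (use fin As' in \<open>auto simp: xi_coeff_nonneg\<close>)
  then have "A = ennreal (\<Sum>n. xi_coeff n * (s-1/2)^(2*n))"
    unfolding As' by (intro suminf_ennreal2) (auto simp: xi_coeff_nonneg)
  moreover have "1/(s-1) - 1/s \<ge> 0" using assms by (simp add: field_simps)
  moreover have "(\<Sum>n. xi_coeff n * (s-1/2)^(2*n)) \<ge> 0"
    by (intro suminf_nonneg sm) (auto simp: xi_coeff_nonneg)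
  moreover have "Lambda_real s \<ge> 0"
    unfolding Lambda_real_def zeta_real_def
    using assms Gamma_real_pos[of "s/2"] zeta_real_sums[OF assms]
    by (intro mult_nonneg_nonneg suminf_nonneg) (auto simp: sums_iff)
  ultimately have "Lambda_real s = 1/(s-1) - 1/s + (\<Sum>n. xi_coeff n * (s-1/2)^(2*n))"
    using A by (simp flip: ennreal_plus)
  moreover have "1/(s-1) - 1/s = 1 / (s * (s-1))" using assms by (simp add: field_simps)
  ultimately show ?thesis using sm by (simp add: sums_iff)
qed

section \<open>Logarithmic derivatives of entire functions of small growth\<close>

lemma borel_caratheodory_deriv:
  assumes holo: "\<phi> holomorphic_on ball 0 R" and R: "R > 0"
    and A: "\<And>z. z \<in> ball 0 R \<Longrightarrow> Re (\<phi> z) - Re (\<phi> 0) < A"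
    and z: "norm z < R / 4"
  shows "norm (deriv \<phi> z) \<le> 8 * A / R"
proof -
  have A0: "A > 0" using A[of 0] R by simp
  define \<psi> where "\<psi> = (\<lambda>z. \<phi> z - \<phi> 0)"
  have \<psi>_holo: "\<psi> holomorphic_on ball 0 R" unfolding \<psi>_def by (intro holomorphic_intros holo)
  have Re_\<psi>: "Re (\<psi> z) < A" if "norm z < R" for z using A[of z] that by (simp add: \<psi>_def)
  \<comment> \<open>The Moebius map takes the half-plane \<open>Re < A\<close> into the unit disc
    and fixes 0, so the Schwarz lemma bounds \<open>w z\<close> by \<open>|z| / R\<close>. Solving
    for \<psi> gives \<open>2 A\<close> on the half disc, and Cauchy's inequality with radius
    \<open>R/4\<close> the final \<open>8 A / R\<close>.\<close>
  define w where "w = (\<lambda>z. \<psi> z / (2 * A - \<psi> z))"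
  have den: "2 * A - \<psi> z \<noteq> 0" if "norm z < R" for z
  proof
    assume "2 * A - \<psi> z = 0"
    then have "Re (2 * complex_of_real A - \<psi> z) = 0" by simp
    then show False using Re_\<psi>[OF that] A0 by simp
  qed
  have w_less: "norm (w z) < 1" if "norm z < R" for z
  proof -
    have "(norm (\<psi> z))^2 < (norm (2 * A - \<psi> z))^2"
      using Re_\<psi>[OF that] A0 unfolding cmod_power2 by (simp add: power2_eq_square algebra_simps)
    then have "norm (\<psi> z) < norm (2 * A - \<psi> z)" by (rule power_less_imp_less_base) simp
    moreover have "norm (2 * A - \<psi> z) > 0" using den[OF that] by (simp only: zero_less_norm_iff) simp
    ultimately show ?thesis by (simp add: w_def norm_divide)
  qed
  have w_holo: "w holomorphic_on ball 0 R"
    unfolding w_def by (intro holomorphic_intros \<psi>_holo) (use den in auto)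
  have w_le: "norm (w z) \<le> norm z / R" if "norm z < R" for z
  proof -
    have sc: "(\<lambda>u. w (R * u)) holomorphic_on ball 0 1"
      by (rule holomorphic_on_compose_gen[of "\<lambda>u. R * u" _ w "ball 0 R", unfolded o_def])
         (use R w_holo in \<open>auto intro!: holomorphic_intros simp: norm_mult\<close>)
    have "norm (w (R * (z / R))) \<le> norm (z / complex_of_real R)"
      by (rule Schwarz_Lemma(1)[OF sc]) (use R that w_less in \<open>auto simp: w_def \<psi>_def norm_mult norm_divide\<close>)
    then show ?thesis using R by (simp add: norm_divide)
  qed
  have \<psi>_le: "norm (\<psi> z) \<le> 2 * A" if "norm z \<le> R / 2" for z
  proof -
    have zR: "norm z < R" using that R by simp
    have "norm (w z) \<le> norm z / R" by (rule w_le[OF zR])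
    also have "\<dots> \<le> 1/2" using that R by (simp add: field_simps)
    finally have w2: "norm (w z) \<le> 1/2" .
    have "1 + w z \<noteq> 0" using w2 norm_triangle_ineq2[of 1 "- w z"] by auto
    then have "\<psi> z = 2 * A * w z / (1 + w z)"
      using den[OF zR] unfolding w_def by (simp add: field_simps)
    then have "norm (\<psi> z) = 2 * A * norm (w z) / norm (1 + w z)"
      using A0 by (simp add: norm_mult norm_divide)
    also have "\<dots> \<le> 2 * A * (1/2) / (1/2)"
    proof (intro frac_le mult_left_mono)
      show "1/2 \<le> norm (1 + w z)" using w2 norm_triangle_ineq2[of 1 "- w z"] by simp
    qed (use w2 A0 in auto)
    finally show ?thesis by simp
  qed
  have sub: "cball z (R/4) \<subseteq> ball 0 R"
  proof
    fix y assume "y \<in> cball z (R/4)"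
    then have "norm (y - z) \<le> R/4" by (simp add: dist_norm norm_minus_commute)
    then show "y \<in> ball 0 R" using z R norm_triangle_ineq[of "y - z" z] by simp
  qed
  have "norm ((deriv ^^ 1) \<psi> z) \<le> fact 1 * (2 * A) / (R/4)^1"
  proof (rule Cauchy_inequality)
    show "\<psi> holomorphic_on ball z (R/4)" using sub by (intro holomorphic_on_subset[OF \<psi>_holo]) auto
    show "continuous_on (cball z (R/4)) \<psi>"
      by (rule holomorphic_on_imp_continuous_on[OF holomorphic_on_subset[OF \<psi>_holo sub]])
    fix x assume "norm (z - x) = R/4"
    then show "norm (\<psi> x) \<le> 2 * A"
      using z norm_triangle_ineq[of "x - z" z] by (intro \<psi>_le) (simp add: norm_minus_commute)
  qed (use R in auto)
  moreover have "deriv \<psi> z = deriv \<phi> z"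
  proof (rule DERIV_imp_deriv)
    have "(\<phi> has_field_derivative deriv \<phi> z) (at z)"
      using z R by (intro holomorphic_derivI[OF holo]) auto
    then show "(\<psi> has_field_derivative deriv \<phi> z) (at z)"
      unfolding \<psi>_def by (auto intro!: derivative_eq_intros)
  qed
  ultimately show ?thesis by simp
qed

lemma entire_divide_zero:
  assumes holo: "g holomorphic_on UNIV" and nz: "g a \<noteq> 0" and u: "g u = 0"
  obtains h n where "h holomorphic_on UNIV" "n > 0" "h u \<noteq> 0" "\<And>v. g v = (v - u)^n * h v"
proof -
  have "\<not> g constant_on UNIV" using nz u unfolding constant_on_def by force
  then obtain k r n where k: "0 < n" "0 < r" "k holomorphic_on ball u r"
      "\<And>w. w \<in> ball u r \<Longrightarrow> g w = (w - u)^n * k w" "\<And>w. w \<in> ball u r \<Longrightarrow> k w \<noteq> 0"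
    using holomorphic_factor_zero_nonconstant[OF holo open_UNIV connected_UNIV UNIV_I u] by metis
  define h where "h = (\<lambda>v. if v = u then k u else g v / (v - u)^n)"
  have hk: "h v = k v" if "v \<in> ball u r" for v
    using k(4)[OF that] by (simp add: h_def)
  have "h holomorphic_on ball u r \<union> - {u}"
  proof (rule holomorphic_on_Un)
    show "h holomorphic_on ball u r" by (rule holomorphic_transform[OF k(3)]) (use hk in simp)
    have "(\<lambda>v. g v / (v - u)^n) holomorphic_on - {u}"
      by (intro holomorphic_intros holomorphic_on_subset[OF holo]) auto
    then show "h holomorphic_on - {u}" by (rule holomorphic_transform) (auto simp: h_def)
  qed auto
  moreover have "ball u r \<union> - {u} = UNIV" using k(2) by auto
  ultimately have "h holomorphic_on UNIV" by simp
  moreover have "g v = (v - u)^n * h v" for v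
    using k(1) u by (auto simp: h_def)
  moreover have "h u \<noteq> 0" using k(2,5) by (simp add: h_def)
  ultimately show thesis using k(1) that by blast
qed

lemma entire_divide_zeros:
  assumes "finite Z"
  shows "g holomorphic_on UNIV \<Longrightarrow> g a \<noteq> 0 \<Longrightarrow> (\<And>u. u \<in> Z \<Longrightarrow> g u = 0) \<Longrightarrow>
    \<exists>h m. h holomorphic_on UNIV \<and> (\<forall>u\<in>Z. m u > 0 \<and> h u \<noteq> 0) \<and> (\<forall>v. g v = (\<Prod>u\<in>Z. (v - u)^(m u)) * h v)"
  using assms
proof (induction Z arbitrary: g rule: finite_induct)
  case empty
  then show ?case by (intro exI[of _ g]) auto
next
  case (insert u Z)
  obtain h0 n where h0: "h0 holomorphic_on UNIV" "n > 0" "h0 u \<noteq> 0" "\<And>v. g v = (v - u)^n * h0 v"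
    using entire_divide_zero[OF insert.prems(1,2), of u] insert.prems(3) by blast
  have "h0 a \<noteq> 0" using insert.prems(2) h0(4)[of a] by auto
  moreover have "h0 w = 0" if "w \<in> Z" for w
    using insert.prems(3)[of w] that h0(4)[of w] insert.hyps(2) by auto
  ultimately obtain h m where h: "h holomorphic_on UNIV" "\<And>u. u \<in> Z \<Longrightarrow> m u > 0 \<and> h u \<noteq> 0"
      "\<And>v. h0 v = (\<Prod>u\<in>Z. (v - u)^(m u)) * h v"
    using insert.IH[OF h0(1)] by metis
  have "h u \<noteq> 0" using h0(3) h(3)[of u] by auto
  have eq: "(\<Prod>w\<in>Z. (v - w)^((m(u:=n)) w)) = (\<Prod>w\<in>Z. (v - w)^(m w))" for v
    by (rule prod.cong) (use insert.hyps(2) in auto)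
  show ?case
  proof (intro exI[of _ h] exI[of _ "m(u := n)"] conjI ballI allI)
    fix v
    show "g v = (\<Prod>w\<in>insert u Z. (v - w)^((m(u:=n)) w)) * h v"
      unfolding prod.insert[OF insert.hyps(1,2)] eq by (simp add: h0(4)[of v] h(3)[of v])
  next
    fix w assume "w \<in> insert u Z"
    then show "(m(u:=n)) w > 0" "h w \<noteq> 0" using h0(2) h(2) \<open>h u \<noteq> 0\<close> insert.hyps(2) by auto
  qed (use h in auto)
qed

text \<open>Dividing by \<open>\<Prod>(1 - v/u)\<close> does not increase the maximum modulus on \<open>\<bar>v\<bar> = 4R\<close>.\<close>
lemma entire_log_deriv_approx:
  fixes g :: "complex \<Rightarrow> complex" and M :: "real \<Rightarrow> real"
  assumes holo: "g holomorphic_on UNIV" and g0: "g 0 \<noteq> 0"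
    and M: "\<And>v. norm (g v) \<le> M (norm v)"
    and growth: "((\<lambda>R. ln (M R) / R) \<longlongrightarrow> 0) at_top"
    and V: "V > 0" and \<epsilon>: "\<epsilon> > 0"
  obtains Z m e where "finite Z" "\<And>u. u \<in> Z \<Longrightarrow> g u = 0 \<and> m u > 0" "\<And>u. g u = 0 \<Longrightarrow> norm u < V \<Longrightarrow> u \<in> Z"
    "e holomorphic_on ball 0 V" "\<And>v. v \<in> ball 0 V \<Longrightarrow> norm (e v) \<le> \<epsilon>"
    "\<And>v. v \<in> ball 0 V \<Longrightarrow> g v \<noteq> 0 \<Longrightarrow> deriv g v / g v = (\<Sum>u\<in>Z. of_nat (m u) / (v - u)) + e v"
proof -
  \<comment> \<open>This is the bound \<open>8 (ln (M (4R)) - ln |g 0| + 1) / R\<close> of the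
    Borel-Caratheodory estimate, rewritten. It tends to 0 because \<open>ln (M R)\<close> is o(R); a
    factor exp(c v) in \<open>g\<close> would leave the constant \<open>c\<close> behind.\<close>
  have lim: "((\<lambda>R. 32 * (ln (M (4 * R)) / (4 * R)) + 8 * (1 - ln (norm (g 0))) / R) \<longlongrightarrow> 32 * 0 + 0) at_top"
  proof (intro tendsto_add tendsto_mult tendsto_const)
    show "((\<lambda>R. ln (M (4 * R)) / (4 * R)) \<longlongrightarrow> 0) at_top"
      by (rule filterlim_compose[OF growth]) real_asymp
    show "((\<lambda>R. 8 * (1 - ln (norm (g 0))) / R) \<longlongrightarrow> 0) at_top" by real_asymp
  qed
  then have "\<forall>\<^sub>F R in at_top. 32 * (ln (M (4 * R)) / (4 * R)) + 8 * (1 - ln (norm (g 0))) / R < \<epsilon>"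
    by (rule order_tendstoD) (use \<epsilon> in simp)
  then have "\<forall>\<^sub>F R in at_top. R > 4 * V \<and> 32 * (ln (M (4 * R)) / (4 * R)) + 8 * (1 - ln (norm (g 0))) / R < \<epsilon>"
    using eventually_gt_at_top by eventually_elim auto
  then obtain R where R: "R > 4 * V" "32 * (ln (M (4 * R)) / (4 * R)) + 8 * (1 - ln (norm (g 0))) / R < \<epsilon>"
    using eventually_happens[of _ "at_top :: real filter"] by auto
  have R0: "R > 0" using R V by simp
  define Z where "Z = {u \<in> cball 0 R. g u = 0}"
  have fin: "finite Z"
  proof (cases "Z = {}")
    case False
    then have "\<not> g constant_on UNIV" using g0 unfolding constant_on_def Z_def by force
    then show ?thesis unfolding Z_def
      using holomorphic_compact_finite_zeros[OF holo open_UNIV connected_UNIV, of "cball 0 R"] by (simp add: Int_def conj_commute)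
  qed simp
  obtain h m where h: "h holomorphic_on UNIV" "\<And>u. u \<in> Z \<Longrightarrow> m u > 0 \<and> h u \<noteq> 0"
      "\<And>v. g v = (\<Prod>u\<in>Z. (v - u)^(m u)) * h v"
  proof -
    have "\<And>u. u \<in> Z \<Longrightarrow> g u = 0" by (simp add: Z_def)
    from entire_divide_zeros[OF fin holo g0 this] show thesis using that by blast
  qed
  define P where "P = (\<lambda>v. \<Prod>u\<in>Z. (v - u)^(m u))"
  have Zn0: "u \<noteq> 0" if "u \<in> Z" for u using that g0 by (auto simp: Z_def)
  have P0: "P 0 \<noteq> 0" unfolding P_def using fin Zn0 by (auto simp: prod_zero_iff)
  define k where "k = (\<lambda>v. P 0 * h v)"
  have k_holo: "k holomorphic_on A" for A unfolding k_def by (intro holomorphic_intros holomorphic_on_subset[OF h(1)]) auto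
  have k0: "k 0 = g 0" by (simp add: k_def P_def h(3)[of 0])
  have k_nz: "k v \<noteq> 0" if "v \<in> ball 0 R" for v
  proof (cases "v \<in> Z")
    case True then show ?thesis using h(2) P0 by (simp add: k_def)
  next
    case False
    then have "g v \<noteq> 0" using that by (simp add: Z_def)
    then show ?thesis using P0 h(3)[of v] by (auto simp: k_def)
  qed
  have k_bd_sphere: "norm (k v) \<le> M (4 * R)" if "norm v = 4 * R" for v
  proof -
    have "norm (P 0) \<le> norm (P v)"
      unfolding P_def prod_norm[symmetric]
    proof (rule prod_mono, safe)
      fix u assume "u \<in> Z"
      then have "norm u \<le> R" by (simp add: Z_def)
      then have "norm (0 - u) \<le> norm (v - u)" using that norm_triangle_ineq2[of v u] R0 by simp
      then show "norm ((0 - u)^m u) \<le> norm ((v - u)^m u)" unfolding norm_power by (intro power_mono) auto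
    qed auto
    then have "norm (P 0) * norm (h v) \<le> norm (P v) * norm (h v)" by (rule mult_right_mono) simp
    also have "\<dots> = norm (g v)" by (simp add: h(3)[of v] P_def norm_mult)
    also have "\<dots> \<le> M (4 * R)" using M[of v] that by simp
    finally show ?thesis by (simp add: k_def norm_mult)
  qed
  have k_bd: "norm (k v) \<le> M (4 * R)" if "v \<in> ball 0 R" for v
  proof (rule maximum_modulus_frontier[where S = "cball 0 (4*R)" and f = k])
    show "k holomorphic_on interior (cball 0 (4*R))" by (rule k_holo)
    show "continuous_on (closure (cball 0 (4*R))) k" by (intro holomorphic_on_imp_continuous_on k_holo)
    show "\<And>z. z \<in> frontier (cball 0 (4*R)) \<Longrightarrow> norm (k z) \<le> M (4 * R)"
      using R0 by (auto simp: k_bd_sphere)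
    show "v \<in> cball 0 (4*R)" using that R0 by auto
  qed auto
  obtain \<phi> where \<phi>: "\<phi> holomorphic_on ball 0 R" "\<And>v. v \<in> ball 0 R \<Longrightarrow> k v = exp (\<phi> v)"
    using contractible_imp_holomorphic_log[OF k_holo convex_imp_contractible[OF convex_ball] k_nz] by metis
  have "0 < norm (k 0)" using k_nz[of 0] R0 by simp
  then have M4: "M (4*R) > 0" using less_le_trans[OF _ k_bd[of 0]] R0 by simp
  have norm_k: "norm (k v) = exp (Re (\<phi> v))" if "v \<in> ball 0 R" for v using \<phi>(2)[OF that] by simp
  have Re0: "Re (\<phi> 0) = ln (norm (g 0))" using norm_k[of 0] R0 k0 by simp
  have Re_le: "Re (\<phi> v) \<le> ln (M (4*R))" if "v \<in> ball 0 R" for v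
    using k_bd[OF that] norm_k[OF that] M4 by (simp add: ln_ge_iff)
  have d\<phi>: "norm (deriv \<phi> v) \<le> \<epsilon>" if "norm v < V" for v
  proof -
    have "norm (deriv \<phi> v) \<le> 8 * (ln (M (4*R)) - ln (norm (g 0)) + 1) / R"
    proof (rule borel_caratheodory_deriv[OF \<phi>(1) R0])
    show "Re (\<phi> z) - Re (\<phi> 0) < ln (M (4*R)) - ln (norm (g 0)) + 1" if "z \<in> ball 0 R" for z
      using Re_le[OF that] Re0 by simp
    show "norm v < R / 4" using that R(1) by simp
  qed
    also have "\<dots> = 32 * (ln (M (4 * R)) / (4 * R)) + 8 * (1 - ln (norm (g 0))) / R"
      using R0 by (simp add: field_simps)
    finally show ?thesis using R(2) by simp
  qed
  show thesis
  proof (rule that[of Z m "deriv \<phi>"])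
    show "deriv \<phi> holomorphic_on ball 0 V"
      using R V by (intro holomorphic_on_subset[OF holomorphic_deriv[OF \<phi>(1)]]) auto
    show "norm (deriv \<phi> v) \<le> \<epsilon>" if "v \<in> ball 0 V" for v using d\<phi> that by simp
    fix v assume v: "v \<in> ball 0 V" and gv: "g v \<noteq> 0"
    then have vR: "v \<in> ball 0 R" using R V by auto
    have vZ: "v \<notin> Z" using gv by (auto simp: Z_def)
    have dk: "(k has_field_derivative deriv \<phi> v * k v) (at v)"
    proof -
      have "(\<phi> has_field_derivative deriv \<phi> v) (at v)" using vR by (intro holomorphic_derivI[OF \<phi>(1)]) auto
      then have "((\<lambda>v. exp (\<phi> v)) has_field_derivative deriv \<phi> v * k v) (at v)"
        by (auto intro!: derivative_eq_intros simp: \<phi>(2)[OF vR])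
      then show ?thesis
        by (rule has_field_derivative_transform_within_open[where S = "ball 0 R"]) (use vR \<phi>(2) in auto)
    qed
    have dP: "(P has_field_derivative (P v * (\<Sum>u\<in>Z. of_nat (m u) / (v - u)))) (at v)"
    proof -
      have "((\<lambda>v. \<Prod>u\<in>Z. (v - u)^(m u)) has_field_derivative
         (\<Prod>u\<in>Z. (v - u)^(m u)) * (\<Sum>u\<in>Z. (of_nat (m u) * (v - u)^(m u - 1)) / (v - u)^(m u))) (at v)"
        using vZ fin by (intro has_field_derivative_prod') (auto intro!: derivative_eq_intros)
      moreover have "(\<Sum>u\<in>Z. (of_nat (m u) * (v - u)^(m u - 1)) / (v - u)^(m u)) = (\<Sum>u\<in>Z. of_nat (m u) / (v - u))"
      proof (rule sum.cong[OF refl])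
        fix u assume u: "u \<in> Z"
        then obtain j where "m u = Suc j" using h(2) gr0_implies_Suc by blast
        then show "(of_nat (m u) * (v - u)^(m u - 1)) / (v - u)^(m u) = of_nat (m u) / (v - u)"
          using vZ u by auto
      qed
      ultimately show ?thesis by (simp add: P_def)
    qed
    have "((\<lambda>v. P v * k v / P 0) has_field_derivative
        (P v * (\<Sum>u\<in>Z. of_nat (m u) / (v - u)) * k v + deriv \<phi> v * k v * P v) / P 0) (at v)"
      by (intro DERIV_cdivide DERIV_mult dP dk)
    moreover have geq: "g = (\<lambda>v. P v * k v / P 0)" using P0 by (auto simp: k_def P_def h(3))
    ultimately have "deriv g v = (P v * (\<Sum>u\<in>Z. of_nat (m u) / (v - u)) * k v + deriv \<phi> v * k v * P v) / P 0"
      by (metis DERIV_imp_deriv)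
    also have "\<dots> = g v * ((\<Sum>u\<in>Z. of_nat (m u) / (v - u)) + deriv \<phi> v)"
      by (subst geq) (simp add: algebra_simps add_divide_distrib)
    finally show "deriv g v / g v = (\<Sum>u\<in>Z. of_nat (m u) / (v - u)) + deriv \<phi> v"
      using gv by simp
  next
    show "g u = 0 \<and> m u > 0" if "u \<in> Z" for u using h(2)[OF that] that by (simp add: Z_def)
    show "u \<in> Z" if "g u = 0" "norm u < V" for u using that R V by (simp add: Z_def)
  qed (rule fin)
qed

subsection \<open>The entire function \<open>\<xi>\<close> in the variable \<open>s (s - 1)\<close>\<close>

lemma summable_xi_coeff:
  assumes "r \<ge> 0"
  shows "summable (\<lambda>n. xi_coeff n * r ^ n)"
proof (rule summable_comparison_test')
  let ?s = "1/2 + sqrt (r + 1)"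
  have "sqrt (r + 1) \<ge> 1" using assms by simp
  then have "?s > 1" by linarith
  then show "summable (\<lambda>n. xi_coeff n * (?s - 1/2)^(2*n))"
    using xi_coeff_sums sums_summable by blast
  fix n :: nat assume "n \<ge> 0"
  have "(?s - 1/2)^(2*n) = (r + 1)^n" using assms by (simp add: power_mult)
  moreover have "r ^ n \<le> (r + 1)^n" using assms by (intro power_mono) auto
  ultimately show "norm (xi_coeff n * r ^ n) \<le> xi_coeff n * (?s - 1/2)^(2*n)"
    using assms xi_coeff_nonneg[of n] by (auto simp: abs_mult intro!: mult_left_mono)
qed

definition xi_series :: "complex \<Rightarrow> complex" where
  "xi_series w = (\<Sum>n. of_real (xi_coeff n) * w ^ n)"

lemma xi_series_sums: "(\<lambda>n. of_real (xi_coeff n) * w ^ n) sums xi_series w"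
proof -
  have "summable (\<lambda>n. norm (of_real (xi_coeff n) * w ^ n))"
    using summable_xi_coeff[of "norm w"] by (simp add: norm_mult norm_power xi_coeff_nonneg)
  then show ?thesis unfolding xi_series_def by (rule summable_sums[OF summable_norm_cancel])
qed

lemma xi_series_holomorphic: "xi_series holomorphic_on A"
proof -
  have "xi_series holomorphic_on ball 0 r" for r
    using xi_series_sums by (intro power_series_holomorphic[of 0 r "\<lambda>n. of_real (xi_coeff n)"]) simp
  then have "xi_series field_differentiable at z" for z
    by (intro holomorphic_on_imp_differentiable_at[of _ "ball 0 (norm z + 1)"]) auto
  then show ?thesis
    unfolding holomorphic_on_def using field_differentiable_at_within by blast
qed

text \<open>Riemann's \<xi>(s) = s (s-1) Lambda(s) / 2 in the variable \<open>v = s (s-1)\<close>,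
  where \<open>v + 1/4 = (s - 1/2)^2\<close>. The polar part \<open>1/v\<close> was removed before
  expanding and returns as the summand 1, so the function is entire. The zeros \<rho> and 1 - \<rho>
  correspond to a single zero in \<open>v\<close>.\<close>

definition xi_sq :: "complex \<Rightarrow> complex" where
  "xi_sq v = (1 + v * xi_series (v + 1/4)) / 2"

lemma xi_sq_holomorphic [holomorphic_intros]: "xi_sq holomorphic_on A"
proof -
  have "(\<lambda>v. xi_series (v + 1/4)) holomorphic_on A"
  proof -
    have "(\<lambda>v::complex. v + 1/4) holomorphic_on A" by (intro holomorphic_intros)
    from holomorphic_on_compose_gen[OF this xi_series_holomorphic[of UNIV]] show ?thesis by (simp add: o_def)
  qed
  then show ?thesis unfolding xi_sq_def [abs_def] by (intro holomorphic_intros) auto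
qed

lemma xi_sq_0: "xi_sq 0 = 1/2"
  by (simp add: xi_sq_def)

lemma xi_series_real:
  assumes "s > 1"
  shows "xi_series (of_real ((s - 1/2)^2)) = of_real (Lambda_real s - 1 / (s * (s-1)))"
proof -
  have "(\<lambda>n. of_real (xi_coeff n * (s - 1/2)^(2*n)) :: complex) sums of_real (Lambda_real s - 1 / (s * (s-1)))"
    using xi_coeff_sums[OF assms] by (rule sums_of_real)
  then show ?thesis
    using xi_series_sums[of "of_real ((s - 1/2)^2)"]
    by (intro sums_unique2[OF xi_series_sums]) (simp add: power_mult)
qed

lemma xi_sq_real:
  assumes "s > 1"
  shows "xi_sq (of_real (s * (s - 1))) = of_real (s * (s - 1) * Lambda_real s / 2)"
proof -
  have "complex_of_real (s * (s - 1)) + 1/4 = of_real ((s - 1/2)^2)"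
    by (simp add: power2_eq_square algebra_simps)
  then have "xi_sq (of_real (s * (s - 1))) = of_real ((1 + s * (s - 1) * (Lambda_real s - 1 / (s * (s-1)))) / 2)"
    unfolding xi_sq_def by (simp only: xi_series_real[OF assms]) simp
  also have "(1 + s * (s - 1) * (Lambda_real s - 1 / (s * (s-1)))) = s * (s - 1) * Lambda_real s"
    using assms by (simp add: right_diff_distrib)
  finally show ?thesis .
qed

lemma xi_sq_cnj: "xi_sq (cnj v) = cnj (xi_sq v)"
proof -
  have "(\<lambda>n. cnj (of_real (xi_coeff n) * w ^ n)) sums cnj (xi_series w)" for w
    using xi_series_sums by (rule bounded_linear.sums[OF bounded_linear_cnj])
  then have "xi_series (cnj w) = cnj (xi_series w)" for w
    using xi_series_sums[of "cnj w"] by (intro sums_unique2[OF xi_series_sums]) simp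
  from this[of "v + 1/4"] have "xi_series (cnj v + 1/4) = cnj (xi_series (v + 1/4))" by simp
  then show ?thesis unfolding xi_sq_def by simp
qed

definition xi_majorant :: "real \<Rightarrow> real" where
  "xi_majorant R = (1 + R * (\<Sum>n. xi_coeff n * (R + 1/4) ^ n)) / 2"

lemma norm_xi_sq_le: "norm (xi_sq v) \<le> xi_majorant (norm v)"
proof -
  have "norm (xi_series w) \<le> (\<Sum>n. xi_coeff n * r ^ n)" if "norm w \<le> r" for w r
    unfolding xi_series_def
  proof (rule norm_suminf_le)
    show "norm (of_real (xi_coeff n) * w ^ n) \<le> xi_coeff n * r ^ n" for n
      using that by (auto simp: norm_mult norm_power xi_coeff_nonneg intro!: mult_left_mono power_mono)
    show "summable (\<lambda>n. xi_coeff n * r ^ n)" using that norm_ge_zero[of w] by (intro summable_xi_coeff) linarith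
  qed
  moreover have "norm (v + 1/4) \<le> norm v + 1/4" using norm_triangle_ineq[of v "1/4"] by simp
  ultimately have *: "norm (xi_series (v + 1/4)) \<le> (\<Sum>n. xi_coeff n * (norm v + 1/4) ^ n)" by blast
  have "norm (1 + v * xi_series (v + 1/4)) \<le> 1 + norm v * norm (xi_series (v + 1/4))"
    using norm_triangle_ineq[of 1 "v * xi_series (v + 1/4)"] by (simp add: norm_mult)
  also have "\<dots> \<le> 1 + norm v * (\<Sum>n. xi_coeff n * (norm v + 1/4) ^ n)"
    using * by (intro add_left_mono mult_left_mono) auto
  finally show ?thesis by (simp add: xi_sq_def xi_majorant_def norm_divide)
qed

lemma Gamma_real_le:
  assumes "(x::real) \<ge> 2"
  shows "Gamma x \<le> (x + 1) powr (x + 1)"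
proof -
  define n where "n = nat \<lceil>x\<rceil>"
  have n: "x \<le> real n" "real n < x + 1" using assms unfolding n_def by linarith+
  have "Gamma x \<le> Gamma (1 + real n)" using Gamma_real_strict_mono[of x "1 + real n"] n assms by simp
  also have "\<dots> = fact n" by (rule Gamma_fact)
  also have "\<dots> \<le> real n ^ n" using fact_le_power[of n] by simp
  also have "\<dots> = real n powr real n" using n assms by (simp add: powr_realpow)
  also have "\<dots> \<le> (x + 1) powr real n" using n assms by (intro powr_mono2) auto
  also have "\<dots> \<le> (x + 1) powr (x + 1)" using n assms by (intro powr_mono) auto
  finally show ?thesis .
qed

text \<open>By nonnegativity of the coefficients the majorant is \<xi> itself at the real point
  \<open>s = 1/2 + sqrt(R + 1/4)\<close>, for which \<open>s (s-1) = R\<close>. The Gamma factor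
  makes its logarithm at most of order sqrt R ln R, so the order in \<open>v\<close> is at most
  1/2.\<close>

lemma xi_majorant_growth: "((\<lambda>R. ln (xi_majorant R) / R) \<longlongrightarrow> 0) at_top"
proof -
  let ?s = "\<lambda>R. 1/2 + sqrt (R + 1/4)"
  let ?x = "\<lambda>R. ?s R / 2 + 1"
  define C where "C = zeta_real 2"
  have zeta_le: "zeta_real s \<le> C" if "s \<ge> 2" for s
    unfolding C_def using that
    by (intro sums_le[OF _ zeta_real_sums zeta_real_sums] powr_mono) auto
  have zeta_pos: "zeta_real s > 0" if "s > 1" for s
  proof -
    have "(\<Sum>n<1. real (Suc n) powr (-s)) \<le> zeta_real s"
      using zeta_real_sums[OF that] by (subst sums_unique[OF zeta_real_sums[OF that]]) (intro sum_le_suminf, auto simp: sums_iff)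
    then show ?thesis by simp
  qed
  have Cpos: "C > 0" using zeta_pos[of 2] by (simp add: C_def)
  have ge: "xi_majorant R \<ge> 1/2" if "R \<ge> 0" for R
    unfolding xi_majorant_def using that summable_xi_coeff[of "R + 1/4"] xi_coeff_nonneg
    by (auto intro!: mult_nonneg_nonneg suminf_nonneg)
  have le: "ln (xi_majorant R) \<le> ln (R * C / 2) + ?x R * ln (?x R)" if R: "R \<ge> 12" for R
  proof -
    have "sqrt (R + 1/4) \<ge> sqrt ((7/2)^2)" using R by (intro real_sqrt_le_mono) (simp add: power2_eq_square)
    then have s4: "?s R \<ge> 4" by simp
    have sq: "(?s R - 1/2)^2 = R + 1/4" using R by simp
    have ss: "?s R * (?s R - 1) = R" using sq by (simp add: power2_eq_square algebra_simps)
    have "(\<lambda>n. xi_coeff n * (R + 1/4) ^ n) sums (Lambda_real (?s R) - 1 / R)"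
      using xi_coeff_sums[of "?s R"] s4 sq ss by (simp add: power_mult)
    then have "xi_majorant R = (1 + R * (Lambda_real (?s R) - 1 / R)) / 2"
      unfolding xi_majorant_def by (simp add: sums_iff)
    also have "\<dots> = R * Lambda_real (?s R) / 2" using R by (simp add: right_diff_distrib)
    also have "\<dots> \<le> R * (1 * ((?s R / 2 + 1) powr (?s R / 2 + 1)) * C) / 2"
      unfolding Lambda_real_def
    proof (intro divide_right_mono mult_left_mono mult_mono)
      have "pi powr (- ?s R / 2) \<le> pi powr 0" using s4 pi_gt3 by (intro powr_mono) auto
      then show "pi powr (- ?s R / 2) \<le> 1" by simp
      show "Gamma (?s R / 2) \<le> (?s R / 2 + 1) powr (?s R / 2 + 1)"
        using s4 by (intro Gamma_real_le) auto
      show "zeta_real (?s R) \<le> C" using s4 by (intro zeta_le) auto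
      show "0 \<le> Gamma (?s R / 2)" using s4 by (intro less_imp_le Gamma_real_pos) auto
      show "0 \<le> zeta_real (?s R)" using s4 by (intro less_imp_le zeta_pos) auto
    qed (use R in auto)
    finally have "xi_majorant R \<le> R * C / 2 * (?x R powr ?x R)" by (simp add: mult_ac)
    then have "ln (xi_majorant R) \<le> ln (R * C / 2 * (?x R powr ?x R))"
      using ge[of R] R by (intro ln_mono) auto
    also have "\<dots> = ln (R * C / 2) + ?x R * ln (?x R)"
    proof -
      have "?x R > 0" by (intro add_nonneg_pos divide_nonneg_nonneg add_nonneg_nonneg) (use R in auto)
      then show ?thesis using R Cpos by (subst ln_mult) (auto simp: ln_powr)
    qed
    finally show ?thesis .
  qed
  show ?thesis
  proof (rule tendsto_sandwich)
    show "\<forall>\<^sub>F R in at_top. ln (1/2) / R \<le> ln (xi_majorant R) / R"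
      using eventually_gt_at_top[of 0]
      by eventually_elim (intro divide_right_mono ln_mono, use ge in \<open>auto intro: less_le_trans[of 0 "1/2"]\<close>)
    show "\<forall>\<^sub>F R in at_top. ln (xi_majorant R) / R \<le> (ln (R * C / 2) + ?x R * ln (?x R)) / R"
      using eventually_ge_at_top[of 12] by eventually_elim (intro divide_right_mono le, auto)
    show "((\<lambda>R::real. ln (1/2) / R) \<longlongrightarrow> 0) at_top" by real_asymp
    show "((\<lambda>R. (ln (R * C / 2) + ?x R * ln (?x R)) / R) \<longlongrightarrow> 0) at_top"
      using Cpos by real_asymp
  qed
qed

subsection \<open>Dirichlet series\<close>

text \<open>\<open>n^(-s)\<close> is written as an exponential so that differentiation multiplies
  the coefficients by powers of \<open>- ln n\<close>. Since \<open>ln 0 = 0\<close>, the term at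
  index 0 is the constant \<open>a 0\<close>, whence the recurring condition
  \<open>a 0 = 0\<close>.\<close>

definition dseries :: "(nat \<Rightarrow> real) \<Rightarrow> complex \<Rightarrow> complex" where
  "dseries a s = (\<Sum>n. of_real (a n) * exp (- s * of_real (ln (real n))))"

lemma norm_dterm: "norm (of_real (a::real) * exp (- s * of_real (ln (real n)))) = \<bar>a\<bar> * exp (- Re s * ln (real n))"
  by (simp add: norm_mult)

lemma dterm_bound:
  fixes a :: "nat \<Rightarrow> real"
  assumes a: "\<And>n. \<bar>a n\<bar> \<le> 1 + ln (real n)" "a 0 = 0" and \<sigma>: "\<sigma> > 1" and s: "Re s \<ge> \<sigma>"
  shows "norm (of_real (a n) * exp (- s * of_real (ln (real n)))) \<le> (1 + 2 / (\<sigma> - 1)) * real n powr (- (1 + \<sigma>) / 2)"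
proof (cases "n = 0")
  case True
  then show ?thesis using \<sigma> a(2) by simp
next
  case False
  then have n: "real n \<ge> 1" by simp
  \<comment> \<open>Half of the room beyond 1 absorbs the logarithm; the other half keeps the
    exponent below -1.\<close>
  define e where "e = (\<sigma> - 1) / 2"
  have e: "e > 0" using \<sigma> by (simp add: e_def)
  have "\<bar>a n\<bar> \<le> 1 + ln (real n)" by (rule a)
  also have "\<dots> \<le> real n powr e + real n powr e / e"
    using n e by (intro add_mono ln_powr_bound) (auto intro: ge_one_powr_ge_zero)
  also have "\<dots> = (1 + 2 / (\<sigma> - 1)) * real n powr e"
    by (simp add: e_def field_simps)
  finally have 1: "\<bar>a n\<bar> \<le> (1 + 2 / (\<sigma> - 1)) * real n powr e" .
  have 2: "exp (- Re s * ln (real n)) \<le> real n powr (- \<sigma>)"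
    using n s by (simp add: powr_def mult_right_mono)
  have "norm (of_real (a n) * exp (- s * of_real (ln (real n)))) \<le> ((1 + 2 / (\<sigma> - 1)) * real n powr e) * real n powr (- \<sigma>)"
    unfolding norm_dterm using 1 2 \<sigma> by (intro mult_mono) auto
  also have "\<dots> = (1 + 2 / (\<sigma> - 1)) * real n powr (e - \<sigma>)"
    by (simp add: powr_diff powr_minus divide_inverse)
  also have "e - \<sigma> = - (1 + \<sigma>) / 2" by (simp add: e_def field_simps)
  finally show ?thesis .
qed

context
  fixes a :: "nat \<Rightarrow> real"
  assumes a: "\<And>n. \<bar>a n\<bar> \<le> 1 + ln (real n)" "a 0 = 0"
begin

lemma dseries_uniform_limit:
  assumes "\<sigma> > 1"
  shows "uniform_limit {s. Re s > \<sigma>} (\<lambda>N s. \<Sum>n<N. of_real (a n) * exp (- s * of_real (ln (real n)))) (dseries a) sequentially"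
  unfolding dseries_def [abs_def]
proof (rule Weierstrass_m_test)
  show "norm (of_real (a n) * exp (- s * of_real (ln (real n)))) \<le> (1 + 2 / (\<sigma> - 1)) * real n powr (- (1 + \<sigma>) / 2)"
    if "s \<in> {s. Re s > \<sigma>}" for n s using dterm_bound[OF a assms] that by simp
  show "summable (\<lambda>n. (1 + 2 / (\<sigma> - 1)) * real n powr (- (1 + \<sigma>) / 2))"
    using assms by (intro summable_mult) (simp add: summable_real_powr_iff)
qed

lemma dseries_sums:
  assumes "Re s > 1"
  shows "(\<lambda>n. of_real (a n) * exp (- s * of_real (ln (real n)))) sums dseries a s"
proof -
  have "(\<lambda>N. \<Sum>n<N. of_real (a n) * exp (- s * of_real (ln (real n)))) \<longlonglongrightarrow> dseries a s"
    by (rule tendsto_uniform_limitI[OF dseries_uniform_limit[of "(1 + Re s)/2"]]) (use assms in auto)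
  then show ?thesis by (simp add: sums_def)
qed

lemma dseries_holomorphic: "dseries a holomorphic_on {s. Re s > 1}"
proof -
  have "dseries a field_differentiable at s" if s: "Re s > 1" for s
  proof -
    have "dseries a holomorphic_on {s'. Re s' > (1 + Re s)/2}"
    proof (rule holomorphic_uniform_sequence[where f = "\<lambda>N s. \<Sum>n<N. of_real (a n) * exp (- s * of_real (ln (real n)))"])
      fix x assume x: "x \<in> {s'. Re s' > (1 + Re s)/2}"
      then obtain d where d: "d > 0" "cball x d \<subseteq> {s'. Re s' > (1 + Re s)/2}"
        using open_contains_cball open_halfspace_Re_gt by blast
      then show "\<exists>d>0. cball x d \<subseteq> {s'. (1 + Re s)/2 < Re s'} \<and>
          uniform_limit (cball x d) (\<lambda>N s. \<Sum>n<N. of_real (a n) * exp (- s * of_real (ln (real n)))) (dseries a) sequentially"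
        using s by (intro exI[of _ d] conjI uniform_limit_on_subset[OF dseries_uniform_limit[of "(1 + Re s)/2"]]) auto
    next
      show "open {s'. Re s' > (1 + Re s)/2}" by (rule open_halfspace_Re_gt)
    qed (intro holomorphic_intros)
    then show ?thesis
      by (rule holomorphic_on_imp_differentiable_at[OF _ open_halfspace_Re_gt]) (use s in simp)
  qed
  then show ?thesis unfolding holomorphic_on_def using field_differentiable_at_within by blast
qed

lemma higher_deriv_dterm:
  "(deriv ^^ k) (\<lambda>s. \<Sum>n<N. of_real (b n) * exp (- s * of_real (ln (real n)))) = 
   (\<lambda>s::complex. \<Sum>n<N. of_real (b n * (- ln (real n)) ^ k) * exp (- s * of_real (ln (real n))))"
proof (induction k arbitrary: b)
  case (Suc k)
  have "deriv (\<lambda>s. \<Sum>n<N. of_real (b n) * exp (- s * of_real (ln (real n)))) =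
     (\<lambda>s::complex. \<Sum>n<N. of_real (b n * (- ln (real n))) * exp (- s * of_real (ln (real n))))"
    by (intro ext DERIV_imp_deriv) (auto intro!: derivative_eq_intros sum.cong)
  then show ?case
    unfolding funpow_Suc_right o_def using Suc.IH[of "\<lambda>n. b n * (- ln (real n))"] by (simp add: mult_ac)
qed simp

lemma higher_deriv_dseries:
  assumes "Re s > 1"
  shows "(\<lambda>n. of_real (a n * (- ln (real n)) ^ k) * exp (- s * of_real (ln (real n)))) sums (deriv ^^ k) (dseries a) s"
proof -
  have "(\<lambda>N. (deriv ^^ k) (\<lambda>s. \<Sum>n<N. of_real (a n) * exp (- s * of_real (ln (real n)))) s) \<longlonglongrightarrow> (deriv ^^ k) (dseries a) s"
  proof (rule higher_deriv_complex_uniform_limit[OF dseries_uniform_limit[of "(1 + Re s)/2"]])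
    show "open {s'. (1 + Re s)/2 < Re s'}" by (rule open_halfspace_Re_gt)
  qed (use assms in \<open>auto intro!: holomorphic_intros always_eventually\<close>)
  then show ?thesis unfolding higher_deriv_dterm sums_def .
qed

end

subsection \<open>The zeta function on \<open>Re s > 1\<close> and its logarithmic derivative\<close>

definition zetac :: "complex \<Rightarrow> complex" where "zetac = dseries (\<lambda>n. of_bool (n > 0))"
definition neg_log_deriv :: "complex \<Rightarrow> complex" where "neg_log_deriv = dseries mangoldt"

lemma mangoldt_le_ln: "mangoldt n \<le> ln (real n)"
proof (cases "n = 0")
  case False
  then have "finite {d. d dvd n}" by simp
  then have "(mangoldt n :: real) \<le> (\<Sum>d | d dvd n. mangoldt d)"
    by (intro member_le_sum) (auto simp: mangoldt_nonneg)
  then show ?thesis using False by (simp add: mangoldt_sum)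
qed simp

lemma coeff_bounds:
  "\<bar>mangoldt n\<bar> \<le> 1 + ln (real n)" "\<bar>of_bool (n > 0)\<bar> \<le> 1 + ln (real n)" "\<bar>ln (real n)\<bar> \<le> 1 + ln (real n)"
  using mangoldt_le_ln[of n] mangoldt_nonneg[of n] by (cases "n = 0"; simp)+

lemma coeff_zero: "mangoldt 0 = (0::real)" "of_bool ((0::nat) > 0) = (0::real)" "ln (real 0) = 0"
  by auto

lemmas mangoldt_dseries = dseries_sums[OF coeff_bounds(1) coeff_zero(1), folded neg_log_deriv_def]
lemmas zetac_dseries = dseries_sums[OF coeff_bounds(2) coeff_zero(2), folded zetac_def]
lemmas ln_dseries = dseries_sums[OF coeff_bounds(3) coeff_zero(3)]

lemma neg_log_deriv_holomorphic: "neg_log_deriv holomorphic_on {s. Re s > 1}"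
  unfolding neg_log_deriv_def by (rule dseries_holomorphic[OF coeff_bounds(1) coeff_zero(1)])

lemma zetac_holomorphic: "zetac holomorphic_on {s. Re s > 1}"
  unfolding zetac_def by (rule dseries_holomorphic[OF coeff_bounds(2) coeff_zero(2)])

lemma ln_dseries_holomorphic: "dseries (\<lambda>n. ln (real n)) holomorphic_on {s. Re s > 1}"
  by (rule dseries_holomorphic[OF coeff_bounds(3) coeff_zero(3)])

lemma deriv_zetac:
  assumes "Re s > 1"
  shows "deriv zetac s = - dseries (\<lambda>n. ln (real n)) s"
proof -
  have "(\<lambda>n. of_real (of_bool (n > 0) * (- ln (real n)) ^ 1) * exp (- s * of_real (ln (real n)))) sums (deriv ^^ 1) zetac s"
    unfolding zetac_def by (rule higher_deriv_dseries[OF coeff_bounds(2) coeff_zero(2) assms])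
  moreover have "(\<lambda>n. - (of_real (ln (real n)) * exp (- s * of_real (ln (real n))))) sums (- dseries (\<lambda>n. ln (real n)) s)"
    by (intro sums_minus ln_dseries assms)
  moreover have "of_real (of_bool (n > 0) * (- ln (real n)) ^ 1) * exp (- s * of_real (ln (real n))) =
       - (of_real (ln (real n)) * exp (- s * of_real (ln (real n))))" for n
    by (cases "n = 0") auto
  ultimately show ?thesis using sums_unique2 by (simp only: funpow_simps_right(2) funpow_0 o_apply One_nat_def funpow.simps id_apply)
qed

lemma has_sum_product_nonneg:
  fixes f g :: "nat \<Rightarrow> real"
  assumes "(f has_sum a) A" "(g has_sum b) B" "\<And>x. f x \<ge> 0" "\<And>x. g x \<ge> 0"
  shows "((\<lambda>(x, y). f x * g y) has_sum (a * b)) (A \<times> B)"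
proof (rule has_sum_SigmaI)
  show inner: "((\<lambda>y. case (x, y) of (x, y) \<Rightarrow> f x * g y) has_sum (f x * b)) B" for x
    using has_sum_cmult_right[OF assms(2), of "f x"] by simp
  show outer: "((\<lambda>x. f x * b) has_sum (a * b)) A" by (rule has_sum_cmult_left[OF assms(1)])
  show "(\<lambda>(x, y). f x * g y) summable_on A \<times> B"
    by (rule summable_on_SigmaI[OF inner]) (use outer assms in \<open>auto simp: summable_on_def\<close>)
qed

lemma dseries_real:
  fixes a :: "nat \<Rightarrow> real"
  assumes "(\<lambda>n. of_real (a n) * exp (- of_real x * of_real (ln (real n)))) sums (S :: complex)"
    and "\<And>n. a n \<ge> 0" "a 0 = 0"
  shows "((\<lambda>n. a n * exp (- x * ln (real n))) has_sum Re S) {1..} \<and> S = of_real (Re S)"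
proof -
  have eq: "of_real (a n) * exp (- of_real x * of_real (ln (real n))) = complex_of_real (a n * exp (- x * ln (real n)))" for n
    by (simp flip: exp_of_real)
  from assms(1) have s: "(\<lambda>n. complex_of_real (a n * exp (- x * ln (real n)))) sums S" by (simp only: eq)
  then have r: "(\<lambda>n. a n * exp (- x * ln (real n))) sums Re S" using sums_Re by fastforce
  then have "((\<lambda>n. a n * exp (- x * ln (real n))) has_sum Re S) UNIV"
    by (rule sums_nonneg_imp_has_sum) (simp add: assms(2))
  then have "((\<lambda>n. a n * exp (- x * ln (real n))) has_sum Re S) {1..}"
    by (rule has_sum_cong_neutral[THEN iffD1, rotated -1]) (use assms(3) in \<open>auto simp: not_le less_Suc_eq\<close>)
  moreover have "S = of_real (Re S)" by (rule sums_unique2[OF s sums_of_real[OF r]])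
  ultimately show ?thesis by blast
qed

text \<open>The convolution identity for \<Lambda> and 1, whose divisor sums are
  \<open>ln n\<close>. At real points all terms are nonnegative, so the double series may be
  regrouped by the product \<open>n = d k\<close>; analytic continuation then carries the identity
  to the half-plane.\<close>

lemma zetac_mult_real:
  assumes "x > 1"
  shows "neg_log_deriv (of_real x) * zetac (of_real x) = dseries (\<lambda>n. ln (real n)) (of_real x)"
proof -
  let ?e = "\<lambda>n. exp (- x * ln (real n))"
  have x: "Re (of_real x) > 1" using assms by simp
  have F: "((\<lambda>n. mangoldt n * ?e n) has_sum Re (neg_log_deriv (of_real x))) {1..}" "neg_log_deriv (of_real x) = of_real (Re (neg_log_deriv (of_real x)))"
    using dseries_real[OF mangoldt_dseries[OF x]] mangoldt_nonneg by auto
  have Z: "((\<lambda>n. of_bool (n > 0) * ?e n) has_sum Re (zetac (of_real x))) {1..}" "zetac (of_real x) = of_real (Re (zetac (of_real x)))"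
    using dseries_real[OF zetac_dseries[OF x]] by auto
  have L: "((\<lambda>n. ln (real n) * ?e n) has_sum Re (dseries (\<lambda>n. ln (real n)) (of_real x))) {1..}"
     "dseries (\<lambda>n. ln (real n)) (of_real x) = of_real (Re (dseries (\<lambda>n. ln (real n)) (of_real x)))"
  proof -
    have "ln (real n) \<ge> 0" for n by (cases "n = 0") auto
    then show "((\<lambda>n. ln (real n) * ?e n) has_sum Re (dseries (\<lambda>n. ln (real n)) (of_real x))) {1..}"
     "dseries (\<lambda>n. ln (real n)) (of_real x) = of_real (Re (dseries (\<lambda>n. ln (real n)) (of_real x)))"
      using dseries_real[OF ln_dseries[OF x]] by auto
  qed
  let ?P = "Re (neg_log_deriv (of_real x)) * Re (zetac (of_real x))"
  let ?h = "\<lambda>(d, k). (mangoldt d * ?e d) * (of_bool (k > 0) * ?e k)"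
  have prod: "(?h has_sum ?P) ({1..} \<times> {1..})"
    by (rule has_sum_product_nonneg[OF F(1) Z(1)]) (auto simp: mangoldt_nonneg)
  have bij: "bij_betw (\<lambda>(n, d). (d, n div d)) (SIGMA n:{1::nat..}. {d. d dvd n}) ({1..} \<times> {1..})"
    by (rule bij_betwI[of _ _ _ "\<lambda>(d, k). (d * k, d)"]) (auto simp: Suc_le_eq dvd_div_eq_0_iff intro: dvd_pos_nat intro!: Nat.gr0I)
  have sig: "((\<lambda>p. ?h ((\<lambda>(n, d). (d, n div d)) p)) has_sum ?P) (SIGMA n:{1::nat..}. {d. d dvd n})"
    by (subst has_sum_reindex_bij_betw[OF bij]) (rule prod)
  have "((\<lambda>n. ln (real n) * ?e n) has_sum ?P) {1..}"
  proof (rule has_sum_SigmaD[OF sig])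
    fix n :: nat assume n: "n \<in> {1..}"
    have eq: "?h (d, n div d) = mangoldt d * ?e n" if "d dvd n" for d
    proof -
      have pos: "d > 0" "n div d > 0" using that n by (auto elim!: dvdE)
      have "real n = real d * real (n div d)" using that by (simp flip: of_nat_mult)
      then have "ln (real n) = ln (real d) + ln (real (n div d))"
        using pos by (simp add: ln_mult_pos)
      then have "?e d * ?e (n div d) = ?e n" by (simp add: algebra_simps flip: exp_add)
      then show ?thesis using pos by (simp add: mult.assoc)
    qed
    have "(\<Sum>d | d dvd n. ?h (d, n div d)) = (\<Sum>d | d dvd n. mangoldt d * ?e n)"
      by (rule sum.cong) (use eq in auto)
    also have "\<dots> = (\<Sum>d | d dvd n. mangoldt d) * ?e n" by (simp only: sum_distrib_right)
    also have "(\<Sum>d | d dvd n. mangoldt d) = ln (real n)"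
      using mangoldt_sum[of n, where ?'a = real] n by simp
    finally have s: "(\<Sum>d | d dvd n. ?h (d, n div d)) = ln (real n) * ?e n" .
    have "finite {d. d dvd n}" using n by simp
    from has_sum_finite[OF this, of "\<lambda>d. ?h (d, n div d)"]
    show "((\<lambda>y. ?h ((\<lambda>(n, d). (d, n div d)) (n, y))) has_sum ln (real n) * ?e n) {d. d dvd n}"
      unfolding s by simp
  qed
  from has_sum_unique[OF this L(1)] have "?P = Re (dseries (\<lambda>n. ln (real n)) (of_real x))" .
  then show ?thesis
    by (subst F(2), subst Z(2), subst L(2)) (simp flip: of_real_mult)
qed

lemma identity_real_axis:
  assumes "f holomorphic_on {s. Re s > 1}" "g holomorphic_on {s. Re s > 1}"
    and "\<And>x. x > 1 \<Longrightarrow> f (of_real x) = g (of_real x)" and "Re s > 1"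
  shows "f s = g s"
proof -
  have "f s - g s = 0"
  proof (rule analytic_continuation[where f = "\<lambda>s. f s - g s" and S = "{s. Re s > 1}" and U = "of_real ` {1<..}" and \<xi> = 2])
    have "(2::real) islimpt {1<..}"
      by (rule interior_limit_point) (simp add: interior_open)
    then show "(2::complex) islimpt of_real ` {1<..}"
    proof -
      have "\<forall>\<^sub>F y in at (2::real). complex_of_real y \<noteq> of_real 2"
        unfolding eventually_at_filter of_real_eq_iff by simp
      from islimpt_isCont_image[OF \<open>2 islimpt {1<..}\<close> _ this] show ?thesis by simp
    qed
  qed (use assms in \<open>auto intro!: holomorphic_intros simp: open_halfspace_Re_gt convex_connected convex_halfspace_Re_gt\<close>)
  then show ?thesis by simp
qed

lemma deriv_zetac_eq:
  assumes "Re s > 1"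
  shows "deriv zetac s = - neg_log_deriv s * zetac s"
proof -
  have "neg_log_deriv s * zetac s = dseries (\<lambda>n. ln (real n)) s"
    by (rule identity_real_axis[OF _ ln_dseries_holomorphic _ assms])
       (auto intro!: holomorphic_intros neg_log_deriv_holomorphic zetac_holomorphic zetac_mult_real)
  then show ?thesis using deriv_zetac[OF assms] by simp
qed

lemma zetac_real_eq:
  assumes "x > 1"
  shows "zetac (of_real x) = of_real (zeta_real x)"
proof -
  have x: "Re (complex_of_real x) > 1" using assms by simp
  have "(\<lambda>n. complex_of_real (of_bool (Suc n > 0)) * exp (- of_real x * of_real (ln (real (Suc n))))) sums
      (zetac (of_real x) - (\<Sum>n<1. of_real (of_bool (n > 0)) * exp (- of_real x * of_real (ln (real n)))))"
    using sums_iff_shift[of "\<lambda>n. complex_of_real (of_bool (n > 0)) * exp (- of_real x * of_real (ln (real n)))" 1] zetac_dseries[OF x]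
    by simp
  then have "(\<lambda>n. exp (- of_real x * of_real (ln (real (Suc n))))) sums zetac (of_real x)" by simp
  moreover have "exp (- of_real x * of_real (ln (real (Suc n)))) = complex_of_real (real (Suc n) powr (-x))" for n
    by (simp add: powr_def flip: exp_of_real)
  ultimately have "(\<lambda>n. complex_of_real (real (Suc n) powr (-x))) sums zetac (of_real x)" by simp
  then show ?thesis using sums_of_real[OF zeta_real_sums[OF assms]] by (rule sums_unique2)
qed

text \<open>If \<open>G\<close> is a primitive of \<open>neg_log_deriv\<close>, then
  \<open>zetac * exp G\<close> has derivative 0. It is therefore constant, and its value at 2 is
  nonzero.\<close>

lemma zetac_nonzero:
  assumes "Re s > 1"
  shows "zetac s \<noteq> 0"
proof -
  let ?S = "{s. Re s > 1}"
  obtain G where G: "\<And>s. s \<in> ?S \<Longrightarrow> (G has_field_derivative neg_log_deriv s) (at s)"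
    using holomorphic_convex_primitive'[OF convex_halfspace_Re_gt open_halfspace_Re_gt neg_log_deriv_holomorphic]
    by (metis at_within_open open_halfspace_Re_gt)
  have "((\<lambda>s. zetac s * exp (G s)) has_field_derivative 0) (at s)" if "s \<in> ?S" for s
  proof -
    have "(zetac has_field_derivative (- neg_log_deriv s * zetac s)) (at s)"
      using holomorphic_derivI[OF zetac_holomorphic open_halfspace_Re_gt that] deriv_zetac_eq that by simp
    then show ?thesis by (auto intro!: derivative_eq_intros G[OF that])
  qed
  then have "\<exists>c. \<forall>s\<in>?S. zetac s * exp (G s) = c"
    by (intro has_field_derivative_zero_constant convex_halfspace_Re_gt) (auto intro: has_field_derivative_at_within)
  then obtain c where c: "\<And>s. s \<in> ?S \<Longrightarrow> zetac s * exp (G s) = c" by blast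
  have "zeta_real 2 > 0"
    using zeta_real_sums[of 2] suminf_pos[of "\<lambda>n. real (Suc n) powr (-2)"] by (simp add: sums_iff)
  then have "zetac (of_real 2) \<noteq> 0" by (subst zetac_real_eq) auto
  then have "c \<noteq> 0" using c[of "of_real 2"] by auto
  then show ?thesis using c[of s] assms by auto
qed

section \<open>The logarithmic derivative of \<xi>\<close>

lemma half_not_nonpos_Int:
  assumes "Re s > 1"
  shows "s / 2 \<notin> \<int>\<^sub>\<le>\<^sub>0"
proof
  assume "s / 2 \<in> \<int>\<^sub>\<le>\<^sub>0"
  then obtain n where n: "s / 2 = of_int n" "n \<le> 0" by (rule nonpos_Ints_cases)
  from n(1) have "Re (s / 2) = of_int n" by simp
  then show False using assms n(2) by simp
qed

lemma xi_sq_eq: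
  assumes "Re s > 1"
  shows "xi_sq (s * (s - 1)) = s * (s - 1) * (exp (- (s/2) * of_real (ln pi)) * Gamma (s/2) * zetac s) / 2"
proof (rule identity_real_axis[OF _ _ _ assms])
  show "(\<lambda>s. xi_sq (s * (s - 1))) holomorphic_on {s. Re s > 1}"
  proof -
    have "(\<lambda>s::complex. s * (s - 1)) holomorphic_on {s. Re s > 1}" by (intro holomorphic_intros)
    from holomorphic_on_compose_gen[OF this xi_sq_holomorphic[of UNIV]] show ?thesis by (simp add: o_def)
  qed
  show "(\<lambda>s. s * (s - 1) * (exp (- (s/2) * of_real (ln pi)) * Gamma (s/2) * zetac s) / 2) holomorphic_on {s. Re s > 1}"
    by (intro holomorphic_intros zetac_holomorphic) (simp_all add: half_not_nonpos_Int)
  fix x :: real assume x: "x > 1"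
  have 1: "complex_of_real x * (complex_of_real x - 1) = of_real (x * (x - 1))" by simp
  have 2: "exp (- (complex_of_real x/2) * of_real (ln pi)) = of_real (pi powr (-x/2))"
    by (simp add: powr_def flip: exp_of_real)
  have 3: "Gamma (complex_of_real x / 2) = of_real (Gamma (x/2))"
    using Gamma_complex_of_real[of "x/2"] by simp
  show "xi_sq (complex_of_real x * (complex_of_real x - 1)) =
      complex_of_real x * (complex_of_real x - 1) * (exp (- (complex_of_real x/2) * of_real (ln pi)) * Gamma (complex_of_real x/2) * zetac (of_real x)) / 2"
    unfolding 1 2 3 xi_sq_real[OF x] zetac_real_eq[OF x] Lambda_real_def by simp
qed

lemma xi_sq_nonzero:
  assumes "Re s > 1"
  shows "xi_sq (s * (s - 1)) \<noteq> 0"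
proof -
  have "Gamma (s/2) \<noteq> 0"
    using half_not_nonpos_Int[OF assms] by (simp add: Gamma_eq_zero_iff)
  then show ?thesis using assms zetac_nonzero[OF assms]
    by (auto simp: xi_sq_eq)
qed

text \<open>Both sides are the logarithmic derivative of \<xi>(s): through the chain rule for
  \<open>v = s (s-1)\<close>, with inner derivative \<open>2 s - 1\<close>, and from the product
  formula. Shifting the digamma argument from \<open>s/2\<close> to \<open>s/2 + 1\<close> absorbs
  the term \<open>1/s\<close>.\<close>

theorem xi_sq_log_deriv:
  assumes s: "Re s > 1"
  shows "(2 * s - 1) * (deriv xi_sq (s * (s - 1)) / xi_sq (s * (s - 1))) =
     1 / (s - 1) - of_real (ln pi) / 2 + Digamma (s/2 + 1) / 2 - neg_log_deriv s"
proof -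
  let ?G = "\<lambda>s. s * (s - 1) * (exp (- (s/2) * of_real (ln pi)) * Gamma (s/2) * zetac s) / 2"
  have nz: "s \<noteq> 0" "s - 1 \<noteq> 0" using s by auto
  have ni: "s / 2 \<notin> \<int>\<^sub>\<le>\<^sub>0" by (rule half_not_nonpos_Int[OF s])
  have G0: "Gamma (s/2) \<noteq> 0" using ni by (simp add: Gamma_eq_zero_iff)
  have z0: "zetac s \<noteq> 0" by (rule zetac_nonzero[OF s])
  have dz: "(zetac has_field_derivative (- neg_log_deriv s * zetac s)) (at s)"
    using holomorphic_derivI[OF zetac_holomorphic open_halfspace_Re_gt, of s] deriv_zetac_eq[OF s] s by simp
  have "((\<lambda>s. xi_sq (s * (s - 1))) has_field_derivative deriv xi_sq (s * (s - 1)) * (2 * s - 1)) (at s)"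
    by (rule DERIV_chain2[where f = xi_sq])
       (auto intro!: derivative_eq_intros holomorphic_derivI[OF xi_sq_holomorphic open_UNIV])
  moreover have "(?G has_field_derivative ?G s * (1/s + 1/(s-1) - of_real (ln pi)/2 + Digamma (s/2)/2 - neg_log_deriv s)) (at s)"
  proof -
    have dG: "((\<lambda>s. Gamma (s/2)) has_field_derivative (Gamma (s/2) * Digamma (s/2) / 2)) (at s)"
      using ni by (auto intro!: derivative_eq_intros)
    have dP: "((\<lambda>s. s * (s - 1)) has_field_derivative (2 * s - 1)) (at s)"
      by (auto intro!: derivative_eq_intros)
    have dE: "((\<lambda>s. exp (- (s/2) * of_real (ln pi))) has_field_derivative (- (of_real (ln pi) / 2) * exp (- (s/2) * of_real (ln pi)))) (at s)"
      by (auto intro!: derivative_eq_intros)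
    have alg: "(Q * (E * g * z) + ((- (c/2) * E * g + g * d / 2 * E) * z + - F * z * (E * g)) * P) / 2 = P * (E * g * z) / 2 * (w - c/2 + d/2 - F)"
      if "P * w = Q" for P Q E g z c d F w :: complex
      unfolding that[symmetric] by (simp add: field_simps)
    have Pw: "s * (s - 1) * (1/s + 1/(s-1)) = 2 * s - 1" using nz by (simp add: field_simps)
    show ?thesis
      by (rule DERIV_cong[OF DERIV_cdivide[OF DERIV_mult[OF dP DERIV_mult[OF DERIV_mult[OF dE dG] dz]]]])
         (rule alg[OF Pw])
  qed
  then have "((\<lambda>s. xi_sq (s * (s - 1))) has_field_derivative ?G s * (1/s + 1/(s-1) - of_real (ln pi)/2 + Digamma (s/2)/2 - neg_log_deriv s)) (at s)"
    by (rule has_field_derivative_transform_within_open[where S = "{s. Re s > 1}"])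
       (use s xi_sq_eq in \<open>auto simp: open_halfspace_Re_gt\<close>)
  ultimately have eq: "deriv xi_sq (s * (s - 1)) * (2 * s - 1) = xi_sq (s * (s - 1)) * (1/s + 1/(s-1) - of_real (ln pi)/2 + Digamma (s/2)/2 - neg_log_deriv s)"
    using DERIV_unique by (subst xi_sq_eq[OF s]) blast
  have "Digamma (s/2 + 1) = Digamma (s/2) + 1 / (s/2)" using nz by (intro Digamma_plus1) simp
  then have D: "Digamma (s/2 + 1) / 2 = Digamma (s/2) / 2 + 1 / s" by (simp add: field_simps)
  have "(2 * s - 1) * (deriv xi_sq (s * (s - 1)) / xi_sq (s * (s - 1))) = (1/s + 1/(s-1) - of_real (ln pi)/2 + Digamma (s/2)/2 - neg_log_deriv s)"
    using eq xi_sq_nonzero[OF s] by (simp add: field_simps)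
  then show ?thesis unfolding D by simp
qed

subsection \<open>Sums over zeros\<close>

text \<open>Of the pair \<rho>, 1 - \<rho> belonging to \<open>u = \<rho> (\<rho> - 1)\<close> the
  principal square root selects the member with real part at least 1/2.\<close>

definition zroot :: "complex \<Rightarrow> complex" where "zroot u = 1/2 + csqrt (u + 1/4)"
definition zbeta :: "complex \<Rightarrow> real" where "zbeta u = Re (zroot u)"
definition zgam :: "complex \<Rightarrow> real" where "zgam u = Im (zroot u)"

lemma zroot_eq: "zroot u * (zroot u - 1) = u"
proof -
  have "zroot u * (zroot u - 1) = (csqrt (u + 1/4))^2 - 1/4"
    unfolding zroot_def by (simp add: power2_eq_square algebra_simps)
  then show ?thesis by simp
qed

lemma zroot_split: "zroot u = Complex (zbeta u) (zgam u)"
  by (simp add: zbeta_def zgam_def)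

lemma zbeta_ge: "zbeta u \<ge> 1/2"
  using Re_csqrt[of "u + 1/4"] by (simp add: zbeta_def zroot_def)

lemma zbeta_le:
  assumes "xi_sq u = 0"
  shows "zbeta u \<le> 1"
proof (rule ccontr)
  assume "\<not> zbeta u \<le> 1"
  then have "Re (zroot u) > 1" by (simp add: zbeta_def)
  from xi_sq_nonzero[OF this] show False using assms by (simp add: zroot_eq)
qed

text \<open>A principal square root with positive real part commutes with conjugation. On the line
  \<beta> = 1/2 the number \<open>u + 1/4\<close> is real and nonpositive, and the root with
  nonnegative imaginary part is chosen for \<open>u\<close> and its conjugate alike; the claim
  therefore concerns zeros off the line.\<close>

lemma zroot_cnj:
  assumes "zbeta u > 1/2"
  shows "zroot (cnj u) = cnj (zroot u)"
proof -
  have "csqrt (cnj u + 1/4) = cnj (csqrt (u + 1/4))"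
  proof (rule csqrt_unique)
    have "cnj (csqrt (u + 1/4)) ^ 2 = cnj ((csqrt (u + 1/4))^2)" by (simp only: complex_cnj_power)
    then show "cnj (csqrt (u + 1/4)) ^ 2 = cnj u + 1/4" by simp
    show "0 < Re (cnj (csqrt (u + 1/4))) \<or> Re (cnj (csqrt (u + 1/4))) = 0 \<and> 0 \<le> Im (cnj (csqrt (u + 1/4)))"
      using assms by (simp add: zbeta_def zroot_def)
  qed
  then show ?thesis by (simp add: zroot_def)
qed

text \<open>What the logarithmic derivative of \<xi> contains besides
  \<open>- neg_log_deriv\<close>: the pole at 1 and the Gamma factor.\<close>

definition arch :: "complex \<Rightarrow> complex" where
  "arch s = 1 / (s - 1) - of_real (ln pi) / 2 + Digamma (s/2 + 1) / 2"

text \<open>The real part of \<open>1/(s - \<rho>) + 1/(s - \<rho>')\<close> for the mirror pair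
  \<rho> = \<beta> + i \<gamma> and \<rho>' = 1 - \<beta> + i \<gamma>, where \<open>y\<close> is
  the height of \<open>s\<close> minus \<gamma>.\<close>

definition pairf :: "real \<Rightarrow> real \<Rightarrow> real \<Rightarrow> real" where
  "pairf \<sigma> \<beta> y = (\<sigma> - \<beta>) / ((\<sigma> - \<beta>)^2 + y^2) + (\<sigma> - 1 + \<beta>) / ((\<sigma> - 1 + \<beta>)^2 + y^2)"

text \<open>With \<open>S = 2\<sigma> - 1\<close>, \<open>D = (2\<beta> - 1)\<^sup>2\<close> and \<open>p = (S\<^sup>2 - D)/4 = (\<sigma> - \<beta>)(\<sigma> - 1 + \<beta>)\<close>, the value is
  \<open>S (p + y\<^sup>2) / ((p + y\<^sup>2)\<^sup>2 + D y\<^sup>2)\<close>, which gives both bounds below.\<close>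

lemma pairf_bounds:
  assumes "\<sigma> > 1" "1/2 \<le> \<beta>" "\<beta> \<le> 1"
  shows "pairf \<sigma> \<beta> y \<ge> (2*\<sigma> - 1) / (((2*\<sigma> - 1)^2 + 3) / 4 + y^2)"
    and "pairf \<sigma> \<beta> y \<le> (2*\<sigma> - 1) / (((2*\<sigma> - 1)^2 - 1) / 4 + y^2)"
proof -
  define a b where "a = \<sigma> - \<beta>" and "b = \<sigma> - 1 + \<beta>"
  define p Y D where "p = a * b" and "Y = y^2" and "D = (b - a)^2"
  have ab: "a > 0" "b > 0" using assms by (auto simp: a_def b_def)
  have S: "a + b = 2 * \<sigma> - 1" by (simp add: a_def b_def)
  have p0: "p > 0" unfolding p_def using ab by simp
  have Y0: "Y \<ge> 0" by (simp add: Y_def)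
  have D0: "D \<ge> 0" by (simp add: D_def)
  have "\<bar>b - a\<bar> \<le> 1" using assms by (auto simp: a_def b_def)
  then have D1: "D \<le> 1" unfolding D_def by (simp add: abs_square_le_1)
  have p4: "4 * p = (2 * \<sigma> - 1)^2 - D"
    unfolding p_def D_def S[symmetric] by (simp add: power2_eq_square algebra_simps)
  have den: "(p + Y)^2 + Y * D > 0" using p0 Y0 D0 by (intro add_pos_nonneg) auto
  have aY: "a^2 + Y > 0" "b^2 + Y > 0" using ab Y0 by (simp_all add: add_pos_nonneg)
  have prod: "(a^2 + Y) * (b^2 + Y) = (p + Y)^2 + Y * D"
    unfolding p_def D_def by (simp add: power2_eq_square algebra_simps)
  have f: "pairf \<sigma> \<beta> y = (a + b) * (p + Y) / ((p + Y)^2 + Y * D)"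
  proof -
    have "pairf \<sigma> \<beta> y = (a * (b^2 + Y) + b * (a^2 + Y)) / ((a^2 + Y) * (b^2 + Y))"
      unfolding pairf_def a_def[symmetric] b_def[symmetric] Y_def[symmetric] using aY
      by (simp add: add_frac_eq)
    also have "a * (b^2 + Y) + b * (a^2 + Y) = (a + b) * (p + Y)"
      by (simp add: p_def power2_eq_square algebra_simps)
    finally show ?thesis by (simp only: prod)
  qed
  have "(a + b) / (p + Y + D) \<le> (a + b) * (p + Y) / ((p + Y)^2 + Y * D)"
  proof -
    have "(p + Y)^2 + Y * D \<le> (p + Y) * (p + Y + D)"
      using p0 D0 by (simp add: power2_eq_square algebra_simps)
    then have "(a + b) * ((p + Y)^2 + Y * D) \<le> (a + b) * ((p + Y) * (p + Y + D))"
      using ab by (intro mult_left_mono) auto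
    then show ?thesis using den p0 Y0 D0
      by (simp add: field_simps add_pos_nonneg)
  qed
  moreover have "(a + b) / (((2*\<sigma> - 1)^2 + 3) / 4 + Y) \<le> (a + b) / (p + Y + D)"
  proof (intro divide_left_mono mult_pos_pos)
    show "p + Y + D \<le> ((2*\<sigma> - 1)^2 + 3) / 4 + Y" using p4 D1 by (simp add: field_simps)
    show "0 < p + Y + D" using p0 Y0 D0 by linarith
    show "0 < ((2*\<sigma> - 1)^2 + 3) / 4 + Y" using p4 p0 Y0 D0 by (intro add_pos_nonneg) auto
  qed (use ab in simp)
  ultimately show "pairf \<sigma> \<beta> y \<ge> (2*\<sigma> - 1) / (((2*\<sigma> - 1)^2 + 3) / 4 + y^2)"
    unfolding f S[symmetric] Y_def[symmetric] by linarith
  have "(a + b) * (p + Y) / ((p + Y)^2 + Y * D) \<le> (a + b) * (p + Y) / ((p + Y)^2)"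
    using ab p0 Y0 D0 by (intro divide_left_mono mult_nonneg_nonneg mult_pos_pos) (auto intro: den)
  also have "\<dots> = (a + b) / (p + Y)" using p0 Y0 by (simp add: power2_eq_square)
  also have "\<dots> \<le> (a + b) / (((2*\<sigma> - 1)^2 - 1) / 4 + Y)"
  proof -
    have "(2*\<sigma> - 1)^2 > 1^2" using assms by (intro power_strict_mono) auto
    then have "0 < ((2*\<sigma> - 1)^2 - 1) / 4 + Y" using Y0 by (intro add_pos_nonneg) auto
    then show ?thesis using p4 D1 p0 Y0 ab by (intro divide_left_mono mult_pos_pos) auto
  qed
  finally show "pairf \<sigma> \<beta> y \<le> (2*\<sigma> - 1) / (((2*\<sigma> - 1)^2 - 1) / 4 + y^2)"
    unfolding f S[symmetric] Y_def[symmetric] .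
qed

lemma pairf_nonneg:
  assumes "\<sigma> > 1" "1/2 \<le> \<beta>" "\<beta> \<le> 1"
  shows "pairf \<sigma> \<beta> y \<ge> 0"
  unfolding pairf_def using assms by (intro add_nonneg_nonneg divide_nonneg_nonneg) auto

text \<open>Stechkin's trick: subtracting \<kappa> times the identity at \<sigma>1 keeps the
  contribution of every zero nonnegative, while the archimedean term of size (ln t)/2 shrinks by the
  factor \<open>1 - \<kappa>\<close>. Once the two bounds of \<open>pairf_bounds\<close> are
  inserted, the inequality is linear in \<open>y^2\<close>; the last two hypotheses compare its
  leading coefficients and its constant terms.\<close>

lemma pairf_stechkin:
  assumes "\<sigma> > 1" "1/2 \<le> \<beta>" "\<beta> \<le> 1" "\<sigma>1 \<ge> \<sigma>" "\<kappa> \<ge> 0"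
    and "\<kappa> * (2*\<sigma>1 - 1) \<le> 2*\<sigma> - 1"
    and "\<kappa> * (2*\<sigma>1 - 1) * ((2*\<sigma> - 1)^2 + 3) \<le> (2*\<sigma> - 1) * ((2*\<sigma>1 - 1)^2 - 1)"
  shows "\<kappa> * pairf \<sigma>1 \<beta> y \<le> pairf \<sigma> \<beta> y"
proof -
  define S S1 Y where "S = 2*\<sigma> - 1" and "S1 = 2*\<sigma>1 - 1" and "Y = y^2"
  have Y0: "Y \<ge> 0" by (simp add: Y_def)
  have "S1^2 > 1^2" unfolding S1_def using assms by (intro power_strict_mono) auto
  then have d1: "(S1^2 - 1) / 4 + Y > 0" using Y0 by (intro add_pos_nonneg) auto
  have d: "(S^2 + 3) / 4 + Y > 0" using Y0 by (intro add_pos_nonneg) (auto intro: add_nonneg_pos)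
  have "\<kappa> * pairf \<sigma>1 \<beta> y \<le> \<kappa> * (S1 / ((S1^2 - 1) / 4 + Y))"
    unfolding S1_def Y_def using assms by (intro mult_left_mono pairf_bounds) auto
  also have "\<dots> \<le> S / ((S^2 + 3) / 4 + Y)"
  proof -
    have "\<kappa> * S1 * Y \<le> S * Y" using assms(6) Y0 unfolding S_def S1_def by (intro mult_right_mono) auto
    then have "\<kappa> * S1 * ((S^2 + 3) / 4 + Y) \<le> S * ((S1^2 - 1) / 4 + Y)"
      using assms(7) unfolding S_def[symmetric] S1_def[symmetric] by (simp only: distrib_left) (simp add: field_simps)
    then show ?thesis using d d1 by (simp add: pos_divide_le_eq pos_le_divide_eq)
  qed
  also have "\<dots> \<le> pairf \<sigma> \<beta> y"
    unfolding S_def Y_def using assms by (intro pairf_bounds) auto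
  finally show ?thesis .
qed

lemma Re_of_nat_mult: "Re (of_nat n * z) = real n * Re z"
  by simp

lemma Re_inverse_Complex: "Re (1 / Complex a b) = a / (a^2 + b^2)"
  by (simp add: Re_divide power2_eq_square)

lemma zero_term_split:
  assumes "s \<noteq> zroot u" "s \<noteq> 1 - zroot u"
  shows "(2 * s - 1) / (s * (s - 1) - u) = 1 / (s - zroot u) + 1 / (s - 1 + zroot u)"
proof -
  have 1: "s * (s - 1) - u = (s - zroot u) * (s - 1 + zroot u)"
    using zroot_eq[of u] by (simp add: algebra_simps)
  have "s - zroot u \<noteq> 0" "s - 1 + zroot u \<noteq> 0" using assms by (auto simp: algebra_simps)
  then show ?thesis unfolding 1 by (simp add: field_simps)
qed

text \<open>The zeros \<rho> and 1 - \<rho> behind one \<open>u\<close> have opposite heights, so at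
  \<open>s\<close> alone their terms do not form a mirror pair. The terms at \<open>cnj s\<close>
  complete the two pairs at distances \<open>t - \<gamma>\<close> and \<open>t + \<gamma>\<close>;
  this avoids a comparison of the multiplicities of \<open>u\<close> and
  \<open>cnj u\<close>.\<close>

lemma zero_term_Re:
  assumes "xi_sq u = 0" "\<sigma> > 1" and that: "s = Complex \<sigma> t"
  shows "Re ((2 * s - 1) / (s * (s - 1) - u)) + Re ((2 * cnj s - 1) / (cnj s * (cnj s - 1) - u)) =
         pairf \<sigma> (zbeta u) (t - zgam u) + pairf \<sigma> (zbeta u) (t + zgam u)" (is "?l = ?r")
proof -
  have b: "1/2 \<le> zbeta u" "zbeta u \<le> 1" using zbeta_ge zbeta_le[OF assms(1)] by auto
  have ne: "Complex \<sigma> r \<noteq> zroot u" "Complex \<sigma> r \<noteq> 1 - zroot u" for r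
    using b assms(2) by (auto simp: zroot_split complex_eq_iff)
  have R: "Re ((2 * s - 1) / (s * (s - 1) - u)) = (\<sigma> - zbeta u) / ((\<sigma> - zbeta u)^2 + (r - zgam u)^2) + 
      (\<sigma> - 1 + zbeta u) / ((\<sigma> - 1 + zbeta u)^2 + (r + zgam u)^2)" if "s = Complex \<sigma> r" for s r
  proof -
    have "s - zroot u = Complex (\<sigma> - zbeta u) (r - zgam u)" "s - 1 + zroot u = Complex (\<sigma> - 1 + zbeta u) (r + zgam u)"
      using that by (auto simp: zroot_split complex_eq_iff)
    then show ?thesis using zero_term_split[of s u] ne[of r] that by (simp add: Re_inverse_Complex)
  qed
  have "cnj s = Complex \<sigma> (-t)" using that by (simp add: complex_eq_iff)
  then have "?l = (\<sigma> - zbeta u) / ((\<sigma> - zbeta u)^2 + (t - zgam u)^2) + (\<sigma> - 1 + zbeta u) / ((\<sigma> - 1 + zbeta u)^2 + (t + zgam u)^2)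
     + ((\<sigma> - zbeta u) / ((\<sigma> - zbeta u)^2 + (- t - zgam u)^2) + (\<sigma> - 1 + zbeta u) / ((\<sigma> - 1 + zbeta u)^2 + (- t + zgam u)^2))"
    using R[OF that] R[of "cnj s" "-t"] by simp
  moreover have "(- t - zgam u)^2 = (t + zgam u)^2" "(- t + zgam u)^2 = (t - zgam u)^2"
    by (simp_all add: power2_eq_square algebra_simps)
  ultimately show ?thesis by (simp add: pairf_def)
qed

lemma neg_log_deriv_cnj:
  assumes "Re s > 1"
  shows "neg_log_deriv (cnj s) = cnj (neg_log_deriv s)"
proof -
  have "(\<lambda>n. cnj (of_real (mangoldt n) * exp (- s * of_real (ln (real n))))) sums cnj (neg_log_deriv s)"
    using mangoldt_dseries[OF assms] by (rule bounded_linear.sums[OF bounded_linear_cnj])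
  then have "(\<lambda>n. of_real (mangoldt n) * exp (- cnj s * of_real (ln (real n)))) sums cnj (neg_log_deriv s)"
    by (simp add: exp_cnj mangoldt_def if_distrib[of cnj] cong: if_cong)
  moreover have "(\<lambda>n. of_real (mangoldt n) * exp (- cnj s * of_real (ln (real n)))) sums neg_log_deriv (cnj s)"
    by (rule mangoldt_dseries) (use assms in simp)
  ultimately show ?thesis by (rule sums_unique2[symmetric])
qed

lemma Digamma_cnj:
  assumes "z \<noteq> 0" "Re z > 0"
  shows "Digamma (cnj z) = cnj (Digamma (z::complex))"
proof -
  have "(\<lambda>m. cnj (of_real (ln (real m)) - (\<Sum>n<m. inverse (z + of_nat n)))) \<longlonglongrightarrow> cnj (Digamma z)"
    by (intro tendsto_cnj Digamma_LIMSEQ assms)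
  then have "(\<lambda>m. of_real (ln (real m)) - (\<Sum>n<m. inverse (cnj z + of_nat n))) \<longlonglongrightarrow> cnj (Digamma z)"
    by simp
  moreover have "(\<lambda>m. of_real (ln (real m)) - (\<Sum>n<m. inverse (cnj z + of_nat n))) \<longlonglongrightarrow> Digamma (cnj z)"
    by (intro Digamma_LIMSEQ) (use assms in auto)
  ultimately show ?thesis by (rule LIMSEQ_unique[symmetric])
qed

lemma arch_cnj:
  assumes "Re s > 1"
  shows "arch (cnj s) = cnj (arch s)"
proof -
  have "Digamma (cnj (s/2 + 1)) = cnj (Digamma (s/2 + 1))"
    by (rule Digamma_cnj) (use assms in \<open>auto simp: complex_eq_iff\<close>)
  then show ?thesis by (simp add: arch_def)
qed

definition zsum :: "complex set \<Rightarrow> (complex \<Rightarrow> nat) \<Rightarrow> real \<Rightarrow> real \<Rightarrow> real" where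
  "zsum Z m \<sigma> t = (\<Sum>u\<in>Z. real (m u) * ((pairf \<sigma> (zbeta u) (t - zgam u) + pairf \<sigma> (zbeta u) (t + zgam u)) / 2))"

text \<open>The family contains all zeros with \<open>|u| < V\<close> and possibly further ones, and
  of the multiplicities only positivity is recorded. The estimates concern sums of nonnegative
  terms, for which one zero or its conjugate can be singled out and the rest kept or
  dropped.\<close>

definition zero_family :: "real \<Rightarrow> complex set \<Rightarrow> (complex \<Rightarrow> nat) \<Rightarrow> bool" where
  "zero_family V Z m \<longleftrightarrow> finite Z \<and> (\<forall>u\<in>Z. xi_sq u = 0 \<and> m u > 0) \<and> (\<forall>u. xi_sq u = 0 \<longrightarrow> norm u < V \<longrightarrow> u \<in> Z)"

theorem zero_family_exists:
  assumes "V > 0" "\<epsilon> > 0"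
  obtains Z m e where "zero_family V Z m" "e holomorphic_on ball 0 V" "\<And>v. v \<in> ball 0 V \<Longrightarrow> norm (e v) \<le> \<epsilon>"
    "\<And>s. Re s > 1 \<Longrightarrow> norm (s * (s - 1)) < V \<Longrightarrow>
       arch s - neg_log_deriv s = (\<Sum>u\<in>Z. of_nat (m u) * ((2 * s - 1) / (s * (s - 1) - u))) + (2 * s - 1) * e (s * (s - 1))"
proof -
  have x0: "xi_sq 0 \<noteq> 0" by (simp add: xi_sq_0)
  show thesis
  proof (rule entire_log_deriv_approx[OF xi_sq_holomorphic x0 norm_xi_sq_le xi_majorant_growth assms])
    fix Z m e
    assume Z: "finite Z" "\<And>u. u \<in> Z \<Longrightarrow> xi_sq u = 0 \<and> m u > 0" "\<And>u. xi_sq u = 0 \<Longrightarrow> norm u < V \<Longrightarrow> u \<in> Z"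
      "e holomorphic_on ball 0 V" "\<And>v. v \<in> ball 0 V \<Longrightarrow> norm (e v) \<le> \<epsilon>"
      "\<And>v. v \<in> ball 0 V \<Longrightarrow> xi_sq v \<noteq> 0 \<Longrightarrow> deriv xi_sq v / xi_sq v = (\<Sum>u\<in>Z. of_nat (m u) / (v - u)) + e v"
    show thesis
    proof (rule that[of Z m e])
      show "zero_family V Z m" unfolding zero_family_def using Z(1-3) by simp
      fix s assume s: "Re s > 1" "norm (s * (s - 1)) < V"
      have "s * (s - 1) \<in> ball 0 V" using s(2) by simp
      from Z(6)[OF this xi_sq_nonzero[OF s(1)]]
      have "(2 * s - 1) * (deriv xi_sq (s * (s - 1)) / xi_sq (s * (s - 1))) = (2 * s - 1) * ((\<Sum>u\<in>Z. of_nat (m u) / (s * (s - 1) - u)) + e (s * (s - 1)))"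
        by (simp only:)
      also have "\<dots> = (\<Sum>u\<in>Z. (2 * s - 1) * (of_nat (m u) / (s * (s - 1) - u))) + (2 * s - 1) * e (s * (s - 1))"
        by (simp only: distrib_left sum_distrib_left)
      also have "(\<Sum>u\<in>Z. (2 * s - 1) * (of_nat (m u) / (s * (s - 1) - u))) = (\<Sum>u\<in>Z. of_nat (m u) * ((2 * s - 1) / (s * (s - 1) - u)))"
        by (simp only: times_divide_eq_right mult.commute)
      finally show "arch s - neg_log_deriv s = (\<Sum>u\<in>Z. of_nat (m u) * ((2 * s - 1) / (s * (s - 1) - u))) + (2 * s - 1) * e (s * (s - 1))"
        using xi_sq_log_deriv[OF s(1)] by (simp only: arch_def)
    qed (fact Z(4,5))+
  qed
qed

text \<open>The average of the expansions at \<open>s\<close> and \<open>cnj s\<close>, whose left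
  sides have the same real part by the reflection symmetry of \<open>arch\<close> and
  \<open>neg_log_deriv\<close>.\<close>

lemma zsum_approx:
  assumes fam: "zero_family V Z m" and e: "\<And>v. v \<in> ball 0 V \<Longrightarrow> norm (e v) \<le> \<epsilon>"
    and eq: "\<And>s. Re s > 1 \<Longrightarrow> norm (s * (s - 1)) < V \<Longrightarrow>
       arch s - neg_log_deriv s = (\<Sum>u\<in>Z. of_nat (m u) * ((2 * s - 1) / (s * (s - 1) - u))) + (2 * s - 1) * e (s * (s - 1))"
    and s: "s = Complex \<sigma> t" "\<sigma> > 1" "norm (s * (s - 1)) < V"
  shows "\<bar>Re (arch s) - Re (neg_log_deriv s) - zsum Z m \<sigma> t\<bar> \<le> norm (2 * s - 1) * \<epsilon>"
proof -
  let ?G = "\<lambda>s u. (2 * s - 1) / (s * (s - 1) - u)"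
  have R1: "Re s > 1" "Re (cnj s) > 1" using s by auto
  have N: "norm (cnj s * (cnj s - 1)) = norm (s * (s - 1))"
  proof -
    have "cnj s * (cnj s - 1) = cnj (s * (s - 1))" by simp
    then show ?thesis by (simp only: complex_mod_cnj)
  qed
  have N2: "norm (2 * cnj s - 1) = norm (2 * s - 1)"
  proof -
    have "2 * cnj s - 1 = cnj (2 * s - 1)" by simp
    then show ?thesis by (simp only: complex_mod_cnj)
  qed
  define E1 E2 where "E1 = (2 * s - 1) * e (s * (s - 1))" and "E2 = (2 * cnj s - 1) * e (cnj s * (cnj s - 1))"
  have Rs: "Re (\<Sum>u\<in>Z. of_nat (m u) * ?G s u) = (\<Sum>u\<in>Z. real (m u) * Re (?G s u))" for s
    by (simp only: Re_sum Re_of_nat_mult)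
  have 1: "Re (arch s) - Re (neg_log_deriv s) = (\<Sum>u\<in>Z. real (m u) * Re (?G s u)) + Re E1"
    using arg_cong[OF eq[OF R1(1) s(3)], of Re] by (simp only: E1_def Rs plus_complex.sel minus_complex.sel)
  have "Re (arch (cnj s)) - Re (neg_log_deriv (cnj s)) = (\<Sum>u\<in>Z. real (m u) * Re (?G (cnj s) u)) + Re E2"
    using arg_cong[OF eq[OF R1(2)], of Re] s(3) N by (simp only: E2_def Rs plus_complex.sel minus_complex.sel)
  then have 2: "Re (arch s) - Re (neg_log_deriv s) = (\<Sum>u\<in>Z. real (m u) * Re (?G (cnj s) u)) + Re E2"
    using R1 by (simp add: arch_cnj neg_log_deriv_cnj)
  have "2 * zsum Z m \<sigma> t = (\<Sum>u\<in>Z. real (m u) * (Re (?G s u) + Re (?G (cnj s) u)))"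
    unfolding zsum_def sum_distrib_left
  proof (rule sum.cong[OF refl])
    fix u assume "u \<in> Z"
    then have "xi_sq u = 0" using fam by (simp add: zero_family_def)
    from zero_term_Re[OF this s(2) s(1)]
    show "2 * (real (m u) * ((pairf \<sigma> (zbeta u) (t - zgam u) + pairf \<sigma> (zbeta u) (t + zgam u)) / 2)) = real (m u) * (Re (?G s u) + Re (?G (cnj s) u))"
      by simp
  qed
  also have "\<dots> = (\<Sum>u\<in>Z. real (m u) * Re (?G s u)) + (\<Sum>u\<in>Z. real (m u) * Re (?G (cnj s) u))"
    by (simp only: distrib_left sum.distrib)
  finally have 3: "2 * zsum Z m \<sigma> t = (\<Sum>u\<in>Z. real (m u) * Re (?G s u)) + (\<Sum>u\<in>Z. real (m u) * Re (?G (cnj s) u))" .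
  have "2 * (x - z) = e1 + e2" if "2 * z = a + b" "x = a + e1" "x = b + e2" for x z a b e1 e2 :: real
    using that by (simp add: algebra_simps)
  from this[OF 3 1 2] have "2 * (Re (arch s) - Re (neg_log_deriv s) - zsum Z m \<sigma> t) = Re E1 + Re E2" .
  moreover have "norm E1 \<le> norm (2 * s - 1) * \<epsilon>"
    unfolding E1_def norm_mult[of "2 * s - 1"] using s(3) by (intro mult_left_mono e) auto
  moreover have "norm E2 \<le> norm (2 * s - 1) * \<epsilon>"
    unfolding E2_def norm_mult[of "2 * cnj s - 1"] N2 using s(3) N by (intro mult_left_mono e) auto
  moreover have "\<bar>q\<bar> \<le> c" if "2 * q = a + b" "x \<le> c" "y \<le> c" "\<bar>a\<bar> \<le> x" "\<bar>b\<bar> \<le> y" for q a b x y c :: real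
    using that by linarith
  ultimately show ?thesis using abs_Re_le_cmod[of E1] abs_Re_le_cmod[of E2] by blast
qed

subsection \<open>Bounds for the digamma function\<close>

text \<open>As functions of the step \<open>h\<close>, the defect \<open>d\<close> and its
  derivative \<open>d1\<close> vanish at 0, and \<open>d1\<close> has derivative
  \<open>h (M - f'' h) / 2\<close>, which is nonnegative. The estimate is one-sided; the opposite
  one comes from the negated functions.\<close>

lemma trapezoid_error:
  fixes F f f' f'' :: "real \<Rightarrow> real"
  assumes "\<And>t. 0 \<le> t \<Longrightarrow> t \<le> 1 \<Longrightarrow> (F has_real_derivative f t) (at t)"
    "\<And>t. 0 \<le> t \<Longrightarrow> t \<le> 1 \<Longrightarrow> (f has_real_derivative f' t) (at t)"
    "\<And>t. 0 \<le> t \<Longrightarrow> t \<le> 1 \<Longrightarrow> (f' has_real_derivative f'' t) (at t)"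
    "\<And>t. 0 \<le> t \<Longrightarrow> t \<le> 1 \<Longrightarrow> f'' t \<le> M"
  shows "(f 0 + f 1) / 2 - (F 1 - F 0) \<le> M / 12"
proof -
  define d where "d = (\<lambda>h. M * h^3 / 12 - (h * (f 0 + f h) / 2 - (F h - F 0)))"
  define d1 where "d1 = (\<lambda>h. M * h^2 / 4 - (h * f' h / 2 - (f h - f 0) / 2))"
  have dd: "(d has_real_derivative d1 h) (at h)" if "0 \<le> h" "h \<le> 1" for h
    unfolding d_def d1_def using assms(1,2)[OF that]
    by (auto intro!: derivative_eq_intros simp: power2_eq_square field_simps)
  have dd1: "(d1 has_real_derivative (h * (M - f'' h) / 2)) (at h)" if "0 \<le> h" "h \<le> 1" for h
    unfolding d1_def using assms(2,3)[OF that]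
    by (auto intro!: derivative_eq_intros simp: power2_eq_square field_simps)
  have "d1 h \<ge> 0" if h: "0 \<le> h" "h \<le> 1" for h
  proof -
    have "d1 0 \<le> d1 h"
    proof (rule DERIV_nonneg_imp_nondecreasing[OF h(1), of d1])
      fix x assume x: "0 \<le> x" "x \<le> h"
      then have "0 \<le> x * (M - f'' x) / 2" using assms(4)[of x] h by simp
      then show "\<exists>y. (d1 has_real_derivative y) (at x) \<and> 0 \<le> y" using dd1[of x] x h by auto
    qed
    then show ?thesis by (simp add: d1_def)
  qed
  then have d1: "d1 h \<ge> 0" if "0 \<le> h" "h \<le> 1" for h using that .
  have "d 0 \<le> d 1"
  proof (rule DERIV_nonneg_imp_nondecreasing[of 0 1 d])
    fix x :: real assume "0 \<le> x" "x \<le> 1"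
    then show "\<exists>y. (d has_real_derivative y) (at x) \<and> 0 \<le> y"
      using dd d1 by (intro exI[of _ "d1 x"] conjI)
  qed simp
  then show ?thesis by (simp add: d_def)
qed

text \<open>The limit formula \<open>ln m\<close> minus the sum of \<open>1/(z+n)\<close> is
  compared on unit intervals with the integral of \<open>1/(z+t)\<close>, whose real part has the
  primitive \<open>ln |z+t|\<close>. The half weight of the trapezoidal rule at the left end
  produces \<open>- f 0 / 2\<close>.\<close>

lemma Re_digamma_sums:
  fixes z :: complex
  assumes z: "Re z > 0"
  defines "f \<equiv> \<lambda>t. Re (1 / (z + of_real t))" and "L \<equiv> \<lambda>t. ln (norm (z + of_real t))"
  assumes d: "\<And>n. \<bar>(f (real n) + f (real n + 1)) / 2 - (L (real n + 1) - L (real n))\<bar> \<le> D n"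
    and D: "\<And>m. (\<Sum>n<m. D n) \<le> B"
  shows "Re (Digamma z) \<le> L 0 - f 0 / 2 + B" "Re (Digamma z) \<ge> L 0 - f 0 / 2 - B"
proof -
  have znz: "z \<noteq> 0" using z by auto
  let ?e = "\<lambda>n. (f (real n) + f (real n + 1)) / 2 - (L (real n + 1) - L (real n))"
  have tele: "(\<Sum>n<m. f (real n)) = L (real m) - L 0 + f 0 / 2 - f (real m) / 2 + (\<Sum>n<m. ?e n)" for m
    by (induction m) (simp_all add: field_simps)
  have "(\<lambda>m. Re (of_real (ln (real m)) - (\<Sum>n<m. inverse (z + of_nat n)))) \<longlonglongrightarrow> Re (Digamma z)"
    by (intro tendsto_Re Digamma_LIMSEQ znz)
  then have lim1: "(\<lambda>m. ln (real m) - (\<Sum>n<m. f (real n))) \<longlonglongrightarrow> Re (Digamma z)"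
    by (simp add: f_def divide_inverse)
  have lim2: "(\<lambda>m. L (real m) - ln (real m)) \<longlonglongrightarrow> 0"
  proof -
    have "(\<lambda>m. norm (z / of_nat m + 1)) \<longlonglongrightarrow> norm (0 + 1 :: complex)"
      by (intro tendsto_norm tendsto_add tendsto_const lim_const_over_n)
    then have "(\<lambda>m. ln (norm (z / of_nat m + 1))) \<longlonglongrightarrow> ln 1" by (intro tendsto_ln) auto
    moreover have "\<forall>\<^sub>F m in sequentially. ln (norm (z / of_nat m + 1)) = L (real m) - ln (real m)"
      using eventually_gt_at_top[of 0]
    proof eventually_elim
      case (elim m)
      have "z + of_nat m \<noteq> 0" using z by (auto simp: complex_eq_iff)
      have "z / of_nat m + 1 = (z + of_nat m) / of_nat m" using elim by (simp add: field_simps)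
      then have "norm (z / of_nat m + 1) = norm (z + of_nat m) / real m" by (simp add: norm_divide)
      then show ?case using elim \<open>z + of_nat m \<noteq> 0\<close> by (simp add: L_def ln_div)
    qed
    ultimately show ?thesis by (simp add: tendsto_cong)
  qed
  have lim3: "(\<lambda>m. f (real m)) \<longlonglongrightarrow> 0"
  proof (rule Lim_null_comparison)
    show "\<forall>\<^sub>F m in sequentially. norm (f (real m)) \<le> 1 / real m"
      using eventually_gt_at_top[of 0]
    proof eventually_elim
      case (elim m)
      have "real m \<le> norm (z + of_nat m)" using z complex_Re_le_cmod[of "z + of_nat m"] by simp
      then have "norm (1 / (z + of_nat m)) \<le> 1 / real m" using elim by (simp add: norm_divide frac_le)
      then show ?case using abs_Re_le_cmod[of "1 / (z + of_nat m)"] by (simp add: f_def)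
    qed
    show "(\<lambda>m. 1 / real m) \<longlonglongrightarrow> 0" by real_asymp
  qed
  have e: "\<bar>\<Sum>n<m. ?e n\<bar> \<le> B" for m
    using sum_abs[of ?e "{..<m}"] sum_mono[of "{..<m}" "\<lambda>n. \<bar>?e n\<bar>" D] d D[of m] by (meson order_trans)
  have lim4: "(\<lambda>m. (L (real m) - ln (real m)) + (ln (real m) - (\<Sum>n<m. f (real n))) - f (real m) / 2) \<longlonglongrightarrow> 0 + Re (Digamma z) - 0 / 2"
    by (intro tendsto_intros lim1 lim2 lim3) auto
  have eq: "(L (real m) - ln (real m)) + (ln (real m) - (\<Sum>n<m. f (real n))) - f (real m) / 2 = L 0 - f 0 / 2 - (\<Sum>n<m. ?e n)" for m
    unfolding tele by simp
  have lim5: "(\<lambda>m. L 0 - f 0 / 2 - (\<Sum>n<m. ?e n)) \<longlonglongrightarrow> Re (Digamma z)"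
    using lim4 unfolding eq by simp
  show "Re (Digamma z) \<le> L 0 - f 0 / 2 + B"
    by (rule LIMSEQ_le_const2[OF lim5]) (use e in \<open>auto simp: abs_le_iff intro!: exI[of _ 0]\<close>)
  show "Re (Digamma z) \<ge> L 0 - f 0 / 2 - B"
    by (rule LIMSEQ_le_const[OF lim5]) (use e in \<open>auto simp: abs_le_iff intro!: exI[of _ 0]\<close>)
qed

lemma Re_digamma_bounds:
  fixes z :: complex
  assumes z: "Re z > 0" "norm z \<ge> 11/4"
  shows "\<bar>Re (Digamma z) - (ln (norm z) - Re z / (2 * norm z ^ 2))\<bar> \<le> 21 / (40 * norm z ^ 2)"
proof -
  let ?f = "\<lambda>t. Re (1 / (z + of_real t))" and ?L = "\<lambda>t. ln (norm (z + of_real t))"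
  define r where "r = norm z"
  have r: "r \<ge> 11/4" using z by (simp add: r_def)
  have nrm: "norm (z + of_real t) \<ge> (r + t) / sqrt 2" if "t \<ge> 0" for t
  proof -
    have "(r + t)^2 \<le> 2 * (r^2 + t^2)" using sum_squares_bound[of r t] by (simp add: power2_eq_square algebra_simps)
    also have "r^2 + t^2 \<le> norm (z + of_real t) ^ 2"
      unfolding r_def cmod_power2 using z that by (simp add: power2_eq_square algebra_simps)
    finally have "((r + t) / sqrt 2)^2 \<le> norm (z + of_real t) ^ 2" by (simp add: power_divide)
    then show ?thesis by (rule power2_le_imp_le) simp
  qed
  have nz: "z + of_real t \<noteq> 0" if "t \<ge> 0" for t using z that by (auto simp: complex_eq_iff)
  have dL: "(?L has_real_derivative ?f t) (at t)" if "t \<ge> 0" for t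
  proof -
    have pos: "0 < (Re z + t)^2 + Im z ^ 2" using z that by (intro add_pos_nonneg) auto
    have "((\<lambda>t. ln (((Re z + t)^2 + Im z ^ 2)) / 2) has_real_derivative ?f t) (at t)"
      using pos by (auto intro!: derivative_eq_intros simp: Re_divide divide_simps power2_eq_square) (simp_all add: algebra_simps)
    moreover have "?L = (\<lambda>t. ln (((Re z + t)^2 + Im z ^ 2)) / 2)"
    proof
      fix t show "?L t = ln (((Re z + t)^2 + Im z ^ 2)) / 2"
        by (simp add: cmod_def ln_sqrt)
    qed
    ultimately show ?thesis by simp
  qed
  let ?g = "\<lambda>t. 1 / (z + complex_of_real t)"
  have dg: "((\<lambda>w. 1 / (z + w)) has_field_derivative - ((1 / (z + of_real t))^2)) (at (of_real t))" if "t \<ge> 0" for t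
    using nz[OF that] by (auto intro!: derivative_eq_intros simp: power2_eq_square)
  have dp1: "((\<lambda>t. Re (?g t)) has_real_derivative Re (- (?g t ^ 2))) (at t)" if "t \<ge> 0" for t
    using bounded_linear.has_vector_derivative[OF bounded_linear_Re has_vector_derivative_real_field[OF dg[OF that]]]
    by (simp add: has_real_derivative_iff_has_vector_derivative)
  have dp2: "((\<lambda>t. Re (- (?g t ^ 2))) has_real_derivative Re (2 * ?g t ^ 3)) (at t)" if "t \<ge> 0" for t
  proof -
    have "((\<lambda>w. - ((1 / (z + w))^2)) has_field_derivative - (of_nat 2 * (- ((1 / (z + of_real t))^2) * (1 / (z + of_real t))^(2 - Suc 0)))) (at (of_real t))"
      by (intro DERIV_minus DERIV_power dg that)
    moreover have "- (of_nat 2 * (- (q^2) * q^(2 - Suc 0))) = 2 * q^3" for q :: complex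
      by (simp add: power2_eq_square power3_eq_cube)
    ultimately have "((\<lambda>w. - ((1 / (z + w))^2)) has_field_derivative 2 * ?g t ^ 3) (at (of_real t))" by (simp only:)
    from bounded_linear.has_vector_derivative[OF bounded_linear_Re has_vector_derivative_real_field[OF this]] show ?thesis
      by (simp add: has_real_derivative_iff_has_vector_derivative)
  qed
  have f2: "\<bar>Re (2 * ?g t ^ 3)\<bar> \<le> 2 / (norm (z + of_real t))^3" for t
    using abs_Re_le_cmod[of "2 * ?g t ^ 3"] by (simp add: norm_divide norm_power norm_mult power_divide)
  \<comment> \<open>The second derivative is at most \<open>2 / |z+x|^3\<close>, where one factor
    \<open>|z+x|\<close> is bounded below by \<open>r\<close> and the other two by
    \<open>(r+n) / sqrt 2\<close>. The factor 4 appears as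
    \<open>2 * sqrt 2 * sqrt 2\<close>.\<close>
  have tz: "\<bar>(?f (real n) + ?f (real n + 1)) / 2 - (?L (real n + 1) - ?L (real n))\<bar> \<le> 1 / (12 * r * (r + real n)^2) * (2 * sqrt 2 * sqrt 2)" for n
  proof -
    let ?M = "1 / (r * (r + real n)^2) * (2 * sqrt 2 * sqrt 2)"
    have M: "2 / (norm (z + of_real (real n + t)))^3 \<le> ?M" if "t \<ge> 0" for t
    proof -
      have n1: "norm (z + of_real (real n + t)) \<ge> (r + real n) / sqrt 2"
      proof -
        have "(r + real n) / sqrt 2 \<le> (r + (real n + t)) / sqrt 2" using that by (intro divide_right_mono) auto
        also have "\<dots> \<le> norm (z + of_real (real n + t))" by (rule nrm) (use that in simp)
        finally show ?thesis .
      qed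
      have n2: "norm (z + of_real (real n + t)) \<ge> r"
      proof -
        have "r^2 \<le> norm (z + of_real (real n + t)) ^ 2"
          unfolding r_def cmod_power2 using z that by (simp add: power2_eq_square algebra_simps)
        then show ?thesis by (rule power2_le_imp_le) simp
      qed
      have "r * ((r + real n) / sqrt 2)^2 \<le> norm (z + of_real (real n + t)) * norm (z + of_real (real n + t))^2"
        using n1 n2 r by (intro mult_mono power_mono) auto
      then have "r * (r + real n)^2 / 2 \<le> norm (z + of_real (real n + t))^3"
        by (simp add: power_divide power2_eq_square power3_eq_cube mult_ac)
      then have "2 / (norm (z + of_real (real n + t)))^3 \<le> 2 / (r * (r + real n)^2 / 2)"
      proof (intro divide_left_mono mult_pos_pos)
        show "0 < norm (z + of_real (real n + t)) ^ 3" using nz[of "real n + t"] that by simp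
      qed (use r in auto)
      then show ?thesis by (simp add: mult.assoc)
    qed
    have shift: "((\<lambda>t. F (real n + t)) has_real_derivative F' (real n + t)) (at t)"
      if "\<And>t. 0 \<le> t \<Longrightarrow> (F has_real_derivative F' t) (at t)" "0 \<le> t" for F F' :: "real \<Rightarrow> real" and t
    proof -
      have "(F has_real_derivative F' (real n + t)) (at (real n + t))" using that by simp
      moreover have "((\<lambda>t. real n + t) has_real_derivative 1) (at t)" by (auto intro!: derivative_eq_intros)
      ultimately show ?thesis using DERIV_chain2[of F "F' (real n + t)" "\<lambda>t. real n + t" t 1] by simp
    qed
    note D1 = shift[OF dL] and D2 = shift[OF dp1] and D3 = shift[OF dp2]
    have up: "(?f (real n) + ?f (real n + 1)) / 2 - (?L (real n + 1) - ?L (real n)) \<le> ?M / 12"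
    proof -
      have "Re (2 * ?g (real n + t) ^ 3) \<le> ?M" if "0 \<le> t" for t
        using f2[of "real n + t"] M[OF that] by linarith
      from trapezoid_error[OF D1 D2 D3 this] show ?thesis by simp
    qed
    have lo: "- (?f (real n) + ?f (real n + 1)) / 2 + (?L (real n + 1) - ?L (real n)) \<le> ?M / 12"
    proof -
      have "- Re (2 * ?g (real n + t) ^ 3) \<le> ?M" if "0 \<le> t" for t
        using f2[of "real n + t"] M[OF that] by linarith
      from trapezoid_error[OF DERIV_minus[OF D1] DERIV_minus[OF D2] DERIV_minus[OF D3] this] show ?thesis by simp
    qed
    have "?M / 12 = 1 / (12 * r * (r + real n)^2) * (2 * sqrt 2 * sqrt 2)" by simp
    then show ?thesis using up lo by (simp only: abs_le_iff) (simp add: field_simps)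
  qed
  have tele: "(\<Sum>n<m. 1 / (12 * r * (r + real n)^2) * (2 * sqrt 2 * sqrt 2)) \<le> 1 / (3 * r) * (1 / (r - 1) - 1 / (r + real m - 1))" for m
  proof (induction m)
    case (Suc m)
    have "1 / (r + real m)^2 \<le> 1 / (r + real m - 1) - 1 / (r + real m)"
      using r by (simp add: divide_simps power2_eq_square; simp add: algebra_simps)
    then have "1 / (3 * r) * (1 / (r + real m)^2) \<le> 1 / (3 * r) * (1 / (r + real m - 1) - 1 / (r + real m))"
      using r by (intro mult_left_mono) auto
    moreover have "1 / (12 * r * (r + real m)^2) * (2 * sqrt 2 * sqrt 2) = 1 / (3 * r) * (1 / (r + real m)^2)"
      by (simp add: mult.assoc)
    ultimately have "(\<Sum>n<Suc m. 1 / (12 * r * (r + real n)^2) * (2 * sqrt 2 * sqrt 2)) \<le>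
       1 / (3 * r) * (1 / (r - 1) - 1 / (r + real m - 1)) + 1 / (3 * r) * (1 / (r + real m - 1) - 1 / (r + real m))"
      using Suc by simp
    also have "\<dots> = 1 / (3 * r) * (1 / (r - 1) - 1 / (r + real (Suc m) - 1))"
      by (simp add: algebra_simps)
    finally show ?case .
  qed simp
  have B: "(\<Sum>n<m. 1 / (12 * r * (r + real n)^2) * (2 * sqrt 2 * sqrt 2)) \<le> 21 / (40 * r^2)" for m
  proof -
    have "1 / (3 * r) * (1 / (r - 1) - 1 / (r + real m - 1)) \<le> 1 / (3 * r) * (1 / (r - 1))"
      using r by (intro mult_left_mono) auto
    \<comment> \<open>This says \<open>r / (r-1) \<le> 63/40\<close>, which holds from
      \<open>r = 63/23\<close> on; the hypothesis \<open>r \<ge> 11/4\<close> lies just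
      above.\<close>
    also have "\<dots> \<le> 21 / (40 * r^2)"
      using r by (simp add: divide_simps power2_eq_square; simp add: algebra_simps)
    finally show ?thesis using tele[of m] by linarith
  qed
  have f0: "?f 0 = Re z / r^2" by (simp add: Re_divide r_def cmod_power2)
  have "Re (Digamma z) \<le> ?L 0 - ?f 0 / 2 + 21 / (40 * r^2)" "Re (Digamma z) \<ge> ?L 0 - ?f 0 / 2 - 21 / (40 * r^2)"
    using Re_digamma_sums[OF z(1) tz B] by auto
  then show ?thesis unfolding f0 by (simp add: r_def abs_le_iff)
qed

lemma ln_le_half_diff:
  assumes "y \<ge> (1::real)"
  shows "ln y \<le> (y - 1 / y) / 2"
proof -
  have "(\<lambda>y. (y - 1 / y) / 2 - ln y) 1 \<le> (\<lambda>y. (y - 1 / y) / 2 - ln y) y"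
  proof (rule DERIV_nonneg_imp_nondecreasing[OF assms, of "\<lambda>y. (y - 1 / y) / 2 - ln y"])
    fix x :: real assume x: "1 \<le> x"
    have "((\<lambda>y. (y - 1 / y) / 2 - ln y) has_real_derivative (1 + 1 / x^2) / 2 - 1 / x) (at x)"
      using x by (auto intro!: derivative_eq_intros simp: power2_eq_square)
    moreover have "(1 + 1 / x^2) / 2 - 1 / x = (1 - 1/x)^2 / 2"
      using x by (simp add: power2_eq_square field_simps)
    ultimately show "\<exists>y. ((\<lambda>y. (y - 1 / y) / 2 - ln y) has_real_derivative y) (at x) \<and> 0 \<le> y"
      by (intro exI[of _ "(1 - 1/x)^2 / 2"]) simp
  qed
  then show ?thesis by simp
qed

text \<open>The difference \<open>D\<close> of the two sides does not increase under
  \<open>y -> y + 1\<close>, by the preceding logarithm inequality at \<open>(y+1)/y\<close>, and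
  along \<open>x + m\<close> its lower bound tends to 0. Hence it is nonnegative.\<close>

lemma Digamma_real_le:
  assumes x: "x > (0::real)"
  shows "Digamma x \<le> ln x - 1 / (2 * x)"
proof -
  define D where "D = (\<lambda>y::real. ln y - 1 / (2 * y) - Digamma y)"
  have step: "D (y + 1) \<le> D y" if y: "y > 0" for y
  proof -
    have "ln ((y + 1) / y) \<le> ((y + 1) / y - 1 / ((y + 1) / y)) / 2" using y by (intro ln_le_half_diff) simp
    also have "((y + 1) / y - 1 / ((y + 1) / y)) / 2 = 1 / y - 1 / (2 * y) + 1 / (2 * (y + 1))"
      using y by (simp add: divide_simps; simp add: algebra_simps)
    also have "ln ((y + 1) / y) = ln (y + 1) - ln y" using y by (simp add: ln_div)
    finally show ?thesis using Digamma_plus1[of y] y by (simp add: D_def)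
  qed
  have ge: "- (21 / (40 * (x + real m)^2)) \<le> D x" if "real m \<ge> 3" for m
  proof -
    have "D (x + real k) \<le> D x" for k
    proof (induction k)
      case (Suc k)
      then show ?case using step[of "x + real k"] x by (simp add: add_ac)
    qed simp
    moreover have "- (21 / (40 * y^2)) \<le> D y" if "y \<ge> 3" for y
    proof -
      have "\<bar>Re (Digamma (of_real y)) - (ln (norm (complex_of_real y)) - Re (of_real y) / (2 * norm (complex_of_real y) ^ 2))\<bar> \<le> 21 / (40 * norm (complex_of_real y) ^ 2)"
        using that by (intro Re_digamma_bounds) auto
      moreover have "Digamma (complex_of_real y) = of_real (Digamma y)" using that by (intro Polygamma_of_real) simp
      ultimately have "\<bar>Digamma y - (ln y - y / (2 * y^2))\<bar> \<le> 21 / (40 * y^2)" using that by simp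
      moreover have "y / (2 * y^2) = 1 / (2 * y)" using that by (simp add: power2_eq_square)
      ultimately show ?thesis unfolding D_def by linarith
    qed
    from this[of "x + real m"] have "- (21 / (40 * (x + real m)^2)) \<le> D (x + real m)" using x that by simp
    ultimately show ?thesis by (meson order_trans)
  qed
  have "(\<lambda>m. - (21 / (40 * (x + real m)^2))) \<longlonglongrightarrow> 0" by real_asymp
  then have "0 \<le> D x"
    by (rule LIMSEQ_le_const2) (use ge in \<open>auto intro!: exI[of _ 3]\<close>)
  then show ?thesis by (simp add: D_def)
qed

subsection \<open>A zero-free region\<close>

text \<open>Removes the error of the finite-family approximation; the point is that \<open>C\<close>
  does not depend on the error.\<close>

lemma le_if_le_add_eps:
  fixes a b C :: real
  assumes "\<And>e. e > 0 \<Longrightarrow> a \<le> b + C * e" "C \<ge> 0"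
  shows "a \<le> b"
proof (rule field_le_epsilon)
  fix e :: real assume e: "e > 0"
  have "a \<le> b + C * (e / (C + 1))" using assms(1)[of "e / (C + 1)"] assms(2) e by simp
  also have "C * (e / (C + 1)) \<le> e" using assms(2) e by (simp add: divide_simps)
  finally show "a \<le> b + e" by simp
qed

lemma neg_log_deriv_Re_sums:
  assumes "\<sigma> > 1"
  shows "(\<lambda>n. mangoldt n * exp (- \<sigma> * ln (real n)) * cos (t * ln (real n))) sums Re (neg_log_deriv (Complex \<sigma> t))"
proof -
  have "(\<lambda>n. of_real (mangoldt n) * exp (- Complex \<sigma> t * of_real (ln (real n)))) sums neg_log_deriv (Complex \<sigma> t)"
    by (rule mangoldt_dseries) (use assms in simp)
  from sums_Re[OF this]
  have "(\<lambda>n. Re (of_real (mangoldt n) * exp (- Complex \<sigma> t * of_real (ln (real n))))) sums Re (neg_log_deriv (Complex \<sigma> t))" .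
  moreover have e: "Re (of_real (mangoldt n) * exp (- Complex \<sigma> t * of_real (ln (real n)))) = mangoldt n * exp (- \<sigma> * ln (real n)) * cos (t * ln (real n))" for n
  proof -
    have r: "Re (of_real a * z) = a * Re z" for a z by simp
    show ?thesis by (simp only: r Re_exp) simp
  qed
  ultimately show ?thesis by (simp only: e)
qed

lemma trig_341_nonneg: "3 + 4 * cos x + cos (2 * x) \<ge> (0::real)"
proof -
  have "3 + 4 * cos x + cos (2 * x) = 2 * (1 + cos x)^2"
    unfolding cos_double_cos by (simp add: power2_eq_square algebra_simps)
  then show ?thesis by simp
qed

text \<open>The classical positivity argument survives Stechkin's subtraction because the
  coefficients \<open>n^(-\<sigma>) - \<kappa> n^(-\<sigma>1)\<close> remain nonnegative.\<close>

lemma neg_log_deriv_341: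
  assumes "1 < \<sigma>" "\<sigma> \<le> \<sigma>1" "0 \<le> \<kappa>" "\<kappa> \<le> 1"
  defines "F \<equiv> \<lambda>\<sigma> t. Re (neg_log_deriv (Complex \<sigma> t))"
  shows "0 \<le> 3 * (F \<sigma> 0 - \<kappa> * F \<sigma>1 0) + 4 * (F \<sigma> t - \<kappa> * F \<sigma>1 t) + (F \<sigma> (2 * t) - \<kappa> * F \<sigma>1 (2 * t))"
proof (rule sums_le[OF _ sums_zero])
  let ?c = "\<lambda>\<sigma> t n. mangoldt n * exp (- \<sigma> * ln (real n)) * cos (t * ln (real n))"
  have s1: "\<sigma>1 > 1" using assms by simp
  note S = neg_log_deriv_Re_sums[OF assms(1), folded F_def] neg_log_deriv_Re_sums[OF s1, folded F_def]
  have d: "(\<lambda>n. ?c \<sigma> r n - \<kappa> * ?c \<sigma>1 r n) sums (F \<sigma> r - \<kappa> * F \<sigma>1 r)" for r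
    using sums_diff[OF neg_log_deriv_Re_sums[OF assms(1), of r] sums_mult[OF neg_log_deriv_Re_sums[OF s1, of r], of \<kappa>]]
    by (simp only: F_def)
  show "(\<lambda>n. 3 * (?c \<sigma> 0 n - \<kappa> * ?c \<sigma>1 0 n) + 4 * (?c \<sigma> t n - \<kappa> * ?c \<sigma>1 t n) + (?c \<sigma> (2*t) n - \<kappa> * ?c \<sigma>1 (2*t) n)) sums
     (3 * (F \<sigma> 0 - \<kappa> * F \<sigma>1 0) + 4 * (F \<sigma> t - \<kappa> * F \<sigma>1 t) + (F \<sigma> (2 * t) - \<kappa> * F \<sigma>1 (2 * t)))"
    by (intro sums_add sums_mult d)
  fix n
  have "3 * (?c \<sigma> 0 n - \<kappa> * ?c \<sigma>1 0 n) + 4 * (?c \<sigma> t n - \<kappa> * ?c \<sigma>1 t n) + (?c \<sigma> (2*t) n - \<kappa> * ?c \<sigma>1 (2*t) n)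
     = mangoldt n * (exp (- \<sigma> * ln (real n)) - \<kappa> * exp (- \<sigma>1 * ln (real n))) * (3 + 4 * cos (t * ln (real n)) + cos (2 * (t * ln (real n))))"
    by (simp add: algebra_simps)
  moreover have "\<kappa> * exp (- \<sigma>1 * ln (real n)) \<le> exp (- \<sigma> * ln (real n))"
  proof (cases "n = 0")
    case False
    then have "exp (- \<sigma>1 * ln (real n)) \<le> exp (- \<sigma> * ln (real n))" using assms by (simp add: mult_right_mono)
    moreover have "\<kappa> * exp (- \<sigma>1 * ln (real n)) \<le> 1 * exp (- \<sigma>1 * ln (real n))" using assms by (intro mult_right_mono) auto
    ultimately show ?thesis by linarith
  qed (use assms in simp)
  ultimately show "0 \<le> 3 * (?c \<sigma> 0 n - \<kappa> * ?c \<sigma>1 0 n) + 4 * (?c \<sigma> t n - \<kappa> * ?c \<sigma>1 t n) + (?c \<sigma> (2*t) n - \<kappa> * ?c \<sigma>1 (2*t) n)"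
    using trig_341_nonneg[of "t * ln (real n)"] by (simp only:) (intro mult_nonneg_nonneg mangoldt_nonneg, auto)
qed

definition archr :: "real \<Rightarrow> real \<Rightarrow> real" where "archr \<sigma> t = Re (arch (Complex \<sigma> t))"

lemma zsum_exists:
  assumes "V > 0" "\<epsilon> > 0"
  obtains Z m where "zero_family V Z m"
    "\<And>a r. a > 1 \<Longrightarrow> norm (Complex a r * (Complex a r - 1)) < V \<Longrightarrow>
      \<bar>archr a r - Re (neg_log_deriv (Complex a r)) - zsum Z m a r\<bar> \<le> norm (2 * Complex a r - 1) * \<epsilon>"
proof (rule zero_family_exists[OF assms])
  fix Z m e
  assume Z: "zero_family V Z m" "\<And>v. v \<in> ball 0 V \<Longrightarrow> norm (e v) \<le> \<epsilon>"
    "\<And>s. Re s > 1 \<Longrightarrow> norm (s * (s - 1)) < V \<Longrightarrow>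
       arch s - neg_log_deriv s = (\<Sum>u\<in>Z. of_nat (m u) * ((2 * s - 1) / (s * (s - 1) - u))) + (2 * s - 1) * e (s * (s - 1))"
  show thesis
    by (rule that[OF Z(1)]) (unfold archr_def, rule zsum_approx[OF Z refl])
qed

text \<open>The partial fraction expansion turns the inequality at heights 0, t and 2t into one
  about zeros. All contributions of zeros are nonnegative and are dropped, except that of the zero
  at height \<open>t\<close>, which is kept with its weight 4.\<close>

lemma zero_ineq_abstract:
  assumes u: "xi_sq u = 0" "zbeta u > 1/2" "zgam u \<noteq> 0" "t = \<bar>zgam u\<bar>"
    and \<sigma>: "1 < \<sigma>" "\<sigma> \<le> \<sigma>1" "0 \<le> \<kappa>" "\<kappa> \<le> 1" "\<kappa> * (2*\<sigma>1 - 1) \<le> 2*\<sigma> - 1"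
      "\<kappa> * (2*\<sigma>1 - 1) * ((2*\<sigma> - 1)^2 + 3) \<le> (2*\<sigma> - 1) * ((2*\<sigma>1 - 1)^2 - 1)"
  shows "4 * (pairf \<sigma> (zbeta u) 0 - \<kappa> * pairf \<sigma>1 (zbeta u) 0) \<le>
    3 * (archr \<sigma> 0 - \<kappa> * archr \<sigma>1 0) + 4 * (archr \<sigma> t - \<kappa> * archr \<sigma>1 t) + (archr \<sigma> (2*t) - \<kappa> * archr \<sigma>1 (2*t))"
proof -
  define sp where "sp = (\<lambda>\<sigma> t. Complex \<sigma> t * (Complex \<sigma> t - 1))"
  define N where "N = (\<lambda>\<sigma> t. norm (2 * Complex \<sigma> t - 1))"
  define V where "V = 1 + norm u + norm (sp \<sigma> 0) + norm (sp \<sigma>1 0) + norm (sp \<sigma> t) + norm (sp \<sigma>1 t) + norm (sp \<sigma> (2*t)) + norm (sp \<sigma>1 (2*t))"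
  define C where "C = 3 * (N \<sigma> 0 + \<kappa> * N \<sigma>1 0) + 4 * (N \<sigma> t + \<kappa> * N \<sigma>1 t) + (N \<sigma> (2*t) + \<kappa> * N \<sigma>1 (2*t))"
  have V: "norm u < V" "norm (sp \<sigma> 0) < V" "norm (sp \<sigma>1 0) < V" "norm (sp \<sigma> t) < V" "norm (sp \<sigma>1 t) < V" "norm (sp \<sigma> (2*t)) < V" "norm (sp \<sigma>1 (2*t)) < V" "V > 0"
    unfolding V_def by (simp_all add: add_nonneg_pos add_pos_nonneg)
  define h where "h = (\<lambda>w r. (pairf \<sigma> (zbeta w) (r - zgam w) + pairf \<sigma> (zbeta w) (r + zgam w)) / 2 - \<kappa> * ((pairf \<sigma>1 (zbeta w) (r - zgam w) + pairf \<sigma>1 (zbeta w) (r + zgam w)) / 2))"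
  have hk: "\<kappa> * pairf \<sigma>1 (zbeta w) y \<le> pairf \<sigma> (zbeta w) y" if "xi_sq w = 0" for w y
    using \<sigma> zbeta_ge[of w] zbeta_le[OF that] by (intro pairf_stechkin) auto
  have h0: "h w r \<ge> 0" if "xi_sq w = 0" for w r
    unfolding h_def using hk[OF that, of "r - zgam w"] hk[OF that, of "r + zgam w"] by (simp add: algebra_simps)
  have main: "4 * (pairf \<sigma> (zbeta u) 0 - \<kappa> * pairf \<sigma>1 (zbeta u) 0) \<le>
    3 * (archr \<sigma> 0 - \<kappa> * archr \<sigma>1 0) + 4 * (archr \<sigma> t - \<kappa> * archr \<sigma>1 t) + (archr \<sigma> (2*t) - \<kappa> * archr \<sigma>1 (2*t)) + C * \<epsilon>"
    if \<epsilon>: "\<epsilon> > 0" for \<epsilon>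
  proof -
    obtain Z m where Z: "zero_family V Z m" and app0: "\<And>a r. a > 1 \<Longrightarrow> norm (Complex a r * (Complex a r - 1)) < V \<Longrightarrow>
        \<bar>archr a r - Re (neg_log_deriv (Complex a r)) - zsum Z m a r\<bar> \<le> norm (2 * Complex a r - 1) * \<epsilon>"
      using zsum_exists[OF V(8) \<epsilon>] by blast
    have zf: "finite Z" "\<And>w. w \<in> Z \<Longrightarrow> xi_sq w = 0 \<and> m w > 0" "\<And>w. xi_sq w = 0 \<Longrightarrow> norm w < V \<Longrightarrow> w \<in> Z"
      using Z by (auto simp: zero_family_def)
    have app: "\<bar>archr a r - Re (neg_log_deriv (Complex a r)) - zsum Z m a r\<bar> \<le> N a r * \<epsilon>" if "a > 1" "norm (sp a r) < V" for a r
      unfolding N_def using app0[OF that(1) that(2)[unfolded sp_def]] .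
    have zs: "zsum Z m \<sigma> r - \<kappa> * zsum Z m \<sigma>1 r = (\<Sum>w\<in>Z. real (m w) * h w r)" for r
      unfolding zsum_def h_def by (simp only: sum_distrib_left right_diff_distrib sum_subtractf) (simp only: mult.left_commute)
    have zs0: "zsum Z m \<sigma> r - \<kappa> * zsum Z m \<sigma>1 r \<ge> 0" for r
      unfolding zs by (intro sum_nonneg mult_nonneg_nonneg) (use h0 zf(2) in auto)
    \<comment> \<open>\<open>zsum\<close> averages over both signs of the height, so
      \<open>u\<close> contributes only half of its main term; the conjugate zero supplies the other
      half.\<close>
    have zs1: "zsum Z m \<sigma> t - \<kappa> * zsum Z m \<sigma>1 t \<ge> pairf \<sigma> (zbeta u) 0 - \<kappa> * pairf \<sigma>1 (zbeta u) 0"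
    proof -
      have cj: "zbeta (cnj u) = zbeta u" "zgam (cnj u) = - zgam u"
        using zroot_cnj[OF u(2)] by (simp_all add: zbeta_def zgam_def)
      then have ne: "u \<noteq> cnj u" using u(3) by (metis neg_equal_zero)
      have zc: "xi_sq (cnj u) = 0" using u(1) by (simp add: xi_sq_cnj)
      have inZ: "u \<in> Z" "cnj u \<in> Z" using zf(3)[OF u(1)] zf(3)[OF zc] V(1) by auto
      have le_mult: "y \<le> real k * y" if "y \<ge> 0" "k > 0" for y k
        using mult_right_mono[of 1 "real k" y] that by simp
      have "h u t + h (cnj u) t \<le> real (m u) * h u t + real (m (cnj u)) * h (cnj u) t"
        using le_mult[OF h0[OF u(1), of t]] le_mult[OF h0[OF zc, of t]] zf(2)[OF inZ(1)] zf(2)[OF inZ(2)]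
        by (intro add_mono) auto
      also have "\<dots> = (\<Sum>w\<in>{u, cnj u}. real (m w) * h w t)" using ne by simp
      also have "\<dots> \<le> (\<Sum>w\<in>Z. real (m w) * h w t)"
        using inZ zf(1,2) h0 by (intro sum_mono2 mult_nonneg_nonneg) auto
      finally have 1: "h u t + h (cnj u) t \<le> zsum Z m \<sigma> t - \<kappa> * zsum Z m \<sigma>1 t" unfolding zs .
      have 2: "h u t + h (cnj u) t = (pairf \<sigma> (zbeta u) (t - zgam u) - \<kappa> * pairf \<sigma>1 (zbeta u) (t - zgam u)) + (pairf \<sigma> (zbeta u) (t + zgam u) - \<kappa> * pairf \<sigma>1 (zbeta u) (t + zgam u))"
        unfolding h_def cj by (simp add: field_simps)
      have "t - zgam u = 0 \<or> t + zgam u = 0" unfolding u(4) by linarith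
      then show ?thesis using 1 2 hk[OF u(1), of "t - zgam u"] hk[OF u(1), of "t + zgam u"] by auto
    qed
    have s1: "\<sigma>1 > 1" using \<sigma> by simp
    have comb: "A - \<kappa> * A1 \<ge> (F - \<kappa> * F1) + (z - \<kappa> * z1) - (n + \<kappa> * n1) * \<epsilon>"
      if "\<bar>A - F - z\<bar> \<le> n * \<epsilon>" "\<bar>A1 - F1 - z1\<bar> \<le> n1 * \<epsilon>" for A A1 F F1 z z1 n n1 :: real
    proof -
      have "\<kappa> * (A1 - F1 - z1) \<le> \<kappa> * (n1 * \<epsilon>)" using that(2) \<sigma>(3) by (intro mult_left_mono) auto
      then show ?thesis using that(1) by (simp add: algebra_simps abs_le_iff)
    qed
    note c0 = comb[OF app[OF \<sigma>(1) V(2)] app[OF s1 V(3)]]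
    note c1 = comb[OF app[OF \<sigma>(1) V(4)] app[OF s1 V(5)]]
    note c2 = comb[OF app[OF \<sigma>(1) V(6)] app[OF s1 V(7)]]
    note f = neg_log_deriv_341[OF \<sigma>(1-4), of t]
    have fin: "4 * p \<le> 3 * a0 + 4 * a1 + a2 + (3 * n0 + 4 * n1 + n2) * \<epsilon>"
      if "a0 \<ge> f0 + z0 - n0 * \<epsilon>" "a1 \<ge> f1 + z1 - n1 * \<epsilon>" "a2 \<ge> f2 + z2 - n2 * \<epsilon>" "0 \<le> 3 * f0 + 4 * f1 + f2" "z0 \<ge> 0" "z1 \<ge> p" "z2 \<ge> 0"
      for p a0 a1 a2 f0 f1 f2 z0 z1 z2 n0 n1 n2 :: real
      using that by (simp add: algebra_simps)
    from fin[OF c0 c1 c2 f zs0 zs1 zs0] show ?thesis unfolding C_def .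
  qed
  show ?thesis
  proof (rule le_if_le_add_eps[OF main])
    show "C \<ge> 0" unfolding C_def N_def using \<sigma>(3) by simp
  qed
qed

lemma archr_real_diff_le:
  assumes "1 < \<sigma>" "\<sigma> \<le> \<sigma>1" "0 \<le> \<kappa>" "\<kappa> \<le> 1"
  shows "archr \<sigma> 0 - \<kappa> * archr \<sigma>1 0 \<le> 1 / (\<sigma> - 1) - \<kappa> / (\<sigma>1 - 1) - (1 - \<kappa>) * ln pi / 2 + (1 - \<kappa>) / 2 * (ln (\<sigma>/2 + 1) - 1 / (\<sigma> + 2))"
proof -
  have A: "archr a 0 = 1 / (a - 1) - ln pi / 2 + Digamma (a/2 + 1) / 2" if "a > 1" for a
  proof -
    have c: "Complex a 0 = of_real a" by (simp add: complex_eq_iff)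
    have d: "Digamma (complex_of_real (a/2 + 1)) = of_real (Digamma (a/2 + 1))"
      using that by (intro Polygamma_of_real) simp
    have "arch (Complex a 0) = of_real (1 / (a - 1) - ln pi / 2 + Digamma (a/2 + 1) / 2)"
      unfolding arch_def c using d by simp
    then show ?thesis by (simp add: archr_def)
  qed
  have D1: "Digamma (\<sigma>/2 + 1) \<le> Digamma (\<sigma>1/2 + 1)" using assms by (intro Digamma_real_mono) auto
  have D2: "Digamma (\<sigma>/2 + 1) \<le> ln (\<sigma>/2 + 1) - 1 / (\<sigma> + 2)"
    using Digamma_real_le[of "\<sigma>/2 + 1"] assms by (simp add: algebra_simps)
  have "Digamma (\<sigma>/2 + 1) - \<kappa> * Digamma (\<sigma>1/2 + 1) \<le> Digamma (\<sigma>/2 + 1) - \<kappa> * Digamma (\<sigma>/2 + 1)"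
    using D1 assms by (simp add: mult_left_mono)
  also have "\<dots> = (1 - \<kappa>) * Digamma (\<sigma>/2 + 1)" by (simp add: algebra_simps)
  also have "\<dots> \<le> (1 - \<kappa>) * (ln (\<sigma>/2 + 1) - 1 / (\<sigma> + 2))" using D2 assms by (intro mult_left_mono) auto
  finally have D: "Digamma (\<sigma>/2 + 1) - \<kappa> * Digamma (\<sigma>1/2 + 1) \<le> (1 - \<kappa>) * (ln (\<sigma>/2 + 1) - 1 / (\<sigma> + 2))" .
  have "p - l / 2 + d / 2 - \<kappa> * (p1 - l / 2 + d1 / 2) \<le> p - \<kappa> * p1 - (1 - \<kappa>) * l / 2 + (1 - \<kappa>) / 2 * q"
    if "d - \<kappa> * d1 \<le> (1 - \<kappa>) * q" for p p1 l d d1 q :: real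
    using that by (simp add: field_simps)
  from this[OF D, of "1 / (\<sigma> - 1)" "ln pi" "1 / (\<sigma>1 - 1)"] show ?thesis
    using assms by (simp add: A)
qed

lemma ln_norm_le:
  assumes "T > 0" "x \<ge> 0"
  shows "ln (norm (Complex x (T/2))) \<le> ln (T/2) + 2 * x^2 / T^2"
proof -
  have pos: "x^2 + (T/2)^2 > 0" using assms by (intro add_nonneg_pos) auto
  have "ln (norm (Complex x (T/2))) = ln (x^2 + (T/2)^2) / 2" unfolding complex_norm using pos by (subst ln_sqrt) auto
  also have "x^2 + (T/2)^2 = (T/2)^2 * (1 + 4 * x^2 / T^2)" using assms by (simp add: power_divide field_simps)
  also have "ln \<dots> = 2 * ln (T/2) + ln (1 + 4 * x^2 / T^2)"
  proof -
    have "1 + 4 * x^2 / T^2 > 0" "(T/2)^2 > 0" using assms by (auto intro!: add_pos_nonneg)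
    moreover have "ln ((T/2)^2) = 2 * ln (T/2)" using assms by (subst ln_realpow) auto
    ultimately show ?thesis by (simp add: ln_mult_pos)
  qed
  also have "ln (1 + 4 * x^2 / T^2) \<le> 4 * x^2 / T^2" by (rule ln_add_one_self_le_self) (use assms in simp)
  finally show ?thesis by simp
qed

lemma archr_le:
  assumes "1 < \<sigma>" "\<bar>t\<bar> \<ge> 11/2"
  shows "archr \<sigma> t \<le> (\<sigma> - 1) / ((\<sigma> - 1)^2 + t^2) - ln pi / 2 + ln (norm (Complex (\<sigma>/2 + 1) (t/2))) / 2"
    and "archr \<sigma> t \<ge> - ln pi / 2 + (ln (norm (Complex (\<sigma>/2 + 1) (t/2))) - ((\<sigma>/2 + 1) / 2 + 21/40) * (4 / t^2)) / 2"
proof -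
  let ?z = "Complex (\<sigma>/2 + 1) (t/2)"
  have z: "Complex \<sigma> t / 2 + 1 = ?z" by (simp add: complex_eq_iff)
  have p: "Re (1 / (Complex \<sigma> t - 1)) = (\<sigma> - 1) / ((\<sigma> - 1)^2 + t^2)"
  proof -
    have "Complex \<sigma> t - 1 = Complex (\<sigma> - 1) t" by (simp add: complex_eq_iff)
    then show ?thesis by (simp only: Re_inverse_Complex)
  qed
  have A: "archr \<sigma> t = (\<sigma> - 1) / ((\<sigma> - 1)^2 + t^2) - ln pi / 2 + Re (Digamma ?z) / 2"
    unfolding archr_def arch_def z by (simp add: p[unfolded one_complex.sel])
  have n: "norm ?z \<ge> \<bar>t\<bar> / 2" using abs_Im_le_cmod[of ?z] by simp
  then have n1: "norm ?z \<ge> 11/4" using assms by simp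
  have n2: "(t/2)^2 \<le> norm ?z ^ 2" unfolding cmod_power2 by simp
  have t0: "t^2 > 0" using assms by auto
  have b: "\<bar>Re (Digamma ?z) - (ln (norm ?z) - (\<sigma>/2 + 1) / (2 * norm ?z ^ 2))\<bar> \<le> 21 / (40 * norm ?z ^ 2)"
    using Re_digamma_bounds[of ?z] assms n1 by simp
  have N0: "norm ?z ^ 2 > 0" using n1 by (intro zero_less_power) linarith
  \<comment> \<open>The correction term of the digamma expansion is negative and outweighs the
    error: \<open>(\<sigma>/2 + 1) / 2\<close> exceeds 3/4, which is more than 21/40.\<close>
  have "21 / (40 * norm ?z ^ 2) \<le> (\<sigma>/2 + 1) / (2 * norm ?z ^ 2)"
    using assms N0 by (simp add: divide_simps)
  then have "Re (Digamma ?z) \<le> ln (norm ?z)" using b by linarith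
  then show "archr \<sigma> t \<le> (\<sigma> - 1) / ((\<sigma> - 1)^2 + t^2) - ln pi / 2 + ln (norm ?z) / 2" unfolding A by simp
  have "(\<sigma>/2 + 1) / (2 * norm ?z ^ 2) + 21 / (40 * norm ?z ^ 2) = ((\<sigma>/2 + 1) / 2 + 21/40) * (1 / norm ?z ^ 2)"
    using N0 by (simp add: field_simps)
  also have "1 / norm ?z ^ 2 \<le> 4 / t^2"
    using n2 t0 N0 by (simp add: power_divide divide_simps)
  then have "((\<sigma>/2 + 1) / 2 + 21/40) * (1 / norm ?z ^ 2) \<le> ((\<sigma>/2 + 1) / 2 + 21/40) * (4 / t^2)"
    using assms by (intro mult_left_mono) auto
  finally have "Re (Digamma ?z) \<ge> ln (norm ?z) - ((\<sigma>/2 + 1) / 2 + 21/40) * (4 / t^2)" using b by linarith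
  moreover have "(\<sigma> - 1) / ((\<sigma> - 1)^2 + t^2) \<ge> 0" using assms by simp
  moreover have "- l / 2 + (n - e) / 2 \<le> p - l / 2 + r / 2" if "r \<ge> n - e" "p \<ge> 0" for l n e p r :: real
    using that by (simp add: field_simps)
  ultimately show "archr \<sigma> t \<ge> - ln pi / 2 + (ln (norm ?z) - ((\<sigma>/2 + 1) / 2 + 21/40) * (4 / t^2)) / 2"
    unfolding A by blast
qed

lemma archr_diff_le:
  assumes "1 < \<sigma>" "\<sigma> \<le> \<sigma>1" "0 \<le> \<kappa>" "\<kappa> \<le> 1" "T \<ge> 11/2"
  defines "x1 \<equiv> \<sigma>1/2 + 1"
  shows "archr \<sigma> T - \<kappa> * archr \<sigma>1 T \<le> (1 - \<kappa>) * (ln (T/2) - ln pi) / 2 +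
     ((\<sigma> - 1) + (1 - \<kappa>) * x1^2 + 2 * \<kappa> * (x1 / 2 + 21/40)) / T^2"
proof -
  have T: "T > 0" "\<bar>T\<bar> \<ge> 11/2" using assms by auto
  let ?l = "ln (norm (Complex x1 (T/2)))"
  have "norm (Complex (\<sigma>/2 + 1) (T/2)) \<le> norm (Complex x1 (T/2))"
    unfolding complex_norm x1_def using assms by (intro real_sqrt_le_mono add_mono power_mono) auto
  moreover have "norm (Complex (\<sigma>/2 + 1) (T/2)) > 0" using assms by (auto simp: complex_eq_iff)
  ultimately have "ln (norm (Complex (\<sigma>/2 + 1) (T/2))) \<le> ?l" by (intro ln_mono) auto
  moreover have "(\<sigma> - 1) / ((\<sigma> - 1)^2 + T^2) \<le> (\<sigma> - 1) / T^2"
    using assms T by (intro divide_left_mono mult_pos_pos add_nonneg_pos) auto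
  ultimately have 1: "archr \<sigma> T \<le> (\<sigma> - 1) / T^2 - ln pi / 2 + ?l / 2"
    using archr_le(1)[OF assms(1) T(2)] by linarith
  have "\<kappa> * (- ln pi / 2 + (?l - (x1 / 2 + 21/40) * (4 / T^2)) / 2) \<le> \<kappa> * archr \<sigma>1 T"
    using archr_le(2)[of \<sigma>1 T] assms T unfolding x1_def by (intro mult_left_mono) auto
  then have 2: "archr \<sigma> T - \<kappa> * archr \<sigma>1 T \<le> (\<sigma> - 1) / T^2 - ln pi / 2 + ?l / 2 - \<kappa> * (- ln pi / 2 + (?l - (x1 / 2 + 21/40) * (4 / T^2)) / 2)"
    using 1 by linarith
  also have "\<dots> = (\<sigma> - 1) / T^2 - (1 - \<kappa>) * ln pi / 2 + (1 - \<kappa>) * ?l / 2 + 2 * \<kappa> * (x1 / 2 + 21/40) / T^2"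
    using T by (simp add: field_simps)
  also have "(1 - \<kappa>) * ?l / 2 \<le> (1 - \<kappa>) * (ln (T/2) + 2 * x1^2 / T^2) / 2"
    using assms T ln_norm_le[OF T(1), of x1] by (intro divide_right_mono mult_left_mono) (auto simp: x1_def)
  also have "(\<sigma> - 1) / T^2 - (1 - \<kappa>) * ln pi / 2 + (1 - \<kappa>) * (ln (T/2) + 2 * x1^2 / T^2) / 2 + 2 * \<kappa> * (x1 / 2 + 21/40) / T^2 =
     (1 - \<kappa>) * (ln (T/2) - ln pi) / 2 + ((\<sigma> - 1) + (1 - \<kappa>) * x1^2 + 2 * \<kappa> * (x1 / 2 + 21/40)) / T^2"
    by (simp add: add_divide_distrib diff_divide_distrib algebra_simps)
  finally show ?thesis by simp
qed

text \<open>The weights 4 at height \<open>t\<close> and 1 at height \<open>2t\<close> give the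
  coefficient 4/2 + 1/2 = 5/2 of \<open>ln t\<close>, and the errors \<open>c / t^2\<close> and
  \<open>c / (4 t^2)\<close> add up to \<open>17/4 * c / t^2\<close>.\<close>

theorem zero_ineq:
  assumes u: "xi_sq u = 0" "zbeta u > 1/2" "t = \<bar>zgam u\<bar>" "t \<ge> 11/2"
    and \<sigma>: "1 < \<sigma>" "\<sigma> \<le> \<sigma>1" "0 \<le> \<kappa>" "\<kappa> \<le> 1" "\<kappa> * (2*\<sigma>1 - 1) \<le> 2*\<sigma> - 1"
      "\<kappa> * (2*\<sigma>1 - 1) * ((2*\<sigma> - 1)^2 + 3) \<le> (2*\<sigma> - 1) * ((2*\<sigma>1 - 1)^2 - 1)"
  defines "x1 \<equiv> \<sigma>1/2 + 1"
  shows "4 * (pairf \<sigma> (zbeta u) 0 - \<kappa> * pairf \<sigma>1 (zbeta u) 0) \<le>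
    3 * (1 / (\<sigma> - 1) - \<kappa> / (\<sigma>1 - 1)) + (1 - \<kappa>) * (5/2 * ln t - 2 * ln 2 - 4 * ln pi) +
    3/2 * (1 - \<kappa>) * (ln (\<sigma>/2 + 1) - 1 / (\<sigma> + 2)) +
    17/4 * ((\<sigma> - 1) + (1 - \<kappa>) * x1^2 + 2 * \<kappa> * (x1 / 2 + 21/40)) / t^2"
proof -
  define c where "c = (\<sigma> - 1) + (1 - \<kappa>) * x1^2 + 2 * \<kappa> * (x1 / 2 + 21/40)"
  have g: "zgam u \<noteq> 0" using u by auto
  note main = zero_ineq_abstract[OF u(1,2) g u(3) \<sigma>]
  have a0: "archr \<sigma> 0 - \<kappa> * archr \<sigma>1 0 \<le> 1 / (\<sigma> - 1) - \<kappa> / (\<sigma>1 - 1) - (1 - \<kappa>) * ln pi / 2 + (1 - \<kappa>) / 2 * (ln (\<sigma>/2 + 1) - 1 / (\<sigma> + 2))"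
    by (rule archr_real_diff_le[OF \<sigma>(1-4)])
  have a1: "archr \<sigma> t - \<kappa> * archr \<sigma>1 t \<le> (1 - \<kappa>) * (ln (t/2) - ln pi) / 2 + c / t^2"
    using archr_diff_le[OF \<sigma>(1-4) u(4)] by (simp add: c_def x1_def)
  have a2: "archr \<sigma> (2*t) - \<kappa> * archr \<sigma>1 (2*t) \<le> (1 - \<kappa>) * (ln t - ln pi) / 2 + c / (4 * t^2)"
    using archr_diff_le[OF \<sigma>(1-4), of "2*t"] u(4) by (simp add: c_def x1_def power_mult_distrib)
  have l: "ln (t/2) = ln t - ln 2" using u(4) by (simp add: ln_div)
  have fin: "3 * (p - q - k * lp / 2 + k / 2 * r) + 4 * (k * (lt - l2 - lp) / 2 + c / T) + (k * (lt - lp) / 2 + c / (4 * T)) =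
     3 * (p - q) + k * (5/2 * lt - 2 * l2 - 4 * lp) + 3/2 * k * r + 17/4 * c / T" for p q k lp r lt l2 T :: real
    by (simp add: field_simps)
  have "3 * (archr \<sigma> 0 - \<kappa> * archr \<sigma>1 0) + 4 * (archr \<sigma> t - \<kappa> * archr \<sigma>1 t) + (archr \<sigma> (2*t) - \<kappa> * archr \<sigma>1 (2*t)) \<le>
     3 * (1 / (\<sigma> - 1) - \<kappa> / (\<sigma>1 - 1) - (1 - \<kappa>) * ln pi / 2 + (1 - \<kappa>) / 2 * (ln (\<sigma>/2 + 1) - 1 / (\<sigma> + 2))) +
     4 * ((1 - \<kappa>) * (ln t - ln 2 - ln pi) / 2 + c / t^2) + ((1 - \<kappa>) * (ln t - ln pi) / 2 + c / (4 * t^2))"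
    using a0 a1 a2 unfolding l by (intro add_mono mult_left_mono) auto
  with main show ?thesis unfolding fin c_def[symmetric] by (rule order_trans)
qed

subsection \<open>Numerical constants\<close>

lemma ln_2_bounds: "ln (2::real) \<ge> 69314/100000" "ln (2::real) \<le> 69316/100000"
  using ln_approx_bounds[of 2 5] by (simp_all add: eval_nat_numeral)

lemma ln_3_ge: "ln (3::real) \<ge> 10986/10000"
  using ln_approx_bounds[of 3 8] by (simp add: eval_nat_numeral)

lemma ln_5_ge: "ln (5::real) \<ge> 16/10"
  using ln_approx_bounds[of 5 6] by (simp add: eval_nat_numeral)

text \<open>Were pi smaller, sin(pi/6) = 1/2 would lie below the sine of 31415/60000; but the
  Maclaurin polynomial of degree 5 at that point, with its remainder, stays below 1/2.\<close>

lemma pi_ge_31415: "pi \<ge> 31415/10000"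
proof (rule ccontr)
  define x :: real where "x = 31415/60000"
  assume "\<not> pi \<ge> 31415/10000"
  then have "pi / 6 < x" by (simp add: x_def)
  moreover have "x < pi / 2" using pi_ge_two by (simp add: x_def)
  ultimately have "sin (pi / 6) < sin x" by (intro sin_monotone_2pi) (auto simp: order_less_imp_le intro: order_trans[of _ 0])
  moreover have "\<bar>sin x - (\<Sum>m<7. sin_coeff m * x ^ m)\<bar> \<le> inverse (fact 7) * \<bar>x\<bar> ^ 7"
    by (rule Maclaurin_sin_bound)
  moreover have "(\<Sum>m<7. sin_coeff m * x ^ m) = x - x^3 / 6 + x^5 / 120"
    by (simp add: sin_coeff_def lessThan_nat_numeral fact_numeral)
  ultimately have "\<bar>sin x - (x - x^3 / 6 + x^5 / 120)\<bar> \<le> x^7 / 5040" "1/2 < sin x"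
    by (simp_all add: sin_30 fact_numeral x_def)
  then have "1/2 < x - x^3 / 6 + x^5 / 120 + x^7 / 5040" by linarith
  then show False by (simp add: x_def eval_nat_numeral)
qed

lemma ln_pi_ge: "ln pi \<ge> 11446/10000"
proof -
  have "ln (31415/10000::real) \<ge> 11446/10000"
    using ln_approx_bounds[of "31415/10000" 6] by (simp add: eval_nat_numeral)
  also have "ln (31415/10000::real) \<le> ln pi" using pi_ge_31415 by simp
  finally show ?thesis .
qed

subsection \<open>Low zeros and weighted sums over zeros\<close>

text \<open>The value of - \<zeta>'/\<zeta> at a real point. It bounds the modulus of the real part
  on the whole vertical line.\<close>

definition Fr :: "real \<Rightarrow> real" where "Fr \<sigma> = Re (neg_log_deriv (Complex \<sigma> 0))"

lemma Fr_sums: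
  assumes "\<sigma> > 1"
  shows "(\<lambda>n. mangoldt n * exp (- \<sigma> * ln (real n))) sums Fr \<sigma>"
  using neg_log_deriv_Re_sums[OF assms, of 0] by (simp add: Fr_def)

lemma neg_Re_neg_log_deriv_le:
  assumes "\<sigma> > 1"
  shows "- Re (neg_log_deriv (Complex \<sigma> t)) \<le> Fr \<sigma>"
proof (rule sums_le[OF _ sums_minus[OF neg_log_deriv_Re_sums[OF assms, of t]] Fr_sums[OF assms]])
  fix n
  have "mangoldt n * exp (- \<sigma> * ln (real n)) * (- cos (t * ln (real n))) \<le> mangoldt n * exp (- \<sigma> * ln (real n)) * 1"
    using cos_ge_minus_one[of "t * ln (real n)"] by (intro mult_left_mono mult_nonneg_nonneg mangoldt_nonneg) auto
  then show "- (mangoldt n * exp (- \<sigma> * ln (real n)) * cos (t * ln (real n))) \<le> mangoldt n * exp (- \<sigma> * ln (real n))"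
    by simp
qed

lemma Fr_decay:
  assumes "1 < b" "b \<le> a"
  shows "Fr a \<le> exp (- (a - b) * ln 2) * Fr b"
proof (rule sums_le[OF _ Fr_sums sums_mult[OF Fr_sums]])
  fix n :: nat
  show "mangoldt n * exp (- a * ln (real n)) \<le> exp (- (a - b) * ln 2) * (mangoldt n * exp (- b * ln (real n)))"
  proof (cases "n \<ge> 2")
    case False
    then have "n = 0 \<or> n = Suc 0" by linarith
    then show ?thesis by auto
  next
    case True
    have "(a - b) * ln 2 \<le> (a - b) * ln (real n)" using assms True by (intro mult_left_mono) auto
    then have "- a * ln (real n) \<le> - (a - b) * ln 2 + - b * ln (real n)" by (simp add: algebra_simps)
    then have "exp (- a * ln (real n)) \<le> exp (- (a - b) * ln 2) * exp (- b * ln (real n))"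
      unfolding exp_add[symmetric] by (simp only: exp_le_cancel_iff)
    from mult_left_mono[OF this mangoldt_nonneg[of n]] show ?thesis by (simp only: mult.left_commute)
  qed
qed (use assms in auto)

lemma Fr_4_ge: "Fr 4 \<ge> 616/10000"
proof -
  have p: "prime (2::nat)" "prime (3::nat)" "prime (5::nat)" by simp_all
  have m4: "mangoldt 4 = ln (2::real)" using mangoldt_primepow'[OF p(1), of 2, where 'a = real] by simp
  have l4: "ln (4::real) = 2 * ln 2" using ln_realpow[of 2 2] by simp
  have e: "exp (- (4 * ln (x::real))) = 1 / x ^ 4" if "x > 0" for x
    using exp_of_nat_mult[of 4 "- ln x"] that by (simp add: exp_minus field_simps power_divide)
  have "(\<Sum>n\<in>{2,3,4,5}. mangoldt n * exp (- 4 * ln (real n))) \<le> Fr 4"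
    using sum_le_suminf[OF sums_summable[OF Fr_sums[of 4]], of "{2,3,4,5}"] sums_unique[OF Fr_sums[of 4]]
    by (simp add: mangoldt_nonneg)
  then have "mangoldt 2 / 16 + mangoldt 3 / 81 + mangoldt 4 / 256 + mangoldt 5 / 625 \<le> Fr 4"
    by (simp add: e)
  then show ?thesis using ln_2_bounds ln_3_ge ln_5_ge p by (simp add: m4)
qed

lemma archr_0_le:
  assumes "a > 1"
  shows "archr a 0 \<le> 1 / (a - 1) - ln pi / 2 + ln (a/2 + 1) / 2"
proof -
  have c: "Complex a 0 = of_real a" by (simp add: complex_eq_iff)
  have d: "Digamma (complex_of_real (a/2 + 1)) = of_real (Digamma (a/2 + 1))"
    using assms by (intro Polygamma_of_real) simp
  have "arch (Complex a 0) = of_real (1 / (a - 1) - ln pi / 2 + Digamma (a/2 + 1) / 2)"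
    unfolding arch_def c using d by simp
  moreover have "Digamma (a/2 + 1) \<le> ln (a/2 + 1)"
    proof -
    have "a/2 + 1 > 0" "1 / (2 * (a/2 + 1)) \<ge> 0" using assms by auto
    then show ?thesis using Digamma_real_le[of "a/2 + 1"] by linarith
  qed
  ultimately show ?thesis by (simp add: archr_def)
qed

text \<open>Here \<open>Digamma 3\<close> equals 3/2 minus Euler's constant, so a lower bound for
  that constant gives the estimate.\<close>

lemma archr_4_le: "archr 4 0 \<le> 2233/10000"
proof -
  have d1: "Digamma (2::real) = Digamma 1 + 1" using Digamma_plus1[of "1::real"] by simp
  have d2: "Digamma (3::real) = Digamma 2 + 1/2" using Digamma_plus1[of "2::real"] by simp
  have Re_em: "Re euler_mascheroni = euler_mascheroni"
    using arg_cong[OF of_real_euler_mascheroni[where 'a = complex], of Re] by (simp only: Re_complex_of_real)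
  have c: "Complex 4 0 = of_real 4" by (simp add: complex_eq_iff)
  have d: "Digamma (complex_of_real 3) = of_real (Digamma 3)" by (intro Polygamma_of_real) simp
  have "arch (Complex 4 0) = of_real (1 / 3 - ln pi / 2 + Digamma 3 / 2)"
    unfolding arch_def c using d by simp
  then have "archr 4 0 = 1/3 - ln pi / 2 + (3/2 - euler_mascheroni) / 2" by (simp add: archr_def d2 d1 Re_em)
  moreover have "1/3 - l / 2 + (3/2 - c) / 2 \<le> 2233/10000" if "l \<ge> 11446/10000" "c > 19/33" for l c :: real
    using that by (simp add: field_simps)
  ultimately show ?thesis using ln_pi_ge euler_mascheroni_gt_19_over_33 by simp
qed

lemma zsum_nonneg: "zero_family V Z m \<Longrightarrow> a > 1 \<Longrightarrow> zsum Z m a t \<ge> 0"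
  unfolding zsum_def using zbeta_ge zbeta_le
  by (intro sum_nonneg mult_nonneg_nonneg divide_nonneg_nonneg add_nonneg_nonneg pairf_nonneg) (auto simp: zero_family_def)

text \<open>The difference of the two sides is the sum over zeros, which is nonnegative.\<close>

lemma Fr_le_archr:
  assumes "a > 1"
  shows "Fr a \<le> archr a 0"
proof (rule le_if_le_add_eps)
  let ?s = "Complex a 0"
  fix \<epsilon> :: real assume "\<epsilon> > 0"
  moreover have V: "norm (?s * (?s - 1)) + 1 > 0" by (simp add: add_nonneg_pos)
  ultimately obtain Z m where Z: "zero_family (norm (?s * (?s - 1)) + 1) Z m"
    and app: "\<And>a r. a > 1 \<Longrightarrow> norm (Complex a r * (Complex a r - 1)) < norm (?s * (?s - 1)) + 1 \<Longrightarrow>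
        \<bar>archr a r - Re (neg_log_deriv (Complex a r)) - zsum Z m a r\<bar> \<le> norm (2 * Complex a r - 1) * \<epsilon>"
    using zsum_exists by blast
  show "Fr a \<le> archr a 0 + norm (2 * Complex a 0 - 1) * \<epsilon>"
    using app[OF assms, of 0] zsum_nonneg[OF Z assms, of 0] unfolding Fr_def by simp
qed simp

lemma Fr_le:
  assumes "a \<ge> 10"
  shows "Fr a \<le> 35/10000"
proof -
  have "Fr a \<le> exp (- (a - 4) * ln 2) * Fr 4" using assms by (intro Fr_decay) auto
  also have "\<dots> \<le> exp (- (6 * ln 2)) * (2233/10000)"
  proof (intro mult_mono)
    have "6 * ln 2 \<le> (a - 4) * ln (2::real)" using assms by (intro mult_right_mono) auto
    then show "exp (- (a - 4) * ln 2) \<le> exp (- (6 * ln (2::real)))" by (simp only: exp_le_cancel_iff mult_minus_left neg_le_iff_le)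
  qed (use Fr_le_archr[of 4] archr_4_le Fr_4_ge in auto)
  also have "exp (- (6 * ln 2)) = (1 / 2 ^ 6 :: real)"
    using exp_of_nat_mult[of 6 "- ln (2::real)"] by (simp add: exp_minus field_simps)
  finally show ?thesis by simp
qed

lemma pairf_even: "pairf \<sigma> \<beta> (- y) = pairf \<sigma> \<beta> y"
  by (simp add: pairf_def)

text \<open>At \<open>s = 4\<close> the whole sum over zeros is at most 0.2233 - 0.0616 = 0.1617,
  while a single zero contributes at least \<open>7 / (13 + \<gamma>^2)\<close>; this forces
  \<gamma>^2 above 30.25 = (11/2)^2. The value 11/2 is also the height from which the digamma bounds
  apply at \<open>s/2 + 1\<close>.\<close>

lemma zgam_ge:
  assumes u: "xi_sq u = 0"
  shows "\<bar>zgam u\<bar> \<ge> 11/2"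
proof -
  let ?s = "Complex 4 0"
  let ?V = "norm (?s * (?s - 1)) + norm u + 1"
  have "7 / (13 + (zgam u)^2) \<le> archr 4 0 - Fr 4"
  proof (rule le_if_le_add_eps)
    fix \<epsilon> :: real assume "\<epsilon> > 0"
    moreover have V: "?V > 0" by (simp add: add_nonneg_pos)
    ultimately obtain Z m where Z: "zero_family ?V Z m"
      and app: "\<And>a r. a > 1 \<Longrightarrow> norm (Complex a r * (Complex a r - 1)) < ?V \<Longrightarrow>
          \<bar>archr a r - Re (neg_log_deriv (Complex a r)) - zsum Z m a r\<bar> \<le> norm (2 * Complex a r - 1) * \<epsilon>"
      using zsum_exists by blast
    have zf: "finite Z" "\<And>w. w \<in> Z \<Longrightarrow> xi_sq w = 0 \<and> m w > 0" "u \<in> Z"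
      using Z u by (auto simp: zero_family_def add_nonneg_pos)
    have p: "pairf 4 (zbeta w) y \<ge> 0" if "w \<in> Z" for w y
      using zf(2)[OF that] zbeta_ge[of w] zbeta_le[of w] by (intro pairf_nonneg) auto
    have "7 / (13 + (zgam u)^2) \<le> 1 * pairf 4 (zbeta u) (zgam u)"
      using pairf_bounds(1)[of 4 "zbeta u" "zgam u"] zbeta_ge[of u] zbeta_le[OF u] by simp
    also have "\<dots> \<le> real (m u) * pairf 4 (zbeta u) (zgam u)"
      using zf(2)[OF zf(3)] p[OF zf(3)] by (intro mult_right_mono) auto
    also have "\<dots> = real (m u) * ((pairf 4 (zbeta u) (0 - zgam u) + pairf 4 (zbeta u) (0 + zgam u)) / 2)"
      by (simp only: pairf_even diff_0 add_0) simp
    also have "\<dots> \<le> zsum Z m 4 0"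
      unfolding zsum_def using zf p by (intro member_le_sum) auto
    finally show "7 / (13 + (zgam u)^2) \<le> archr 4 0 - Fr 4 + norm (2 * Complex 4 0 - 1) * \<epsilon>"
      using app[of 4 0] unfolding Fr_def by (simp add: add_nonneg_pos)
  qed simp
  also have "\<dots> \<le> 1617/10000" using archr_4_le Fr_4_ge by simp
  finally have "(11/2)^2 \<le> (zgam u)^2" by (simp add: divide_simps power2_eq_square add_nonneg_pos add_pos_nonneg)
  then show ?thesis using abs_le_square_iff[of "11/2" "zgam u"] by simp
qed

section \<open>Comparison of sums over zeros with one value of the logarithmic derivative\<close>

definition kernel_const :: "real \<Rightarrow> real" where "kernel_const t = (if t = 0 then 1 else 1/2)"

text \<open>At height 0 both averaged terms see the distance \<bar>\<gamma>\<bar> and count fully.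
  At other heights only the nearer of the two is retained, which accounts for the factor 1/2 in
  \<open>kernel_const\<close>.\<close>

lemma kernel_lower:
  assumes "xi_sq u = 0" "a > 1" "t \<ge> 0"
  shows "kernel_const t * (2*a - 1) / (((2*a - 1)^2 + 3)/4 + (\<bar>zgam u\<bar> - t)^2) \<le> (pairf a (zbeta u) (t - zgam u) + pairf a (zbeta u) (t + zgam u)) / 2"
proof -
  let ?g = "\<lambda>y. (2*a - 1) / (((2*a - 1)^2 + 3)/4 + y^2)"
  have p: "pairf a (zbeta u) y \<ge> ?g y" "pairf a (zbeta u) y \<ge> 0" for y
    using pairf_bounds(1)[of a "zbeta u" y] pairf_nonneg[of a "zbeta u" y] zbeta_ge[of u] zbeta_le[OF assms(1)] assms by auto
  let ?f = "\<lambda>Y. (2*a - 1) / (((2*a - 1)^2 + 3)/4 + Y)"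
  show ?thesis
  proof (cases "t = 0")
    case True
    have "g \<le> (x + y) / 2" if "g \<le> x" "g \<le> y" for g x y :: real using that by simp
    from this[OF p(1)[of "- zgam u", unfolded power2_minus] p(1)[of "zgam u"]] True show ?thesis
      by (simp only: kernel_const_def) simp
  next
    case False
    have "zgam u = \<bar>zgam u\<bar> \<or> zgam u = - \<bar>zgam u\<bar>" by linarith
    then have or: "(t - zgam u)^2 = (\<bar>zgam u\<bar> - t)^2 \<or> (t + zgam u)^2 = (\<bar>zgam u\<bar> - t)^2"
      by (metis add_uminus_conv_diff diff_minus_eq_add minus_diff_eq power2_commute)
    have kc: "kernel_const t * (2*a - 1) / (((2*a - 1)^2 + 3)/4 + (\<bar>zgam u\<bar> - t)^2) = ?f ((\<bar>zgam u\<bar> - t)^2) / 2"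
      using False by (simp add: kernel_const_def)
    have "k \<le> (x + y) / 2" if "A = C \<or> B = C" "k = f C / 2" "f A \<le> x" "f B \<le> y" "0 \<le> x" "0 \<le> y"
      for k x y A B C :: real and f :: "real \<Rightarrow> real"
      using that by auto
    note * = this[of _ _ _ _ ?f]
    show ?thesis by (rule *[OF or kc]) (rule p)+
  qed
qed

text \<open>Pointwise domination of the weights by the kernel at \<open>a + i t\<close> bounds their
  sum over all zeros by one value of \<open>zsum\<close>. This takes the place of counting zeros up
  to a height.\<close>

lemma weighted_zero_sum_le:
  assumes Z: "zero_family V Z m" and a: "a > 1" "t \<ge> 0" and \<mu>: "\<mu> \<ge> 0"
    and w: "\<And>u. xi_sq u = 0 \<Longrightarrow> w u * (((2*a - 1)^2 + 3)/4 + (\<bar>zgam u\<bar> - t)^2) \<le> \<mu> * (kernel_const t * (2*a - 1))"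
  shows "(\<Sum>u\<in>Z. real (m u) * w u) \<le> \<mu> * zsum Z m a t"
  unfolding zsum_def sum_distrib_left
proof (rule sum_mono)
  fix u assume "u \<in> Z"
  then have u: "xi_sq u = 0" using Z by (simp add: zero_family_def)
  let ?q = "((2*a - 1)^2 + 3)/4 + (\<bar>zgam u\<bar> - t)^2"
  have q: "?q > 0" by (intro add_pos_nonneg) (auto intro: add_nonneg_pos)
  have "w u \<le> \<mu> * (kernel_const t * (2*a - 1)) / ?q" using w[OF u] q by (simp only: pos_le_divide_eq)
  also have "\<dots> = \<mu> * (kernel_const t * (2*a - 1) / ?q)" by simp
  also have "\<dots> \<le> \<mu> * ((pairf a (zbeta u) (t - zgam u) + pairf a (zbeta u) (t + zgam u)) / 2)"
    by (intro mult_left_mono kernel_lower u a \<mu>)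
  finally have "real (m u) * w u \<le> real (m u) * (\<mu> * ((pairf a (zbeta u) (t - zgam u) + pairf a (zbeta u) (t + zgam u)) / 2))"
    by (rule mult_left_mono) simp
  then show "real (m u) * w u \<le> \<mu> * (real (m u) * ((pairf a (zbeta u) (t - zgam u) + pairf a (zbeta u) (t + zgam u)) / 2))"
    by (simp only: mult.left_commute)
qed

subsection \<open>An explicit formula from Taylor polynomials\<close>

text \<open>\<open>u i\<close> is meant to bound the tail of the exponential series from index
  \<open>K + i\<close>, divided by its first term, at the argument \<open>K\<close>. Such ratios
  satisfy a backward recursion, and the claim is that \<open>u\<close> is a supersolution of it. At
  \<open>i = 0\<close> its value is \<open>sqrt (2 K) + 1\<close>.\<close>

lemma poisson_tail_step:
  fixes i K :: nat
  defines "u \<equiv> \<lambda>i. sqrt (real i ^ 2 + 2 * real K) - real i + 1"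
  assumes K: "K > 0"
  shows "1 + real K / real (K + i + 1) * u (i + 1) \<le> u i"
proof -
  define j k where "j = real i" and "k = real K"
  define a where "a = sqrt (j ^ 2 + 2 * k)"
  have j: "j \<ge> 0" "k > 0" using K by (auto simp: j_def k_def)
  have a2: "a ^ 2 = j ^ 2 + 2 * k" using j by (simp add: a_def)
  have a: "a > 0" "j \<le> a" using j by (auto simp: a_def add_nonneg_pos intro: real_le_rsqrt)
  have "sqrt ((j + 1) ^ 2 + 2 * k) \<le> a + (2 * j + 1) / (2 * a)"
  proof (rule real_le_lsqrt)
    have "(a + (2 * j + 1) / (2 * a)) ^ 2 = a ^ 2 + (2 * j + 1) + ((2 * j + 1) / (2 * a)) ^ 2"
      using a by (simp add: power2_eq_square field_simps)
    moreover have "((2 * j + 1) / (2 * a)) ^ 2 \<ge> 0" by simp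
    ultimately show "(j + 1) ^ 2 + 2 * k \<le> (a + (2 * j + 1) / (2 * a)) ^ 2" using a2 by (simp add: power2_sum)
  qed (use j a in auto)
  then have u1: "u (i + 1) \<le> (a - j) + (2 * j + 1) / (2 * a)"
    unfolding u_def by (simp add: j_def k_def add.commute)
  have "k * ((2 * j + 1) / (2 * a)) \<le> (j + 1) * (a - j)"
  proof -
    have "(a - j) * (a + j) = 2 * k" using a2 by (simp add: power2_eq_square algebra_simps)
    then have kk: "k = (a - j) * (a + j) / 2" by simp
    have "k * ((2 * j + 1) / (2 * a)) = (a - j) * ((a + j) * (2 * j + 1) / (4 * a))" unfolding kk by simp
    also have "\<dots> \<le> (a - j) * (j + 1)"
    proof (rule mult_left_mono)
      have "(a + j) * (2 * j + 1) \<le> (2 * a) * (2 * j + 2)" using j a by (intro mult_mono) auto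
      then show "(a + j) * (2 * j + 1) / (4 * a) \<le> j + 1" using a by (simp add: divide_simps algebra_simps)
    qed (use a in simp)
    finally show ?thesis by (simp add: mult.commute)
  qed
  then have "k * ((a - j) + (2 * j + 1) / (2 * a)) \<le> (k + j + 1) * (a - j)" by (simp add: algebra_simps)
  moreover have "k * u (i + 1) \<le> k * ((a - j) + (2 * j + 1) / (2 * a))" using u1 j by (intro mult_left_mono) auto
  ultimately have "k * u (i + 1) \<le> (k + j + 1) * (a - j)" by linarith
  then have "k / (k + j + 1) * u (i + 1) \<le> a - j" using j by (simp add: pos_divide_le_eq mult.commute)
  moreover have "real (K + i + 1) = k + j + 1" by (simp add: k_def j_def)
  ultimately show ?thesis unfolding u_def by (simp add: a_def j_def k_def add_ac)
qed

text \<open>Induction on the number of tail terms with free starting index, fed by the supersolution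
  \<open>u\<close>. The quotient of consecutive terms grows with \<open>y\<close>, so the ratio at
  \<open>y = K\<close> covers all smaller \<open>y\<close>.\<close>

lemma poisson_majorant:
  assumes K: "K > 0" and y: "0 \<le> y" "y \<le> real K"
  shows "exp y \<le> (\<Sum>k<K. y ^ k / fact k) + (sqrt (2 * real K) + 1) * (y ^ K / fact K)"
proof -
  define u where "u = (\<lambda>i::nat. sqrt (real i ^ 2 + 2 * real K) - real i + 1)"
  define t where "t = (\<lambda>i. y ^ (K + i) / fact (K + i))"
  have t0: "t i \<ge> 0" for i using y by (simp add: t_def)
  have u0: "u i \<ge> 0" for i
    using real_le_rsqrt[of "real i" "real i ^ 2 + 2 * real K"] by (simp add: u_def)
  have t1: "t (Suc i) \<le> real K / real (K + i + 1) * t i" for i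
  proof -
    have "t (Suc i) = y / real (K + i + 1) * t i" by (simp add: t_def field_simps)
    also have "\<dots> \<le> real K / real (K + i + 1) * t i"
      by (intro mult_right_mono divide_right_mono y t0) auto
    finally show ?thesis .
  qed
  have main: "(\<Sum>j<N. t (i + j)) \<le> u i * t i" for N i
  proof (induction N arbitrary: i)
    case 0
    show ?case using t0 u0 by simp
  next
    case (Suc N)
    have "(\<Sum>j<Suc N. t (i + j)) = t i + (\<Sum>j<N. t (Suc i + j))" by (subst sum.lessThan_Suc_shift) simp
    also have "\<dots> \<le> t i + u (Suc i) * t (Suc i)" using Suc.IH[of "Suc i"] by simp
    also have "\<dots> \<le> t i + u (Suc i) * (real K / real (K + i + 1) * t i)"
      by (intro add_left_mono mult_left_mono t1 u0)
    also have "\<dots> = (1 + real K / real (K + i + 1) * u (i + 1)) * t i" by (simp add: distrib_right)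
    also have "\<dots> \<le> u i * t i" unfolding u_def by (intro mult_right_mono t0 poisson_tail_step K)
    finally show ?case .
  qed
  have "(\<lambda>n. y ^ n / fact n) sums exp y" using exp_converges[of y] by (simp add: field_simps)
  then have s: "(\<lambda>n. y ^ (n + K) / fact (n + K)) sums (exp y - (\<Sum>k<K. y ^ k / fact k))"
    by (rule sums_split_initial_segment)
  have "exp y - (\<Sum>k<K. y ^ k / fact k) \<le> u 0 * t 0"
  proof (rule LIMSEQ_le_const2[OF s[unfolded sums_def]], intro exI allI impI)
    fix N :: nat
    show "(\<Sum>n<N. y ^ (n + K) / fact (n + K)) \<le> u 0 * t 0" using main[of 0 N] by (simp add: t_def add.commute)
  qed
  then show ?thesis by (simp add: u_def t_def)
qed

section \<open>Taylor polynomials as a linear functional\<close>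

definition tcoef :: "nat \<Rightarrow> real \<Rightarrow> real \<Rightarrow> nat \<Rightarrow> real" where
  "tcoef K B Z k = (if k < K then 1 else B) * ((- Z) ^ k / fact k)"

text \<open>Applied to \<open>n^(-s)\<close> this gives P(N < K) + B P(N = K) for a Poisson variable
  N of mean \<open>Z ln n\<close>. Because it is linear in \<open>G\<close>, the pole, the Gamma
  factor and each zero can be evaluated separately.\<close>

definition taylor_op :: "nat \<Rightarrow> real \<Rightarrow> real \<Rightarrow> (complex \<Rightarrow> complex) \<Rightarrow> complex" where
  "taylor_op K B Z G = (\<Sum>k\<le>K. of_real (tcoef K B Z k) * (deriv ^^ k) G (of_real Z))"

lemma tcoef_sum: "(\<Sum>k\<le>K. tcoef K B Z k * g k) = (\<Sum>k<K. (- Z) ^ k / fact k * g k) + B * ((- Z) ^ K / fact K * g K)"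
  by (simp add: tcoef_def flip: lessThan_Suc_atMost)

lemma taylor_op_add:
  assumes "f holomorphic_on S" "g holomorphic_on S" "open S" "of_real Z \<in> S"
  shows "taylor_op K B Z (\<lambda>s. f s + g s) = taylor_op K B Z f + taylor_op K B Z g"
  unfolding taylor_op_def by (simp only: higher_deriv_add[OF assms] distrib_left sum.distrib)

lemma taylor_op_diff:
  assumes "f holomorphic_on S" "g holomorphic_on S" "open S" "of_real Z \<in> S"
  shows "taylor_op K B Z (\<lambda>s. f s - g s) = taylor_op K B Z f - taylor_op K B Z g"
  unfolding taylor_op_def by (simp only: higher_deriv_diff[OF assms] right_diff_distrib sum_subtractf)

lemma taylor_op_cmult:
  assumes "f holomorphic_on S" "open S" "of_real Z \<in> S"
  shows "taylor_op K B Z (\<lambda>s. c * f s) = c * taylor_op K B Z f"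
  unfolding taylor_op_def by (simp only: higher_deriv_cmult[OF assms(1,3,2)] sum_distrib_left mult.left_commute)

lemma taylor_op_cong:
  assumes "f holomorphic_on S" "g holomorphic_on S" "open S" "of_real Z \<in> S" "\<And>s. s \<in> S \<Longrightarrow> f s = g s"
  shows "taylor_op K B Z f = taylor_op K B Z g"
  unfolding taylor_op_def by (simp only: higher_deriv_transform_within_open[OF assms])

lemma taylor_op_const:
  assumes "K > 0"
  shows "taylor_op K B Z (\<lambda>s. c) = c"
proof -
  have "(\<Sum>k\<le>K. of_real (tcoef K B Z k) * (deriv ^^ k) (\<lambda>s. c) (of_real Z)) = (\<Sum>k\<in>{0}. of_real (tcoef K B Z k) * (deriv ^^ k) (\<lambda>s. c) (of_real Z))"
    by (rule sum.mono_neutral_right) (auto simp: higher_deriv_const)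
  then show ?thesis using assms by (simp add: taylor_op_def tcoef_def)
qed

lemma taylor_op_sum:
  assumes "\<And>i. i \<in> I \<Longrightarrow> f i holomorphic_on S" "open S" "of_real Z \<in> S" "K > 0"
  shows "taylor_op K B Z (\<lambda>s. \<Sum>i\<in>I. f i s) = (\<Sum>i\<in>I. taylor_op K B Z (f i))"
  using assms(1)
proof (induction I rule: infinite_finite_induct)
  case (insert i I)
  then have "taylor_op K B Z (\<lambda>s. f i s + (\<Sum>i\<in>I. f i s)) = taylor_op K B Z (f i) + taylor_op K B Z (\<lambda>s. \<Sum>i\<in>I. f i s)"
    using assms by (intro taylor_op_add holomorphic_intros) auto
  with insert show ?case by simp
qed (use taylor_op_const[OF assms(4)] in auto)

lemma higher_deriv_inverse_shift:
  assumes "s \<noteq> \<rho>"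
  shows "(deriv ^^ k) (\<lambda>s. 1 / (s - \<rho>)) s = (-1) ^ k * fact k / (s - \<rho>) ^ Suc k"
  using assms
proof (induction k arbitrary: s)
  case (Suc k)
  have "eventually (\<lambda>w. w \<in> - {\<rho>}) (nhds s)" using Suc.prems by (intro eventually_nhds_in_open) auto
  then have "eventually (\<lambda>w. (deriv ^^ k) (\<lambda>s. 1 / (s - \<rho>)) w = (-1) ^ k * fact k / (w - \<rho>) ^ Suc k) (nhds s)"
    by (rule eventually_mono) (use Suc.IH in auto)
  then have "deriv ((deriv ^^ k) (\<lambda>s. 1 / (s - \<rho>))) s = deriv (\<lambda>w. (-1) ^ k * fact k / (w - \<rho>) ^ Suc k) s"
    by (rule deriv_cong_ev) simp
  also have "\<dots> = (-1) ^ Suc k * fact (Suc k) / (s - \<rho>) ^ Suc (Suc k)"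
  proof (rule DERIV_imp_deriv)
    have ne: "s - \<rho> \<noteq> 0" using Suc.prems by simp
    have "((\<lambda>w. (w - \<rho>) ^ Suc k) has_field_derivative (of_nat (Suc k) * (s - \<rho>) ^ k)) (at s)"
      by (auto intro!: derivative_eq_intros simp del: power_Suc)
    from DERIV_divide[OF DERIV_const this, of "(-1) ^ k * fact k"]
    have "((\<lambda>w. (-1) ^ k * fact k / (w - \<rho>) ^ Suc k) has_field_derivative
       (0 * (s - \<rho>) ^ Suc k - (-1) ^ k * fact k * (of_nat (Suc k) * (s - \<rho>) ^ k)) / ((s - \<rho>) ^ Suc k * (s - \<rho>) ^ Suc k)) (at s)"
      using ne by simp
    moreover have "(0 * (s - \<rho>) ^ Suc k - (-1) ^ k * fact k * (of_nat (Suc k) * (s - \<rho>) ^ k)) / ((s - \<rho>) ^ Suc k * (s - \<rho>) ^ Suc k)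
       = (-1) ^ Suc k * fact (Suc k) / (s - \<rho>) ^ Suc (Suc k)"
      using ne by (simp add: divide_simps)
    ultimately show "((\<lambda>w. (-1) ^ k * fact k / (w - \<rho>) ^ Suc k) has_field_derivative (-1) ^ Suc k * fact (Suc k) / (s - \<rho>) ^ Suc (Suc k)) (at s)"
      by simp
  qed
  finally show ?case by simp
qed simp

text \<open>The derivatives of \<open>1/(s - \<rho>)\<close> make the Taylor sum geometric with
  ratio \<open>q\<close>, and \<open>(q - 1) (Z - \<rho>) = \<rho>\<close> turns it into
  \<open>(q^K - 1) / \<rho>\<close>. The modified last coefficient \<open>B\<close> gives the
  remaining term.\<close>

lemma taylor_op_inverse_shift:
  fixes \<rho> :: complex
  assumes "of_real Z \<noteq> \<rho>" "\<rho> \<noteq> 0" "Z \<noteq> 0"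
  defines "q \<equiv> of_real Z / (of_real Z - \<rho>)"
  shows "taylor_op K B Z (\<lambda>s. 1 / (s - \<rho>)) = (q ^ K - 1) / \<rho> + of_real (B / Z) * q ^ Suc K"
proof -
  have ne: "of_real Z - \<rho> \<noteq> 0" using assms by simp
  have tm: "of_real ((- Z) ^ k / fact k) * (deriv ^^ k) (\<lambda>s. 1 / (s - \<rho>)) (of_real Z) = q ^ k / (of_real Z - \<rho>)" for k
  proof -
    have "of_real ((- Z) ^ k / fact k) * ((-1) ^ k * fact k / (of_real Z - \<rho>) ^ Suc k)
      = ((- of_real Z) * (-1)) ^ k / (of_real Z - \<rho>) ^ Suc k" 
      unfolding power_mult_distrib by simp
    also have "\<dots> = q ^ k / (of_real Z - \<rho>)" by (simp add: q_def power_divide)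
    finally show ?thesis using assms(1) by (simp only: higher_deriv_inverse_shift not_False_eq_True)
  qed
  have q1: "q - 1 = \<rho> / (of_real Z - \<rho>)" using ne by (simp add: q_def field_simps)
  have qne: "q \<noteq> 1" using q1 assms(2) ne by auto
  have "taylor_op K B Z (\<lambda>s. 1 / (s - \<rho>)) = (\<Sum>k<K. q ^ k / (of_real Z - \<rho>)) + of_real B * (q ^ K / (of_real Z - \<rho>))"
  proof -
    have "taylor_op K B Z (\<lambda>s. 1 / (s - \<rho>)) = (\<Sum>k\<le>K. of_real (if k < K then 1 else B) * (of_real ((- Z) ^ k / fact k) * (deriv ^^ k) (\<lambda>s. 1 / (s - \<rho>)) (of_real Z)))"
      unfolding taylor_op_def tcoef_def by (simp only: of_real_mult mult.assoc)
    also have "\<dots> = (\<Sum>k\<le>K. of_real (if k < K then 1 else B) * (q ^ k / (of_real Z - \<rho>)))" by (simp only: tm)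
    also have "\<dots> = (\<Sum>k<K. q ^ k / (of_real Z - \<rho>)) + of_real B * (q ^ K / (of_real Z - \<rho>))"
      by (simp flip: lessThan_Suc_atMost)
    finally show ?thesis .
  qed
  also have "(\<Sum>k<K. q ^ k / (of_real Z - \<rho>)) = (q ^ K - 1) / (q - 1) / (of_real Z - \<rho>)"
    unfolding sum_divide_distrib[symmetric] by (subst geometric_sum[OF qne]) simp
  also have "\<dots> = (q ^ K - 1) / \<rho>" unfolding q1 using ne by simp
  also have "of_real B * (q ^ K / (of_real Z - \<rho>)) = of_real (B / Z) * q ^ Suc K"
    using assms(3) by (simp add: q_def)
  finally show ?thesis .
qed

definition psi :: "real \<Rightarrow> real" where "psi x = (\<Sum>n\<le>nat \<lfloor>x\<rfloor>. mangoldt n)"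

text \<open>The relation \<open>Z = K / L\<close> means \<open>Z ln n \<le> K\<close> for
  \<open>n \<le> exp L\<close>; there the Poisson majorant raises the coefficient to at least
  \<Lambda>(n). All other coefficients are nonnegative.\<close>

lemma psi_le_taylor_op:
  assumes K: "K > 0" and L: "L > 0" "Z = real K / L" "Z > 1"
  shows "psi (exp L) \<le> Re (taylor_op K (sqrt (2 * real K) + 1) Z neg_log_deriv)"
proof -
  define B where "B = sqrt (2 * real K) + 1"
  define c where "c = (\<lambda>n. mangoldt n * exp (- Z * ln (real n)) *
       ((\<Sum>k<K. (Z * ln (real n)) ^ k / fact k) + B * ((Z * ln (real n)) ^ K / fact K)))"
  have Z1: "Re (of_real Z) > 1" using L by simp
  have s: "(\<lambda>n. \<Sum>k\<le>K. of_real (tcoef K B Z k) * (of_real (mangoldt n * (- ln (real n)) ^ k) * exp (- of_real Z * of_real (ln (real n))))) sums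
     taylor_op K B Z neg_log_deriv"
    unfolding taylor_op_def neg_log_deriv_def
    by (intro sums_sum sums_mult higher_deriv_dseries Z1 coeff_bounds coeff_zero)
  have cn: "(\<Sum>k\<le>K. of_real (tcoef K B Z k) * (of_real (mangoldt n * (- ln (real n)) ^ k) * exp (- of_real Z * of_real (ln (real n))))) = complex_of_real (c n)" for n
  proof -
    have e: "exp (- of_real Z * of_real (ln (real n))) = complex_of_real (exp (- Z * ln (real n)))"
      by (simp add: exp_of_real[symmetric])
    have "(\<Sum>k\<le>K. of_real (tcoef K B Z k) * (of_real (mangoldt n * (- ln (real n)) ^ k) * exp (- of_real Z * of_real (ln (real n))))) =
       complex_of_real (\<Sum>k\<le>K. tcoef K B Z k * (mangoldt n * (- ln (real n)) ^ k * exp (- Z * ln (real n))))"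
      unfolding e by (simp only: of_real_mult of_real_sum)
    also have "(\<Sum>k\<le>K. tcoef K B Z k * (mangoldt n * (- ln (real n)) ^ k * exp (- Z * ln (real n)))) =
       mangoldt n * exp (- Z * ln (real n)) * (\<Sum>k\<le>K. tcoef K B Z k * (- ln (real n)) ^ k)"
      by (simp only: sum_distrib_left mult.assoc mult.commute mult.left_commute)
    also have "(\<Sum>k\<le>K. tcoef K B Z k * (- ln (real n)) ^ k) = (\<Sum>k<K. (Z * ln (real n)) ^ k / fact k) + B * ((Z * ln (real n)) ^ K / fact K)"
    proof -
      have p: "(- Z) ^ k / fact k * (- ln (real n)) ^ k = (Z * ln (real n)) ^ k / fact k" for k
      proof -
        have "(- Z) ^ k * (- ln (real n)) ^ k = (Z * ln (real n)) ^ k" unfolding power_mult_distrib[symmetric] by simp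
        then show ?thesis by (simp add: divide_simps)
      qed
      show ?thesis unfolding tcoef_sum p ..
    qed
    finally show ?thesis by (simp only: c_def)
  qed
  have sc: "c sums Re (taylor_op K B Z neg_log_deriv)"
    using sums_Re[OF s] unfolding cn by simp
  have l0: "0 \<le> Z * ln (real n)" for n :: nat using L by (cases "n = 0") auto
  have c0: "c n \<ge> 0" for n
    unfolding c_def B_def using l0[of n] by (intro mult_nonneg_nonneg add_nonneg_nonneg mangoldt_nonneg sum_nonneg) auto
  have c1: "mangoldt n \<le> c n" if "n \<le> nat \<lfloor>exp L\<rfloor>" for n
  proof (cases "n = 0")
    case False
    have "real n \<le> exp L" using that False by linarith
    then have "ln (real n) \<le> L" using False by (metis ln_exp ln_le_cancel_iff exp_gt_zero of_nat_0_less_iff not_gr0)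
    then have "Z * ln (real n) \<le> Z * L" using L by (intro mult_left_mono) auto
    then have "Z * ln (real n) \<le> real K" using L by simp
    from poisson_majorant[OF K l0 this]
    have "exp (- Z * ln (real n)) * exp (Z * ln (real n)) \<le> exp (- Z * ln (real n)) * ((\<Sum>k<K. (Z * ln (real n)) ^ k / fact k) + B * ((Z * ln (real n)) ^ K / fact K))"
      unfolding B_def by (intro mult_left_mono) auto
    moreover have "exp (- Z * ln (real n)) * exp (Z * ln (real n)) = 1" by (simp add: exp_minus)
    ultimately have *: "1 \<le> exp (- Z * ln (real n)) * ((\<Sum>k<K. (Z * ln (real n)) ^ k / fact k) + B * ((Z * ln (real n)) ^ K / fact K))"
      by linarith
    show ?thesis unfolding c_def using mult_left_mono[OF * mangoldt_nonneg[of n]] by (simp only: mult_1_right mult.assoc)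
  qed (use c0[of 0] in simp)
  have "psi (exp L) \<le> (\<Sum>n\<le>nat \<lfloor>exp L\<rfloor>. c n)" unfolding psi_def by (intro sum_mono c1) auto
  also have "\<dots> \<le> Re (taylor_op K B Z neg_log_deriv)"
    using sum_le_suminf[OF sums_summable[OF sc], of "{..nat \<lfloor>exp L\<rfloor>}"] c0 sums_unique[OF sc] by simp
  finally show ?thesis by (simp only: B_def)
qed

text \<open>Cauchy's estimates on a circle about \<open>Z\<close>. The factor may be enormous, but
  it depends only on \<open>K\<close>, \<open>B\<close>, \<open>Z\<close> and \<open>r\<close>,
  whereas \<open>C\<close> will be proportional to an arbitrarily small error.\<close>

lemma taylor_op_error:
  assumes f: "f holomorphic_on S" "open S" "cball (of_real Z) r \<subseteq> S" "r > 0"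
    and C: "\<And>s. s \<in> S \<Longrightarrow> norm (f s) \<le> C"
  shows "norm (taylor_op K B Z f) \<le> (\<Sum>k\<le>K. \<bar>tcoef K B Z k\<bar> * (fact k / r ^ k)) * C"
  unfolding taylor_op_def sum_distrib_right
proof (rule order_trans[OF norm_sum sum_mono])
  fix k
  have "norm ((deriv ^^ k) f (of_real Z)) \<le> fact k * C / r ^ k"
  proof (rule Cauchy_inequality[OF _ _ f(4)])
    show "f holomorphic_on ball (of_real Z) r" by (rule holomorphic_on_subset[OF f(1)]) (use f(3) ball_subset_cball in blast)
    show "continuous_on (cball (of_real Z) r) f" using f holomorphic_on_imp_continuous_on continuous_on_subset by blast
    fix x :: complex assume "norm (of_real Z - x) = r"
    then have "x \<in> cball (of_real Z) r" by (simp add: dist_norm)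
    then show "norm (f x) \<le> C" using C f(3) by blast
  qed
  then have "\<bar>tcoef K B Z k\<bar> * norm ((deriv ^^ k) f (of_real Z)) \<le> \<bar>tcoef K B Z k\<bar> * (fact k * C / r ^ k)"
    by (rule mult_left_mono) simp
  then show "norm (of_real (tcoef K B Z k) * (deriv ^^ k) f (of_real Z)) \<le> \<bar>tcoef K B Z k\<bar> * (fact k / r ^ k) * C"
    by (simp add: norm_mult)
qed

lemma Digamma_half_holomorphic: "(\<lambda>s. Digamma (1/2 * s + 1)) holomorphic_on {s. Re s > 1}"
proof -
  have "(Polygamma 0 \<circ> (\<lambda>s. 1/2 * s + 1)) holomorphic_on {s. Re s > 1}"
  proof (rule holomorphic_on_compose)
    show "Polygamma 0 holomorphic_on (\<lambda>s. 1/2 * s + 1) ` {s. 1 < Re s}"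
      by (rule holomorphic_on_Polygamma) (auto elim!: nonpos_Ints_cases simp: complex_eq_iff)
  qed (intro holomorphic_intros)
  then show ?thesis by (simp add: o_def)
qed

lemma arch_eq: "arch s = 1 / (s - 1) + ((1/2) * Digamma (1/2 * s + 1) - of_real (ln pi / 2))"
  by (simp add: arch_def)

lemma arch_holomorphic: "arch holomorphic_on {s. Re s > 1}"
  unfolding arch_eq[abs_def]
  by (intro holomorphic_intros Digamma_half_holomorphic) auto

text \<open>The polygamma functions alternate in sign like the powers of \<open>- Z\<close>, in such
  a way that every Taylor term of positive order is nonpositive. Of the Gamma factor only its value
  at \<open>Z\<close> remains.\<close>

lemma taylor_op_arch:
  assumes "K > 0" "B \<ge> 0" "Z > 1"
  defines "q \<equiv> Z / (Z - 1)"
  shows "Re (taylor_op K B Z arch) \<le> (q ^ K - 1) + B / Z * q ^ Suc K + ln (Z/2 + 1) / 2 - ln pi / 2"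
proof -
  let ?S = "{s. Re s > 1}"
  let ?D = "\<lambda>s::complex. Digamma (1/2 * s + 1)"
  have S: "open ?S" "complex_of_real Z \<in> ?S" using assms by (auto intro: open_halfspace_Re_gt)
  have h1: "(\<lambda>s. 1 / (s - 1)) holomorphic_on ?S" by (intro holomorphic_intros) auto
  have h2: "(\<lambda>s. complex_of_real (ln pi / 2)) holomorphic_on ?S" by (intro holomorphic_intros)
  have h3: "(\<lambda>s. (1/2) * ?D s) holomorphic_on ?S" by (intro holomorphic_intros Digamma_half_holomorphic)
  have h4: "(\<lambda>s. (1/2) * ?D s - complex_of_real (ln pi / 2)) holomorphic_on ?S" by (intro holomorphic_on_diff h2 h3)
  have t1: "taylor_op K B Z (\<lambda>s. 1 / (s - 1)) = of_real (q ^ K - 1 + B / Z * q ^ Suc K)"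
    using taylor_op_inverse_shift[of Z 1 K B] assms by (simp add: q_def)
  have z: "Z / 2 + 1 > 0" using assms by simp
  have d: "(deriv ^^ k) ?D (of_real Z) = of_real ((1/2) ^ k * Polygamma k (Z/2 + 1))" for k
  proof -
    have "(deriv ^^ k) ?D (of_real Z) = (1/2) ^ k * (deriv ^^ k) Digamma (1/2 * complex_of_real Z + 1)"
    proof (rule higher_deriv_compose_linear'[where S = ?S])
      show "Digamma holomorphic_on {s :: complex. Re s > 0}" by (rule holomorphic_on_Polygamma) (auto elim!: nonpos_Ints_cases)
      show "open {s :: complex. Re s > 0}" by (rule open_halfspace_Re_gt)
    qed (use S in auto)
    also have "1/2 * complex_of_real Z + 1 = of_real (Z/2 + 1)" by simp
    also have "(deriv ^^ k) Digamma (complex_of_real (Z/2 + 1)) = of_real (Polygamma k (Z/2 + 1))"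
    proof -
      have "(deriv ^^ k) Digamma (complex_of_real (Z/2 + 1)) = Polygamma (0 + k) (complex_of_real (Z/2 + 1))"
        by (rule higher_deriv_Polygamma) (use z in \<open>auto elim!: nonpos_Ints_cases simp: complex_eq_iff\<close>)
      then show ?thesis using z by (simp only: add_0 Polygamma_of_real)
    qed
    finally show ?thesis by simp
  qed
  have "Re (taylor_op K B Z ?D) = (\<Sum>k\<le>K. tcoef K B Z k * ((1/2) ^ k * Polygamma k (Z/2 + 1)))"
    unfolding taylor_op_def d by (simp only: of_real_mult[symmetric] of_real_sum[symmetric] Re_complex_of_real)
  also have "\<dots> \<le> (\<Sum>k\<le>K. if k = 0 then Digamma (Z/2 + 1) else 0)"
  proof (rule sum_mono)
    fix k assume "k \<in> {..K}"
    show "tcoef K B Z k * ((1/2) ^ k * Polygamma k (Z/2 + 1)) \<le> (if k = 0 then Digamma (Z/2 + 1) else 0)"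
    proof (cases "k = 0")
      case True
      then show ?thesis using assms by (simp add: tcoef_def)
    next
      case False
      have "(-1) ^ k * Polygamma k (Z/2 + 1) \<le> 0"
      proof (cases "even k")
        case True
        then show ?thesis using Polygamma_real_even_neg[OF z, of k] False by simp
      next
        case odd: False
        have "Z/2 + 1 \<notin> \<int>\<^sub>\<le>\<^sub>0" using z by (auto elim!: nonpos_Ints_cases)
        then show ?thesis using Polygamma_real_odd_pos[of "Z/2 + 1" k] odd by simp
      qed
      moreover have "(if k < K then 1 else B) * (Z ^ k / fact k) * (1/2) ^ k \<ge> 0"
        using assms by (intro mult_nonneg_nonneg) auto
      ultimately have "(if k < K then 1 else B) * (Z ^ k / fact k) * (1/2) ^ k * ((-1) ^ k * Polygamma k (Z/2 + 1)) \<le> 0"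
        by (rule mult_nonneg_nonpos[rotated])
      moreover have "(- Z) ^ k = (-1) ^ k * Z ^ k" by (rule power_minus)
      ultimately show ?thesis using False by (simp only: tcoef_def if_False) (simp add: mult_ac)
    qed
  qed
  also have "\<dots> = Digamma (Z/2 + 1)" by simp
  also have "\<dots> \<le> ln (Z/2 + 1)"
  proof -
    have "1 / (2 * (Z/2 + 1)) \<ge> 0" using z by simp
    then show ?thesis using Digamma_real_le[OF z] by linarith
  qed
  finally have D: "Re (taylor_op K B Z ?D) \<le> ln (Z/2 + 1)" .
  have "taylor_op K B Z arch = taylor_op K B Z (\<lambda>s. 1 / (s - 1)) + ((1/2) * taylor_op K B Z ?D - of_real (ln pi / 2))"
    unfolding arch_eq[abs_def] taylor_op_add[OF h1 h4 S] taylor_op_diff[OF h3 h2 S]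
      taylor_op_cmult[OF Digamma_half_holomorphic S] taylor_op_const[OF assms(1)] ..
  then have "Re (taylor_op K B Z arch) = (q ^ K - 1) + B / Z * q ^ Suc K + Re (taylor_op K B Z ?D) / 2 - ln pi / 2"
    unfolding t1 by simp
  then show ?thesis using D by linarith
qed

lemma norm_ge_abs_Im_inverse: "Im z \<noteq> 0 \<Longrightarrow> 1 / norm z \<le> 1 / \<bar>Im z\<bar>"
  using abs_Im_le_cmod[of z] by (intro divide_left_mono mult_pos_pos) auto

text \<open>The contribution has two parts. The constant \<open>1/\<rho>\<close> does not decay with
  \<open>K\<close>, but its real part is at most \<open>1/\<gamma>^2\<close> and can be summed
  separately; the terms with \<open>q^K\<close> carry the decay.\<close>

lemma neg_Re_taylor_op_pole:
  fixes \<rho> :: complex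
  assumes "0 \<le> Re \<rho>" "Re \<rho> \<le> 1" "Im \<rho> \<noteq> 0" "B \<ge> 0" "Z > 1"
  shows "- Re (taylor_op K B Z (\<lambda>s. 1 / (s - \<rho>))) \<le>
    1 / (Im \<rho>)^2 + norm (of_real Z / (of_real Z - \<rho>)) ^ K * (1 / \<bar>Im \<rho>\<bar> + B / Z * (Z / (Z - 1)))"
proof -
  define q where "q = of_real Z / (of_real Z - \<rho>)"
  have ne: "\<rho> \<noteq> 0" "of_real Z \<noteq> \<rho>" using assms by (auto simp: complex_eq_iff)
  have "Re (of_real Z - \<rho>) \<le> norm (of_real Z - \<rho>)" by (rule complex_Re_le_cmod)
  then have n: "Z - 1 \<le> norm (of_real Z - \<rho>)" using assms by simp
  have q: "norm q \<le> Z / (Z - 1)"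
    unfolding q_def norm_divide using n assms by (auto intro!: divide_left_mono mult_pos_pos)
  have "Re (1 / \<rho>) \<le> 1 / (Im \<rho>)^2"
  proof -
    have "Re (1 / \<rho>) = Re \<rho> / ((Re \<rho>)^2 + (Im \<rho>)^2)" using Re_inverse_Complex[of "Re \<rho>" "Im \<rho>"] by simp
    also have "\<dots> \<le> 1 / (Im \<rho>)^2" using assms by (intro frac_le) auto
    finally show ?thesis .
  qed
  moreover have "- Re (q ^ K / \<rho>) \<le> norm q ^ K * (1 / \<bar>Im \<rho>\<bar>)"
  proof -
    have "- Re (q ^ K / \<rho>) \<le> norm (q ^ K / \<rho>)" using abs_Re_le_cmod[of "q ^ K / \<rho>"] by linarith
    also have "\<dots> = norm q ^ K * (1 / norm \<rho>)" by (simp add: norm_divide norm_power)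
    also have "\<dots> \<le> norm q ^ K * (1 / \<bar>Im \<rho>\<bar>)" by (intro mult_left_mono norm_ge_abs_Im_inverse assms) auto
    finally show ?thesis .
  qed
  moreover have "- Re (of_real (B / Z) * q ^ Suc K) \<le> norm q ^ K * (B / Z * (Z / (Z - 1)))"
  proof -
    have "- Re (of_real (B / Z) * q ^ Suc K) \<le> norm (of_real (B / Z) * q ^ Suc K)" using abs_Re_le_cmod[of "of_real (B / Z) * q ^ Suc K"] by linarith
    also have "\<dots> = B / Z * (norm q * norm q ^ K)" using assms by (simp add: norm_mult norm_power norm_divide)
    also have "\<dots> \<le> B / Z * (Z / (Z - 1) * norm q ^ K)" using assms q by (intro mult_left_mono mult_right_mono) auto
    finally show ?thesis by (simp only: mult_ac)
  qed
  moreover have "taylor_op K B Z (\<lambda>s. 1 / (s - \<rho>)) = q ^ K / \<rho> - 1 / \<rho> + of_real (B / Z) * q ^ Suc K"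
    unfolding q_def using assms ne by (subst taylor_op_inverse_shift) (auto simp: diff_divide_distrib)
  ultimately show ?thesis unfolding q_def[symmetric] distrib_left by simp
qed

text \<open>The decaying part for \<rho> and 1 - \<rho> together. In the last factor,
  \<open>1/\<bar>\<gamma>\<bar>\<close> comes from the division by \<rho> and the other summand from
  the extra Taylor term.\<close>

definition zero_weight :: "nat \<Rightarrow> real \<Rightarrow> complex \<Rightarrow> real" where
  "zero_weight K Z u = (norm (of_real Z / (of_real Z - zroot u)) ^ K + norm (of_real Z / (of_real Z - (1 - zroot u))) ^ K) *
     (1 / \<bar>zgam u\<bar> + (sqrt (2 * real K) + 1) / Z * (Z / (Z - 1)))"

lemma neg_Re_taylor_op_zero:
  assumes u: "xi_sq u = 0" and Z: "Z > 1" and K: "K > 0"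
  shows "- Re (taylor_op K (sqrt (2 * real K) + 1) Z (\<lambda>s. (2 * s - 1) / (s * (s - 1) - u))) \<le> 2 / (zgam u)^2 + zero_weight K Z u"
proof -
  let ?S = "{s. Re s > 1}" and ?B = "sqrt (2 * real K) + 1" and ?\<rho> = "zroot u"
  have S: "open ?S" "complex_of_real Z \<in> ?S" using Z by (auto intro: open_halfspace_Re_gt)
  have b: "1/2 \<le> Re ?\<rho>" "Re ?\<rho> \<le> 1" using zbeta_ge[of u] zbeta_le[OF u] by (auto simp: zbeta_def)
  have g: "Im ?\<rho> \<noteq> 0" using zgam_ge[OF u] by (auto simp: zgam_def)
  have h: "(\<lambda>s. 1 / (s - ?\<rho>)) holomorphic_on ?S" "(\<lambda>s. 1 / (s - (1 - ?\<rho>))) holomorphic_on ?S"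
    using b by (auto intro!: holomorphic_intros)
  have e: "(2 * s - 1) / (s * (s - 1) - u) = 1 / (s - ?\<rho>) + 1 / (s - (1 - ?\<rho>))" if "s \<in> ?S" for s
  proof -
    have "s \<noteq> ?\<rho>" "s \<noteq> 1 - ?\<rho>" using b that by (auto simp: complex_eq_iff)
    from zero_term_split[OF this] show ?thesis by (simp add: algebra_simps)
  qed
  have "taylor_op K ?B Z (\<lambda>s. (2 * s - 1) / (s * (s - 1) - u)) = taylor_op K ?B Z (\<lambda>s. 1 / (s - ?\<rho>) + 1 / (s - (1 - ?\<rho>)))"
  proof (rule taylor_op_cong[OF _ _ S e])
    show h2: "(\<lambda>s. 1 / (s - ?\<rho>) + 1 / (s - (1 - ?\<rho>))) holomorphic_on ?S" by (intro holomorphic_on_add h)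
    show "(\<lambda>s. (2 * s - 1) / (s * (s - 1) - u)) holomorphic_on ?S"
      using h2 by (rule holomorphic_transform) (simp only: e)
  qed
  also have "\<dots> = taylor_op K ?B Z (\<lambda>s. 1 / (s - ?\<rho>)) + taylor_op K ?B Z (\<lambda>s. 1 / (s - (1 - ?\<rho>)))"
    by (rule taylor_op_add[OF h S])
  finally have eq: "taylor_op K ?B Z (\<lambda>s. (2 * s - 1) / (s * (s - 1) - u)) = \<dots>" .
  have B: "?B \<ge> 0" by simp
  have i: "Im (1 - ?\<rho>) = - Im ?\<rho>" "Re (1 - ?\<rho>) = 1 - Re ?\<rho>" by simp_all
  have 1: "- Re (taylor_op K ?B Z (\<lambda>s. 1 / (s - ?\<rho>))) \<le> 1 / (zgam u)^2 + norm (of_real Z / (of_real Z - ?\<rho>)) ^ K * (1 / \<bar>zgam u\<bar> + ?B / Z * (Z / (Z - 1)))"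
    unfolding zgam_def using b by (intro neg_Re_taylor_op_pole g B Z) auto
  have 2: "- Re (taylor_op K ?B Z (\<lambda>s. 1 / (s - (1 - ?\<rho>)))) \<le> 1 / (zgam u)^2 + norm (of_real Z / (of_real Z - (1 - ?\<rho>))) ^ K * (1 / \<bar>zgam u\<bar> + ?B / Z * (Z / (Z - 1)))"
    using neg_Re_taylor_op_pole[of "1 - ?\<rho>" ?B Z K] b g B Z unfolding i zgam_def by simp
  show ?thesis unfolding eq zero_weight_def distrib_right using 1 2 by simp
qed

text \<open>The constants cancel: the \<open>- 1\<close> of the pole and \<open>- ln pi / 2\<close>
  absorb the sum of \<open>2/\<gamma>^2\<close>, which is at most the zero sum at
  \<open>s = 4\<close> and so at most 1/2. The decaying weights are compared with the kernel at
  \<open>a + i t\<close>, where the sum over zeros is at most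
  \<open>archr a t + Fr a\<close>.\<close>

theorem psi_le_zeros:
  assumes K: "K > 0" and L: "L > 0" "Z = real K / L" "Z > 1"
    and a: "a > 1" "t \<ge> 0" and \<mu>: "\<mu> \<ge> 0"
    and w: "\<And>u. xi_sq u = 0 \<Longrightarrow> zero_weight K Z u * (((2*a - 1)^2 + 3)/4 + (\<bar>zgam u\<bar> - t)^2) \<le> \<mu> * (kernel_const t * (2*a - 1))"
  defines "B \<equiv> sqrt (2 * real K) + 1" and "q \<equiv> Z / (Z - 1)"
  shows "psi (exp L) \<le> q ^ K + B / Z * q ^ Suc K + ln (Z/2 + 1) / 2 + \<mu> * (archr a t + Fr a)"
proof -
  define S where "S = ball (complex_of_real Z) (Z - 1)"
  define A where "A = (\<Sum>k\<le>K. \<bar>tcoef K B Z k\<bar> * (fact k / ((Z - 1) / 2) ^ k))"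
  define s1 where "s1 = Complex a t"
  define s0 where "s0 = Complex 4 0"
  \<comment> \<open>\<open>S\<close> is the disc about \<open>Z\<close> that touches the line
    \<open>Re s = 1\<close>. \<open>V\<close> is chosen so that \<open>s (s-1)\<close> stays below
    it in modulus on \<open>S\<close> and at the comparison points \<open>a + i t\<close> and
    4.\<close>
  define V where "V = 2 * Z * (2 * Z + 1) + norm (s1 * (s1 - 1)) + norm (s0 * (s0 - 1)) + 1"
  define C where "C = A * (4 * Z + 1) + \<mu> * norm (2 * s1 - 1) + norm (2 * s0 - 1)"
  have V: "V > 0" "2 * Z * (2 * Z + 1) < V" "norm (s1 * (s1 - 1)) < V" "norm (s0 * (s0 - 1)) < V"
    using L by (auto simp: V_def add_nonneg_pos add_pos_nonneg)
  have S: "open S" "complex_of_real Z \<in> S" using L by (auto simp: S_def)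
  have A0: "A \<ge> 0" unfolding A_def using L by (intro sum_nonneg) auto
  have SR: "S \<subseteq> {s. Re s > 1}"
  proof
    fix s assume "s \<in> S"
    then have "norm (of_real Z - s) < Z - 1" by (simp add: S_def dist_norm)
    moreover have "Z - Re s \<le> norm (of_real Z - s)" using complex_Re_le_cmod[of "of_real Z - s"] by simp
    ultimately show "s \<in> {s. Re s > 1}" by simp
  qed
  have Sn: "norm s < 2 * Z" if "s \<in> S" for s
  proof -
    have "norm (of_real Z - s) < Z - 1" using that by (simp add: S_def dist_norm)
    moreover have "norm s \<le> norm (complex_of_real Z) + norm (of_real Z - s)" using norm_triangle_sub[of s "of_real Z"] by (simp add: norm_minus_commute)
    moreover have "norm (complex_of_real Z) = Z" using L(3) by simp
    ultimately show ?thesis by linarith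
  qed
  show ?thesis
  proof (rule le_if_le_add_eps)
    show "C \<ge> 0" unfolding C_def using A0 L \<mu> by (intro add_nonneg_nonneg mult_nonneg_nonneg) auto
    fix \<epsilon> :: real assume \<epsilon>: "\<epsilon> > 0"
    show "psi (exp L) \<le> q ^ K + B / Z * q ^ Suc K + ln (Z/2 + 1) / 2 + \<mu> * (archr a t + Fr a) + C * \<epsilon>"
    proof (rule zero_family_exists[OF V(1) \<epsilon>])
    fix F m e
    assume F1: "zero_family V F m" and F2: "\<And>v. v \<in> ball 0 V \<Longrightarrow> norm (e v) \<le> \<epsilon>"
      and F3: "\<And>s. Re s > 1 \<Longrightarrow> norm (s * (s - 1)) < V \<Longrightarrow>
       arch s - neg_log_deriv s = (\<Sum>u\<in>F. of_nat (m u) * ((2 * s - 1) / (s * (s - 1) - u))) + (2 * s - 1) * e (s * (s - 1))"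
    note F = F1 F2 F3
    have Fz: "xi_sq u = 0" if "u \<in> F" for u using F(1) that by (simp add: zero_family_def)
    define G where "G = (\<lambda>u s :: complex. (2 * s - 1) / (s * (s - 1) - u))"
    have app: "\<bar>archr a r - Re (neg_log_deriv (Complex a r)) - zsum F m a r\<bar> \<le> norm (2 * Complex a r - 1) * \<epsilon>"
      if "a > 1" "norm (Complex a r * (Complex a r - 1)) < V" for a r
      unfolding archr_def by (rule zsum_approx[OF F refl that])
    have Gh: "G u holomorphic_on S" if "u \<in> F" for u
    proof -
      have "s * (s - 1) - u \<noteq> 0" if "s \<in> S" for s
        using xi_sq_nonzero[of s] Fz[OF \<open>u \<in> F\<close>] SR that by auto
      then show ?thesis unfolding G_def by (intro holomorphic_intros) auto
    qed
    define E where "E = (\<lambda>s. arch s - neg_log_deriv s - (\<Sum>u\<in>F. of_nat (m u) * G u s))"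
    have mGh: "(\<lambda>s. of_nat (m u) * G u s) holomorphic_on S" if "u \<in> F" for u
      by (intro holomorphic_intros Gh that)
    have ah: "arch holomorphic_on S" "neg_log_deriv holomorphic_on S"
      by (rule holomorphic_on_subset[OF arch_holomorphic SR], rule holomorphic_on_subset[OF neg_log_deriv_holomorphic SR])
    have dh: "(\<lambda>s. arch s - neg_log_deriv s) holomorphic_on S" by (intro holomorphic_on_diff ah)
    have sh: "(\<lambda>s. \<Sum>u\<in>F. of_nat (m u) * G u s) holomorphic_on S" by (intro holomorphic_on_sum mGh)
    have Eh: "E holomorphic_on S" unfolding E_def by (intro holomorphic_on_diff dh sh)
    have En: "norm (E s) \<le> (4 * Z + 1) * \<epsilon>" if "s \<in> S" for s
    proof -
      have R: "Re s > 1" using SR that by auto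
      have "norm (s * (s - 1)) \<le> (2 * Z) * (2 * Z + 1)"
        unfolding norm_mult using Sn[OF that] norm_triangle_ineq4[of s 1] L by (intro mult_mono) auto
      then have nV: "norm (s * (s - 1)) < V" using V(2) by linarith
      then have "E s = (2 * s - 1) * e (s * (s - 1))" unfolding E_def G_def F(3)[OF R nV] by simp
      then have "norm (E s) = norm (2 * s - 1) * norm (e (s * (s - 1)))" by (simp only: norm_mult)
      also have "\<dots> \<le> (4 * Z + 1) * \<epsilon>"
        using norm_triangle_ineq4[of "2 * s" 1] Sn[OF that] nV L by (intro mult_mono F(2)) (auto simp: norm_mult)
      finally show ?thesis .
    qed
    let ?T = "taylor_op K B Z"
    have "norm (?T E) \<le> A * ((4 * Z + 1) * \<epsilon>)"
      unfolding A_def using L(3) by (intro taylor_op_error[OF Eh S(1) _ _ En]) (auto simp: S_def)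
    then have TE: "- Re (?T E) \<le> A * (4 * Z + 1) * \<epsilon>" using abs_Re_le_cmod[of "?T E"] by simp
    have ts: "?T (\<lambda>s. \<Sum>u\<in>F. of_nat (m u) * G u s) = (\<Sum>u\<in>F. ?T (\<lambda>s. of_nat (m u) * G u s))"
      by (rule taylor_op_sum[OF mGh S K])
    have tc: "?T (\<lambda>s. of_nat (m u) * G u s) = of_nat (m u) * ?T (G u)" if "u \<in> F" for u
      by (rule taylor_op_cmult[OF Gh[OF that] S])
    have "?T E = ?T arch - ?T neg_log_deriv - (\<Sum>u\<in>F. of_nat (m u) * ?T (G u))"
      unfolding E_def taylor_op_diff[OF dh sh S] taylor_op_diff[OF ah S] ts
      using tc by (simp cong: sum.cong)
    then have "Re (?T neg_log_deriv) = Re (?T arch) + (\<Sum>u\<in>F. real (m u) * (- Re (?T (G u)))) - Re (?T E)"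
      by (simp add: sum_negf)
    also have "(\<Sum>u\<in>F. real (m u) * (- Re (?T (G u)))) \<le> (\<Sum>u\<in>F. real (m u) * (2 / (zgam u)^2 + zero_weight K Z u))"
      unfolding G_def B_def by (intro sum_mono mult_left_mono neg_Re_taylor_op_zero Fz L K) auto
    also have "\<dots> = (\<Sum>u\<in>F. real (m u) * (2 / (zgam u)^2)) + (\<Sum>u\<in>F. real (m u) * zero_weight K Z u)"
      by (simp only: distrib_left sum.distrib)
    also have "(\<Sum>u\<in>F. real (m u) * zero_weight K Z u) \<le> \<mu> * zsum F m a t"
      by (rule weighted_zero_sum_le[OF F(1) a \<mu> w])
    also have "(\<Sum>u\<in>F. real (m u) * (2 / (zgam u)^2)) \<le> 1 * zsum F m 4 0"
    proof (rule weighted_zero_sum_le[OF F(1)])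
      fix u assume "xi_sq u = 0"
      from zgam_ge[OF this] have "(11/2)^2 \<le> \<bar>zgam u\<bar>^2" by (intro power_mono) auto
      \<comment> \<open>The left side is \<open>2 + 26/\<gamma>^2\<close>, and
        \<open>\<gamma>^2 \<ge> 121/4\<close> keeps it below 7.\<close>
      then show "2 / (zgam u)^2 * (((2*4 - 1)^2 + 3)/4 + (\<bar>zgam u\<bar> - 0)^2) \<le> 1 * (kernel_const 0 * (2*4 - 1))"
        by (simp add: kernel_const_def divide_simps power2_eq_square)
    qed auto
    finally have main: "Re (?T neg_log_deriv) \<le> Re (?T arch) + (zsum F m 4 0 + \<mu> * zsum F m a t) - Re (?T E)" by simp
    have z1: "zsum F m a t \<le> archr a t + Fr a + norm (2 * s1 - 1) * \<epsilon>"
      using app[OF a(1), of t] V(3) neg_Re_neg_log_deriv_le[OF a(1), of t] unfolding s1_def by linarith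
    have z0: "zsum F m 4 0 \<le> 1/2 + norm (2 * s0 - 1) * \<epsilon>"
      using app[of 4 0] V(4) archr_4_le Fr_4_ge unfolding s0_def Fr_def by simp
    have "\<mu> * zsum F m a t \<le> \<mu> * (archr a t + Fr a + norm (2 * s1 - 1) * \<epsilon>)"
      using z1 \<mu> by (rule mult_left_mono)
    then have z1: "\<mu> * zsum F m a t \<le> \<mu> * (archr a t + Fr a) + \<mu> * norm (2 * s1 - 1) * \<epsilon>"
      by (simp only: distrib_left mult.assoc)
    have ar: "Re (?T arch) \<le> (q ^ K - 1) + B / Z * q ^ Suc K + ln (Z/2 + 1) / 2 - ln pi / 2"
      unfolding q_def by (rule taylor_op_arch) (use K L in \<open>auto simp: B_def\<close>)
    have CE: "C * \<epsilon> = A * (4 * Z + 1) * \<epsilon> + \<mu> * norm (2 * s1 - 1) * \<epsilon> + norm (2 * s0 - 1) * \<epsilon>"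
      by (simp only: C_def distrib_right)
    have "psi (exp L) \<le> Re (?T neg_log_deriv)" unfolding B_def by (rule psi_le_taylor_op[OF K L])
    then show "psi (exp L) \<le> q ^ K + B / Z * q ^ Suc K + ln (Z/2 + 1) / 2 + \<mu> * (archr a t + Fr a) + C * \<epsilon>"
      using main z1 z0 ar TE ln_pi_ge unfolding CE by linarith
    qed
  qed
qed

section \<open>Decay of the weight of a zero\<close>

lemma zero_power_bound:
  assumes Z: "Z > 1" and b: "0 \<le> b" "b \<le> 1" and m: "K = 2 * m * N"
  shows "norm (of_real Z / (of_real Z - Complex b g)) ^ K * (1 + real N * (g^2 / Z^2)) ^ m \<le> (Z / (Z - 1)) ^ K * exp (- (1 - b) * (real K / Z))"
proof -
  define P where "P = Z - b"
  define n where "n = norm (of_real Z - Complex b g)"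
  have P: "P > 0" "Z - 1 \<le> P" "P \<le> Z" using Z b by (auto simp: P_def)
  have y: "g^2 / Z^2 \<ge> 0" by simp
  have "of_real Z - Complex b g = Complex P (- g)" by (simp add: complex_eq_iff P_def)
  then have n2: "n^2 = P^2 + g^2" unfolding n_def by (simp add: cmod_power2)
  have n0: "n > 0" using n2 P by (auto simp: n_def intro!: gr0I)
  have "P^2 * (1 + g^2 / Z^2) \<le> P^2 + g^2"
  proof -
    have "P^2 / Z^2 \<le> 1" using P Z by (simp add: power_mono)
    from mult_right_mono[OF this, of "g^2"] show ?thesis by (simp add: distrib_left)
  qed
  then have "(P^2 * (1 + g^2 / Z^2)) ^ (m * N) \<le> (n^2) ^ (m * N)"
    unfolding n2 using y by (intro power_mono mult_nonneg_nonneg add_nonneg_nonneg) auto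
  also have "(n^2) ^ (m * N) = n ^ K" by (simp add: m power_mult[symmetric] mult.assoc)
  also have "(P^2 * (1 + g^2 / Z^2)) ^ (m * N) = P ^ K * ((1 + g^2 / Z^2) ^ N) ^ m"
    by (simp add: m power_mult_distrib power_mult[symmetric] mult_ac)
  finally have 1: "P ^ K * ((1 + g^2 / Z^2) ^ N) ^ m \<le> n ^ K" .
  \<comment> \<open>Bernoulli's inequality trades the exponent \<open>m N = K/2\<close> for the
    fixed exponent \<open>m\<close>. The damping becomes a rational expression of fixed degree, yet
    remains close to exp(K g^2 / (2 Z^2)) as long as that exponent is small against
    \<open>m\<close>.\<close>
  have "1 + real N * (g^2 / Z^2) \<le> (1 + g^2 / Z^2) ^ N" using Bernoulli_inequality[of "g^2 / Z^2" N] y by linarith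
  then have "(1 + real N * (g^2 / Z^2)) ^ m \<le> ((1 + g^2 / Z^2) ^ N) ^ m"
    using y by (intro power_mono add_nonneg_nonneg mult_nonneg_nonneg) auto
  then have "P ^ K * (1 + real N * (g^2 / Z^2)) ^ m \<le> n ^ K" using 1 P by (intro order_trans[OF mult_left_mono 1]) auto
  then have 2: "(1 + real N * (g^2 / Z^2)) ^ m \<le> n ^ K / P ^ K" using P by (simp add: pos_le_divide_eq mult.commute)
  have "norm (of_real Z / (of_real Z - Complex b g)) = Z / n" using Z by (simp add: norm_divide n_def)
  then have "norm (of_real Z / (of_real Z - Complex b g)) ^ K * (1 + real N * (g^2 / Z^2)) ^ m = (Z / n) ^ K * (1 + real N * (g^2 / Z^2)) ^ m" by simp
  also have "\<dots> \<le> (Z / n) ^ K * (n ^ K / P ^ K)" using 2 Z n0 by (intro mult_left_mono) auto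
  also have "\<dots> = (Z / P) ^ K" using n0 by (simp add: power_divide)
  also have "\<dots> \<le> (Z / (Z - 1) * exp (- (1 - b) / Z)) ^ K"
  proof (rule power_mono)
    have "(Z - 1) / P = 1 + - ((1 - b) / P)" using P by (simp add: P_def field_simps)
    also have "\<dots> \<le> exp (- ((1 - b) / P))" by (rule exp_ge_add_one_self)
    also have "\<dots> \<le> exp (- (1 - b) / Z)"
    proof -
      have "(1 - b) / Z \<le> (1 - b) / P" using b P Z by (intro divide_left_mono) auto
      then show ?thesis by (simp only: exp_le_cancel_iff minus_divide_left neg_le_iff_le)
    qed
    finally have "(Z - 1) / P \<le> exp (- (1 - b) / Z)" .
    from mult_left_mono[OF this, of "Z / (Z - 1)"] Z P show "Z / P \<le> Z / (Z - 1) * exp (- (1 - b) / Z)" by simp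
  qed (use Z P in auto)
  also have "\<dots> = (Z / (Z - 1)) ^ K * exp (real K * (- (1 - b) / Z))" by (simp only: power_mult_distrib exp_of_nat_mult)
  also have "real K * (- (1 - b) / Z) = - (1 - b) * (real K / Z)" by simp
  finally show ?thesis .
qed

lemma zero_weight_le:
  assumes u: "xi_sq u = 0" and K: "K = 2 * m * N" "K > 0" and L: "L > 0" "Z = real K / L" "Z > 1"
  defines "q \<equiv> Z / (Z - 1)"
  shows "zero_weight K Z u * (1 + (zgam u)^2 * (L^2 / real K) / real (2 * m)) ^ m \<le>
    q ^ K * ((exp (- L * (1 - zbeta u)) + exp (- L * zbeta u)) * (1 / \<bar>zgam u\<bar> + (sqrt (2 * real K) + 1) / Z * q))"
proof -
  define G where "G = (1 + (zgam u)^2 * (L^2 / real K) / real (2 * m)) ^ m"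
  have b: "0 \<le> zbeta u" "zbeta u \<le> 1" using zbeta_ge[of u] zbeta_le[OF u] by auto
  have mN: "m > 0" "N > 0" using K by auto
  have "real N * ((zgam u)^2 / Z^2) = (zgam u)^2 * (L^2 / real K) / real (2 * m)"
    using L(1) mN unfolding L(2) K(1) by (simp add: power2_eq_square field_simps)
  then have G: "G = (1 + real N * ((zgam u)^2 / Z^2)) ^ m" by (simp add: G_def)
  have KZ: "real K / Z = L" using L K by simp
  have z: "zroot u = Complex (zbeta u) (zgam u)" "1 - zroot u = Complex (1 - zbeta u) (- zgam u)"
    by (simp_all add: zroot_split complex_eq_iff)
  have 1: "norm (of_real Z / (of_real Z - zroot u)) ^ K * G \<le> q ^ K * exp (- L * (1 - zbeta u))"
    using zero_power_bound[OF L(3) b K(1), of "zgam u"] unfolding G z(1)[symmetric] KZ q_def by (simp only: minus_mult_commute mult.commute)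
  have 2: "norm (of_real Z / (of_real Z - (1 - zroot u))) ^ K * G \<le> q ^ K * exp (- L * zbeta u)"
    using zero_power_bound[OF L(3) _ _ K(1), of "1 - zbeta u" "- zgam u"] b unfolding G z(2)[symmetric] KZ q_def by (simp add: mult.commute)
  have "zero_weight K Z u * G = (norm (of_real Z / (of_real Z - zroot u)) ^ K * G + norm (of_real Z / (of_real Z - (1 - zroot u))) ^ K * G) * (1 / \<bar>zgam u\<bar> + (sqrt (2 * real K) + 1) / Z * q)"
  proof -
    have "(x + y) * c * g = (x * g + y * g) * c" for x y c g :: real by (simp add: algebra_simps)
    then show ?thesis unfolding zero_weight_def q_def .
  qed
  also have "\<dots> \<le> (q ^ K * exp (- L * (1 - zbeta u)) + q ^ K * exp (- L * zbeta u)) * (1 / \<bar>zgam u\<bar> + (sqrt (2 * real K) + 1) / Z * q)"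
    using 1 2 L unfolding q_def by (intro mult_right_mono add_mono add_nonneg_nonneg mult_nonneg_nonneg) auto
  also have "\<dots> = q ^ K * ((exp (- L * (1 - zbeta u)) + exp (- L * zbeta u)) * (1 / \<bar>zgam u\<bar> + (sqrt (2 * real K) + 1) / Z * q))"
    by (simp only: distrib_left mult.assoc distrib_right)
  finally show ?thesis by (simp only: G_def)
qed

subsection \<open>Bounds for \<open>psi\<close> on ranges of \<open>L = ln x\<close>\<close>

text \<open>Domination of the weights by the kernel after division by \<open>q^K\<close>. With
  \<open>m = 16\<close> the power \<open>(1 + x/32)^16\<close> stands in for exp(x/2) at
  \<open>x = \<gamma>^2 \<delta>^2\<close>; 143/100 is sqrt 2 enlarged by the rounding in
  \<open>B\<close> and \<open>q\<close>, and 999/1000 pays for rounding \<open>K\<close> up to a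
  multiple of 32.\<close>

definition row_ok :: "real \<Rightarrow> real \<Rightarrow> real \<Rightarrow> real \<Rightarrow> real \<Rightarrow> bool" where
  "row_ok L \<delta> t a \<mu> \<longleftrightarrow> (\<forall>u. xi_sq u = 0 \<longrightarrow>
     (exp (- L * (1 - zbeta u)) + exp (- L / 2)) * (1 / \<bar>zgam u\<bar> + 143/100 * \<delta>) * (((2*a - 1)^2 + 3)/4 + (\<bar>zgam u\<bar> - t)^2)
      \<le> \<mu> * (kernel_const t * (2*a - 1)) * (1 + (zgam u)^2 * (999/1000 * \<delta>^2) / 32) ^ 16)"

lemma exp_le_quadratic: "0 \<le> x \<Longrightarrow> x \<le> 1 \<Longrightarrow> exp x \<le> 1 + x + (x::real)^2"
  by (rule exp_bound)

text \<open>The relative error has these sources: \<open>q^K\<close> exceeds exp L by the factor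
  \<open>1 + 1.02 \<delta>^2\<close>, the extra Taylor term at the pole costs
  \<open>1.43 \<delta>\<close>, the zeros cost \<open>\<mu> M\<close>, and \<open>c\<close> covers
  the slowly growing \<open>ln (Z/2 + 1) / 2\<close>.\<close>

theorem psi_row:
  assumes \<delta>: "0 < \<delta>" "\<delta> \<le> 1/20" and L: "24 \<le> L0" "L0 \<le> L" "L / \<delta>^2 \<le> exp L * c"
    and a: "a > 1" "t \<ge> 0" "\<mu> \<ge> 0" "archr a t + Fr a \<le> M" "M \<ge> 0" and row: "row_ok L0 \<delta> t a \<mu>"
  shows "psi (exp L) \<le> exp L * ((1 + 102/100 * \<delta>^2) * (1 + 143/100 * \<delta> + \<mu> * M) + c)"
proof -
  define X where "X = (L / \<delta>)^2"
  \<comment> \<open>This makes \<open>K\<close> the number \<open>(L/\<delta>)^2\<close> rounded up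
    to a multiple of 32, the form \<open>2 m N\<close> that the decay estimate asks for.\<close>
  define N where "N = nat \<lceil>X / 32\<rceil>"
  define K where "K = 2 * 16 * N"
  define D where "D = L^2 / real K"
  define Z where "Z = real K / L"
  define q where "q = Z / (Z - 1)"
  define B where "B = sqrt (2 * real K) + 1"
  have L0: "L \<ge> 24" "L > 0" using L by auto
  have "L / \<delta> \<ge> 24 / (1/20)" using L0 \<delta> by (intro frac_le) auto
  then have "X \<ge> 480^2" unfolding X_def by (intro power_mono) auto
  then have X: "X \<ge> 230400" by simp
  have XD: "X = L^2 / \<delta>^2" by (simp add: X_def power_divide)
  have "real N \<ge> X / 32" "real N \<le> X / 32 + 1" using X unfolding N_def by linarith+
  then have KX: "real K \<ge> X" "real K \<le> X + 32" by (simp_all add: K_def)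
  then have KX': "real K \<le> 1001/1000 * X" using X by simp
  have K0: "K > 0" "real K > 0" using KX X by (auto simp: K_def intro!: gr0I)
  have D: "D \<le> \<delta>^2" "D \<ge> 999/1000 * \<delta>^2" "D > 0"
  proof -
    have "L^2 = \<delta>^2 * X" using \<delta> by (simp add: XD)
    then have *: "D = \<delta>^2 * (X / real K)" by (simp add: D_def)
    have "X / real K \<le> 1" using KX K0 by simp
    then show "D \<le> \<delta>^2" unfolding * by (intro mult_left_le) auto
    have "X / real K \<ge> 999/1000" using KX' K0 X by (simp add: pos_le_divide_eq)
    from mult_left_mono[OF this, of "\<delta>^2"] show "D \<ge> 999/1000 * \<delta>^2" unfolding * by simp
    show "D > 0" using K0 L0 by (simp add: D_def)
  qed
  have \<delta>2: "\<delta>^2 \<le> 1/400" using power_mono[OF \<delta>(2), of 2] \<delta> by (simp add: power_divide)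
  have ZD: "Z = L / D" using L0 by (simp add: Z_def D_def power2_eq_square)
  have Z: "Z \<ge> 9600"
  proof -
    have "L / D \<ge> 24 / (1/400)" using L0 D \<delta>2 by (intro frac_le) auto
    then show ?thesis by (simp add: ZD)
  qed
  have q: "q \<le> 1 + 2/10000" "q \<ge> 1" using Z by (auto simp: q_def divide_simps)
  have qK: "q ^ K \<le> exp L * (1 + 102/100 * \<delta>^2)"
  proof -
    have "q = 1 + 1 / (Z - 1)" using Z by (simp add: q_def field_simps)
    also have "\<dots> \<le> exp (1 / (Z - 1))" by (rule exp_ge_add_one_self)
    finally have "q ^ K \<le> exp (1 / (Z - 1)) ^ K" using q by (intro power_mono) auto
    also have "\<dots> = exp (real K * (1 / (Z - 1)))" by (rule exp_of_nat_mult[symmetric])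
    also have "real K * (1 / (Z - 1)) = L + D * q"
    proof -
      have "real K = L * Z" using L0 by (simp add: Z_def)
      moreover have "D * Z = L" using D by (simp add: ZD)
      moreover have "D * q = D * Z / (Z - 1)" by (simp add: q_def)
      ultimately show ?thesis using Z by (simp add: field_simps)
    qed
    also have "exp (L + D * q) = exp L * exp (D * q)" by (rule exp_add)
    also have "exp (D * q) \<le> 1 + 102/100 * \<delta>^2"
    proof -
      have 1: "D * q \<le> \<delta>^2 * (1 + 2/10000)" using D q by (intro mult_mono) auto
      then have 2: "D * q \<le> 1/300" using \<delta>2 by simp
      have 3: "D * q \<ge> 0" using D q by simp
      have "exp (D * q) \<le> 1 + D * q + (D * q)^2" using 2 3 by (intro exp_le_quadratic) auto
      also have "(D * q)^2 \<le> D * q * (1/300)" unfolding power2_eq_square using 2 3 by (intro mult_left_mono) auto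
      finally have "exp (D * q) \<le> 1 + D * q + D * q * (1/300)" by simp
      moreover have "e \<le> 1 + 102/100 * y" if "e \<le> 1 + x + x * (1/300)" "x \<le> y * (1 + 2/10000)" "0 \<le> y" for e x y :: real
        using that by (simp add: field_simps)
      ultimately show ?thesis using 1 zero_le_power2[of \<delta>] by blast
    qed
    finally show ?thesis by simp
  qed
  have Bq: "B / Z * q \<le> 143/100 * \<delta>"
  proof -
    have s: "sqrt (real K) \<ge> 480" using KX X by (intro real_le_rsqrt) auto
    have s2: "sqrt (real K) ^ 2 = real K" by simp
    have "B = sqrt 2 * sqrt (real K) + 1" by (simp add: B_def real_sqrt_mult)
    also have "\<dots> \<le> 14143/10000 * sqrt (real K) + 1/480 * sqrt (real K)"
      using s by (intro add_mono mult_right_mono real_le_lsqrt) (auto simp: power2_eq_square)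
    also have "\<dots> \<le> 1417/1000 * sqrt (real K)" using s by simp
    finally have "B / Z \<le> 1417/1000 * sqrt (real K) / Z" using Z by (intro divide_right_mono) auto
    also have "sqrt (real K) / Z = L / sqrt (real K)" proof -
      have "real K / L = sqrt (real K) * (sqrt (real K) / L)" using s2 by (simp add: power2_eq_square)
      moreover have "r / (r * (r / L)) = L / r" if "r \<ge> 480" for r :: real using that by simp
      ultimately show ?thesis using s unfolding Z_def by (simp only:)
    qed
    then have "1417/1000 * sqrt (real K) / Z = 1417/1000 * (L / sqrt (real K))" by simp
    also have "L / sqrt (real K) \<le> \<delta>"
    proof -
      have "sqrt (real K) \<ge> L / \<delta>" using KX(1) unfolding X_def by (intro real_le_rsqrt)
      then show ?thesis using \<delta> s by (simp add: divide_simps mult.commute)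
    qed
    finally have "B / Z \<le> 1417/1000 * \<delta>" by simp
    then have "B / Z * q \<le> 1417/1000 * \<delta> * (1 + 2/10000)" using q \<delta> by (intro mult_mono) auto
    moreover have "y \<le> 143/100 * x" if "y \<le> 1417/1000 * x * (1 + 2/10000)" "x > 0" for x y :: real
      using that by simp
    ultimately show ?thesis using \<delta>(1) by blast
  qed
  have w: "zero_weight K Z u * (((2*a - 1)^2 + 3)/4 + (\<bar>zgam u\<bar> - t)^2) \<le> (q ^ K * \<mu>) * (kernel_const t * (2*a - 1))" if u: "xi_sq u = 0" for u
  proof -
    let ?Q = "((2*a - 1)^2 + 3)/4 + (\<bar>zgam u\<bar> - t)^2"
    define G where "G = (1 + (zgam u)^2 * D / 32) ^ 16"
    define G' where "G' = (1 + (zgam u)^2 * (999/1000 * \<delta>^2) / 32) ^ 16"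
    have G': "G' \<le> G" unfolding G_def G'_def using D by (intro power_mono add_left_mono divide_right_mono mult_left_mono) auto
    have G0: "G' > 0" unfolding G'_def by (intro zero_less_power add_pos_nonneg) auto
    have Q0: "?Q \<ge> 0" by simp
    have R0: "\<mu> * (kernel_const t * (2*a - 1)) \<ge> 0" using a by (simp add: kernel_const_def)
    have "zero_weight K Z u * G \<le> q ^ K * ((exp (- L * (1 - zbeta u)) + exp (- L * zbeta u)) * (1 / \<bar>zgam u\<bar> + B / Z * q))"
      using zero_weight_le[OF u K_def K0(1) L0(2) Z_def] Z unfolding G_def D_def B_def q_def by simp
    also have "\<dots> \<le> q ^ K * ((exp (- L0 * (1 - zbeta u)) + exp (- L0 / 2)) * (1 / \<bar>zgam u\<bar> + 143/100 * \<delta>))"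
    proof (rule mult_left_mono, rule mult_mono)
      have "L0 * (1 - zbeta u) \<le> L * (1 - zbeta u)" using L zbeta_le[OF u] by (intro mult_right_mono) auto
      then have "exp (- L * (1 - zbeta u)) \<le> exp (- L0 * (1 - zbeta u))" by simp
      moreover have "L0 * (1/2) \<le> L * zbeta u" using L zbeta_ge[of u] by (intro mult_mono) auto
      then have "exp (- L * zbeta u) \<le> exp (- L0 / 2)" by simp
      ultimately show "exp (- L * (1 - zbeta u)) + exp (- L * zbeta u) \<le> exp (- L0 * (1 - zbeta u)) + exp (- L0 / 2)"
        by (rule add_mono)
      show "1 / \<bar>zgam u\<bar> + B / Z * q \<le> 1 / \<bar>zgam u\<bar> + 143/100 * \<delta>" using Bq by (rule add_left_mono)
      have "B / Z * q \<ge> 0" using Z q unfolding B_def by (intro mult_nonneg_nonneg divide_nonneg_nonneg) auto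
      then show "0 \<le> 1 / \<bar>zgam u\<bar> + B / Z * q" by simp
      show "0 \<le> q ^ K" using q by simp
    qed (auto intro: add_nonneg_nonneg)
    finally have "zero_weight K Z u * G * ?Q \<le> q ^ K * ((exp (- L0 * (1 - zbeta u)) + exp (- L0 / 2)) * (1 / \<bar>zgam u\<bar> + 143/100 * \<delta>)) * ?Q"
      by (rule mult_right_mono[OF _ Q0])
    also have "\<dots> = q ^ K * ((exp (- L0 * (1 - zbeta u)) + exp (- L0 / 2)) * (1 / \<bar>zgam u\<bar> + 143/100 * \<delta>) * ?Q)"
      by (simp only: mult.assoc)
    also have "\<dots> \<le> q ^ K * (\<mu> * (kernel_const t * (2*a - 1)) * G')"
      using row u q unfolding row_ok_def G'_def by (intro mult_left_mono) auto
    also have "\<dots> \<le> q ^ K * (\<mu> * (kernel_const t * (2*a - 1)) * G)"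
      using G' R0 q by (intro mult_left_mono) auto
    finally have "zero_weight K Z u * ?Q * G \<le> (q ^ K * \<mu>) * (kernel_const t * (2*a - 1)) * G"
      by (simp only: mult_ac)
    then show ?thesis using G0 G' by (simp only: mult_le_cancel_right)
  qed
  have \<mu>0: "q ^ K * \<mu> \<ge> 0" using q a by simp
  have Z1: "Z > 1" using Z by simp
  have "psi (exp L) \<le> q ^ K + B / Z * q ^ Suc K + ln (Z/2 + 1) / 2 + (q ^ K * \<mu>) * (archr a t + Fr a)"
    unfolding B_def q_def by (rule psi_le_zeros[OF K0(1) L0(2) Z_def Z1 a(1,2) \<mu>0[unfolded q_def] w[unfolded q_def]])
  also have "B / Z * q ^ Suc K = q ^ K * (B / Z * q)" by simp
  also have "\<dots> \<le> q ^ K * (143/100 * \<delta>)" using Bq q by (intro mult_left_mono) auto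
  also have "(q ^ K * \<mu>) * (archr a t + Fr a) \<le> (q ^ K * \<mu>) * M" using a \<mu>0 by (intro mult_left_mono)
  also have "ln (Z/2 + 1) / 2 \<le> exp L * c"
  proof -
    have "ln (1 + Z/2) \<le> Z/2" using Z by (intro ln_add_one_self_le_self) auto
    moreover have "Z \<le> 1001/1000 * (L / \<delta>^2)"
    proof -
      have "Z \<le> 1001/1000 * X / L" unfolding Z_def using KX' L0 by (intro divide_right_mono) auto
      also have "\<dots> = 1001/1000 * (L / \<delta>^2)" using L0 unfolding XD by (simp add: power2_eq_square)
      finally show ?thesis .
    qed
    moreover have "L / \<delta>^2 \<ge> 0" using L0 by simp
    moreover have "l / 2 \<le> e" if "l \<le> Z / 2" "Z \<le> 1001/1000 * y" "y \<ge> 0" "y \<le> e" for l y e :: real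
      using that by simp
    ultimately show ?thesis using L(3) by (simp only: add.commute)
  qed
  finally have "psi (exp L) \<le> q ^ K * (1 + 143/100 * \<delta> + \<mu> * M) + exp L * c" by (simp add: distrib_left)
  also have "q ^ K * (1 + 143/100 * \<delta> + \<mu> * M) \<le> exp L * (1 + 102/100 * \<delta>^2) * (1 + 143/100 * \<delta> + \<mu> * M)"
  proof (rule mult_right_mono[OF qK])
    have "\<mu> * M \<ge> 0" using a by simp
    then show "0 \<le> 1 + 143/100 * \<delta> + \<mu> * M" using \<delta> by simp
  qed
  finally have *: "psi (exp L) \<le> exp L * (1 + 102/100 * \<delta>^2) * (1 + 143/100 * \<delta> + \<mu> * M) + exp L * c" by simp
  have "e * c * d + e * k = e * (c * d + k)" for e c d k :: real by (simp add: distrib_left)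
  with * show ?thesis by (simp only:)
qed

section \<open>Certified zero-free intervals\<close>

lemma ln_3_le: "ln (3::real) \<le> 10987/10000"
  using ln_approx_bounds[of 3 8] by (simp add: eval_nat_numeral)

lemma ln_5_le: "ln (5::real) \<le> 16095/10000"
  using ln_approx_bounds[of 5 12] by (simp add: eval_nat_numeral)

lemma ln_5_ge': "ln (5::real) \<ge> 16094/10000"
  using ln_approx_bounds[of 5 12] by (simp add: eval_nat_numeral)

text \<open>Logarithms are only evaluated at 5-smooth numbers, which are coded by their exponents.\<close>
definition smooth :: "nat \<times> nat \<times> nat \<Rightarrow> real" where
  "smooth = (\<lambda>(i, j, k). 2 ^ i * 3 ^ j * 5 ^ k)"

definition smooth_ln :: "nat \<times> nat \<times> nat \<Rightarrow> real" where
  "smooth_ln = (\<lambda>(i, j, k). 69316/100000 * real i + 10987/10000 * real j + 16095/10000 * real k)"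

lemma smooth_pos: "smooth n > 0"
  by (cases n) (simp add: smooth_def)

lemma ln_smooth_le: "ln (smooth n) \<le> smooth_ln n"
proof -
  obtain i j k where n: "n = (i, j, k)" by (cases n)
  have "ln (smooth n) = real i * ln 2 + real j * ln 3 + real k * ln 5"
    by (simp add: n smooth_def ln_mult_pos ln_realpow)
  also have "\<dots> \<le> real i * (69316/100000) + real j * (10987/10000) + real k * (16095/10000)"
    by (intro add_mono mult_left_mono ln_2_bounds ln_3_le ln_5_le) auto
  finally show ?thesis by (simp add: n smooth_ln_def mult.commute)
qed

lemma pairf_0: 
  assumes "\<sigma> > 1" "0 \<le> \<beta>" "\<beta> \<le> 1"
  shows "pairf \<sigma> \<beta> 0 = (2*\<sigma> - 1) / (((2*\<sigma> - 1)^2 - (2*\<beta> - 1)^2) / 4)"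
proof -
  have "((2*\<sigma> - 1)^2 - (2*\<beta> - 1)^2) / 4 = (\<sigma> - \<beta>) * (\<sigma> - 1 + \<beta>)"
    by (simp add: power2_eq_square field_simps)
  moreover have "\<sigma> - \<beta> > 0" "\<sigma> - 1 + \<beta> > 0" using assms by auto
  moreover have "x / x^2 + y / y^2 = (x + y) / (x * y)" if "x > 0" "y > 0" for x y :: real
    using that by (simp add: power2_eq_square divide_simps)
  ultimately show ?thesis by (simp add: pairf_def)
qed

text \<open>The right side of \<open>zero_ineq\<close> with rational constants: lower bounds for ln
  2 and ln pi, and for \<open>ln (\<sigma>/2 + 1)\<close> the tangent at 5/3, where 511/1000 bounds
  ln(5/3) from above. \<open>g\<close> bounds the height from below and \<open>l\<close> its
  logarithm from above.\<close>

definition zf_rhs :: "real \<Rightarrow> real \<Rightarrow> real \<Rightarrow> real \<Rightarrow> real \<Rightarrow> real" where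
  "zf_rhs \<sigma> \<kappa> \<sigma>1 g l = 3 * (1 / (\<sigma> - 1) - \<kappa> / (\<sigma>1 - 1)) + (1 - \<kappa>) * (5/2 * l - 2 * (69314/100000) - 4 * (11446/10000)) +
    3/2 * (1 - \<kappa>) * (511/1000 + (3/5 * (\<sigma>/2 + 1) - 1) - 1 / (\<sigma> + 2)) +
    17/4 * ((\<sigma> - 1) + (1 - \<kappa>) * (\<sigma>1/2 + 1)^2 + 2 * \<kappa> * ((\<sigma>1/2 + 1) / 2 + 21/40)) / g^2"

definition zf_lhs :: "real \<Rightarrow> real \<Rightarrow> real \<Rightarrow> real \<Rightarrow> real" where
  "zf_lhs \<sigma> \<kappa> \<sigma>1 \<eta> = 4 * ((2*\<sigma> - 1) / (((2*\<sigma> - 1)^2 - (1 - 2*\<eta>)^2) / 4) - \<kappa> * ((2*\<sigma>1 - 1) / (((2*\<sigma>1 - 1)^2 - (1 - 2*\<eta>)^2) / 4)))"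

text \<open>Moving \<beta> away from 1 increases the denominators of both terms, \<open>p\<close>
  and \<open>p + c\<close>, by the same amount. The term at \<sigma> has the smaller denominator and
  the larger numerator, so it loses more than the subtracted one.\<close>

lemma zf_lhs_antimono:
  assumes \<sigma>: "1 < \<sigma>" "\<sigma> \<le> \<sigma>1" "0 \<le> \<kappa>" "\<kappa> * (2*\<sigma>1 - 1) \<le> 2*\<sigma> - 1" and \<eta>: "0 \<le> \<eta>'" "\<eta>' \<le> \<eta>" "\<eta> \<le> 1/2"
  shows "zf_lhs \<sigma> \<kappa> \<sigma>1 \<eta> \<le> zf_lhs \<sigma> \<kappa> \<sigma>1 \<eta>'"
proof -
  define S S1 where "S = 2*\<sigma> - 1" and "S1 = 2*\<sigma>1 - 1"
  define p where "p = (\<lambda>\<eta>. (S^2 - (1 - 2*\<eta>)^2) / 4)"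
  define c where "c = (S1^2 - S^2) / 4"
  have c: "c \<ge> 0" unfolding c_def S_def S1_def using \<sigma> by (simp add: power_mono)
  have p1: "(S1^2 - (1 - 2*x)^2) / 4 = p x + c" for x by (simp add: p_def c_def field_simps)
  have pp: "p \<eta>' > 0" 
  proof -
    have "(1 - 2*\<eta>')^2 \<le> 1^2" using \<eta> by (intro power_mono) auto
    moreover have "S^2 > 1^2" unfolding S_def using \<sigma> by (intro power_strict_mono) auto
    ultimately show ?thesis by (simp add: p_def)
  qed
  have pm: "p \<eta>' \<le> p \<eta>" unfolding p_def using \<eta> by (intro divide_right_mono diff_left_mono power_mono) auto
  have "S / p \<eta> - \<kappa> * (S1 / (p \<eta> + c)) \<le> S / p \<eta>' - \<kappa> * (S1 / (p \<eta>' + c))"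
  proof -
    have d: "a / p \<eta>' - a / p \<eta> = a * ((p \<eta> - p \<eta>') / (p \<eta> * p \<eta>'))" "a / (p \<eta>' + c) - a / (p \<eta> + c) = a * ((p \<eta> - p \<eta>') / ((p \<eta> + c) * (p \<eta>' + c)))" for a
      using pp pm c by (simp_all add: divide_simps algebra_simps)
    have "(p \<eta> - p \<eta>') / ((p \<eta> + c) * (p \<eta>' + c)) \<le> (p \<eta> - p \<eta>') / (p \<eta> * p \<eta>')"
      using pp pm c by (intro divide_left_mono mult_mono mult_pos_pos) auto
    then have "\<kappa> * S1 * ((p \<eta> - p \<eta>') / ((p \<eta> + c) * (p \<eta>' + c))) \<le> S * ((p \<eta> - p \<eta>') / (p \<eta> * p \<eta>'))"
      using \<sigma> pp pm c unfolding S_def S1_def by (intro mult_mono) auto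
    then have "\<kappa> * (S1 / (p \<eta>' + c) - S1 / (p \<eta> + c)) \<le> S / p \<eta>' - S / p \<eta>" unfolding d by (simp only: mult.assoc)
    then show ?thesis by (simp add: right_diff_distrib)
  qed
  then show ?thesis unfolding zf_lhs_def S_def[symmetric] S1_def[symmetric] p1 by (simp add: p_def)
qed

lemma zf_lhs_eq:
  assumes "1 < \<sigma>" "\<sigma> \<le> \<sigma>1" "xi_sq u = 0"
  shows "zf_lhs \<sigma> \<kappa> \<sigma>1 (1 - zbeta u) = 4 * (pairf \<sigma> (zbeta u) 0 - \<kappa> * pairf \<sigma>1 (zbeta u) 0)"
proof -
  have b: "0 \<le> zbeta u" "zbeta u \<le> 1" using zbeta_ge[of u] zbeta_le[OF assms(3)] by auto
  have e: "1 - 2 * (1 - zbeta u) = 2 * zbeta u - 1" by simp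
  show ?thesis unfolding zf_lhs_def e using assms b by (simp only: pairf_0 order.strict_trans2)
qed

lemma zero_free:
  assumes u: "xi_sq u = 0" and g: "11/2 \<le> g0" "g0 \<le> \<bar>zgam u\<bar>" "ln \<bar>zgam u\<bar> \<le> l"
    and \<sigma>: "1 < \<sigma>" "\<sigma> \<le> \<sigma>1" "0 \<le> \<kappa>" "\<kappa> \<le> 1" "\<kappa> * (2*\<sigma>1 - 1) \<le> 2*\<sigma> - 1"
      "\<kappa> * (2*\<sigma>1 - 1) * ((2*\<sigma> - 1)^2 + 3) \<le> (2*\<sigma> - 1) * ((2*\<sigma>1 - 1)^2 - 1)"
    and \<eta>: "\<eta> \<le> 1/2" and less: "zf_rhs \<sigma> \<kappa> \<sigma>1 g0 l < zf_lhs \<sigma> \<kappa> \<sigma>1 \<eta>"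
  shows "\<eta> \<le> 1 - zbeta u"
proof (rule ccontr)
  assume "\<not> \<eta> \<le> 1 - zbeta u"
  then have b: "1 - zbeta u \<le> \<eta>" "zbeta u > 1/2" using \<eta> by auto
  define c where "c = (\<sigma> - 1) + (1 - \<kappa>) * (\<sigma>1/2 + 1)^2 + 2 * \<kappa> * ((\<sigma>1/2 + 1) / 2 + 21/40)"
  let ?t = "\<bar>zgam u\<bar>"
  have "zf_lhs \<sigma> \<kappa> \<sigma>1 \<eta> \<le> zf_lhs \<sigma> \<kappa> \<sigma>1 (1 - zbeta u)"
    using b \<eta> zbeta_le[OF u] by (intro zf_lhs_antimono \<sigma>(1,2,3,5)) auto
  also have "\<dots> = 4 * (pairf \<sigma> (zbeta u) 0 - \<kappa> * pairf \<sigma>1 (zbeta u) 0)" by (rule zf_lhs_eq[OF \<sigma>(1,2) u])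
  also have "\<dots> \<le> 3 * (1 / (\<sigma> - 1) - \<kappa> / (\<sigma>1 - 1)) + (1 - \<kappa>) * (5/2 * ln ?t - 2 * ln 2 - 4 * ln pi) +
    3/2 * (1 - \<kappa>) * (ln (\<sigma>/2 + 1) - 1 / (\<sigma> + 2)) + 17/4 * c / ?t^2"
    unfolding c_def by (rule zero_ineq[OF u b(2) refl _ \<sigma>]) (use g in simp)
  also have "\<dots> \<le> 3 * (1 / (\<sigma> - 1) - \<kappa> / (\<sigma>1 - 1)) + (1 - \<kappa>) * (5/2 * l - 2 * (69314/100000) - 4 * (11446/10000)) +
    3/2 * (1 - \<kappa>) * (511/1000 + (3/5 * (\<sigma>/2 + 1) - 1) - 1 / (\<sigma> + 2)) + 17/4 * c / g0^2"
  proof (intro add_mono mult_left_mono order_refl)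
    show "5/2 * ln ?t - 2 * ln 2 - 4 * ln pi \<le> 5/2 * l - 2 * (69314/100000) - 4 * (11446/10000)"
      using g(3) ln_2_bounds ln_pi_ge by simp
    have "ln (3/5 * (\<sigma>/2 + 1)) \<le> 3/5 * (\<sigma>/2 + 1) - 1" using \<sigma> by (intro ln_le_minus_one) auto
    moreover have "ln (3/5 * (\<sigma>/2 + 1)) = ln 3 - ln 5 + ln (\<sigma>/2 + 1)" using \<sigma> by (subst ln_mult_pos) (auto simp: ln_div)
    ultimately show "ln (\<sigma>/2 + 1) - 1 / (\<sigma> + 2) \<le> 511/1000 + (3/5 * (\<sigma>/2 + 1) - 1) - 1 / (\<sigma> + 2)"
      using ln_3_ge ln_5_le by simp
    have "c \<ge> 0" unfolding c_def using \<sigma> by (intro add_nonneg_nonneg mult_nonneg_nonneg) auto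
    then show "17/4 * c / ?t^2 \<le> 17/4 * c / g0^2" using g by (intro divide_left_mono power_mono mult_pos_pos) auto
  qed (use \<sigma> in auto)
  also have "\<dots> = zf_rhs \<sigma> \<kappa> \<sigma>1 g0 l" by (simp add: zf_rhs_def c_def)
  finally show False using less by simp
qed

definition zfree :: "real \<Rightarrow> real \<Rightarrow> real \<Rightarrow> bool" where
  "zfree g0 g1 \<eta> \<longleftrightarrow> (\<forall>u. xi_sq u = 0 \<longrightarrow> g0 \<le> \<bar>zgam u\<bar> \<longrightarrow> \<bar>zgam u\<bar> \<le> g1 \<longrightarrow> \<eta> \<le> 1 - zbeta u)"

definition zfree_cert :: "real \<Rightarrow> nat \<times> nat \<times> nat \<Rightarrow> real \<Rightarrow> real \<Rightarrow> real \<Rightarrow> real \<Rightarrow> bool" where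
  "zfree_cert g0 n \<eta> \<sigma> \<kappa> \<sigma>1 \<longleftrightarrow> 11/2 \<le> g0 \<and> \<eta> \<le> 1/2 \<and> 1 < \<sigma> \<and> \<sigma> \<le> \<sigma>1 \<and> 0 \<le> \<kappa> \<and> \<kappa> \<le> 1 \<and> \<kappa> * (2*\<sigma>1 - 1) \<le> 2*\<sigma> - 1 \<and>
     \<kappa> * (2*\<sigma>1 - 1) * ((2*\<sigma> - 1)^2 + 3) \<le> (2*\<sigma> - 1) * ((2*\<sigma>1 - 1)^2 - 1) \<and>
     zf_rhs \<sigma> \<kappa> \<sigma>1 g0 (smooth_ln n) < zf_lhs \<sigma> \<kappa> \<sigma>1 \<eta>"

lemma zfree_cert:
  assumes "zfree_cert g0 n \<eta> \<sigma> \<kappa> \<sigma>1"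
  shows "zfree g0 (smooth n) \<eta>"
  unfolding zfree_def
proof (intro allI impI)
  fix u assume u: "xi_sq u = 0" "g0 \<le> \<bar>zgam u\<bar>" "\<bar>zgam u\<bar> \<le> smooth n"
  have "\<bar>zgam u\<bar> > 0" using assms u by (auto simp: zfree_cert_def)
  then have "ln \<bar>zgam u\<bar> \<le> ln (smooth n)" using u smooth_pos[of n] by (subst ln_le_cancel_iff) auto
  then have l: "ln \<bar>zgam u\<bar> \<le> smooth_ln n" using ln_smooth_le[of n] by linarith
  show "\<eta> \<le> 1 - zbeta u"
    by (rule zero_free[OF u(1) _ u(2) l, of \<sigma> \<sigma>1 \<kappa>]) (use assms in \<open>simp_all only: zfree_cert_def\<close>)
qed

fun zfree_certs :: "real \<Rightarrow> ((nat \<times> nat \<times> nat) \<times> real \<times> real \<times> real \<times> real) list \<Rightarrow> bool" where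
  "zfree_certs g0 [] \<longleftrightarrow> True"
| "zfree_certs g0 ((n, \<eta>, \<sigma>, \<kappa>, \<sigma>1) # xs) \<longleftrightarrow> zfree_cert g0 n \<eta> \<sigma> \<kappa> \<sigma>1 \<and> zfree_certs (smooth n) xs"

fun zfree_list :: "real \<Rightarrow> (real \<times> real) list \<Rightarrow> bool" where
  "zfree_list g0 [] \<longleftrightarrow> True"
| "zfree_list g0 ((g1, \<eta>) # xs) \<longleftrightarrow> zfree g0 g1 \<eta> \<and> zfree_list g1 xs"

lemma zfree_certs:
  "zfree_certs g0 xs \<Longrightarrow> zfree_list g0 (map (\<lambda>(n, \<eta>, _). (smooth n, \<eta>)) xs)"
  by (induction g0 xs rule: zfree_certs.induct) (auto intro: zfree_cert)

definition zero_table :: "((nat \<times> nat \<times> nat) \<times> real \<times> real \<times> real \<times> real) list" where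
  "zero_table = [
   ((2,1,0), 1/2, 47/25, 18/25, 241/100),
   ((1,1,1), 1509/5000, 9/5, 29/50, 137/50),
   ((2,2,0), 2653/10000, 46/25, 69/100, 61/25),
   ((3,0,1), 2193/10000, 9/5, 73/100, 57/25),
   ((0,2,1), 451/2500, 17/10, 71/100, 219/100),
   ((1,0,2), 1543/10000, 42/25, 19/25, 41/20),
   ((2,1,1), 151/1250, 81/50, 37/50, 201/100),
   ((3,2,0), 243/2500, 38/25, 71/100, 193/100),
   ((4,0,1), 873/10000, 73/50, 69/100, 189/100),
   ((1,2,1), 97/1250, 73/50, 69/100, 189/100),
   ((2,0,2), 349/5000, 36/25, 17/25, 47/25),
   ((3,1,1), 149/2500, 34/25, 13/20, 91/50),
   ((1,1,2), 499/10000, 33/25, 63/100, 9/5),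
   ((2,2,1), 437/10000, 13/10, 31/50, 179/100),
   ((3,0,2), 203/5000, 63/50, 3/5, 44/25),
   ((1,0,3), 177/5000, 31/25, 59/100, 7/4),
   ((2,1,2), 4/125, 61/50, 29/50, 87/50),
   ((4,0,2), 69/2500, 59/50, 14/25, 171/100),
   ((2,0,3), 31/1250, 59/50, 14/25, 171/100),
   ((3,1,2), 113/5000, 59/50, 14/25, 171/100),
   ((5,0,2), 203/10000, 57/50, 53/100, 169/100),
   ((3,0,3), 187/10000, 28/25, 13/25, 42/25),
   ((2,1,3), 41/2500, 28/25, 13/25, 42/25),
   ((4,0,3), 19/1250, 11/10, 51/100, 167/100),
   ((3,1,3), 27/2000, 11/10, 51/100, 167/100),
   ((5,0,3), 31/2500, 11/10, 51/100, 167/100),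
   ((4,1,3), 113/10000, 27/25, 49/100, 83/50),
   ((4,0,4), 101/10000, 53/50, 12/25, 33/20),
   ((5,0,4), 9/1000, 53/50, 12/25, 33/20)]"

lemma zero_table: "zfree_certs (11/2) zero_table"
  by (simp add: zero_table_def zfree_cert_def zf_rhs_def zf_lhs_def smooth_def smooth_ln_def power2_eq_square)

section \<open>Certificates for a bound on the zero weights\<close>

lemma archr_Fr_le:
  assumes a: "a \<ge> 10" and t: "t = 0 \<or> t \<ge> 11/2" and n: "(a/2 + 1)^2 + (t/2)^2 \<le> smooth n"
    and M: "(a - 1) / ((a - 1)^2 + t^2) + smooth_ln n / 4 - 5688/10000 \<le> M"
  shows "archr a t + Fr a \<le> M"
proof -
  have pos: "(a/2 + 1)^2 + (t/2)^2 > 0" using a by (intro add_pos_nonneg) auto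
  have "ln ((a/2 + 1)^2 + (t/2)^2) \<le> ln (smooth n)" using pos n smooth_pos[of n] by (subst ln_le_cancel_iff) auto
  then have l: "ln ((a/2 + 1)^2 + (t/2)^2) \<le> smooth_ln n" using ln_smooth_le[of n] by linarith
  have "archr a t \<le> (a - 1) / ((a - 1)^2 + t^2) - ln pi / 2 + ln ((a/2 + 1)^2 + (t/2)^2) / 4"
  proof (cases "t = 0")
    case True
    have "ln ((a/2 + 1)^2) = 2 * ln (a/2 + 1)" using a by (subst ln_realpow) auto
    moreover have "(a - 1) / (a - 1)^2 = 1 / (a - 1)" using a by (simp add: power2_eq_square)
    ultimately show ?thesis using archr_0_le[of a] a True by simp
  next
    case False
    have "norm (Complex (a/2 + 1) (t/2)) = sqrt ((a/2 + 1)^2 + (t/2)^2)" by (simp add: complex_norm)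
    then have "ln (norm (Complex (a/2 + 1) (t/2))) = ln ((a/2 + 1)^2 + (t/2)^2) / 2" using pos by (simp add: ln_sqrt)
    then show ?thesis using archr_le(1)[of a t] a t False by simp
  qed
  \<comment> \<open>0.5688 = 0.5723 - 0.0035: half the lower bound for \<open>ln pi\<close>, minus
    the bound for \<open>Fr a\<close>.\<close>
  then show ?thesis using l M ln_pi_ge Fr_le[OF a] by simp
qed

text \<open>0.841 lies slightly above exp(-0.174) and close to 2^(-1/4), so the codes
  \<open>(j, i)\<close> with \<open>i\<close> up to 3 bound exponentials by a grid of roughly
  quarter powers of two.\<close>

definition exp_bound :: "nat \<times> nat \<Rightarrow> real" where "exp_bound = (\<lambda>(j, i). (1/2) ^ j * (841/1000) ^ i)"
definition exp_cert :: "nat \<times> nat \<Rightarrow> real" where "exp_cert = (\<lambda>(j, i). 69316/100000 * real j + 174/1000 * real i)"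

text \<open>Each interval of zeros comes with two hints: a code \<open>k\<close> for an upper bound of \<open>exp (- L \<eta>)\<close>, and a lower bound \<open>p\<close>
  for the base of the damping factor. The last pair handles all remaining zeros, using only \<open>\<beta> \<le> 1\<close>.\<close>

fun row_cert :: "real \<Rightarrow> real \<Rightarrow> real \<Rightarrow> real \<Rightarrow> real \<Rightarrow> real \<Rightarrow> real \<Rightarrow> (real \<times> real) list \<Rightarrow> ((nat \<times> nat) \<times> real) list \<Rightarrow> bool" where
  "row_cert L \<delta> t Q R e g0 xs [(k, p)] \<longleftrightarrow> t \<le> g0 \<and> 0 \<le> p \<and> p \<le> 1 + g0^2 * (999/1000 * \<delta>^2) / 32 \<and> 225/100 \<le> g0^2 * (999/1000 * \<delta>^2) \<and>
     2 * (1 / g0 + 143/100 * \<delta>) * (Q + g0^2) \<le> R * p ^ 16"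
| "row_cert L \<delta> t Q R e g0 ((g1, \<eta>) # xs) ((k, p) # h # hs) \<longleftrightarrow> 0 < g1 \<and> exp_cert k \<le> L * \<eta> \<and> 0 \<le> p \<and> p \<le> 1 + g0^2 * (999/1000 * \<delta>^2) / 32 \<and>
     (exp_bound k + e) * (1 + 143/100 * (\<delta> * g0)) * (Q + (g0 - t)^2) \<le> R * g0 * p ^ 16 \<and>
     (exp_bound k + e) * (1 + 143/100 * (\<delta> * g0)) * (Q + (g1 - t)^2) \<le> R * g0 * p ^ 16 \<and> row_cert L \<delta> t Q R e g1 xs (h # hs)"
| "row_cert L \<delta> t Q R e g0 _ _ \<longleftrightarrow> False"

lemma exp_bound_pos: "exp_bound k > 0"
  by (cases k) (simp add: exp_bound_def)

lemma exp_cert: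
  assumes "exp_cert k \<le> x"
  shows "exp (- x) \<le> exp_bound k"
proof -
  obtain j i where k: "k = (j, i)" by (cases k)
  have "1 + 174/1000 + (174/1000)^2 / 2 \<le> exp (174/1000 :: real)" by (rule exp_lower_Taylor_quadratic) simp
  then have "1000/841 \<le> exp (174/1000 :: real)" by (simp add: power2_eq_square)
  then have 1: "exp (- (174/1000) :: real) \<le> 841/1000" by (simp add: exp_minus divide_simps)
  have "exp (- x) \<le> exp (real j * - ln 2 + real i * - (174/1000))"
    using assms mult_left_mono[OF ln_2_bounds(2), of "real j"] by (simp add: exp_cert_def k mult.commute)
  also have "\<dots> = exp (- ln 2) ^ j * exp (- (174/1000)) ^ i" by (simp only: exp_add exp_of_nat_mult)
  also have "exp (- ln 2) = (1/2 :: real)" by (simp add: exp_minus)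
  also have "(1/2 :: real) ^ j * exp (- (174/1000)) ^ i \<le> (1/2) ^ j * (841/1000) ^ i"
    using 1 by (intro mult_left_mono power_mono) auto
  finally show ?thesis by (simp add: exp_bound_def k)
qed

lemma square_dist_le_max:
  fixes g :: real
  assumes "g0 \<le> g" "g \<le> g1"
  shows "(g - t)^2 \<le> (g0 - t)^2 \<or> (g - t)^2 \<le> (g1 - t)^2"
proof -
  have "\<bar>g - t\<bar> \<le> \<bar>g0 - t\<bar> \<or> \<bar>g - t\<bar> \<le> \<bar>g1 - t\<bar>" using assms by linarith
  then show ?thesis by (simp only: abs_le_square_iff)
qed

text \<open>By Bernoulli the power 16 multiplies the relative growth of \<open>1 + x\<close> by 16,
  and \<open>16/(1+x) \<ge> 1/x\<close> from \<open>x = 1/15\<close> on. In \<open>row_cert\<close>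
  this is secured by the condition with 225/100, since 2.25/32 exceeds 1/15. From there on the
  damping outweighs the quadratic growth of the denominator of the kernel.\<close>

lemma power_16_ratio:
  fixes x y :: real
  assumes "1/15 \<le> x" "x \<le> y"
  shows "y / x \<le> ((1 + y) / (1 + x)) ^ 16"
proof -
  have x: "x > 0" using assms by linarith
  define r where "r = (y - x) / (1 + x)"
  have r: "r \<ge> 0" using assms x by (simp add: r_def)
  have "(1 + y) / (1 + x) = 1 + r" using x by (simp add: r_def field_simps)
  moreover have "1 + 16 * r \<le> (1 + r) ^ 16" using Bernoulli_inequality[of r 16] r by simp
  moreover have "y / x \<le> 1 + 16 * r"
  proof -
    have "(y - x) / x \<le> 16 * ((y - x) / (1 + x))"
    proof -
      have "1 / x \<le> 16 / (1 + x)" using assms x by (simp add: divide_simps)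
      then have "(y - x) * (1 / x) \<le> (y - x) * (16 / (1 + x))" using assms by (intro mult_left_mono) auto
      then show ?thesis by (simp only: times_divide_eq_right mult_1_right mult.commute)
    qed
    moreover have "y / x = 1 + (y - x) / x" using x by (simp add: field_simps)
    ultimately show ?thesis by (simp add: r_def)
  qed
  ultimately show ?thesis by simp
qed

text \<open>On a bounded interval the distance to \<open>t\<close> is largest at an end point, and
  all other factors are estimated at the left end. Beyond the last interval the distance term grows
  at most like \<open>(\<gamma>/g0)^2\<close>, and the damping gains at least as much.\<close>

lemma row_cert_sound:
  assumes "row_cert L \<delta> t Q R e g0 xs hs" "zfree_list g0 xs" "g0 > 0" "\<delta> > 0" "Q \<ge> 0" "R \<ge> 0" "L \<ge> 0" "t \<ge> 0" "exp (- L / 2) \<le> e" "e \<le> 1"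
    "xi_sq u = 0" "g0 \<le> \<bar>zgam u\<bar>"
  shows "(exp (- L * (1 - zbeta u)) + exp (- L / 2)) * (1 / \<bar>zgam u\<bar> + 143/100 * \<delta>) * (Q + (\<bar>zgam u\<bar> - t)^2)
      \<le> R * (1 + (zgam u)^2 * (999/1000 * \<delta>^2) / 32) ^ 16"
  using assms
proof (induction L \<delta> t Q R e g0 xs hs rule: row_cert.induct)
  case (1 L \<delta> t Q R e g0 xs k p)
  define g where "g = \<bar>zgam u\<bar>"
  define c where "c = 999/1000 * \<delta>^2 / 32"
  have g2: "(zgam u)^2 = g^2" by (simp add: g_def)
  have g: "g0 \<le> g" "g > 0" using 1 by (auto simp: g_def)
  have c: "t \<le> g0" "0 \<le> p" "p \<le> 1 + g0^2 * c" "225/100 \<le> g0^2 * (c * 32)"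
     "2 * (1 / g0 + 143/100 * \<delta>) * (Q + g0^2) \<le> R * p ^ 16"
    using 1(1) by (simp_all add: c_def)
  have c0: "c > 0" using 1 by (simp add: c_def)
  have \<beta>: "zbeta u \<le> 1" using 1 by (intro zbeta_le)
  have "- L * (1 - zbeta u) \<le> 0" "- L / 2 \<le> 0" using 1 \<beta> by (auto simp: mult_nonneg_nonneg)
  then have E: "exp (- L * (1 - zbeta u)) + exp (- L / 2) \<le> 2"
    using exp_le_one_iff[of "- L * (1 - zbeta u)"] exp_le_one_iff[of "- L / 2"] by linarith
  have Q: "Q + (g - t)^2 \<le> (Q + g0^2) * (g^2 / g0^2)"
  proof -
    have "(g - t)^2 \<le> g^2" using c g 1 by (intro power_mono) auto
    moreover have "g0^2 \<le> g^2" using g 1 by (intro power_mono) auto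
    then have "Q * 1 \<le> Q * (g^2 / g0^2)" using 1 by (intro mult_left_mono) auto
    moreover have "(Q + g0^2) * (g^2 / g0^2) = Q * (g^2 / g0^2) + g^2" using \<open>g0 > 0\<close> by (simp only: distrib_right) simp
    ultimately show ?thesis by simp
  qed
  have rat: "g^2 / g0^2 \<le> ((1 + g^2 * c) / (1 + g0^2 * c)) ^ 16"
  proof -
    have "(g^2 * c) / (g0^2 * c) \<le> ((1 + g^2 * c) / (1 + g0^2 * c)) ^ 16"
      using c c0 g 1 by (intro power_16_ratio mult_right_mono power_mono) auto
    then show ?thesis using c0 by simp
  qed
  have P0: "1 + g0^2 * c > 0" using c0 by (intro add_pos_nonneg) auto
  have "(exp (- L * (1 - zbeta u)) + exp (- L / 2)) * (1 / g + 143/100 * \<delta>) * (Q + (g - t)^2) \<le>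
      2 * (1 / g0 + 143/100 * \<delta>) * ((Q + g0^2) * (g^2 / g0^2))"
    using E Q g 1 by (intro mult_mono add_right_mono divide_left_mono mult_pos_pos add_nonneg_nonneg mult_nonneg_nonneg) auto
  also have "\<dots> = 2 * (1 / g0 + 143/100 * \<delta>) * (Q + g0^2) * (g^2 / g0^2)" by (simp only: mult.assoc)
  also have "\<dots> \<le> R * p ^ 16 * ((1 + g^2 * c) / (1 + g0^2 * c)) ^ 16"
    by (rule mult_mono[OF c(5) rat]) (use 1 in auto)
  also have "\<dots> \<le> R * (1 + g0^2 * c) ^ 16 * ((1 + g^2 * c) / (1 + g0^2 * c)) ^ 16"
    using c 1 c0 by (intro mult_right_mono mult_left_mono power_mono) auto
  also have "\<dots> = R * (1 + g^2 * c) ^ 16" using P0 by (simp add: power_divide)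
  finally show ?case unfolding g2 g_def by (simp add: c_def)
next
  case (2 L \<delta> t Q R e g0 g1 \<eta> xs k p h hs)
  note pre = 2(4-13)
  define g where "g = \<bar>zgam u\<bar>"
  have g2: "(zgam u)^2 = g^2" by (simp add: g_def)
  have g: "g0 \<le> g" using pre by (simp add: g_def)
  show ?case
  proof (cases "g \<le> g1")
    case True
    have \<eta>: "\<eta> \<le> 1 - zbeta u" using 2(3) pre True by (auto simp: zfree_def g_def)
    have c: "exp_cert k \<le> L * \<eta>" "0 \<le> p" "p \<le> 1 + g0^2 * (999/1000 * \<delta>^2) / 32"
      "(exp_bound k + e) * (1 + 143/100 * (\<delta> * g0)) * (Q + (g0 - t)^2) \<le> R * g0 * p ^ 16"
      "(exp_bound k + e) * (1 + 143/100 * (\<delta> * g0)) * (Q + (g1 - t)^2) \<le> R * g0 * p ^ 16"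
      using 2(2) by simp_all
    have div: "x * (1 / g0 + 143/100 * \<delta>) * y \<le> R * P" if "x * (1 + 143/100 * (\<delta> * g0)) * y \<le> R * g0 * P" for x y P
    proof -
      have g0: "g0 > 0" using pre by simp
      have "x * (1 / g0 + 143/100 * \<delta>) * y = x * (1 + 143/100 * (\<delta> * g0)) * y / g0" using g0 by (simp add: field_simps)
      also have "\<dots> \<le> R * g0 * P / g0" using that g0 by (intro divide_right_mono) auto
      finally show ?thesis using g0 by simp
    qed
    have "L * \<eta> \<le> L * (1 - zbeta u)" using \<eta> pre by (intro mult_left_mono) auto
    then have "exp (- (L * (1 - zbeta u))) \<le> exp_bound k" using c(1) by (intro exp_cert) linarith
    then have E: "exp (- L * (1 - zbeta u)) + exp (- L / 2) \<le> exp_bound k + e"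
      using pre by simp
    have e0: "e \<ge> 0" using pre by (meson exp_ge_zero order_trans)
    have "(exp (- L * (1 - zbeta u)) + exp (- L / 2)) * (1 / g + 143/100 * \<delta>) * (Q + (g - t)^2) \<le>
       (exp_bound k + e) * (1 / g0 + 143/100 * \<delta>) * (Q + (g - t)^2)"
      using E g pre e0 exp_bound_pos[of k] by (intro mult_right_mono mult_mono add_right_mono divide_left_mono mult_pos_pos add_nonneg_nonneg) auto
    also have "\<dots> \<le> R * p ^ 16"
    proof -
      have n: "(exp_bound k + e) * (1 / g0 + 143/100 * \<delta>) \<ge> 0" using pre e0 exp_bound_pos[of k] by (intro mult_nonneg_nonneg add_nonneg_nonneg) auto
      from square_dist_le_max[OF g True, of t] show ?thesis
      proof
        assume "(g - t)^2 \<le> (g0 - t)^2"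
        then have "Q + (g - t)^2 \<le> Q + (g0 - t)^2" by simp
        from mult_left_mono[OF this n] div[OF c(4)] show ?thesis by linarith
      next
        assume "(g - t)^2 \<le> (g1 - t)^2"
        then have "Q + (g - t)^2 \<le> Q + (g1 - t)^2" by simp
        from mult_left_mono[OF this n] div[OF c(5)] show ?thesis by linarith
      qed
    qed
    also have "\<dots> \<le> R * (1 + g^2 * (999/1000 * \<delta>^2) / 32) ^ 16"
    proof (intro mult_left_mono power_mono)
      have "g0^2 * (999/1000 * \<delta>^2) \<le> g^2 * (999/1000 * \<delta>^2)" using g pre by (intro mult_right_mono power_mono) auto
      then show "p \<le> 1 + g^2 * (999/1000 * \<delta>^2) / 32" using c(3) by linarith
    qed (use c pre in auto)
    finally show ?thesis unfolding g2 g_def .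
  next
    case False
    then have g1: "g1 \<le> \<bar>zgam u\<bar>" by (simp add: g_def)
    have "row_cert L \<delta> t Q R e g1 xs (h # hs)" "zfree_list g1 xs" "g1 > 0" using 2(2,3) by simp_all
    from 2(1)[OF this 2(5-12) g1] show ?thesis .
  qed
qed auto

definition zeros :: "(real \<times> real) list" where
  "zeros = map (\<lambda>(n, \<eta>, _). (smooth n, \<eta>)) zero_table"

lemma zeros: "zfree_list (11/2) zeros"
  unfolding zeros_def by (rule zfree_certs[OF zero_table])

lemmas zeros_list = zeros_def[unfolded zero_table_def list.map prod.case smooth_def]

text \<open>\<open>k1\<close> and \<open>k2\<close> code powers of two above exp(-L/2) and exp(-L).
  The share 1/10^5 of \<epsilon> is reserved for the logarithmic term of \<open>psi_row\<close>. The
  data are checked at one \<open>L\<close> and serve all larger ones.\<close>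

definition full_cert where
  "full_cert L \<delta> t a \<mu> M n k1 k2 \<epsilon> hs \<longleftrightarrow> 0 < \<delta> \<and> \<delta> \<le> 1/20 \<and> 24 \<le> L \<and> 10 \<le> a \<and> (t = 0 \<or> t \<ge> 11/2) \<and> 0 \<le> \<mu> \<and> 0 \<le> M \<and>
    (a/2 + 1)^2 + (t/2)^2 \<le> smooth n \<and> (a - 1) / ((a - 1)^2 + t^2) + smooth_ln n / 4 - 5688/10000 \<le> M \<and>
    exp_cert (k1, 0) \<le> L / 2 \<and> exp_cert (k2, 0) \<le> L \<and> L * 10^5 * exp_bound (k2, 0) \<le> \<delta>^2 \<and>
    (1 + 102/100 * \<delta>^2) * (1 + 143/100 * \<delta> + \<mu> * M) + 1/10^5 \<le> 1 + \<epsilon> \<and>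
    row_cert L \<delta> t (((2*a - 1)^2 + 3)/4) (\<mu> * (kernel_const t * (2*a - 1))) (exp_bound (k1, 0)) (11/2) zeros hs"

lemma psi_le_full_cert:
  assumes c: "full_cert L0 \<delta> t a \<mu> M n k1 k2 \<epsilon> hs" and L: "L0 \<le> L"
  shows "psi (exp L) \<le> exp L * (1 + \<epsilon>)"
proof -
  have c1: "0 < \<delta>" "\<delta> \<le> 1/20" "24 \<le> L0" "10 \<le> a" "t = 0 \<or> t \<ge> 11/2" "0 \<le> \<mu>" "0 \<le> M" "(a/2 + 1)^2 + (t/2)^2 \<le> smooth n"
    "(a - 1) / ((a - 1)^2 + t^2) + smooth_ln n / 4 - 5688/10000 \<le> M" "exp_cert (k1, 0) \<le> L0 / 2"
    "exp_cert (k2, 0) \<le> L0" "L0 * 10^5 * exp_bound (k2, 0) \<le> \<delta>^2"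
    "(1 + 102/100 * \<delta>^2) * (1 + 143/100 * \<delta> + \<mu> * M) + 1/10^5 \<le> 1 + \<epsilon>"
    "row_cert L0 \<delta> t (((2*a - 1)^2 + 3)/4) (\<mu> * (kernel_const t * (2*a - 1))) (exp_bound (k1, 0)) (11/2) zeros hs"
    using c unfolding full_cert_def by simp_all
  have t: "t \<ge> 0" "a > 1" using c1 by auto
  have e: "exp (- L0 / 2) \<le> exp_bound (k1, 0)" using exp_cert[OF c1(10)] by simp
  have e1: "exp_bound (k1, 0) \<le> 1" by (simp add: exp_bound_def power_le_one)
  have row: "row_ok L0 \<delta> t a \<mu>" unfolding row_ok_def
  proof (intro allI impI)
    fix u assume u: "xi_sq u = 0"
    show "(exp (- L0 * (1 - zbeta u)) + exp (- L0 / 2)) * (1 / \<bar>zgam u\<bar> + 143/100 * \<delta>) * (((2*a - 1)^2 + 3)/4 + (\<bar>zgam u\<bar> - t)^2)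
      \<le> \<mu> * (kernel_const t * (2*a - 1)) * (1 + (zgam u)^2 * (999/1000 * \<delta>^2) / 32) ^ 16"
    proof (rule row_cert_sound[OF c1(14) zeros _ c1(1) _ _ _ t(1) e e1 u zgam_ge[OF u]])
      show "\<mu> * (kernel_const t * (2*a - 1)) \<ge> 0" using c1 t by (intro mult_nonneg_nonneg) (auto simp: kernel_const_def)
    qed (use c1 in auto)
  qed
  \<comment> \<open>\<open>L exp(-L)\<close> decreases, so the condition at \<open>L0\<close> is
    inherited; \<open>L \<le> L0 * exp (L - L0)\<close> expresses this.\<close>
  have LL: "L / \<delta>^2 \<le> exp L * (1/10^5)"
  proof -
    have "exp (- L0) \<le> exp_bound (k2, 0)" by (rule exp_cert[OF c1(11)])
    then have "L0 * 10^5 * exp (- L0) \<le> L0 * 10^5 * exp_bound (k2, 0)" using c1(3) by (intro mult_left_mono) auto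
    also have "\<dots> \<le> \<delta>^2" by (rule c1(12))
    finally have 1: "L0 * 10^5 \<le> \<delta>^2 * exp L0" by (simp add: exp_minus divide_simps)
    have 2: "L \<le> L0 * exp (L - L0)"
    proof -
      have "L \<le> L0 * (1 + (L - L0))" using mult_right_mono[of 1 L0 "L - L0"] c1 L by (simp add: algebra_simps)
      also have "\<dots> \<le> L0 * exp (L - L0)" using c1 by (intro mult_left_mono exp_ge_add_one_self) auto
      finally show ?thesis .
    qed
    have "L * 10^5 \<le> L0 * exp (L - L0) * 10^5" using 2 by simp
    also have "\<dots> = (L0 * 10^5) * exp (L - L0)" by simp
    also have "\<dots> \<le> (\<delta>^2 * exp L0) * exp (L - L0)" using 1 by (intro mult_right_mono) auto
    also have "\<dots> = \<delta>^2 * exp L" by (simp add: mult.assoc exp_add[symmetric])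
    finally show ?thesis using c1(1) by (simp add: divide_simps mult.commute)
  qed
  have "psi (exp L) \<le> exp L * ((1 + 102/100 * \<delta>^2) * (1 + 143/100 * \<delta> + \<mu> * M) + 1/10^5)"
    by (rule psi_row[OF c1(1-3) L LL t(2,1) c1(6) archr_Fr_le[OF c1(4,5,8,9)] c1(7) row])
  also have "\<dots> \<le> exp L * (1 + \<epsilon>)" using c1(13) by (intro mult_left_mono) auto
  finally show ?thesis .
qed

text \<open>From row 2 on \<delta> decreases with \<open>L\<close>, because the smoothing cost
  \<open>1.43 \<delta>\<close> must fit into the shrinking \<epsilon>. The damping then sets in at
  larger heights, and the comparison point \<open>a + i t\<close> moves outward with the zeros that
  matter. The last two rows use the real point \<open>a = 600\<close>, where the kernel counts
  fully.\<close>

lemma row_1: "full_cert 24 (37/1000) 60 15 (39/2000) (11619/10000) (3, 0, 3) 17 34 (1927/25000)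
    [((17, 1), 1001/1000), ((10, 1), 503/500), ((9, 0), 519/500), ((7, 2), 211/200), ((6, 0), 267/250), ((5, 1), 543/500), ((4, 0), 553/500), ((3, 1), 1153/1000), ((3, 0), 1221/1000), ((2, 2), 1273/1000), ((2, 1), 673/500), ((2, 0), 1427/1000), ((1, 2), 323/200), ((0, 0), 1961/1000)]"
  by (simp add: full_cert_def zeros_list kernel_const_def smooth_def smooth_ln_def exp_bound_def exp_cert_def power2_eq_square power_divide)

lemma row_2: "full_cert 32 (191/5000) 60 15 (8079/1000000) (11619/10000) (3, 0, 3) 23 46 (6561/100000)
    [((23, 0), 1001/1000), ((13, 3), 503/500), ((12, 0), 1041/1000), ((10, 0), 1059/1000), ((8, 1), 134/125), ((7, 0), 273/250), ((5, 2), 1113/1000), ((4, 1), 291/250), ((4, 0), 309/250), ((3, 2), 1291/1000), ((3, 0), 1369/1000), ((2, 2), 291/200), ((2, 1), 207/125), ((0, 0), 81/40)]"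
  by (simp add: full_cert_def zeros_list kernel_const_def smooth_def smooth_ln_def exp_bound_def exp_cert_def power2_eq_square power_divide)

lemma row_3: "full_cert 41 (327/10000) 70 25 (409/62500) (6269/5000) (5, 2, 1) 29 59 (5613/100000)
    [((29, 2), 1001/1000), ((17, 3), 251/250), ((15, 2), 103/100), ((12, 3), 1043/1000), ((10, 2), 1053/1000), ((9, 0), 1067/1000), ((7, 0), 1083/1000), ((5, 2), 28/25), ((5, 0), 1173/1000), ((4, 2), 1213/1000), ((4, 0), 127/100), ((3, 2), 1333/1000), ((2, 3), 37/25), ((2, 2), 1751/1000), ((0, 0), 2081/1000)]"
  by (simp add: full_cert_def zeros_list kernel_const_def smooth_def smooth_ln_def exp_bound_def exp_cert_def power2_eq_square power_divide)

lemma row_4: "full_cert 52 (269/10000) 90 40 (6491/1000000) (6957/5000) (2, 0, 4) 30 60 (4829/100000)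
    [((37, 2), 1), ((22, 2), 1003/1000), ((19, 3), 51/50), ((16, 1), 1029/1000), ((13, 2), 259/250), ((11, 2), 209/200), ((9, 0), 132/125), ((7, 1), 1081/1000), ((6, 2), 1117/1000), ((5, 3), 143/125), ((5, 0), 591/500), ((4, 1), 49/40), ((3, 2), 53/40), ((3, 1), 377/250), ((3, 0), 1731/1000), ((0, 0), 1903/1000)]"
  by (simp add: full_cert_def zeros_list kernel_const_def smooth_def smooth_ln_def exp_bound_def exp_cert_def power2_eq_square power_divide)

lemma row_5: "full_cert 65 (213/10000) 120 40 (569/100000) (944/625) (1, 4, 2) 30 60 (791/20000)
    [((40, 3), 1), ((28, 1), 501/500), ((24, 3), 253/250), ((20, 2), 509/500), ((16, 3), 511/500), ((14, 1), 257/250), ((11, 1), 207/200), ((9, 0), 21/20), ((8, 0), 1073/1000), ((7, 1), 109/100), ((6, 2), 557/500), ((5, 2), 1141/1000), ((4, 2), 1203/1000), ((4, 0), 659/500), ((3, 3), 729/500), ((3, 1), 783/500), ((0, 0), 377/200)]"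
  by (simp add: full_cert_def zeros_list kernel_const_def smooth_def smooth_ln_def exp_bound_def exp_cert_def power2_eq_square power_divide)

lemma row_6: "full_cert 86 (2/125) 140 50 (2619/500000) (15923/10000) (0, 2, 4) 30 60 (63/2000)
    [((40, 3), 1), ((37, 1), 1001/1000), ((32, 3), 1007/1000), ((27, 0), 101/100), ((22, 1), 253/250), ((19, 0), 127/125), ((14, 3), 1019/1000), ((12, 0), 257/250), ((10, 3), 1041/1000), ((9, 2), 1051/1000), ((8, 2), 133/125), ((7, 1), 1079/1000), ((6, 0), 223/200), ((5, 1), 1179/1000), ((5, 0), 629/500), ((4, 1), 1319/1000), ((3, 3), 1499/1000), ((3, 1), 1719/1000), ((0, 0), 1139/500)]"
  by (simp add: full_cert_def zeros_list kernel_const_def smooth_def smooth_ln_def exp_bound_def exp_cert_def power2_eq_square power_divide)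

lemma row_7: "full_cert 117 (139/10000) 160 80 (2651/1000000) (8419/5000) (2, 4, 2) 30 60 (307/12500)
    [((40, 3), 1), ((40, 3), 1), ((40, 3), 201/200), ((37, 0), 1007/1000), ((30, 1), 1009/1000), ((26, 0), 253/250), ((20, 1), 203/200), ((16, 1), 1021/1000), ((14, 2), 1031/1000), ((13, 0), 519/500), ((11, 3), 131/125), ((10, 0), 53/50), ((8, 1), 543/500), ((7, 1), 227/200), ((6, 3), 239/200), ((5, 3), 1241/1000), ((5, 1), 172/125), ((4, 2), 771/500), ((0, 0), 393/200)]"
  by (simp add: full_cert_def zeros_list kernel_const_def smooth_def smooth_ln_def exp_bound_def exp_cert_def power2_eq_square power_divide)

lemma row_8: "full_cert 162 (1/100) 250 100 (727/500000) (9441/5000) (11, 2, 0) 30 60 (429/25000)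
    [((40, 3), 1), ((40, 3), 1), ((40, 3), 501/500), ((40, 3), 251/250), ((40, 3), 251/250), ((36, 0), 503/500), ((28, 0), 1007/1000), ((22, 2), 1011/1000), ((20, 1), 127/125), ((18, 0), 1019/1000), ((16, 1), 41/40), ((13, 3), 1031/1000), ((11, 2), 261/250), ((10, 0), 107/100), ((9, 1), 1101/1000), ((8, 1), 281/250), ((7, 1), 239/200), ((6, 1), 32/25), ((5, 3), 1499/1000), ((5, 1), 89/50), ((0, 0), 2123/1000)]"
  by (simp add: full_cert_def zeros_list kernel_const_def smooth_def smooth_ln_def exp_bound_def exp_cert_def power2_eq_square power_divide)

lemma row_9: "full_cert 257 (27/5000) 250 200 (587/500000) (987/500) (6, 4, 1) 30 60 (63/6250)
    [((40, 3), 1), ((40, 3), 1), ((40, 3), 1), ((40, 3), 1001/1000), ((40, 3), 1001/1000), ((40, 3), 1001/1000), ((40, 3), 501/500), ((36, 0), 1003/1000), ((32, 1), 251/250), ((28, 3), 201/200), ((25, 3), 1007/1000), ((22, 0), 1009/1000), ((18, 1), 1013/1000), ((16, 0), 51/50), ((15, 0), 1029/1000), ((13, 0), 259/250), ((11, 3), 132/125), ((10, 0), 1081/1000), ((9, 0), 229/200), ((8, 1), 1227/1000), ((7, 2), 1327/1000), ((6, 3), 791/500), ((6, 0), 191/100), ((0, 0), 381/125)]"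
  by (simp add: full_cert_def zeros_list kernel_const_def smooth_def smooth_ln_def exp_bound_def exp_cert_def power2_eq_square power_divide)

lemma row_10: "full_cert 499 (177/100000) 0 600 (203/400000) (22881/10000) (0, 6, 3) 30 60 (371/100000)
    [((40, 3), 1), ((40, 3), 1), ((40, 3), 1), ((40, 3), 1), ((40, 3), 1), ((40, 3), 1), ((40, 3), 1), ((40, 3), 1), ((40, 3), 1), ((40, 3), 1), ((40, 3), 1), ((40, 3), 1), ((35, 3), 1001/1000), ((31, 1), 501/500), ((29, 0), 1003/1000), ((25, 1), 1003/1000), ((23, 0), 503/500), ((19, 3), 126/125), ((17, 3), 203/200), ((16, 1), 128/125), ((14, 2), 207/200), ((13, 1), 531/500), ((11, 3), 1097/1000), ((10, 3), 61/50), ((9, 2), 1391/1000), ((8, 3), 47/25), ((0, 0), 641/250)]"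
  by (simp add: full_cert_def zeros_list kernel_const_def smooth_def smooth_ln_def exp_bound_def exp_cert_def power2_eq_square power_divide)

lemma row_11: "full_cert 1664 (39/100000) 0 600 (1631/100000000) (22881/10000) (0, 6, 3) 30 60 (61/100000)
    [((40, 3), 1), ((40, 3), 1), ((40, 3), 1), ((40, 3), 1), ((40, 3), 1), ((40, 3), 1), ((40, 3), 1), ((40, 3), 1), ((40, 3), 1), ((40, 3), 1), ((40, 3), 1), ((40, 3), 1), ((40, 3), 1), ((40, 3), 1), ((40, 3), 1), ((40, 3), 1), ((40, 3), 1), ((40, 3), 1), ((40, 3), 1), ((40, 3), 1001/1000), ((40, 3), 1001/1000), ((40, 3), 1003/1000), ((39, 1), 251/250), ((36, 1), 101/100), ((32, 1), 509/500), ((29, 3), 521/500), ((27, 0), 43/40), ((24, 0), 117/100), ((21, 2), 737/500), ((0, 0), 2899/1000)]"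
  by (simp add: full_cert_def zeros_list kernel_const_def smooth_def smooth_ln_def exp_bound_def exp_cert_def power2_eq_square power_divide)

section \<open>The range \<open>L \<ge> 4000\<close>\<close>

lemma zero_free_generic:
  assumes u: "xi_sq u = 0" and g: "\<bar>zgam u\<bar> \<ge> 20000"
  shows "1 / (20 * ln \<bar>zgam u\<bar>) \<le> 1 - zbeta u"
proof -
  define g where "g = \<bar>zgam u\<bar>"
  define T where "T = ln g"
  define x where "x = 1 / T"
  have g: "g \<ge> 20000" using assms by (simp add: g_def)
  have "ln (20000::real) = 5 * ln 2 + 4 * ln 5"
    using ln_mult_pos[of 32 "625::real"] ln_realpow[of 2 5] ln_realpow[of 5 4] by simp
  then have "ln (20000::real) \<ge> 99/10" using ln_2_bounds ln_5_ge' by simp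
  moreover have "ln 20000 \<le> T" using g by (simp add: T_def)
  ultimately have T: "T \<ge> 99/10" by linarith
  have x: "x > 0" "x \<le> 10/99" using T by (auto simp: x_def divide_simps)
  \<comment> \<open>With \<kappa> = 4/9 and \<sigma>1 = 13/8 one has
    \<open>\<kappa> (2 \<sigma>1 - 1) = 1\<close>. For \<sigma> - 1 = x/3 and \<eta> = x/20 the
    coefficient of \<open>T = 1/x\<close> is 9 + 25/18 = 187/18 on the right and 4/(1/3 + 1/20) =
    240/23 on the left, which is larger.\<close>
  define \<sigma> where "\<sigma> = 1 + x / 3"
  define \<eta> where "\<eta> = x / 20"
  have s: "1 < \<sigma>" "\<sigma> \<le> 311/300" using x by (auto simp: \<sigma>_def)
  have e: "0 < \<eta>" "\<eta> \<le> 1/100" using x by (auto simp: \<eta>_def)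
  have "\<eta> \<le> 1 - zbeta u"
  proof (rule zero_free[OF u _ order_refl order_refl s(1), of "13/8" "4/9"])
    show "11/2 \<le> \<bar>zgam u\<bar>" using g by (simp add: g_def)
    show "4/9 * (2 * (13/8) - 1) * ((2 * \<sigma> - 1)^2 + 3) \<le> (2 * \<sigma> - 1) * ((2 * (13/8) - 1)^2 - (1::real))"
    proof -
      have "(\<sigma> - 1) * (2 * \<sigma> - 3) \<le> 0" using s by (intro mult_nonneg_nonpos) auto
      then have "2 * \<sigma>^2 \<le> 5 * \<sigma> - 3" by (simp add: power2_eq_square algebra_simps)
      moreover have "(2 * \<sigma> - 1)^2 = 4 * \<sigma>^2 - 4 * \<sigma> + 1" by (simp add: power2_eq_square algebra_simps)
      ultimately have "(2 * \<sigma> - 1)^2 + 3 \<le> 6 * \<sigma> - 2" by linarith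
      moreover have "4/9 * (2 * (13/8) - 1) = (1::real)" "(2 * (13/8) - 1)^2 - (1::real) = 65/16" by (simp_all add: power2_eq_square)
      ultimately show ?thesis using s by (simp only: mult_1_left) simp
    qed
    have g2: "g^2 \<ge> 20000^2" using g by (intro power_mono) auto
    have r1: "3 * (1 / (\<sigma> - 1) - 4/9 / (13/8 - 1)) = 9 * T - 32/15"
      using T by (simp add: \<sigma>_def x_def)
    have r2: "511/1000 + (3/5 * (\<sigma>/2 + 1) - 1) - 1 / (\<sigma> + 2) \<le> 1/10"
    proof -
      have 1: "1 / (911/300) \<le> 1 / (\<sigma> + 2)" using s by (intro divide_left_mono) auto
      have "511/1000 + (3/5 * (x/2 + 1) - 1) - y \<le> 1/10" if "1 / (911/300) \<le> y" "x \<le> 311/300" for x y :: real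
        using that by (simp add: field_simps)
      from this[OF 1 s(2)] show ?thesis .
    qed
    have r3: "17/4 * ((\<sigma> - 1) + (1 - 4/9) * ((13/8)/2 + 1)^2 + 2 * (4/9) * (((13/8)/2 + 1) / 2 + 21/40)) / g^2 \<le> 1/100"
    proof -
      have "17/4 * ((\<sigma> - 1) + (1 - 4/9) * ((13/8)/2 + 1)^2 + 2 * (4/9) * (((13/8)/2 + 1) / 2 + 21/40)) \<le> 20"
        using s by (simp add: power2_eq_square)
      also have "20 \<le> 1/100 * g^2" using g2 by simp
      finally show ?thesis using g2 by (subst pos_divide_le_eq) auto
    qed
    have "zf_rhs \<sigma> (4/9) (13/8) g T \<le> (9 * T - 32/15) + (1 - 4/9) * (5/2 * T - 2 * (69314/100000) - 4 * (11446/10000)) +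
      3/2 * (1 - 4/9) * (1/10) + 1/100"
      unfolding zf_rhs_def r1 by (intro add_mono mult_left_mono r2 r3 order_refl) auto
    also have "\<dots> \<le> 187/18 * T - 53/10" by (simp add: field_simps)
    finally have R: "zf_rhs \<sigma> (4/9) (13/8) g T \<le> 187/18 * T - 53/10" .
    have l1: "(2 * \<sigma> - 1) / (((2 * \<sigma> - 1)^2 - (1 - 2 * \<eta>)^2) / 4) \<ge> 60/23 * T"
    proof -
      define a b where "a = \<sigma> - 1 + \<eta>" and "b = \<sigma> - \<eta>"
      have ab: "a > 0" "b > 0" using s e by (auto simp: a_def b_def)
      have "2 * \<sigma> - 1 = a + b" "((2 * \<sigma> - 1)^2 - (1 - 2 * \<eta>)^2) / 4 = a * b"
        by (simp_all add: a_def b_def power2_eq_square field_simps)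
      then have "(2 * \<sigma> - 1) / (((2 * \<sigma> - 1)^2 - (1 - 2 * \<eta>)^2) / 4) = 1 / a + 1 / b"
        using ab by (simp add: divide_simps)
      moreover have "1 / a = 60/23 * T" using T by (simp add: a_def \<sigma>_def \<eta>_def x_def)
      ultimately show ?thesis using ab by simp
    qed
    have l2: "4/9 * ((2 * (13/8) - 1) / (((2 * (13/8) - 1)^2 - (1 - 2 * \<eta>)^2) / 4)) \<le> (1::real)"
    proof -
      have "(1 - 2 * \<eta>)^2 \<le> 1^2" using e by (intro power_mono) auto
      then have d: "((2 * (13/8) - 1)^2 - (1 - 2 * \<eta>)^2) / 4 \<ge> (1::real)" by (simp add: power2_eq_square)
      have "(2 * (13/8) - 1) / (((2 * (13/8) - 1)^2 - (1 - 2 * \<eta>)^2) / 4) \<le> (2 * (13/8) - 1) / (1::real)"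
        using d by (intro divide_left_mono) auto
      then show ?thesis by simp
    qed
    have "240/23 * T - 4 \<le> 4 * (a - b)" if "60/23 * T \<le> a" "b \<le> 1" for a b :: real using that by (simp add: algebra_simps)
    from this[OF l1 l2] have "zf_lhs \<sigma> (4/9) (13/8) \<eta> \<ge> 240/23 * T - 4" unfolding zf_lhs_def .
    then have "zf_rhs \<sigma> (4/9) (13/8) g T < zf_lhs \<sigma> (4/9) (13/8) \<eta>" using R T by linarith
    then show "zf_rhs \<sigma> (4/9) (13/8) \<bar>zgam u\<bar> (ln \<bar>zgam u\<bar>) < zf_lhs \<sigma> (4/9) (13/8) \<eta>"
      by (simp add: g_def T_def)
  qed (use s e in auto)
  then show ?thesis by (simp add: \<eta>_def x_def T_def g_def)
qed

lemma zfree_list_min: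
  assumes "zfree_list g0 xs" "\<forall>(g1, \<eta>)\<in>set xs. c \<le> \<eta>" "xi_sq u = 0" "g0 \<le> \<bar>zgam u\<bar>" "xs \<noteq> []" "\<bar>zgam u\<bar> \<le> fst (last xs)"
  shows "c \<le> 1 - zbeta u"
  using assms
proof (induction xs arbitrary: g0)
  case (Cons y xs)
  obtain g1 \<eta> where y: "y = (g1, \<eta>)" by (cases y)
  show ?case
  proof (cases "\<bar>zgam u\<bar> \<le> g1")
    case True
    then have "\<eta> \<le> 1 - zbeta u" using Cons.prems by (simp add: y zfree_def)
    then show ?thesis using Cons.prems(2) by (simp add: y)
  next
    case False
    then have "xs \<noteq> []" using Cons.prems(6) by (auto simp: y)
    then show ?thesis using Cons.IH[of g1] Cons.prems False by (simp add: y)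
  qed
qed simp

lemma zero_free_low:
  assumes u: "xi_sq u = 0" and g: "\<bar>zgam u\<bar> \<le> 20000"
  shows "1/120 \<le> 1 - zbeta u"
proof (rule zfree_list_min[OF zeros _ u zgam_ge[OF u]])
  show "\<forall>(g1, \<eta>)\<in>set zeros. 1/120 \<le> \<eta>" by (simp add: zeros_list)
  show "zeros \<noteq> []" by (simp add: zeros_list)
  show "\<bar>zgam u\<bar> \<le> fst (last zeros)" using g by (simp add: zeros_list)
qed

lemma ln_4000_bounds: "ln (4000::real) \<ge> 829/100" "ln (4000::real) \<le> 83/10"
proof -
  have "ln (4000::real) = 5 * ln 2 + 3 * ln 5"
    using ln_mult_pos[of 32 "125::real"] ln_realpow[of 2 5] ln_realpow[of 5 3] by simp
  then show "ln (4000::real) \<ge> 829/100" "ln (4000::real) \<le> 83/10" using ln_2_bounds ln_5_ge' ln_5_le by simp_all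
qed

text \<open>For these parameters the right side is nearly the damping \<open>P\<close>, and the left
  side is at most a multiple of \<open>E L^2 (1 + z)\<close> with \<open>z = (\<gamma>/L)^2\<close>.
  Up to height 20000 the table gives \<open>1 - \<beta> \<ge> 1/120\<close>; up to
  \<open>L^(3/2)\<close> the distance \<open>1/(20 ln \<gamma>)\<close> still makes \<open>E\<close>
  of order \<open>1/L^2\<close>; beyond that \<open>z \<ge> L\<close>, and
  \<open>P \<ge> 100 z^2\<close> wins although \<open>E\<close> is only bounded by 2.\<close>

lemma row_ok_generic:
  assumes L: "L \<ge> 4000"
  shows "row_ok L (1 / L) 0 L (1 / (2 * L))"
  unfolding row_ok_def
proof (intro allI impI)
  fix u assume u: "xi_sq u = 0"
  define l where "l = ln L"
  define g where "g = \<bar>zgam u\<bar>"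
  define z where "z = g^2 / L^2"
  define P where "P = (1 + 999/32000 * z) ^ 16"
  define E where "E = exp (- L * (1 - zbeta u)) + exp (- L / 2)"
  have L0: "L > 0" using L by simp
  have z0: "z \<ge> 0" by (simp add: z_def)
  have g: "g \<ge> 11/2" using zgam_ge[OF u] by (simp add: g_def)
  have l: "l \<ge> 829/100" using ln_4000_bounds L unfolding l_def by (intro order_trans[OF ln_4000_bounds(1)]) simp
  have lu: "l \<le> 73/10 + L / 4000"
  proof -
    have "ln (L / 4000) \<le> L / 4000 - 1" using L by (intro ln_le_minus_one) auto
    then show ?thesis using ln_4000_bounds L by (simp add: l_def ln_div)
  qed
  have expl: "exp (2 * l) = L^2" using L0 exp_of_nat_mult[of 2 l] by (simp add: l_def)
  have half: "exp (- L / 2) \<le> 1 / L^2"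
  proof -
    have "exp (- L / 2) \<le> exp (- (2 * l))" using lu L by simp
    then show ?thesis using expl by (simp add: exp_minus inverse_eq_divide)
  qed
  have Q: "((2 * L - 1)^2 + 3)/4 + (g - 0)^2 \<le> L^2 * (1 + z)"
    using L by (simp add: z_def distrib_left power2_eq_square field_simps)
  have Q0: "((2 * L - 1)^2 + 3)/4 + (g - 0)^2 \<ge> 0" by simp
  have P1: "1 + z \<le> 201/100 * P"
  proof -
    have "1 + 16 * (999/32000 * z) \<le> P" using Bernoulli_inequality[of "999/32000 * z" 16] z0 by (simp add: P_def)
    then show ?thesis using z0 by linarith
  qed
  have P0: "P \<ge> 0" using P1 z0 by linarith
  have E0: "E \<ge> 0" by (simp add: E_def add_nonneg_nonneg)
  have E2: "E \<le> 2"
  proof -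
    have "- L * (1 - zbeta u) \<le> 0" "- L / 2 \<le> 0" using L0 zbeta_le[OF u] by auto
    then show ?thesis unfolding E_def
      using exp_le_one_iff[of "- L * (1 - zbeta u)"] exp_le_one_iff[of "- L / 2"] by linarith
  qed
  have fin: "E * (1 / g + 143/100 * (1 / L)) * (((2 * L - 1)^2 + 3)/4 + (g - 0)^2) \<le> 99/100 * P"
    if "E * w * (L^2 * (1 + z)) \<le> 99/100 * P" "1 / g + 143/100 * (1 / L) \<le> w" for w
  proof -
    have w0: "1 / g + 143/100 * (1 / L) \<ge> 0" using g L0 by simp
    have "E * (1 / g + 143/100 * (1 / L)) * (((2 * L - 1)^2 + 3)/4 + (g - 0)^2) \<le> E * w * (L^2 * (1 + z))"
      using that(2) w0 E0 Q Q0 by (intro mult_mono) auto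
    then show ?thesis using that(1) by linarith
  qed
  have small: "E * w * (L^2 * (1 + z)) \<le> 99/100 * P" if "E \<le> c / L^2" "c * w \<le> 49/100" "w \<ge> 0" for c w
  proof -
    have "E * w * (L^2 * (1 + z)) \<le> c / L^2 * w * (L^2 * (1 + z))" using that z0 by (intro mult_right_mono) auto
    also have "\<dots> = c * w * (1 + z)" using L0 by simp
    also have "\<dots> \<le> 49/100 * (1 + z)" using that z0 by (intro mult_right_mono) auto
    also have "\<dots> \<le> 99/100 * P" using mult_left_mono[OF P1, of "49/100"] P0 by simp
    finally show ?thesis .
  qed
  have main: "E * (1 / g + 143/100 * (1 / L)) * (((2 * L - 1)^2 + 3)/4 + (g - 0)^2) \<le> 99/100 * P"
  proof (cases "g \<le> 20000")
    case True
    have "L * (1/120) \<le> L * (1 - zbeta u)" using zero_free_low[OF u] True L0 by (intro mult_left_mono) (auto simp: g_def)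
    then have "2 * l \<le> L * (1 - zbeta u)" using lu L by linarith
    then have "exp (- L * (1 - zbeta u)) \<le> exp (- (2 * l))" by simp
    then have "exp (- L * (1 - zbeta u)) \<le> 1 / L^2" using expl by (simp add: exp_minus inverse_eq_divide)
    then have E: "E \<le> 2 / L^2" using half unfolding E_def by (simp add: add_divide_distrib)
    have w: "1 / g + 143/100 * (1 / L) \<le> 2/10"
    proof -
      have "1 / g \<le> 1 / (11/2)" "1 / L \<le> 1 / 4000" using g L by (intro divide_left_mono; simp)+
      then show ?thesis by simp
    qed
    show ?thesis by (rule fin[OF small[OF E] w]) simp_all
  next
    case False
    have w1: "1 / g \<le> 1 / 20000" "1 / L \<le> 1 / 4000" using False L by (intro divide_left_mono; simp)+
    show ?thesis
    proof (cases "ln g \<le> 3/2 * l")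
      case True
      have lg: "ln g > 0" using False by simp
      have "1 / (30 * l) \<le> 1 / (20 * ln g)" using True lg l by (intro divide_left_mono) auto
      also have "\<dots> \<le> 1 - zbeta u" using zero_free_generic[OF u] False by (simp add: g_def)
      finally have "L * (1 / (30 * l)) \<le> L * (1 - zbeta u)" using L0 by (intro mult_left_mono) auto
      \<comment> \<open>The offset 4 is what \<open>L = 4000\<close> requires: there
        \<open>60 l^2\<close> would exceed 4000, whereas \<open>30 l (2 l - 4)\<close> is about
        3130. For larger \<open>L\<close> the quadratic Taylor bound of exp in
        \<open>s = l - ln 4000\<close> suffices.\<close>
      moreover have "2 * l - 4 \<le> L * (1 / (30 * l))"
      proof -
        define s where "s = l - ln 4000"
        have s: "s \<ge> 0" using L by (simp add: s_def l_def)
        have "L = 4000 * exp s" using L0 by (simp add: s_def l_def exp_diff)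
        moreover have "1 + s + s^2 / 2 \<le> exp s" by (rule exp_lower_Taylor_quadratic[OF s])
        ultimately have L4: "L \<ge> 4000 * (1 + s + s^2/2)" by simp
        have lb: "l \<le> 83/10 + s" using ln_4000_bounds by (simp add: s_def)
        have "(2 * l - 4) * (30 * l) \<le> (2 * (83/10 + s) - 4) * (30 * (83/10 + s))"
          using lb l by (intro mult_mono) auto
        also have "\<dots> \<le> 4000 * (1 + s + s^2/2)" using s by (simp add: power2_eq_square algebra_simps)
        finally have "(2 * l - 4) * (30 * l) \<le> L" using L4 by linarith
        then show ?thesis using l by (simp add: pos_le_divide_eq)
      qed
      ultimately have "exp (- L * (1 - zbeta u)) \<le> exp (4 - 2 * l)" by simp
      also have "\<dots> = exp 4 / L^2" by (simp only: exp_diff expl)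
      also have "\<dots> \<le> 81 / L^2"
      proof -
        have "exp (4::real) = exp 1 ^ 4" using exp_of_nat_mult[of 4 "1::real"] by simp
        also have "\<dots> \<le> 3 ^ 4" using exp_le by (intro power_mono) auto
        finally show ?thesis by (intro divide_right_mono) auto
      qed
      finally have E: "E \<le> 82 / L^2" using half unfolding E_def by (simp add: add_divide_distrib)
      have w: "1 / g + 143/100 * (1 / L) \<le> 1/2000" using w1 by simp
      show ?thesis by (rule fin[OF small[OF E] w]) simp_all
    next
      case False
      have "exp (3 * l) \<le> exp (2 * ln g)" using False by simp
      also have "\<dots> = g^2" using exp_of_nat_mult[of 2 "ln g"] g by simp
      finally have "L ^ 3 \<le> g^2" using exp_of_nat_mult[of 3 l] L0 by (simp add: l_def)
      then have zL: "L \<le> z" using L0 by (simp add: z_def pos_le_divide_eq power2_eq_square power3_eq_cube)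
      have "1 * L^2 \<le> g^2"
      proof -
        have "1 * L^2 \<le> L * L^2" using L by (intro mult_right_mono) auto
        also have "\<dots> = L ^ 3" by (simp add: power2_eq_square power3_eq_cube)
        finally show ?thesis using \<open>L ^ 3 \<le> g^2\<close> by simp
      qed
      then have gL: "L \<le> g" using g power2_le_imp_le[of L g] by simp
      have w: "1 / g + 143/100 * (1 / L) \<le> 243/100 * (1 / L)"
      proof -
        have "1 / g \<le> 1 / L" using gL L0 by (intro divide_left_mono) auto
        then show ?thesis by simp
      qed
      have z4: "z \<ge> 4000" using zL L by simp
      have "E * (243/100 * (1 / L)) * (L^2 * (1 + z)) \<le> 2 * (243/100 * (1 / L)) * (L^2 * (1 + z))"
        using E2 L0 z0 by (intro mult_right_mono) auto
      also have "\<dots> = 486/100 * (L * (1 + z))" using L0 by (simp add: power2_eq_square)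
      also have "\<dots> \<le> 486/100 * (z * (2 * z))" using zL z4 L0 by (intro mult_left_mono mult_mono) auto
      also have "\<dots> \<le> 99/100 * P"
      proof -
        define y where "y = 999/32000 * z"
        have "1 + 4 * y \<le> (1 + y) ^ 4" using Bernoulli_inequality[of y 4] z0 by (simp add: y_def)
        then have "(1 + 4 * y) ^ 4 \<le> ((1 + y) ^ 4) ^ 4" using z0 by (intro power_mono) (auto simp: y_def)
        moreover have "((1 + y) ^ 4) ^ 4 = P" by (simp add: P_def y_def power_mult[symmetric])
        moreover have "(4 * y) ^ 4 \<le> (1 + 4 * y) ^ 4" using z0 by (intro power_mono) (auto simp: y_def)
        moreover have "z^2 * 100 \<le> (4 * y) ^ 4"
        proof -
          have "12/100 * z \<le> 4 * y" using z0 by (simp add: y_def)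
          then have "(12/100 * z) ^ 4 \<le> (4 * y) ^ 4" using z0 by (intro power_mono) auto
          moreover have "z^2 * 4000^2 \<le> z^2 * z^2" using z4 by (intro mult_left_mono power_mono) auto
          moreover have "(12/100 * z) ^ 4 = 20736/100000000 * (z^2 * z^2)" by (simp add: eval_nat_numeral)
          moreover have "w * 100 \<le> r" if "a \<le> r" "w * 4000^2 \<le> v" "a = 20736/100000000 * v" "0 \<le> w" for a r w v :: real
            using that by simp
          ultimately show ?thesis using zero_le_power2[of z] by blast
        qed
        ultimately have "z^2 * 100 \<le> P" by linarith
        moreover have "486/100 * (z * (2 * z)) \<le> 99/100 * p" if "z^2 * 100 \<le> p" for p
        proof -
          have "z * z \<ge> 0" by simp
          then show ?thesis using that unfolding power2_eq_square by linarith
        qed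
        ultimately show ?thesis by blast
      qed
      finally show ?thesis by (intro fin[OF _ w])
    qed
  qed
  have "99/100 * P \<le> 1 / (2 * L) * (kernel_const 0 * (2 * L - 1)) * P"
    using L P0 by (intro mult_right_mono) (auto simp: kernel_const_def field_simps)
  also have PP: "P = (1 + (zgam u)^2 * (999/1000 * (1 / L)^2) / 32) ^ 16"
  proof -
    have "999/32000 * z = (zgam u)^2 * (999/1000 * (1 / L)^2) / 32" by (simp add: z_def g_def power_divide mult.commute)
    then show ?thesis by (simp only: P_def)
  qed
  finally have "E * (1 / \<bar>zgam u\<bar> + 143/100 * (1 / L)) * (((2 * L - 1)^2 + 3)/4 + (\<bar>zgam u\<bar> - 0)^2) \<le> 1 / (2 * L) * (kernel_const 0 * (2 * L - 1)) * (1 + (zgam u)^2 * (999/1000 * (1 / L)^2) / 32) ^ 16"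
    using main unfolding g_def PP by linarith
  then show "(exp (- L * (1 - zbeta u)) + exp (- L / 2)) * (1 / \<bar>zgam u\<bar> + 143/100 * (1 / L)) * (((2 * L - 1)^2 + 3)/4 + (\<bar>zgam u\<bar> - 0)^2) \<le> 1 / (2 * L) * (kernel_const 0 * (2 * L - 1)) * (1 + (zgam u)^2 * (999/1000 * (1 / L)^2) / 32) ^ 16"
    unfolding E_def .
qed

text \<open>The zeros cost \<open>ln L / (4 L)\<close>. The other half of the claimed error pays for
  the smoothing, \<open>1.43 / L\<close>, and for the small terms, because \<open>ln L / 4\<close>
  exceeds 2.\<close>

lemma psi_le_generic:
  assumes L: "L \<ge> 4000"
  shows "psi (exp L) \<le> exp L * (1 + ln L / (2 * L))"
proof -
  define l where "l = ln L"
  have L0: "L > 0" using L by simp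
  have l: "l \<ge> 829/100" using ln_4000_bounds L unfolding l_def by (intro order_trans[OF ln_4000_bounds(1)]) simp
  have M: "archr L 0 + Fr L \<le> l / 2"
  proof -
    have 1: "ln (L/2 + 1) \<le> l" using L unfolding l_def by (subst ln_le_cancel_iff) auto
    have 2: "1 / (L - 1) \<le> 1/3999" using L by (intro divide_left_mono) auto
    have 3: "archr L 0 \<le> 1 / (L - 1) - ln pi / 2 + ln (L/2 + 1) / 2" by (rule archr_0_le) (use L in simp)
    have 4: "Fr L \<le> 35/10000" by (rule Fr_le) (use L in simp)
    have "x + f \<le> l / 2" if "a \<le> l" "b \<le> 1/3999" "x \<le> b - p / 2 + a / 2" "f \<le> 35/10000" "p \<ge> 11446/10000" for a b x f p :: real
      using that by (simp add: field_simps)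
    from this[OF 1 2 3 4 ln_pi_ge] show ?thesis .
  qed
  have e: "L / (1 / L)^2 \<le> exp L * (1 / (10 * L))"
  proof -
    have "L / 8 \<le> exp (L / 8)" using exp_ge_add_one_self[of "L / 8"] by linarith
    then have "(L / 8) ^ 8 \<le> exp (L / 8) ^ 8" using L by (intro power_mono) auto
    also have "\<dots> = exp L" using exp_of_nat_mult[of 8 "L / 8"] by simp
    finally have "(L / 8) ^ 8 \<le> exp L" .
    moreover have "(L / 8) ^ 8 = (L / 8^2) ^ 4 * L ^ 4" by (simp add: power_divide power_add[symmetric])
    moreover have "2 ^ 4 \<le> (L / 8^2) ^ 4" using L by (intro power_mono) auto
    then have "16 \<le> (L / 8^2) ^ 4" by simp
    then have "16 * L ^ 4 \<le> (L / 8^2) ^ 4 * L ^ 4" by (intro mult_right_mono) auto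
    moreover have "L ^ 4 \<ge> 0" by simp
    ultimately have "10 * L ^ 4 \<le> exp L" by linarith
    then have "10 * L ^ 4 / (10 * L) \<le> exp L / (10 * L)" using L0 by (intro divide_right_mono) auto
    then show ?thesis using L0 by (simp add: power_divide eval_nat_numeral)
  qed
  have "psi (exp L) \<le> exp L * ((1 + 102/100 * (1 / L)^2) * (1 + 143/100 * (1 / L) + 1 / (2 * L) * (l / 2)) + 1 / (10 * L))"
    by (rule psi_row[OF _ _ _ order_refl e _ _ _ M _ row_ok_generic[OF L]])
      (use L l in \<open>auto simp: divide_simps\<close>)
  also have "\<dots> \<le> exp L * (1 + l / (2 * L))"
  proof (rule mult_left_mono)
    define y where "y = 1 / L"
    have y: "y > 0" "y \<le> 1/4000" using L by (auto simp: y_def divide_simps)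
    have yl: "y * l \<le> 1"
      using ln_le_minus_one[of L] L by (simp add: y_def l_def divide_simps)
    have "102/100 * y^2 * (1 + 143/100 * y + y * l / 4) \<le> 102/100 * y^2 * 2" using y yl by (intro mult_left_mono) auto
    also have "\<dots> = y * (204/100 * y)" by (simp add: power2_eq_square)
    also have "\<dots> \<le> y * (1/1000)" using y by (intro mult_left_mono) auto
    finally have "(1 + 102/100 * y^2) * (1 + 143/100 * y + y * l / 4) + y / 10 \<le> 1 + 153/100 * y + y * l / 4 + 1/1000 * y"
      by (simp add: algebra_simps)
    moreover have "y * (829/100) \<le> y * l" using l y by (intro mult_left_mono) auto
    then have y8: "829/100 * y \<le> y * l" by simp
    ultimately have "(1 + 102/100 * y^2) * (1 + 143/100 * y + y * l / 4) + y / 10 \<le> 1 + y * l / 2" using y(1) by linarith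
    moreover have "1 / (2 * L) * (l / 2) = y * l / 4" "l / (2 * L) = y * l / 2" "1 / (10 * L) = y / 10" by (simp_all add: y_def)
    ultimately show "(1 + 102/100 * (1 / L)^2) * (1 + 143/100 * (1 / L) + 1 / (2 * L) * (l / 2)) + 1 / (10 * L) \<le> 1 + l / (2 * L)"
      unfolding y_def[symmetric] by (simp only:)
  qed simp
  finally show ?thesis by (simp add: l_def)
qed

subsection \<open>Chebyshev estimates\<close>

text \<open>The coefficients divided by 1, 2, 3, 5, 7, 10, 14, 15 respectively sum to 0, which makes
  this combination of floors periodic with period 210 and cancels the terms \<open>x ln x\<close> of
  the factorials.\<close>

definition cheb :: "nat \<Rightarrow> int" where
  "cheb m = 4 * int m - 4 * int (m div 2) - 4 * int (m div 3) - 3 * int (m div 5) - 4 * int (m div 7) + 3 * int (m div 10) + int (m div 14) + 2 * int (m div 15)"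

lemma cheb_period: "cheb (m + 210) = cheb m"
proof -
  have d: "(m + 210) div 2 = m div 2 + 105" "(m + 210) div 3 = m div 3 + 70" "(m + 210) div 5 = m div 5 + 42" "(m + 210) div 7 = m div 7 + 30"
    "(m + 210) div 10 = m div 10 + 21" "(m + 210) div 14 = m div 14 + 15" "(m + 210) div 15 = m div 15 + 14" by simp_all
  show ?thesis unfolding cheb_def d by simp
qed

definition cheb_ok :: "nat \<Rightarrow> bool" where
  "cheb_ok m \<longleftrightarrow> cheb m \<ge> -2 \<and> (m \<ge> 1 \<longrightarrow> cheb m + (if m \<ge> 6 then 3 else 0) + (if m \<ge> 28 then 2 else 0) + (if m \<ge> 36 then 1 else 0) \<ge> 4)"

lemma cheb_list: "cheb_ok 0 \<and> cheb_ok 1 \<and> list_all cheb_ok [2..<210]"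
  by (simp add: upt_rec_numeral cheb_ok_def cheb_def)

lemma cheb_ok:
  assumes "m < 210"
  shows "cheb_ok m"
proof -
  have "m = 0 \<or> m = 1 \<or> m \<in> set [2..<210]" unfolding set_upt atLeastLessThan_iff using assms by linarith
  then show ?thesis using cheb_list unfolding list_all_iff by blast
qed

text \<open>From 36 on the three corrections add up to 6, so by periodicity the minimum -2 over one
  period is enough; the numbers below 210 are checked directly.\<close>

lemma cheb_ge: 
  assumes "m \<ge> 1"
  shows "cheb m + (if m \<ge> 6 then 3 else 0) + (if m \<ge> 28 then 2 else 0) + (if m \<ge> 36 then 1 else 0) \<ge> 4"
proof (cases "m < 210")
  case True
  from cheb_ok[OF this] assms show ?thesis by (simp only: cheb_ok_def)
next
  case False
  have p: "cheb (r + 210 * k) = cheb r" for r k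
  proof (induction k)
    case (Suc k)
    have "r + 210 * Suc k = (r + 210 * k) + 210" by simp
    then show ?case using Suc cheb_period by (simp only:)
  qed simp
  have "cheb m = cheb (m mod 210)" using p[of "m mod 210" "m div 210"] by simp
  moreover have "cheb (m mod 210) \<ge> -2" using cheb_ok[of "m mod 210"] by (simp add: cheb_ok_def)
  ultimately show ?thesis using False by simp
qed

definition psin :: "nat \<Rightarrow> real" where "psin N = (\<Sum>n\<in>{1..N}. mangoldt n)"

lemma psi_eq_psin: "psi x = psin (nat \<lfloor>x\<rfloor>)"
proof -
  have "{..nat \<lfloor>x\<rfloor>} = insert 0 {1..nat \<lfloor>x\<rfloor>}" by auto
  then show ?thesis by (simp add: psi_def psin_def)
qed

lemma sum_mangoldt_div: "(\<Sum>n\<in>{1..N}. mangoldt n * real (N div n)) = ln (fact N)"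
proof -
  have "ln (fact N) = (\<Sum>k\<in>{1..N}. ln (real k))"
    by (induction N) (simp_all add: ln_mult_pos)
  also have "\<dots> = (\<Sum>k\<in>{1..N}. \<Sum>n | n dvd k. mangoldt n)"
    by (intro sum.cong refl) (simp add: mangoldt_sum)
  also have "\<dots> = (\<Sum>k\<in>{1..N}. \<Sum>n\<in>{1..N}. if n dvd k then mangoldt n else 0)"
  proof (rule sum.cong[OF refl])
    fix k assume k: "k \<in> {1..N}"
    have "{n. n dvd k} = {n\<in>{1..N}. n dvd k}" using k by (auto dest: dvd_imp_le intro: Suc_leI dvd_pos_nat)
    show "(\<Sum>n | n dvd k. mangoldt n) = (\<Sum>n\<in>{1..N}. if n dvd k then mangoldt n else (0::real))"
      unfolding \<open>{n. n dvd k} = _\<close> by (rule sum.inter_filter) simp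
  qed
  also have "\<dots> = (\<Sum>n\<in>{1..N}. \<Sum>k\<in>{1..N}. if n dvd k then mangoldt n else 0)" by (rule sum.swap)
  also have "\<dots> = (\<Sum>n\<in>{1..N}. mangoldt n * real (N div n))"
  proof (rule sum.cong[OF refl])
    fix n assume n: "n \<in> {1..N}"
    have "(\<Sum>k\<in>{1..N}. if n dvd k then mangoldt n else (0::real)) = real (card {k\<in>{1..N}. n dvd k}) * mangoldt n"
      by (simp add: sum.inter_filter[symmetric])
    also have "{k\<in>{1..N}. n dvd k} = (\<lambda>j. n * j) ` {1..N div n}"
    proof (intro set_eqI iffI)
      fix k assume "k \<in> {k\<in>{1..N}. n dvd k}"
      then obtain j where j: "k = n * j" "1 \<le> k" "k \<le> N" by auto
      have "j \<le> N div n" using div_le_mono[OF j(3), of n] n j(1) by simp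
      then show "k \<in> (\<lambda>j. n * j) ` {1..N div n}" using j by (auto intro!: imageI Suc_leI gr0I)
    next
      fix k assume "k \<in> (\<lambda>j. n * j) ` {1..N div n}"
      then obtain j where "k = n * j" "j \<in> {1..N div n}" by blast
      then have j: "k = n * j" "1 \<le> j" "j \<le> N div n" by simp_all
      have "n * j \<le> n * (N div n)" using j by simp
      also have "\<dots> \<le> N" by simp
      finally show "k \<in> {k\<in>{1..N}. n dvd k}" using j n by (auto intro!: Suc_leI)
    qed
    also have "card \<dots> = N div n" using n by (subst card_image) (auto simp: inj_on_def)
    finally show "(\<Sum>k\<in>{1..N}. if n dvd k then mangoldt n else (0::real)) = mangoldt n * real (N div n)" by simp
  qed
  finally show ?thesis ..
qed

lemma sum_mangoldt_div_div:
  assumes "d \<ge> 1"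
  shows "(\<Sum>n\<in>{1..N}. mangoldt n * real (N div n div d)) = ln (fact (N div d))"
proof -
  have "(\<Sum>n\<in>{1..N div d}. mangoldt n * real (N div d div n)) = (\<Sum>n\<in>{1..N}. mangoldt n * real (N div d div n))"
    by (rule sum.mono_neutral_left) (auto intro: order_trans[OF _ div_le_dividend])
  then show ?thesis unfolding sum_mangoldt_div by (simp add: div_mult2_eq[symmetric] mult.commute)
qed

lemma sum_mangoldt_ind:
  assumes "d \<ge> 1"
  shows "(\<Sum>n\<in>{1..N}. mangoldt n * (if N div n \<ge> d then c else 0)) = c * psin (N div d)"
proof -
  have "(\<Sum>n\<in>{1..N}. mangoldt n * (if N div n \<ge> d then c else 0)) = (\<Sum>n\<in>{n\<in>{1..N}. N div n \<ge> d}. mangoldt n * c)"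
    by (subst sum.inter_filter) (auto intro!: sum.cong)
  also have "{n\<in>{1..N}. N div n \<ge> d} = {1..N div d}"
  proof -
    have "n \<le> N" if "n * d \<le> N" for n by (rule order_trans[OF _ that]) (use assms in simp)
    then show ?thesis using assms by (auto simp: less_eq_div_iff_mult_less_eq mult.commute)
  qed
  finally show ?thesis by (simp add: psin_def sum_distrib_left mult.commute)
qed

text \<open>The inequality for \<open>cheb\<close> at \<open>N div n\<close> is summed against
  \<Lambda>(n). Floors turn into logarithms of factorials by Chebyshev's identity, and the
  corrections at 6, 28 and 36 into \<psi> at smaller arguments.\<close>

lemma psin_recursion:
  "4 * psin N \<le> 4 * ln (fact N) - 4 * ln (fact (N div 2)) - 4 * ln (fact (N div 3)) - 3 * ln (fact (N div 5)) - 4 * ln (fact (N div 7))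
     + 3 * ln (fact (N div 10)) + ln (fact (N div 14)) + 2 * ln (fact (N div 15))
     + 3 * psin (N div 6) + 2 * psin (N div 28) + psin (N div 36)"
proof -
  let ?S = "\<lambda>f. \<Sum>n\<in>{1..N}. mangoldt n * (f (N div n) :: real)"
  have d1: "numeral d \<ge> (1::nat)" for d by simp
  let ?i = "\<lambda>d (c::real) m. if m \<ge> (d::nat) then c else 0"
  have "4 * psin N = ?S (\<lambda>m. 4)" by (simp add: psin_def sum_distrib_left mult.commute)
  also have "\<dots> \<le> ?S (\<lambda>m. 4 * real m - 4 * real (m div 2) - 4 * real (m div 3) - 3 * real (m div 5) - 4 * real (m div 7) + 3 * real (m div 10) + real (m div 14) + 2 * real (m div 15)
      + ?i 6 3 m + ?i 28 2 m + ?i 36 1 m)"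
  proof (intro sum_mono mult_left_mono mangoldt_nonneg)
    fix n assume n: "n \<in> {1..N}"
    define m where "m = N div n"
    have m: "m \<ge> 1" using n by (simp add: m_def Suc_le_eq div_greater_zero_iff)
    have "4 \<le> cheb m + (if m \<ge> 6 then 3 else 0) + (if m \<ge> 28 then 2 else 0) + (if m \<ge> 36 then 1 else 0)" by (rule cheb_ge[OF m])
    then have "real_of_int 4 \<le> real_of_int (cheb m + (if m \<ge> 6 then 3 else 0) + (if m \<ge> 28 then 2 else 0) + (if m \<ge> 36 then 1 else 0))"
      by (simp only: of_int_le_iff)
    then show "4 \<le> 4 * real (N div n) - 4 * real (N div n div 2) - 4 * real (N div n div 3) - 3 * real (N div n div 5) - 4 * real (N div n div 7) + 3 * real (N div n div 10) + real (N div n div 14) + 2 * real (N div n div 15)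
      + ?i 6 3 (N div n) + ?i 28 2 (N div n) + ?i 36 1 (N div n)"
      unfolding m_def[symmetric] by (simp only: cheb_def of_int_add of_int_diff of_int_mult of_int_numeral of_int_of_nat_eq if_distrib[of real_of_int] of_int_0 of_int_1)
  qed
  also have "\<dots> = 4 * ?S real - 4 * ?S (\<lambda>m. real (m div 2)) - 4 * ?S (\<lambda>m. real (m div 3)) - 3 * ?S (\<lambda>m. real (m div 5)) - 4 * ?S (\<lambda>m. real (m div 7))
      + 3 * ?S (\<lambda>m. real (m div 10)) + ?S (\<lambda>m. real (m div 14)) + 2 * ?S (\<lambda>m. real (m div 15)) + ?S (?i 6 3) + ?S (?i 28 2) + ?S (?i 36 1)"
    by (simp only: sum_distrib_left sum_subtractf sum.distrib distrib_left right_diff_distrib mult.left_commute)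
  finally show ?thesis by (simp only: sum_mangoldt_div sum_mangoldt_div_div[OF d1] sum_mangoldt_ind[OF d1] mult_1)
qed

lemma ln_fact_nat:
  assumes "m \<ge> 1"
  shows "real m * ln m - real m + 1 \<le> ln (fact m) \<and> ln (fact m) \<le> real m * ln m - real m + 1 + ln m"
  using assms
proof (induction m rule: nat_induct_at_least)
  case (Suc m)
  define x where "x = real m"
  have x: "x \<ge> 1" using Suc by (simp add: x_def)
  have "ln (1 + 1 / x) \<le> 1 / x" using x by (intro ln_add_one_self_le_self) auto
  moreover have r: "ln (1 + 1 / x) = ln (x + 1) - ln x"
  proof -
    have "1 + 1 / x = (x + 1) / x" using x by (simp add: field_simps)
    then show ?thesis using x by (simp add: ln_div)
  qed
  ultimately have 1: "x * (ln (x + 1) - ln x) \<le> 1" using x by (simp add: pos_le_divide_eq mult.commute)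
  have "ln (x / (x + 1)) \<le> x / (x + 1) - 1" using x by (intro ln_le_minus_one) auto
  then have "ln x - ln (x + 1) \<le> - (1 / (x + 1))" using x by (simp add: ln_div field_simps)
  then have "1 / (x + 1) \<le> ln (x + 1) - ln x" by simp
  then have 2: "1 \<le> (x + 1) * (ln (x + 1) - ln x)" using x by (simp add: pos_divide_le_eq mult.commute)
  have f: "ln (fact (Suc m)) = ln (x + 1) + ln (fact m)" unfolding fact_Suc by (subst ln_mult_pos) (simp_all add: x_def add.commute)
  have s: "real (Suc m) = x + 1" by (simp add: x_def)
  show ?case using Suc.IH 1 2 unfolding f s x_def[symmetric] by (simp add: algebra_simps)
qed simp

lemma ln_fact_floor:
  fixes y :: real
  assumes y: "y \<ge> 1"
  defines "T \<equiv> ln (fact (nat \<lfloor>y\<rfloor>))"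
  shows "y * ln y - y + 1 - ln y \<le> T" "T \<le> y * ln y - y + 1 + ln y"
proof -
  define m where "m = real (nat \<lfloor>y\<rfloor>)"
  have "\<lfloor>y\<rfloor> \<ge> 1" using y by simp
  then have m: "m \<ge> 1" "m \<le> y" "y < m + 1" "nat \<lfloor>y\<rfloor> \<ge> 1" unfolding m_def by linarith+
  have T: "m * ln m - m + 1 \<le> T" "T \<le> m * ln m - m + 1 + ln m"
    using ln_fact_nat[OF m(4)] by (simp_all add: T_def m_def)
  have l: "ln m \<le> ln y" "0 \<le> ln m" using m by simp_all
  have r: "ln (y / m) = ln y - ln m" "ln (m / y) = ln m - ln y" using m by (simp_all add: ln_div)
  have "ln (y / m) \<le> y / m - 1" using m by (intro ln_le_minus_one) auto
  then have "m * (ln y - ln m) \<le> m * (y / m - 1)" using m unfolding r by (intro mult_left_mono) auto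
  then have 1: "m * (ln y - ln m) \<le> y - m" using m by (simp add: right_diff_distrib)
  have 2: "(y - m) * ln y \<le> 1 * ln y" using m l by (intro mult_right_mono) auto
  show "y * ln y - y + 1 - ln y \<le> T" using 1 2 T by (simp add: algebra_simps)
  have "ln (m / y) \<le> m / y - 1" using m by (intro ln_le_minus_one) auto
  then have "y * (ln m - ln y) \<le> y * (m / y - 1)" using m unfolding r by (intro mult_left_mono) auto
  then have 3: "y * (ln m - ln y) \<le> m - y" using m by (simp add: right_diff_distrib)
  have 4: "0 \<le> (y - m) * ln m" using m l by simp
  show "T \<le> y * ln y - y + 1 + ln y" using 3 4 T l by (simp add: algebra_simps)
qed

lemma ln_7_bounds: "ln (7::real) \<ge> 19/10" "ln (7::real) \<le> 1946/1000"
  using ln_approx_bounds[of 7 12] by (simp_all add: eval_nat_numeral)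

text \<open>0.9222 bounds a quarter of the linear coefficient left by Stirling's formula. Iterating
  the recursion drives the slope towards 0.9222 / (1 - 1/8 - 1/56 - 1/144), about 1.085, so the
  constants 1.104 and 1.0892 are within reach.\<close>

lemma psi_recursion:
  assumes x: "x \<ge> 15"
  shows "psi x \<le> 9222/10000 * x + 25/4 * ln x - 8 + 3/4 * psi (x/6) + 1/2 * psi (x/28) + 1/4 * psi (x/36)"
proof -
  define N where "N = nat \<lfloor>x\<rfloor>"
  have d: "N div d = nat \<lfloor>x / real d\<rfloor>" if "d > 0" for d
    using that x floor_divide_real_eq_div[of "int d" x] by (simp add: N_def nat_div_distrib)
  have p: "psi (x / real d) = psin (N div d)" if "d > 0" for d unfolding psi_eq_psin d[OF that] ..
  define U where "U = (\<lambda>d. (x / d) * (ln x - ln d) - x / d)"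
  define T where "T = (\<lambda>d. ln (fact (N div d)) :: real)"
  have F: "U (real d) + 1 - (ln x - ln (real d)) \<le> T d" "T d \<le> U (real d) + 1 + (ln x - ln (real d))" if "0 < d" "d \<le> 15" for d
    using ln_fact_floor[of "x / real d"] that x unfolding T_def U_def d[OF that(1)] by (simp_all add: ln_div pos_le_divide_eq)
  define l2 l3 l5 l7 where "l2 = ln (2::real)" and "l3 = ln (3::real)" and "l5 = ln (5::real)" and "l7 = ln (7::real)"
  have lg: "ln (10::real) = l2 + l5" "ln (14::real) = l2 + l7" "ln (15::real) = l3 + l5"
    using ln_mult_pos[of 2 "5::real"] ln_mult_pos[of 2 "7::real"] ln_mult_pos[of 3 "5::real"] by (simp_all add: l2_def l3_def l5_def l7_def)
  have R: "4 * psi x \<le> 4 * T 1 - 4 * T 2 - 4 * T 3 - 3 * T 5 - 4 * T 7 + 3 * T 10 + T 14 + 2 * T 15 + 3 * psi (x/6) + 2 * psi (x/28) + psi (x/36)"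
    using psin_recursion[of N] p[of 1] p[of 6] p[of 28] p[of 36] unfolding T_def by simp
  have F1: "T 1 \<le> U 1 + 1 + ln x" using F(2)[of 1] by simp
  have F2: "U 2 + 1 - (ln x - l2) \<le> T 2" using F(1)[of 2] by (simp add: l2_def)
  have F3: "U 3 + 1 - (ln x - l3) \<le> T 3" using F(1)[of 3] by (simp add: l3_def)
  have F5: "U 5 + 1 - (ln x - l5) \<le> T 5" using F(1)[of 5] by (simp add: l5_def)
  have F7: "U 7 + 1 - (ln x - l7) \<le> T 7" using F(1)[of 7] by (simp add: l7_def)
  have F10: "T 10 \<le> U 10 + 1 + (ln x - (l2 + l5))" using F(2)[of 10] by (simp add: lg)
  have F14: "T 14 \<le> U 14 + 1 + (ln x - (l2 + l7))" using F(2)[of 14] by (simp add: lg)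
  have F15: "T 15 \<le> U 15 + 1 + (ln x - (l3 + l5))" using F(2)[of 15] by (simp add: lg)
  \<comment> \<open>25 is the sum of the absolute values of the eight coefficients, since each
    factorial is known up to an error \<open>ln (x/d)\<close>.\<close>
  have "4 * psi x \<le> (4 * U 1 - 4 * U 2 - 4 * U 3 - 3 * U 5 - 4 * U 7 + 3 * U 10 + U 14 + 2 * U 15) + 25 * ln x - (8 * l2 + 6 * l3 + 8 * l5 + 5 * l7) - 1
      + 3 * psi (x/6) + 2 * psi (x/28) + psi (x/36)"
    using R F1 F2 F3 F5 F7 F10 F14 F15 by linarith
  also have "4 * U 1 - 4 * U 2 - 4 * U 3 - 3 * U 5 - 4 * U 7 + 3 * U 10 + U 14 + 2 * U 15 = x * (57/35 * l2 + 6/5 * l3 + 1/6 * l5 + 1/2 * l7)"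
    unfolding U_def lg l2_def[symmetric] l3_def[symmetric] l5_def[symmetric] l7_def[symmetric] by (simp add: field_simps)
  also have "x * (57/35 * l2 + 6/5 * l3 + 1/6 * l5 + 1/2 * l7) \<le> x * (4 * (9222/10000))"
    using ln_2_bounds ln_7_bounds ln_3_le ln_5_le x unfolding l2_def l3_def l5_def l7_def by (intro mult_left_mono) auto
  finally have "4 * psi x \<le> x * (4 * (9222/10000)) + 25 * ln x - (8 * l2 + 6 * l3 + 8 * l5 + 5 * l7) - 1 + 3 * psi (x/6) + 2 * psi (x/28) + psi (x/36)"
    by simp
  moreover have "8 * l2 + 6 * l3 + 8 * l5 + 5 * l7 \<ge> 31"
    using ln_2_bounds ln_7_bounds ln_3_ge ln_5_ge unfolding l2_def l3_def l5_def l7_def by simp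
  ultimately show ?thesis by simp
qed

lemma psin_le_ln_fact: "psin N \<le> ln (fact N)"
  unfolding psin_def sum_mangoldt_div[symmetric]
proof (rule sum_mono)
  fix n assume "n \<in> {1..N}"
  then have "1 \<le> N div n" by (simp add: Suc_le_eq div_greater_zero_iff)
  then have "1 \<le> real (N div n)" by linarith
  from mult_left_mono[OF this mangoldt_nonneg[of n]] show "mangoldt n \<le> mangoldt n * real (N div n)" by simp
qed

lemma psin_le_small:
  assumes "N \<le> 14"
  shows "psin N \<le> 2 * real N"
proof (cases "N \<le> 1")
  case True
  then have "{1..N} \<subseteq> {1}" by auto
  then have "psin N = 0" unfolding psin_def using mangoldt_Suc_0 by (intro sum.neutral) auto
  then show ?thesis by simp
next
  case False
  then have N: "N \<ge> 1" "real N \<ge> 2" by auto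
  have "psin N \<le> real N * ln N - real N + 1 + ln N" using psin_le_ln_fact[of N] ln_fact_nat[OF N(1)] by linarith
  also have "\<dots> \<le> 2 * real N"
  proof -
    have *: "real N * ln N - real N + 1 + ln N \<le> 2 * real N" if "ln (real N) \<le> c" "real N * c - real N + 1 + c \<le> 2 * real N" for c
      using mult_left_mono[OF that(1), of "real N"] that by linarith
    have l: "ln (real N) \<le> ln c" if "real N \<le> c" for c using that N by (subst ln_le_cancel_iff) auto
    consider "real N \<le> 4" | "real N > 4" "real N \<le> 10" | "real N > 10" "real N \<le> 14" using assms by linarith
    then show ?thesis
    proof cases
      case 1
      have "ln (4::real) \<le> 1387/1000" using ln_realpow[of 2 2] ln_2_bounds by simp
      then have "ln (real N) \<le> 1387/1000" using l[OF 1] by linarith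
      then show ?thesis by (rule *) (use N in simp)
    next
      case 2
      have "N \<ge> 5" using 2(1) by simp
      then have "real N \<ge> 5" by simp
      have "ln (10::real) \<le> 231/100" using ln_mult_pos[of 2 "5::real"] ln_2_bounds ln_5_le by simp
      then have "ln (real N) \<le> 231/100" using l[OF 2(2)] by linarith
      then show ?thesis by (rule *) (use \<open>real N \<ge> 5\<close> in simp)
    next
      case 3
      have "N \<ge> 11" using 3(1) by simp
      then have "real N \<ge> 11" by simp
      have "ln (14::real) \<le> 264/100" using ln_mult_pos[of 2 "7::real"] ln_2_bounds ln_7_bounds by simp
      then have "ln (real N) \<le> 264/100" using l[OF 3(2)] by linarith
      then show ?thesis by (rule *) (use \<open>real N \<ge> 11\<close> in simp)
    qed
  qed
  finally show ?thesis .
qed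

lemma ln_le_tangent:
  assumes "x > 0" "X > 0"
  shows "ln x \<le> ln X + x / X - (1::real)"
proof -
  have "ln (x / X) \<le> x / X - 1" using assms by (intro ln_le_minus_one) auto
  then show ?thesis using assms by (simp add: ln_div)
qed

text \<open>The starting point of the bootstrap. The recursion reduces the integer part of
  \<open>x\<close>, and below 15 the trivial bound of \<psi> by the logarithm of a factorial
  applies.\<close>

lemma psi_le_2: "0 \<le> x \<Longrightarrow> psi x \<le> 2 * x"
proof (induction "nat \<lfloor>x\<rfloor>" arbitrary: x rule: less_induct)
  case less
  show ?case
  proof (cases "x < 15")
    case True
    then have "nat \<lfloor>x\<rfloor> \<le> 14" by linarith
    then have "psi x \<le> 2 * real (nat \<lfloor>x\<rfloor>)" unfolding psi_eq_psin by (rule psin_le_small)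
    then show ?thesis using less by linarith
  next
    case False
    then have x: "x \<ge> 15" by simp
    have lt: "nat \<lfloor>x / d\<rfloor> < nat \<lfloor>x\<rfloor>" if "d \<ge> 2" for d
    proof -
      have "x / d \<le> x / 2" using x that by (intro divide_left_mono) auto
      then have "x / d \<le> x - 1" using x by linarith
      then have "\<lfloor>x / d\<rfloor> \<le> \<lfloor>x - 1\<rfloor>" by (rule floor_mono)
      moreover have "\<lfloor>x\<rfloor> \<ge> 1" using x by simp
      ultimately show ?thesis by (simp add: zless_nat_conj)
    qed
    have IH: "psi (x / d) \<le> 2 * (x / d)" if "d \<ge> 2" for d
      by (rule less.hyps[OF lt[OF that]]) (use x that in simp)
    have "ln (15::real) \<le> 271/100" using ln_mult_pos[of 3 "5::real"] ln_3_le ln_5_le by simp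
    then have "ln x \<le> 171/100 + x / 15" using ln_le_tangent[of x 15] x by simp
    then show ?thesis using psi_recursion[OF x] IH[of 6] IH[of 28] IH[of 36] x by simp
  qed
qed

text \<open>One round of the bootstrap: bounds known from \<open>X/6\<close>, \<open>X/28\<close>
  and \<open>X/36\<close> on yield a better one from \<open>X\<close> on. The tangent of the
  logarithm at \<open>X\<close> makes the error term proportional to \<open>x\<close>.\<close>

lemma psi_stage:
  assumes X: "X \<ge> 15" "ln X \<le> l" "25/4 * l \<ge> 57/4"
    and b: "\<And>x. x \<ge> X / 6 \<Longrightarrow> psi x \<le> c6 * x" "\<And>x. x \<ge> X / 28 \<Longrightarrow> psi x \<le> c28 * x" "\<And>x. x \<ge> X / 36 \<Longrightarrow> psi x \<le> c36 * x"
    and c: "9222/10000 + (25/4 * l - 8) / X + c6 / 8 + c28 / 56 + c36 / 144 \<le> c" and x: "x \<ge> X"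
  shows "psi x \<le> c * x"
proof -
  have "25/4 * ln x - 8 \<le> (25/4 * l - 8) / X * x"
  proof -
    have "ln x \<le> l + x / X - 1" using ln_le_tangent[of x X] X x by simp
    then have "25/4 * ln x - 8 \<le> (25/4 * l - 57/4) * 1 + 25/4 * (x / X)" by simp
    also have "\<dots> \<le> (25/4 * l - 57/4) * (x / X) + 25/4 * (x / X)"
      using X x by (intro add_right_mono mult_left_mono) auto
    also have "\<dots> = (25/4 * l - 8) / X * x" using X by (simp add: field_simps)
    finally show ?thesis .
  qed
  moreover have "psi (x/6) \<le> c6 * (x / 6)" "psi (x/28) \<le> c28 * (x / 28)" "psi (x/36) \<le> c36 * (x / 36)"
    by (rule b; use x in simp)+
  moreover have "psi x \<le> 9222/10000 * x + 25/4 * ln x - 8 + 3/4 * psi (x/6) + 1/2 * psi (x/28) + 1/4 * psi (x/36)"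
    using X x by (intro psi_recursion) simp
  moreover have "(9222/10000 + (25/4 * l - 8) / X + c6 / 8 + c28 / 56 + c36 / 144) * x \<le> c * x"
    using c x X by (intro mult_right_mono) auto
  ultimately show ?thesis by (simp add: distrib_right)
qed

text \<open>The thresholds are 5-smooth, and their quotients by 6, 28 and 36 reach those of earlier
  stages: for instance 8100/6 = 1350, 8100/28 > 288 and 8100/36 = 225.\<close>

lemma psi_stages:
  shows "x \<ge> 36 \<Longrightarrow> psi x \<le> 16231/10000 * x"
    and "x \<ge> 48 \<Longrightarrow> psi x \<le> 156/100 * x"
    and "x \<ge> 225 \<Longrightarrow> psi x \<le> 129/100 * x"
    and "x \<ge> 288 \<Longrightarrow> psi x \<le> 1263/1000 * x"
    and "x \<ge> 1350 \<Longrightarrow> psi x \<le> 1151/1000 * x"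
    and psi_le_8100: "x \<ge> 8100 \<Longrightarrow> psi x \<le> 1104/1000 * x"
    and psi_le_162000: "x \<ge> 162000 \<Longrightarrow> psi x \<le> 10892/10000 * x"
proof -
  have l: "ln (36::real) \<le> smooth_ln (2, 2, 0)" "ln (48::real) \<le> smooth_ln (4, 1, 0)" "ln (225::real) \<le> smooth_ln (0, 2, 2)"
    "ln (288::real) \<le> smooth_ln (5, 2, 0)" "ln (1350::real) \<le> smooth_ln (1, 3, 2)" "ln (8100::real) \<le> smooth_ln (2, 4, 2)"
    "ln (162000::real) \<le> smooth_ln (4, 4, 3)"
    using ln_smooth_le[of "(2, 2, 0)"] ln_smooth_le[of "(4, 1, 0)"] ln_smooth_le[of "(0, 2, 2)"] ln_smooth_le[of "(5, 2, 0)"]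
      ln_smooth_le[of "(1, 3, 2)"] ln_smooth_le[of "(2, 4, 2)"] ln_smooth_le[of "(4, 4, 3)"] by (simp_all add: smooth_def)
  have 1: "psi x \<le> 16231/10000 * x" if "x \<ge> 36" for x
    by (rule psi_stage[OF _ l(1) _ psi_le_2 psi_le_2 psi_le_2 _ that]) (auto simp: smooth_ln_def)
  have 2: "psi x \<le> 156/100 * x" if "x \<ge> 48" for x
    by (rule psi_stage[OF _ l(2) _ psi_le_2 psi_le_2 psi_le_2 _ that]) (auto simp: smooth_ln_def)
  have 3: "psi x \<le> 129/100 * x" if "x \<ge> 225" for x
    by (rule psi_stage[OF _ l(3) _ 1 psi_le_2 psi_le_2 _ that]) (auto simp: smooth_ln_def)
  have 4: "psi x \<le> 1263/1000 * x" if "x \<ge> 288" for x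
    by (rule psi_stage[OF _ l(4) _ 2 psi_le_2 psi_le_2 _ that]) (auto simp: smooth_ln_def)
  have 5: "psi x \<le> 1151/1000 * x" if "x \<ge> 1350" for x
    by (rule psi_stage[OF _ l(5) _ 3 2 1 _ that]) (auto simp: smooth_ln_def)
  have 6: "psi x \<le> 1104/1000 * x" if "x \<ge> 8100" for x
    by (rule psi_stage[OF _ l(6) _ 5 4 3 _ that]) (auto simp: smooth_ln_def)
  have 7: "psi x \<le> 10892/10000 * x" if "x \<ge> 162000" for x
    by (rule psi_stage[OF _ l(7) _ 6 5 5 _ that]) (auto simp: smooth_ln_def)
  show "x \<ge> 36 \<Longrightarrow> psi x \<le> 16231/10000 * x" "x \<ge> 48 \<Longrightarrow> psi x \<le> 156/100 * x" "x \<ge> 225 \<Longrightarrow> psi x \<le> 129/100 * x"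
    "x \<ge> 288 \<Longrightarrow> psi x \<le> 1263/1000 * x" "x \<ge> 1350 \<Longrightarrow> psi x \<le> 1151/1000 * x" "x \<ge> 8100 \<Longrightarrow> psi x \<le> 1104/1000 * x"
    "x \<ge> 162000 \<Longrightarrow> psi x \<le> 10892/10000 * x" by (fact 1 2 3 4 5 6 7)+
qed

subsection \<open>Primes below 8640\<close>

definition prime_count :: "nat \<Rightarrow> nat \<Rightarrow> nat" where
  "prime_count a b = card {p. prime p \<and> a < p \<and> p \<le> b}"

text \<open>For each number coprime to 30 in a block of length 30, the hint is either a proper divisor or 1; only the entries 1 are
  counted as primes, so nothing has to be checked for them.\<close>
definition block_ok :: "nat \<Rightarrow> nat list \<Rightarrow> bool" where
  "block_ok j ds \<longleftrightarrow> list_all2 (\<lambda>r d. d = 1 \<or> 1 < d \<and> d < 30 * j + r \<and> (30 * j + r) mod d = 0) [1, 7, 11, 13, 17, 19, 23, 29] ds"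

fun blocks_ok :: "nat \<Rightarrow> nat list list \<Rightarrow> bool" where
  "blocks_ok j [] \<longleftrightarrow> True"
| "blocks_ok j (ds # dss) \<longleftrightarrow> block_ok j ds \<and> blocks_ok (j + 1) dss"

lemma finite_prime_count: "finite {p::nat. prime p \<and> a < p \<and> p \<le> b}"
  by (rule finite_subset[of _ "{..b}"]) auto

lemma prime_count_split: "a \<le> b \<Longrightarrow> b \<le> c \<Longrightarrow> prime_count a c = prime_count a b + prime_count b c"
proof -
  assume ab: "a \<le> b" "b \<le> c"
  have "{p. prime p \<and> a < p \<and> p \<le> c} = {p. prime p \<and> a < p \<and> p \<le> b} \<union> {p. prime p \<and> b < p \<and> p \<le> c}" using ab by auto
  then show ?thesis unfolding prime_count_def using finite_prime_count by (simp add: card_Un_disjoint disjoint_iff)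
qed

lemma not_prime_if_dvd: "1 < d \<Longrightarrow> d < n \<Longrightarrow> n mod d = 0 \<Longrightarrow> \<not> prime (n::nat)"
  using prime_nat_iff[of n] by (auto simp: mod_eq_0_iff_dvd)

text \<open>Since \<open>j \<ge> 1\<close>, all numbers of the block exceed 30, so a prime among
  them is coprime to 30 and has one of the eight residues.\<close>

lemma prime_count_block:
  assumes "block_ok j ds" "j \<ge> 1"
  shows "prime_count (30 * j) (30 * (j + 1)) \<le> length (filter (\<lambda>d. d = 1) ds)"
proof -
  let ?R = "[1, 7, 11, 13, 17, 19, 23, 29::nat]"
  have l: "length ds = length ?R" and nth: "\<And>i. i < length ds \<Longrightarrow> ds ! i = 1 \<or> \<not> prime (30 * j + ?R ! i)"
    using assms(1) not_prime_if_dvd unfolding block_ok_def list_all2_conv_all_nth by auto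
  have "{p. prime p \<and> 30 * j < p \<and> p \<le> 30 * (j + 1)} \<subseteq> (\<lambda>i. 30 * j + ?R ! i) ` {i. i < length ds \<and> ds ! i = 1}"
  proof
    fix p assume "p \<in> {p. prime p \<and> 30 * j < p \<and> p \<le> 30 * (j + 1)}"
    then have p: "prime p" "30 * j < p" "p \<le> 30 * j + 30" by auto
    define r where "r = p - 30 * j"
    have r: "p = 30 * j + r" "r \<le> 30" "r \<ge> 1" using p by (auto simp: r_def)
    have nd: "\<not> d dvd p" if "d \<in> {2, 3, 5}" for d
      using not_prime_if_dvd[of d p] p assms that by auto
    have "\<not> d dvd r" if "d \<in> {2, 3, 5}" for d
    proof
      assume "d dvd r"
      moreover have "d dvd 30 * j" using that by auto
      ultimately show False using nd[OF that] r by (simp add: dvd_add)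
    qed
    then have "\<not> 2 dvd r" "\<not> 3 dvd r" "\<not> 5 dvd r" by auto
    then have "r \<in> set ?R" using r(2,3) by simp presburger
    then obtain i where i: "i < length ?R" "?R ! i = r" by (auto simp only: in_set_conv_nth)
    then have "ds ! i = 1" using nth[of i] l p r by auto
    then show "p \<in> (\<lambda>i. 30 * j + ?R ! i) ` {i. i < length ds \<and> ds ! i = 1}" using i l r by (auto intro!: image_eqI[of _ _ i])
  qed
  then have "prime_count (30 * j) (30 * (j + 1)) \<le> card ((\<lambda>i. 30 * j + ?R ! i) ` {i. i < length ds \<and> ds ! i = 1})"
    unfolding prime_count_def by (intro card_mono) auto
  also have "\<dots> \<le> card {i. i < length ds \<and> ds ! i = 1}" by (rule card_image_le) auto
  finally show ?thesis by (simp add: length_filter_conv_card)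
qed

lemma prime_count_blocks_aux:
  "blocks_ok j dss \<Longrightarrow> j \<ge> 1 \<Longrightarrow> prime_count (30 * j) (30 * (j + length dss)) \<le> sum_list (map (\<lambda>ds. length (filter (\<lambda>d. d = 1) ds)) dss)"
proof (induction j dss rule: blocks_ok.induct)
  case (1 j)
  then show ?case by (simp add: prime_count_def)
next
  case (2 j ds dss)
  have "prime_count (30 * j) (30 * (j + length (ds # dss))) = prime_count (30 * j) (30 * (j + 1)) + prime_count (30 * (j + 1)) (30 * ((j + 1) + length dss))"
    by (subst prime_count_split[of "30 * j" "30 * (j + 1)"]) auto
  then show ?case using 2 prime_count_block[of j ds] by simp
qed

lemma prime_count_blocks:
  assumes "blocks_ok j dss" "j \<ge> 1" "a = 30 * j" "b = 30 * (j + length dss)" "sum_list (map (\<lambda>ds. length (filter (\<lambda>d. d = 1) ds)) dss) \<le> c"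
  shows "prime_count a b \<le> c"
  using prime_count_blocks_aux[OF assms(1,2)] assms(3-5) by simp

text \<open>As \<open>M ln M\<close> is increasing for \<open>M \<ge> 1\<close>, this is the
  inequality for the inverse function of \<open>w exp w\<close> in disguise. \<open>M\<close> is
  real so that it can be a counted number for small \<open>n\<close> and an analytic bound for large
  \<open>n\<close>.\<close>

definition pi_ok :: "nat \<Rightarrow> bool" where
  "pi_ok n \<longleftrightarrow> (\<exists>M\<ge>0. real (prime_count 0 n) \<le> M \<and> M * ln M < real n)"

definition smooth_ln' :: "nat \<times> nat \<times> nat \<Rightarrow> real" where
  "smooth_ln' = (\<lambda>(i, j, k). 69314/100000 * real i + 10986/10000 * real j + 16094/10000 * real k)"

lemma ln_smooth_ge: "smooth_ln' n \<le> ln (smooth n)"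
proof -
  obtain i j k where n: "n = (i, j, k)" by (cases n)
  have "real i * (69314/100000) + real j * (10986/10000) + real k * (16094/10000) \<le> real i * ln 2 + real j * ln 3 + real k * ln 5"
    by (intro add_mono mult_left_mono ln_2_bounds ln_3_ge ln_5_ge') auto
  also have "\<dots> = ln (smooth n)"
    by (simp add: n smooth_def ln_mult_pos ln_realpow)
  finally show ?thesis by (simp add: n smooth_ln'_def mult.commute)
qed

lemma mult_ln_le_smooth:
  assumes "real K \<le> smooth s"
  shows "real K * ln (real K) \<le> real K * smooth_ln s"
proof (cases "K = 0")
  case False
  then have "ln (real K) \<le> ln (smooth s)" using assms smooth_pos[of s] by (subst ln_le_cancel_iff) auto
  then show ?thesis using ln_smooth_le[of s] by (intro mult_left_mono) auto
qed simp

lemma prime_count_mono: "b \<le> c \<Longrightarrow> prime_count a b \<le> prime_count a c"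
  unfolding prime_count_def by (intro card_mono finite_prime_count) auto

lemma prime_count_0: "prime_count 0 0 = 0"
proof -
  have "{p::nat. prime p \<and> 0 < p \<and> p \<le> 0} = {}" by auto
  then show ?thesis by (simp only: prime_count_def card.empty)
qed

lemma prime_count_Suc: "prime_count 0 (Suc n) = prime_count 0 n + (if prime (Suc n) then 1 else 0)"
proof -
  have "{p. prime p \<and> 0 < p \<and> p \<le> Suc n} = {p. prime p \<and> 0 < p \<and> p \<le> n} \<union> (if prime (Suc n) then {Suc n} else {})"
    by (auto simp: le_Suc_eq)
  then show ?thesis unfolding prime_count_def using finite_prime_count[of 0 n] by (simp add: card_Un_disjoint)
qed

text \<open>An entry with \<open>d = 1\<close> counts \<open>n\<close> as a prime, and
  \<open>s\<close> codes a smooth number above the new count, which certifies the inequality at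
  \<open>n\<close>. At a composite number the count stays while \<open>n\<close> grows, so a divisor
  is all that is checked.\<close>

fun small_ok :: "nat \<Rightarrow> nat \<Rightarrow> (nat \<times> nat \<times> nat \<times> nat) list \<Rightarrow> bool" where
  "small_ok n K [] \<longleftrightarrow> True"
| "small_ok n K ((d, s) # xs) \<longleftrightarrow> (if d = 1 then real (K + 1) \<le> smooth s \<and> real (K + 1) * smooth_ln s < real n \<and> small_ok (n + 1) (K + 1) xs
     else 1 < d \<and> d < n \<and> n mod d = 0 \<and> small_ok (n + 1) K xs)"

lemma small_ok:
  assumes "small_ok n K xs" "n \<ge> 1" "prime_count 0 (n - 1) \<le> K" "real K * ln (real K) < real n" "n \<le> m" "m < n + length xs"
  shows "pi_ok m"
  using assms
proof (induction n K xs rule: small_ok.induct)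
  case (2 n K d s xs)
  have pc: "prime_count 0 n = prime_count 0 (n - 1) + (if prime n then 1 else 0)" using prime_count_Suc[of "n - 1"] 2 by simp
  define K' where "K' = (if d = 1 then K + 1 else K)"
  have np: "\<not> prime n" if "d \<noteq> 1" using 2(3) that not_prime_if_dvd[of d n] by simp
  have K': "prime_count 0 n \<le> K'" using pc 2(5) np by (auto simp: K'_def)
  have l: "real K' * ln (real K') < real n"
  proof (cases "d = 1")
    case True
    then have "real (K + 1) \<le> smooth s" "real (K + 1) * smooth_ln s < real n" using 2(3) by simp_all
    then have "real (K + 1) * ln (real (K + 1)) < real n" using mult_ln_le_smooth[of "K + 1" s] by linarith
    then show ?thesis using True by (simp only: K'_def True refl if_True)
  qed (use 2 in \<open>simp add: K'_def\<close>)
  show ?case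
  proof (cases "m = n")
    case True
    then show ?thesis unfolding pi_ok_def using K' l by (intro exI[of _ "real K'"]) simp
  next
    case False
    have a: "n + 1 \<ge> 1" "prime_count 0 (n + 1 - 1) \<le> K'" "real K' * ln (real K') < real (n + 1)" "n + 1 \<le> m" "m < n + 1 + length xs"
      using False 2 K' l by auto
    show ?thesis
    proof (cases "d = 1")
      case True
      have "small_ok (n + 1) (K + 1) xs" using 2(3) True by simp
      from 2(1)[OF True this] show ?thesis using a True by (simp add: K'_def)
    next
      case d: False
      have "small_ok (n + 1) K xs" using 2(3) d by simp
      from 2(2)[OF d this] show ?thesis using a d by (simp add: K'_def)
    qed
  qed
qed simp

text \<open>The difference of \<pi> and \<theta> / ln 8640 on an interval, written as a sum over
  primes. Its value up to 8640 is what starts the partial summation there.\<close>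

definition excess :: "nat \<Rightarrow> nat \<Rightarrow> real" where
  "excess a b = (\<Sum>p | prime p \<and> a < p \<and> p \<le> b. 1 - ln (real p) / ln 8640)"

lemma ln_8640: "ln (8640::real) \<le> smooth_ln (6, 3, 1)" "ln (8640::real) \<ge> 9"
  using ln_smooth_le[of "(6, 3, 1)"] ln_smooth_ge[of "(6, 3, 1)"] by (simp_all add: smooth_def smooth_ln'_def)

text \<open>The table serves two purposes. \<open>su\<close> certifies that the count at the end of
  the block already satisfies the inequality at its first number; \<open>sl\<close> lies below all
  primes of the block and bounds their \<open>excess\<close>. Blocks up to 240 = 30 * 8 are exempt
  from the first, as numbers up to 240 are treated singly.\<close>

fun chain_ok :: "nat \<Rightarrow> nat \<Rightarrow> (nat \<times> nat \<times> (nat \<times> nat \<times> nat) \<times> (nat \<times> nat \<times> nat)) list \<Rightarrow> bool" where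
  "chain_ok a K [] \<longleftrightarrow> True"
| "chain_ok a K ((b, c, su, sl) # xs) \<longleftrightarrow> a \<le> b \<and> prime_count (30 * a) (30 * b) \<le> c \<and>
     (b \<le> 8 \<or> real (K + c) \<le> smooth su \<and> real (K + c) * smooth_ln su < real (30 * a + 1)) \<and>
     smooth sl \<le> real (30 * a) \<and> smooth_ln' sl \<le> smooth_ln (6, 3, 1) \<and> chain_ok b (K + c) xs"

fun chain_end where
  "chain_end a [] = a"
| "chain_end a ((b, c, su, sl) # xs) = chain_end b xs"

fun chain_weight where
  "chain_weight [] = 0"
| "chain_weight ((b, c, su, sl) # xs) = real c * (1 - smooth_ln' sl / smooth_ln (6, 3, 1)) + chain_weight xs"

lemma chain_ok:
  assumes "chain_ok a K xs" "prime_count 0 (30 * a) \<le> K" "30 * a < m" "240 < m" "m \<le> 30 * chain_end a xs"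
  shows "pi_ok m"
  using assms
proof (induction a K xs rule: chain_ok.induct)
  case (2 a K b c su sl xs)
  have "prime_count 0 (30 * b) = prime_count 0 (30 * a) + prime_count (30 * a) (30 * b)" using 2 by (intro prime_count_split) auto
  then have pc: "prime_count 0 (30 * b) \<le> K + c" using 2 by simp
  show ?case
  proof (cases "m \<le> 30 * b")
    case True
    then have s: "real (K + c) \<le> smooth su" "real (K + c) * smooth_ln su < real (30 * a + 1)" using 2(2,5) by auto
    have "prime_count 0 m \<le> K + c" using prime_count_mono[OF True, of 0] pc by simp
    moreover have "real (30 * a + 1) \<le> real m" using 2(4) by simp
    then have "real (K + c) * ln (real (K + c)) < real m" using mult_ln_le_smooth[OF s(1)] s(2) by linarith
    ultimately show ?thesis unfolding pi_ok_def by (intro exI[of _ "real (K + c)"]) simp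
  next
    case False
    have c: "chain_ok b (K + c) xs" "m \<le> 30 * chain_end b xs" using 2 by simp_all
    show ?thesis by (rule "2.IH"[OF c(1) pc _ 2(5) c(2)]) (use False in simp)
  qed
qed simp

lemma excess_split: "a \<le> b \<Longrightarrow> b \<le> c \<Longrightarrow> excess a c = excess a b + excess b c"
proof -
  assume ab: "a \<le> b" "b \<le> c"
  have "{p. prime p \<and> a < p \<and> p \<le> c} = {p. prime p \<and> a < p \<and> p \<le> b} \<union> {p. prime p \<and> b < p \<and> p \<le> c}" using ab by auto
  then show ?thesis unfolding excess_def using finite_prime_count by (simp add: sum.union_disjoint disjoint_iff)
qed

lemma excess_le:
  assumes "smooth sl \<le> real a" "smooth_ln' sl \<le> smooth_ln (6, 3, 1)" "prime_count a b \<le> c"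
  shows "excess a b \<le> real c * (1 - smooth_ln' sl / smooth_ln (6, 3, 1))"
proof -
  let ?w = "1 - smooth_ln' sl / smooth_ln (6, 3, 1)"
  have pos: "smooth_ln (6, 3, 1) > 0" "smooth_ln' sl \<ge> 0" by (cases sl; simp add: smooth_ln_def smooth_ln'_def)+
  have w: "?w \<ge> 0" using assms pos by (simp add: pos_divide_le_eq)
  have "excess a b \<le> (\<Sum>p | prime p \<and> a < p \<and> p \<le> b. ?w)"
    unfolding excess_def
  proof (intro sum_mono diff_left_mono)
    fix p assume p: "p \<in> {p. prime p \<and> a < p \<and> p \<le> b}"
    have "ln (smooth sl) \<le> ln (real p)" using p assms(1) smooth_pos[of sl] by (subst ln_le_cancel_iff) auto
    then have "smooth_ln' sl \<le> ln (real p)" using ln_smooth_ge[of sl] by linarith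
    then show "smooth_ln' sl / smooth_ln (6, 3, 1) \<le> ln (real p) / ln 8640"
      using pos ln_8640 by (intro frac_le) auto
  qed
  also have "\<dots> = real (prime_count a b) * ?w" by (simp add: prime_count_def)
  also have "\<dots> \<le> real c * ?w" using assms(3) w by (intro mult_right_mono) auto
  finally show ?thesis .
qed

lemma chain_weight:
  "chain_ok a K xs \<Longrightarrow> a \<le> chain_end a xs \<and> excess (30 * a) (30 * chain_end a xs) \<le> chain_weight xs"
proof (induction a K xs rule: chain_ok.induct)
  case (1 a K)
  have "{p. prime p \<and> 30 * a < p \<and> p \<le> 30 * a} = {}" by auto
  then show ?case by (simp only: excess_def sum.empty chain_end.simps chain_weight.simps) simp
next
  case (2 a K b c su sl xs)
  have IH: "b \<le> chain_end b xs" "excess (30 * b) (30 * chain_end b xs) \<le> chain_weight xs" using 2 by simp_all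
  have "excess (30 * a) (30 * b) \<le> real c * (1 - smooth_ln' sl / smooth_ln (6, 3, 1))"
    using 2(2) by (intro excess_le) auto
  moreover have "excess (30 * a) (30 * chain_end b xs) = excess (30 * a) (30 * b) + excess (30 * b) (30 * chain_end b xs)"
    using 2(2) IH by (intro excess_split) auto
  ultimately show ?case using IH 2(2) by simp
qed

subsection \<open>Partial summation\<close>

definition thetan :: "nat \<Rightarrow> real" where "thetan N = (\<Sum>p | prime p \<and> 0 < p \<and> p \<le> N. ln (real p))"

lemma thetan_le_psin: "thetan N \<le> psin N"
proof -
  have "thetan N = (\<Sum>p | prime p \<and> 0 < p \<and> p \<le> N. mangoldt p)" unfolding thetan_def by (intro sum.cong) auto
  also have "\<dots> \<le> psin N" unfolding psin_def by (intro sum_mono2) (auto simp: mangoldt_nonneg)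
  finally show ?thesis .
qed

lemma thetan_Suc: "thetan (Suc n) = thetan n + (if prime (Suc n) then ln (real (Suc n)) else 0)"
proof -
  have "{p. prime p \<and> 0 < p \<and> p \<le> Suc n} = {p. prime p \<and> 0 < p \<and> p \<le> n} \<union> (if prime (Suc n) then {Suc n} else {})"
    by (auto simp: le_Suc_eq)
  then show ?thesis unfolding thetan_def using finite_prime_count[of 0 n] by (simp add: sum.union_disjoint)
qed

text \<open>A majorant for the integral of \<open>1 / ln^2\<close>: with \<open>l = ln t\<close> its
  derivative is \<open>1/l^2 + 1/l^3 - 9/l^4\<close>, which is at least \<open>1/l^2\<close> from
  \<open>l = 9\<close> on. The starting point 8640 lies above exp 9.\<close>

definition hfun :: "real \<Rightarrow> real" where "hfun t = t / ln t ^ 2 + 3 * t / ln t ^ 3"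

lemma hfun_step:
  assumes N: "N > 1" "ln N \<ge> 9"
  shows "N * (1 / ln N - 1 / ln (N + 1)) \<le> hfun (N + 1) - hfun N"
proof -
  define G where "G = (\<lambda>t. t / ln t ^ 2 + 3 * t / ln t ^ 3 + N / ln t)"
  have "G N \<le> G (N + 1)"
  proof (rule DERIV_nonneg_imp_nondecreasing[of N "N + 1" G])
    fix t assume t: "N \<le> t" "t \<le> N + 1"
    define l where "l = ln t"
    have "ln N \<le> ln t" using N t by (subst ln_le_cancel_iff) auto
    then have l: "l \<ge> 9" using N by (simp add: l_def)
    have t0: "t > 0" using t N by simp
    have "(G has_real_derivative (1 / l^2 + 1 / l^3 - 9 / l^4 - N / (t * l^2))) (at t)"
    proof -
      have "((\<lambda>t. t / ln t ^ 2 + 3 * t / ln t ^ 3 + N / ln t) has_real_derivative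
        ((1 * ln t ^ 2 - t * (2 * ln t * (1 / t))) / (ln t ^ 2 * ln t ^ 2) + (3 * ln t ^ 3 - 3 * t * (3 * ln t ^ 2 * (1 / t))) / (ln t ^ 3 * ln t ^ 3) + (0 * ln t - N * (1 / t)) / (ln t * ln t))) (at t)"
        using l t0 unfolding l_def by (auto intro!: derivative_eq_intros simp: eval_nat_numeral)
      moreover have "(1 * l^2 - t * (2 * l * (1 / t))) / (l^2 * l^2) + (3 * l^3 - 3 * t * (3 * l^2 * (1 / t))) / (l^3 * l^3) + (0 * l - N * (1 / t)) / (l * l)
         = 1 / l^2 + 1 / l^3 - 9 / l^4 - N / (t * l^2)"
        using l t0 by (simp add: divide_simps eval_nat_numeral) (simp add: algebra_simps)
      ultimately show ?thesis unfolding G_def l_def by simp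
    qed
    moreover have "1 / l^2 + 1 / l^3 - 9 / l^4 - N / (t * l^2) \<ge> 0"
    proof -
      have "N / (t * l^2) \<le> 1 / l^2" using t t0 l by (simp add: divide_simps)
      moreover have "9 / l^4 \<le> 1 / l^3" using l by (simp add: divide_simps eval_nat_numeral)
      ultimately show ?thesis by linarith
    qed
    ultimately show "\<exists>y. (G has_real_derivative y) (at t) \<and> 0 \<le> y" by blast
  qed simp
  then show ?thesis unfolding G_def hfun_def by (simp add: right_diff_distrib)
qed

text \<open>Abel summation as an induction. In passing to \<open>N + 1\<close> the decrease of
  \<open>1 / ln\<close> is weighted by \<open>thetan N \<le> 1.104 N\<close> and paid by the
  increment of \<open>hfun\<close>, while a new prime contributes 1 to both sides.\<close>

lemma prime_count_le:
  assumes base: "real (prime_count 0 8640) \<le> thetan 8640 / ln 8640 + 1104/1000 * hfun 8640" and N: "N \<ge> 8640"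
  shows "real (prime_count 0 N) \<le> thetan N / ln N + 1104/1000 * hfun N"
  using N
proof (induction N rule: nat_induct_at_least)
  case base
  then show ?case using assms(1) by simp
next
  case (Suc N)
  have l: "ln (real N) \<ge> 9"
  proof -
    have "ln 8640 \<le> ln (real N)" using Suc by (subst ln_le_cancel_iff) auto
    then show ?thesis using ln_8640 by linarith
  qed
  have l1: "ln (real N + 1) \<ge> ln (real N)" using Suc by simp
  have th: "thetan N \<le> 1104/1000 * real N"
  proof -
    have "thetan N \<le> psi (real N)" using thetan_le_psin[of N] by (simp add: psi_eq_psin)
    also have "\<dots> \<le> 1104/1000 * real N" using Suc by (intro psi_le_8100) simp
    finally show ?thesis .
  qed
  have d0: "1 / ln (real N) - 1 / ln (real N + 1) \<ge> 0" using l l1 by (simp add: frac_le)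
  have "thetan N / ln N = thetan N / ln (real N + 1) + thetan N * (1 / ln (real N) - 1 / ln (real N + 1))"
    by (simp add: right_diff_distrib)
  also have "thetan N * (1 / ln (real N) - 1 / ln (real N + 1)) \<le> 1104/1000 * real N * (1 / ln (real N) - 1 / ln (real N + 1))"
    using th d0 by (rule mult_right_mono)
  also have "\<dots> = 1104/1000 * (real N * (1 / ln (real N) - 1 / ln (real N + 1)))" by simp
  also have "\<dots> \<le> 1104/1000 * (hfun (real N + 1) - hfun N)"
    using Suc l by (intro mult_left_mono hfun_step) auto
  finally have A: "thetan N / ln N \<le> thetan N / ln (real N + 1) + 1104/1000 * (hfun (real N + 1) - hfun N)" by simp
  have B: "thetan (Suc N) / ln (real N + 1) = thetan N / ln (real N + 1) + (if prime (Suc N) then 1 else 0)"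
    unfolding thetan_Suc using l l1 by (simp add: add_divide_distrib add.commute)
  have e: "real (Suc N) = real N + 1" by simp
  have A': "thetan N / ln N \<le> thetan N / ln (real N + 1) + 1104/1000 * hfun (real N + 1) - 1104/1000 * hfun N"
    using A by (simp only: right_diff_distrib)
  have c: "real (prime_count 0 N + (if prime (Suc N) then 1 else 0)) = real (prime_count 0 N) + (if prime (Suc N) then 1 else 0)" by simp
  show ?case unfolding e B prime_count_Suc c using Suc.IH A' by linarith
qed

text \<open>Since \<open>ln (1 + \<kappa>) \<le> \<kappa>\<close>, the logarithm of \<open>M\<close>
  is at most \<open>L + \<kappa> - ln L\<close>, and \<open>M ln M < N\<close> reduces to the last
  hypothesis. The sharp \<epsilon> enters only at \<open>N\<close> itself; for the integral over
  smaller arguments the uniform 1.104 is used.\<close>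

lemma pi_ok_final:
  assumes base: "real (prime_count 0 8640) \<le> thetan 8640 / ln 8640 + 1104/1000 * hfun 8640" and N: "N \<ge> 8640"
    and L: "L = ln (real N)" and \<epsilon>: "psi (real N) \<le> real N * (1 + \<epsilon>)" "\<epsilon> \<ge> 0"
    and \<kappa>: "\<kappa> = \<epsilon> + 1104/1000 * (1 + 3 / L) / L" "\<kappa> * L < (1 + \<kappa>) * (ln L - \<kappa>)"
  shows "pi_ok N"
proof -
  define M where "M = real N * ((1 + \<kappa>) / L)"
  have l: "L \<ge> 9"
  proof -
    have "ln 8640 \<le> ln (real N)" using N by (subst ln_le_cancel_iff) auto
    then show ?thesis using ln_8640 L by linarith
  qed
  have \<kappa>0: "\<kappa> \<ge> 0" unfolding \<kappa>(1) using \<epsilon> l by (intro add_nonneg_nonneg divide_nonneg_nonneg mult_nonneg_nonneg) auto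
  have N0: "real N > 0" using N by simp
  have M0: "M > 0" unfolding M_def using l \<kappa>0 N0 by (intro mult_pos_pos divide_pos_pos) auto
  have "thetan N \<le> real N * (1 + \<epsilon>)" using thetan_le_psin[of N] \<epsilon>(1) by (simp add: psi_eq_psin)
  then have "thetan N / L \<le> real N * (1 + \<epsilon>) / L" using l by (intro divide_right_mono) auto
  then have "real (prime_count 0 N) \<le> real N * (1 + \<epsilon>) / L + 1104/1000 * hfun N"
    using prime_count_le[OF base N] L by simp
  also have "\<dots> = M" unfolding M_def hfun_def L[symmetric] \<kappa>(1) using l by (simp add: field_simps eval_nat_numeral)
  finally have 1: "real (prime_count 0 N) \<le> M" .
  have "ln M = ln (real N) + ln ((1 + \<kappa>) / L)" unfolding M_def using N0 l \<kappa>0 by (intro ln_mult_pos divide_pos_pos) auto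
  also have "ln ((1 + \<kappa>) / L) = ln (1 + \<kappa>) - ln L" using l \<kappa>0 by (simp add: ln_div)
  finally have "ln M = L + ln (1 + \<kappa>) - ln L" using L by simp
  also have "\<dots> \<le> L + \<kappa> - ln L" using ln_add_one_self_le_self[OF \<kappa>0] by simp
  finally have "M * ln M \<le> M * (L + \<kappa> - ln L)" using M0 by (intro mult_left_mono) auto
  also have "\<dots> = real N * ((1 + \<kappa>) * (L + \<kappa> - ln L) / L)" by (simp add: M_def)
  also have "\<dots> < real N * 1"
  proof -
    have "(1 + \<kappa>) * (L + \<kappa> - ln L) < L" using \<kappa>(2) by (simp add: algebra_simps)
    then show ?thesis using N0 l by (intro mult_strict_left_mono) auto
  qed
  finally have 2: "M * ln M < real N" by simp
  show ?thesis unfolding pi_ok_def using 1 2 M0 by (intro exI[of _ M]) auto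
qed

section \<open>From \<open>M ln M < x\<close> to the Lambert function\<close>

lemma lambert_W_less:
  assumes x: "x > 0" and M: "M \<ge> 0" "M * ln M < x"
  shows "M < exp (lambert_W x) \<and> x / lambert_W x = exp (lambert_W x)"
proof -
  have "x \<ge> - exp (- 1)" using x exp_gt_zero[of "- 1 :: real"] by linarith
  from theI'[OF lambert_W_ex1[OF this]] have w: "lambert_W x * exp (lambert_W x) = x"
    unfolding lambert_W_def by blast
  define w where "w = lambert_W x"
  have w: "w * exp w = x" using w by (simp add: w_def)
  have w0: "w > 0"
  proof (rule ccontr)
    assume "\<not> w > 0"
    then have "w * exp w \<le> 0" by (intro mult_nonpos_nonneg) auto
    then show False using w x by linarith
  qed
  have "M < exp w"
  proof (rule ccontr)
    assume "\<not> M < exp w"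
    then have e: "exp w \<le> M" by simp
    then have "w \<le> ln M" using ln_le_cancel_iff[of "exp w" M] by (simp add: order.strict_trans2[OF exp_gt_zero])
    then have "exp w * w \<le> M * ln M" using e w0 M by (intro mult_mono) auto
    then show False using w M by (simp add: mult.commute)
  qed
  moreover have "x / w = exp w" using w w0 by (simp add: divide_simps mult.commute)
  ultimately show ?thesis by (simp add: w_def)
qed

lemma lambert_W_0: "lambert_W 0 = 0"
proof -
  have "(0::real) \<ge> - exp (- 1)" by simp
  from the1_equality[OF lambert_W_ex1[OF this], of 0] show ?thesis by (simp add: lambert_W_def)
qed

lemma primes_pi_eq: "x \<ge> 0 \<Longrightarrow> primes_pi x = prime_count 0 (nat \<lfloor>x\<rfloor>)"
proof -
  assume x: "x \<ge> 0"
  have "{p :: nat. prime p \<and> real p \<le> x} = {p. prime p \<and> 0 < p \<and> p \<le> nat \<lfloor>x\<rfloor>}"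
    using x by (auto simp: le_nat_floor prime_gt_0_nat) linarith
  then show ?thesis by (simp add: primes_pi_def prime_count_def)
qed

lemma theorem1_if_pi_ok:
  fixes x :: real
  assumes ok: "\<And>n. n \<ge> 1 \<Longrightarrow> pi_ok n" and x: "x \<ge> 0"
  shows "(x > 0 \<longrightarrow> real (primes_pi x) < x / lambert_W x \<and> x / lambert_W x = exp (lambert_W x)) \<and>
         (x = 0 \<longrightarrow> real (primes_pi x) < exp (lambert_W x) \<and> exp (lambert_W x) = 1)"
proof (intro conjI impI)
  assume x0: "x > 0"
  obtain M where M: "M \<ge> 0" "real (primes_pi x) \<le> M" "M * ln M < x"
  proof (cases "nat \<lfloor>x\<rfloor> \<ge> 1")
    case True
    from ok[OF this] obtain M where "M \<ge> 0" "real (prime_count 0 (nat \<lfloor>x\<rfloor>)) \<le> M" "M * ln M < real (nat \<lfloor>x\<rfloor>)"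
      unfolding pi_ok_def by blast
    moreover have "real (nat \<lfloor>x\<rfloor>) \<le> x" using x by linarith
    ultimately show ?thesis using that[of M] primes_pi_eq[OF x] by simp
  next
    case False
    \<comment> \<open>For \<open>0 < x < 1\<close> there are no primes and the witness is
      \<open>M = 0\<close>, with \<open>0 * ln 0 = 0\<close>.\<close>
    then have "nat \<lfloor>x\<rfloor> = 0" by linarith
    then have "primes_pi x = 0" using primes_pi_eq[OF x] by (simp only: prime_count_0)
    then show ?thesis using that[of 0] x0 by simp
  qed
  from lambert_W_less[OF x0 M(1,3)] M(2) show "real (primes_pi x) < x / lambert_W x" "x / lambert_W x = exp (lambert_W x)" by auto
next
  assume "x = 0"
  then show "real (primes_pi x) < exp (lambert_W x)" "exp (lambert_W x) = 1"
    using primes_pi_eq[OF x] by (simp_all add: lambert_W_0 prime_count_0)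
qed

section \<open>Stepping through the range of \<open>L\<close>\<close>

definition psi_bound :: "real \<Rightarrow> real \<Rightarrow> bool" where
  "psi_bound L0 \<epsilon> \<longleftrightarrow> (\<forall>L\<ge>L0. psi (exp L) \<le> exp L * (1 + \<epsilon>))"

text \<open>On \<open>[l, l']\<close> the condition of \<open>pi_ok_final\<close> is checked once,
  with each term taken at its worse end. \<open>c\<close> is a rational lower bound for
  \<open>ln l\<close>; it is carried from step to step by
  \<open>ln (l'/l) \<ge> 2 (l' - l) / (l' + l)\<close>, so that the whole check is rational
  arithmetic.\<close>

fun steps_ok :: "real \<Rightarrow> real \<Rightarrow> (real \<times> real \<times> real \<times> real) list \<Rightarrow> bool" where
  "steps_ok l c [] \<longleftrightarrow> True"
| "steps_ok l c ((l', c', L0, \<epsilon>) # xs) \<longleftrightarrow> l < l' \<and> L0 \<le> l \<and> 0 \<le> \<epsilon> \<and> psi_bound L0 \<epsilon> \<and> c' \<le> c + 2 * (l' - l) / (l' + l) \<and>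
     \<epsilon> * l' + 1104/1000 * (1 + 3 / l) < (1 + (\<epsilon> + 1104/1000 * (1 + 3 / l') / l')) * (c - (\<epsilon> + 1104/1000 * (1 + 3 / l) / l)) \<and>
     0 \<le> c - (\<epsilon> + 1104/1000 * (1 + 3 / l) / l) \<and> steps_ok l' c' xs"

text \<open>The first Pade approximant of the logarithm: the difference of the two sides vanishes at
  \<open>a\<close> and has derivative \<open>(t - a)^2 / (t (t + a)^2)\<close>.\<close>

lemma ln_ratio_ge:
  assumes "0 < a" "a \<le> (b::real)"
  shows "ln a + 2 * (b - a) / (b + a) \<le> ln b"
proof -
  define f where "f = (\<lambda>t. ln t - 2 * (t - a) / (t + a))"
  have "f a \<le> f b"
  proof (rule DERIV_nonneg_imp_nondecreasing[of a b f])
    fix t assume t: "a \<le> t" "t \<le> b"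
    have t0: "t > 0" "t + a > 0" using t assms by auto
    have "(f has_real_derivative (1 / t - (2 * (t + a) - 2 * (t - a)) / ((t + a) * (t + a)))) (at t)"
      unfolding f_def using t0 by (auto intro!: derivative_eq_intros)
    moreover have "1 / t - (2 * (t + a) - 2 * (t - a)) / ((t + a) * (t + a)) = (t - a)^2 / (t * ((t + a) * (t + a)))"
      using t0 by (simp add: divide_simps) (simp add: power2_eq_square algebra_simps)
    ultimately show "\<exists>y. (f has_real_derivative y) (at t) \<and> 0 \<le> y" using t0 by (intro exI[of _ "(t - a)^2 / (t * ((t + a) * (t + a)))"]) simp
  qed (use assms in simp)
  then show ?thesis using assms by (simp add: f_def)
qed

lemma steps_ok:
  assumes base: "real (prime_count 0 8640) \<le> thetan 8640 / ln 8640 + 1104/1000 * hfun 8640" and N: "N \<ge> 8640" and L: "L = ln (real N)"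
  shows "steps_ok l c xs \<Longrightarrow> 0 < l \<Longrightarrow> c \<le> ln l \<Longrightarrow> l \<le> L \<Longrightarrow> xs \<noteq> [] \<Longrightarrow> L \<le> fst (last xs) \<Longrightarrow> pi_ok N"
proof (induction l c xs rule: steps_ok.induct)
  case (2 l c l' c' L0 \<epsilon> xs)
  define C :: real where "C = 1104/1000"
  have C0: "C > 0" by (simp add: C_def)
  have s: "l < l'" "L0 \<le> l" "0 \<le> \<epsilon>" "psi_bound L0 \<epsilon>" "c' \<le> c + 2 * (l' - l) / (l' + l)"
    "\<epsilon> * l' + C * (1 + 3 / l) < (1 + (\<epsilon> + C * (1 + 3 / l') / l')) * (c - (\<epsilon> + C * (1 + 3 / l) / l))"
    "0 \<le> c - (\<epsilon> + C * (1 + 3 / l) / l)" "steps_ok l' c' xs"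
    using 2(2) unfolding C_def by simp_all
  show ?case
  proof (cases "L \<le> l'")
    case True
    define \<kappa> where "\<kappa> = \<epsilon> + C * (1 + 3 / L) / L"
    have LL: "0 < l" "l \<le> L" "0 < L" "L \<le> l'" "0 < l'" using 2 True by auto
    have k: "C * (1 + 3 / y) / y \<le> C * (1 + 3 / x) / x" if "0 < x" "x \<le> y" for x y
    proof -
      have "3 / y \<le> 3 / x" using that by (intro divide_left_mono) auto
      then show ?thesis using that C0 by (intro frac_le mult_left_mono mult_nonneg_nonneg add_nonneg_nonneg) auto
    qed
    have k1: "\<kappa> \<le> \<epsilon> + C * (1 + 3 / l) / l" "\<epsilon> + C * (1 + 3 / l') / l' \<le> \<kappa>"
      unfolding \<kappa>_def using k LL by auto
    have k0: "\<epsilon> + C * (1 + 3 / l') / l' \<ge> 0" using s(3) C0 LL by (intro add_nonneg_nonneg divide_nonneg_nonneg mult_nonneg_nonneg) auto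
    have "\<kappa> * L = \<epsilon> * L + C * (1 + 3 / L)" unfolding \<kappa>_def using LL by (simp add: distrib_right)
    also have "\<dots> \<le> \<epsilon> * l' + C * (1 + 3 / l)"
      using LL s(3) C0 by (intro add_mono mult_left_mono divide_left_mono) auto
    also have "\<dots> < (1 + (\<epsilon> + C * (1 + 3 / l') / l')) * (c - (\<epsilon> + C * (1 + 3 / l) / l))" by (rule s(6))
    also have "\<dots> \<le> (1 + \<kappa>) * (ln L - \<kappa>)"
    proof (rule mult_mono)
      have "ln l \<le> ln L" using LL by (subst ln_le_cancel_iff) auto
      then show "c - (\<epsilon> + C * (1 + 3 / l) / l) \<le> ln L - \<kappa>" using 2(4) k1 by linarith
    qed (use k1 k0 s(7) in auto)
    finally have fin: "\<kappa> * L < (1 + \<kappa>) * (ln L - \<kappa>)" .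
    have "psi (exp L) \<le> exp L * (1 + \<epsilon>)" using s(2,4) LL unfolding psi_bound_def by auto
    then have "psi (real N) \<le> real N * (1 + \<epsilon>)" using N L by simp
    from pi_ok_final[OF base N L this s(3) \<kappa>_def[unfolded C_def] fin] show ?thesis .
  next
    case False
    have "ln l + 2 * (l' - l) / (l' + l) \<le> ln l'" using s 2(3) by (intro ln_ratio_ge) auto
    then have c': "c' \<le> ln l'" using s(5) 2(4) by linarith
    have "xs \<noteq> []" using 2(7) False by auto
    then show ?thesis using "2.IH"[OF s(8) _ c'] 2 False s(1) by simp
  qed
qed simp

text \<open>With \<open>l = ln L\<close> the quantity \<open>\<kappa> L\<close> is about
  \<open>l/2 + 1.1\<close>, to be compared with nearly \<open>l\<close>; since
  \<open>l \<ge> 8.29\<close> there is ample room.\<close>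

lemma pi_ok_generic:
  assumes base: "real (prime_count 0 8640) \<le> thetan 8640 / ln 8640 + 1104/1000 * hfun 8640" and N: "N \<ge> 8640" and L: "L = ln (real N)" "L \<ge> 4000"
    and gen: "psi (exp L) \<le> exp L * (1 + ln L / (2 * L))" and l4: "ln (4000::real) \<ge> 829/100" "ln (4000::real) \<le> 83/10"
  shows "pi_ok N"
proof -
  define l where "l = ln L"
  define \<kappa> where "\<kappa> = ln L / (2 * L) + 1104/1000 * (1 + 3 / L) / L"
  have l: "l \<ge> 829/100"
  proof -
    have "ln 4000 \<le> l" unfolding l_def using L(2) by (subst ln_le_cancel_iff) auto
    then show ?thesis using l4 by linarith
  qed
  have lu: "l \<le> 73/10 + L / 4000" using ln_le_tangent[of L 4000] L(2) l4 by (simp add: l_def)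
  have L0: "L > 0" using L by simp
  have "(a / (2 * L) + c / L) * L = a / 2 + c" for a c :: real using L0 by (simp add: distrib_right)
  then have k: "\<kappa> * L = l / 2 + 1104/1000 * (1 + 3 / L)" unfolding \<kappa>_def l_def .
  have "3 / L \<le> 3 / 4000" using L(2) by (intro divide_left_mono) auto
  then have k1: "\<kappa> * L \<le> l / 2 + 111/100" unfolding k by simp
  have "\<kappa> * L \<le> 1/100 * L" using k1 lu L(2) by linarith
  then have k2: "\<kappa> \<le> 1/100" using L0 by simp
  have k0: "\<kappa> \<ge> 0" unfolding \<kappa>_def l_def[symmetric] using L0 l by (intro add_nonneg_nonneg divide_nonneg_nonneg mult_nonneg_nonneg) auto
  have 1: "1 * (l - 1/100) \<le> (1 + \<kappa>) * (l - \<kappa>)" using k0 k2 l by (intro mult_mono) auto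
  have 2: "l / 2 + 111/100 < l - 1/100" using l by simp
  note k1
  also note 2
  also have "l - 1/100 \<le> (1 + \<kappa>) * (ln L - \<kappa>)" using 1 by (simp only: mult_1 l_def)
  finally have fin: "\<kappa> * L < (1 + \<kappa>) * (ln L - \<kappa>)" .
  have e: "psi (real N) \<le> real N * (1 + ln L / (2 * L))" using gen N L(1) by simp
  have e0: "ln L / (2 * L) \<ge> 0" using L(2) by (intro divide_nonneg_nonneg) auto
  from pi_ok_final[OF base N L(1) e e0 \<kappa>_def fin] show ?thesis .
qed

section \<open>Tables for the primes up to 8640\<close>

lemma primes_30: "prime_count 30 60 \<le> 7"
  by (rule prime_count_blocks[of 1 "[[1,1,1,1,1,7,1,1]]"]) (simp_all add: block_ok_def)

lemma primes_60: "prime_count 60 90 \<le> 7"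
  by (rule prime_count_blocks[of 2 "[[1,1,1,1,7,1,1,1]]"]) (simp_all add: block_ok_def)

lemma primes_90: "prime_count 90 120 \<le> 6"
  by (rule prime_count_blocks[of 3 "[[7,1,1,1,1,1,1,7]]"]) (simp_all add: block_ok_def)

lemma primes_120: "prime_count 120 150 \<le> 5"
  by (rule prime_count_blocks[of 4 "[[11,1,1,7,1,1,11,1]]"]) (simp_all add: block_ok_def)

lemma primes_150: "prime_count 150 180 \<le> 6"
  by (rule prime_count_blocks[of 5 "[[1,1,7,1,1,13,1,1]]"]) (simp_all add: block_ok_def)

lemma primes_180: "prime_count 180 210 \<le> 5"
  by (rule prime_count_blocks[of 6 "[[1,11,1,1,1,1,7,11]]"]) (simp_all add: block_ok_def)

lemma primes_210: "prime_count 210 240 \<le> 6"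
  by (rule prime_count_blocks[of 7 "[[1,7,13,1,1,1,1,1]]"]) (simp_all add: block_ok_def)

lemma primes_240: "prime_count 240 270 \<le> 5"
  by (rule prime_count_blocks[of 8 "[[1,13,1,11,1,7,1,1]]"]) (simp_all add: block_ok_def)

lemma primes_270: "prime_count 270 300 \<le> 5"
  by (rule prime_count_blocks[of 9 "[[1,1,1,1,7,17,1,13]]"]) (simp_all add: block_ok_def)

lemma primes_300: "prime_count 300 330 \<le> 4"
  by (rule prime_count_blocks[of 10 "[[7,1,1,1,1,11,17,7]]"]) (simp_all add: block_ok_def)

lemma primes_330: "prime_count 330 360 \<le> 6"
  by (rule prime_count_blocks[of 11 "[[1,1,11,7,1,1,1,1]]"]) (simp_all add: block_ok_def)

lemma primes_360: "prime_count 360 390 \<le> 5"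
  by (rule prime_count_blocks[of 12 "[[19,1,7,1,13,1,1,1]]"]) (simp_all add: block_ok_def)

lemma primes_390: "prime_count 390 420 \<le> 4"
  by (rule prime_count_blocks[of 13 "[[17,1,1,13,11,1,7,1]]"]) (simp_all add: block_ok_def)

lemma primes_420: "prime_count 420 450 \<le> 6"
  by (rule prime_count_blocks[of 14 "[[1,7,1,1,19,1,1,1]]"]) (simp_all add: block_ok_def)

lemma primes_450: "prime_count 450 480 \<le> 5"
  by (rule prime_count_blocks[of 15 "[[11,1,1,1,1,7,11,1]]"]) (simp_all add: block_ok_def)

lemma primes_480: "prime_count 480 510 \<le> 5"
  by (rule prime_count_blocks[of 16 "[[13,1,1,17,7,1,1,1]]"]) (simp_all add: block_ok_def)

lemma primes_510: "prime_count 510 540 \<le> 2"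
  by (rule prime_count_blocks[of 17 "[[7,11,1,1,17,23,13,7]]"]) (simp_all add: block_ok_def)

lemma primes_540: "prime_count 540 570 \<le> 5"
  by (rule prime_count_blocks[of 18 "[[1,1,19,7,1,13,1,1]]"]) (simp_all add: block_ok_def)

lemma primes_570: "prime_count 570 600 \<le> 5"
  by (rule prime_count_blocks[of 19 "[[1,1,7,11,1,19,1,1]]"]) (simp_all add: block_ok_def)

lemma primes_600: "prime_count 600 630 \<le> 5"
  by (rule prime_count_blocks[of 20 "[[1,1,13,1,1,1,7,17]]"]) (simp_all add: block_ok_def)

lemma primes_630: "prime_count 630 660 \<le> 6"
  by (rule prime_count_blocks[of 21 "[[1,7,1,1,1,11,1,1]]"]) (simp_all add: block_ok_def)

lemma primes_660: "prime_count 660 690 \<le> 4"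
  by (rule prime_count_blocks[of 22 "[[1,23,11,1,1,7,1,13]]"]) (simp_all add: block_ok_def)

lemma primes_690: "prime_count 690 720 \<le> 4"
  by (rule prime_count_blocks[of 23 "[[1,17,1,19,7,1,23,1]]"]) (simp_all add: block_ok_def)

lemma primes_720: "prime_count 720 750 \<le> 4"
  by (rule prime_count_blocks[of 24 "[[7,1,17,1,11,1,1,7]]"]) (simp_all add: block_ok_def)

lemma primes_750: "prime_count 750 780 \<le> 5"
  by (rule prime_count_blocks[of 25 "[[1,1,1,7,13,1,1,19]]"]) (simp_all add: block_ok_def)

lemma primes_780: "prime_count 780 810 \<le> 3"
  by (rule prime_count_blocks[of 26 "[[11,1,7,13,1,17,11,1]]"]) (simp_all add: block_ok_def)

lemma primes_810: "prime_count 810 840 \<le> 6"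
  by (rule prime_count_blocks[of 27 "[[1,19,1,1,1,1,7,1]]"]) (simp_all add: block_ok_def)

lemma primes_840: "prime_count 840 870 \<le> 4"
  by (rule prime_count_blocks[of 28 "[[29,7,23,1,1,1,1,11]]"]) (simp_all add: block_ok_def)

lemma primes_870: "prime_count 870 930 \<le> 8"
  by (rule prime_count_blocks[of 29 "[[13,1,1,1,1,7,19,29], [17,1,1,11,7,1,13,1]]"]) (simp_all add: block_ok_def)

lemma primes_930: "prime_count 930 990 \<le> 8"
  by (rule prime_count_blocks[of 31 "[[7,1,1,23,1,13,1,7], [31,1,1,7,1,11,1,23]]"]) (simp_all add: block_ok_def)

lemma primes_990: "prime_count 990 1050 \<le> 10"
  by (rule prime_count_blocks[of 33 "[[1,1,7,17,19,1,1,1], [1,13,1,1,17,1,7,1]]"]) (simp_all add: block_ok_def)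

lemma primes_1050: "prime_count 1050 1110 \<le> 10"
  by (rule prime_count_blocks[of 35 "[[1,7,1,1,11,1,29,13], [23,1,1,1,1,7,1,1]]"]) (simp_all add: block_ok_def)

lemma primes_1110: "prime_count 1110 1170 \<le> 6"
  by (rule prime_count_blocks[of 37 "[[11,1,19,1,7,1,11,17], [7,31,1,1,13,19,1,7]]"]) (simp_all add: block_ok_def)

lemma primes_1170: "prime_count 1170 1230 \<le> 9"
  by (rule prime_count_blocks[of 39 "[[1,11,1,7,1,29,1,11], [1,17,7,1,1,23,1,1]]"]) (simp_all add: block_ok_def)

lemma primes_1230: "prime_count 1230 1290 \<le> 8"
  by (rule prime_count_blocks[of 41 "[[1,1,17,11,29,1,7,1], [13,7,31,19,1,1,1,1]]"]) (simp_all add: block_ok_def)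

lemma primes_1290: "prime_count 1290 1380 \<le> 11"
  by (rule prime_count_blocks[of 43 "[[1,1,1,1,1,7,13,1], [1,1,11,31,7,13,17,19], [7,23,1,29,1,37,1,7]]"]) (simp_all add: block_ok_def)

lemma primes_1380: "prime_count 1380 1470 \<le> 12"
  by (rule prime_count_blocks[of 46 "[[1,19,13,7,11,1,23,1], [17,13,7,1,1,1,1,1], [11,1,1,1,31,1,7,13]]"]) (simp_all add: block_ok_def)

lemma primes_1470: "prime_count 1470 1560 \<le> 14"
  by (rule prime_count_blocks[of 49 "[[1,7,1,1,1,1,1,1], [19,11,1,17,37,7,1,11], [1,29,23,1,7,1,1,1]]"]) (simp_all add: block_ok_def)

lemma primes_1560: "prime_count 1560 1650 \<le> 13"
  by (rule prime_count_blocks[of 52 "[[7,1,1,11,19,1,1,7], [37,1,1,7,1,1,1,1], [1,1,7,23,1,11,31,17]]"]) (simp_all add: block_ok_def)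

lemma primes_1650: "prime_count 1650 1740 \<le> 11"
  by (rule prime_count_blocks[of 55 "[[13,1,11,1,1,1,7,23], [41,7,19,1,1,1,13,1], [29,17,1,1,11,7,1,37]]"]) (simp_all add: block_ok_def)

lemma primes_1740: "prime_count 1740 1860 \<le> 13"
  by (rule prime_count_blocks[of 58 "[[1,1,17,1,7,1,41,29], [7,1,13,1,1,1,11,7], [1,13,1,7,23,17,1,31], [1,11,7,19,1,43,17,11]]"]) (simp_all add: block_ok_def)

lemma primes_1860: "prime_count 1860 1980 \<le> 16"
  by (rule prime_count_blocks[of 62 "[[1,1,1,1,1,1,7,1], [31,7,1,11,1,23,1,19], [17,41,1,1,13,7,29,1], [1,19,37,13,7,11,1,1]]"]) (simp_all add: block_ok_def)

lemma primes_1980: "prime_count 1980 2100 \<le> 18"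
  by (rule prime_count_blocks[of 66 "[[7,1,11,1,1,1,1,7], [1,1,43,7,1,1,19,1], [13,23,7,1,11,29,1,1], [19,31,1,1,1,1,7,1]]"]) (simp_all add: block_ok_def)

lemma primes_2100: "prime_count 2100 2220 \<le> 13"
  by (rule prime_count_blocks[of 70 "[[11,7,1,1,29,13,11,1], [1,1,1,1,19,7,1,17], [1,11,13,41,7,1,37,11], [7,13,31,1,1,47,1,7]]"]) (simp_all add: block_ok_def)

lemma primes_2220: "prime_count 2220 2370 \<le> 20"
  by (rule prime_count_blocks[of 74 "[[1,17,23,7,1,1,1,13], [1,37,7,31,1,1,1,43], [1,1,29,1,1,11,7,1], [1,7,11,23,13,17,1,1], [1,1,1,13,1,7,17,23]]"]) (simp_all add: block_ok_def)

lemma primes_2370: "prime_count 2370 2520 \<le> 18"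
  by (rule prime_count_blocks[of 79 "[[1,1,1,1,7,1,1,1], [7,29,1,19,1,41,1,7], [11,1,1,7,1,31,11,1], [23,1,7,1,1,37,13,19], [47,11,41,1,23,13,7,11]]"]) (simp_all add: block_ok_def)

lemma primes_2520: "prime_count 2520 2670 \<le> 18"
  by (rule prime_count_blocks[of 84 "[[1,7,1,17,43,1,1,1], [1,1,13,11,17,7,31,1], [29,13,1,1,7,23,19,1], [7,1,1,43,37,11,1,7], [19,1,11,7,1,1,1,17]]"]) (simp_all add: block_ok_def)

lemma primes_2670: "prime_count 2670 2850 \<le> 27"
  by (rule prime_count_blocks[of 89 "[[1,1,7,1,1,1,1,1], [37,1,1,1,11,1,7,1], [1,7,1,13,41,1,1,31], [11,1,17,47,1,7,11,1], [1,1,1,1,7,53,29,1], [7,11,19,1,1,17,1,7]]"]) (simp_all add: block_ok_def)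

lemma primes_2850: "prime_count 2850 3030 \<le> 21"
  by (rule prime_count_blocks[of 95 "[[1,1,1,7,47,19,13,1], [43,1,7,11,1,13,1,1], [41,1,23,37,1,29,7,1], [17,7,13,1,1,11,1,1], [1,13,11,19,29,7,41,1], [1,31,1,23,7,1,1,13]]"]) (simp_all add: block_ok_def)

lemma primes_3030: "prime_count 3030 3240 \<le> 23"
  by (rule prime_count_blocks[of 101 "[[7,1,1,17,11,1,43,7], [1,1,37,7,17,1,1,1], [11,19,7,29,13,1,11,1], [1,53,31,13,1,43,7,47], [23,7,29,1,1,1,19,11], [1,1,1,31,23,7,1,1], [13,1,1,11,7,1,53,41]]"]) (simp_all add: block_ok_def)

lemma primes_3240: "prime_count 3240 3450 \<le> 25"
  by (rule prime_count_blocks[of 108 "[[7,17,1,1,1,1,13,7], [1,29,17,7,19,11,37,1], [1,1,7,1,31,1,1,1], [1,47,13,1,1,17,7,1], [1,7,1,1,11,31,17,1], [1,43,19,41,1,7,1,13], [11,23,47,1,7,19,11,1]]"]) (simp_all add: block_ok_def)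

lemma primes_3450: "prime_count 3450 3690 \<le> 32"
  by (rule prime_count_blocks[of 115 "[[7,1,1,1,1,1,23,7], [59,11,1,7,13,1,31,11], [1,1,7,13,1,1,1,1], [1,1,53,11,1,1,7,43], [1,7,1,1,17,37,1,59], [13,1,23,1,1,7,1,19], [1,1,11,1,7,41,13,1], [7,19,1,1,1,13,29,7]]"]) (simp_all add: block_ok_def)

lemma primes_3690: "prime_count 3690 3930 \<le> 31"
  by (rule prime_count_blocks[of 123 "[[1,1,1,7,11,1,47,1], [61,1,7,1,37,1,19,23], [11,13,1,53,1,1,7,1], [19,7,17,1,1,29,1,13], [37,11,1,1,43,7,1,11], [23,1,1,1,7,17,1,53], [7,1,1,11,13,1,17,7], [47,1,1,7,1,1,1,1]]"]) (simp_all add: block_ok_def)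

lemma primes_3930: "prime_count 3930 4200 \<le> 29"
  by (rule prime_count_blocks[of 131 "[[1,31,7,1,1,11,59,37], [17,1,11,29,41,23,7,1], [13,7,1,1,1,19,1,1], [1,1,29,37,11,7,13,1], [1,1,31,17,7,13,1,1], [7,61,1,1,17,1,11,7], [1,23,13,7,1,1,1,1], [41,11,7,1,1,1,23,11], [43,1,37,47,53,59,7,13]]"]) (simp_all add: block_ok_def)

lemma primes_4200: "prime_count 4200 4470 \<le> 33"
  by (rule prime_count_blocks[of 140 "[[1,7,1,11,1,1,41,1], [1,19,1,1,31,7,1,1], [1,17,1,1,7,11,1,1], [7,1,11,13,59,31,19,7], [29,1,61,7,1,1,43,1], [19,1,7,1,11,17,1,29], [13,41,1,23,1,53,7,1], [11,7,1,1,19,43,11,23], [1,1,1,61,1,7,1,41]]"]) (simp_all add: block_ok_def)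

lemma primes_4470: "prime_count 4470 4770 \<le> 34"
  by (rule prime_count_blocks[of 149 "[[17,11,1,1,7,67,1,11], [7,1,13,1,1,1,1,7], [23,13,19,7,1,1,29,47], [1,1,7,17,23,19,1,13], [1,1,43,1,17,11,7,31], [1,7,11,41,1,1,1,1], [1,1,59,1,13,7,1,1], [31,43,1,13,7,37,1,17], [7,53,1,1,29,1,1,7], [11,47,1,7,67,1,11,19]]"]) (simp_all add: block_ok_def)

lemma primes_4770: "prime_count 4770 5100 \<le> 40"
  by (rule prime_count_blocks[of 159 "[[13,17,7,1,1,1,1,1], [1,11,17,1,1,61,7,11], [1,7,47,29,37,13,23,43], [1,31,1,11,1,7,19,1], [67,59,13,1,7,1,17,1], [7,13,1,1,1,11,1,7], [1,1,11,7,1,1,1,13], [17,1,7,1,19,1,1,1], [1,29,1,1,11,47,7,1], [71,7,1,31,13,1,61,37], [11,1,1,13,1,7,11,1]]"]) (simp_all add: block_ok_def)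

lemma primes_5100: "prime_count 5100 5430 \<le> 35"
  by (rule prime_count_blocks[of 170 "[[1,1,19,1,7,1,47,23], [7,11,53,37,1,19,1,7], [13,1,1,7,31,1,71,1], [29,1,7,11,41,1,13,17], [23,1,1,1,1,13,7,29], [59,7,1,19,23,11,1,1], [1,17,11,67,1,7,1,1], [47,13,17,1,7,73,1,19], [7,1,1,53,11,23,31,7], [41,19,1,7,1,17,1,1], [11,1,7,1,1,1,11,61]]"]) (simp_all add: block_ok_def)

lemma primes_5430: "prime_count 5430 5790 \<le> 43"
  by (rule prime_count_blocks[of 181 "[[1,1,1,1,13,1,7,53], [43,7,1,13,1,1,1,11], [17,23,1,1,1,7,37,1], [1,1,1,11,7,29,23,31], [7,1,67,1,19,1,1,7], [1,37,1,7,29,11,13,71], [31,41,7,1,17,13,43,1], [1,1,1,1,1,1,7,1], [53,7,13,1,11,1,1,41], [1,13,1,29,1,7,59,17], [11,1,1,1,7,1,11,13], [7,73,29,23,53,1,1,7]]"]) (simp_all add: block_ok_def)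

lemma primes_5790: "prime_count 5790 6150 \<le> 42"
  by (rule prime_count_blocks[of 193 "[[1,11,1,7,1,37,1,11], [1,1,7,19,13,1,1,1], [1,1,1,11,1,1,7,1], [1,7,43,71,1,17,1,19], [23,61,31,1,1,7,17,1], [13,19,11,1,7,59,67,47], [7,43,1,31,1,53,13,7], [17,1,1,7,11,13,19,1], [37,1,7,1,1,23,1,73], [11,1,13,1,59,1,7,1], [1,7,1,17,31,41,1,29], [1,11,1,1,17,7,1,11]]"]) (simp_all add: block_ok_def)

lemma primes_6150: "prime_count 6150 6510 \<le> 41"
  by (rule prime_count_blocks[of 205 "[[1,47,61,1,7,31,1,37], [7,23,41,11,1,1,1,7], [1,1,1,7,13,1,23,17], [79,1,7,13,1,11,1,1], [1,1,11,61,1,19,7,1], [1,7,1,59,1,71,1,1], [13,1,17,1,11,7,1,1], [1,1,23,1,7,1,13,1], [7,1,37,19,43,13,11,7], [1,1,59,7,41,47,17,1], [1,11,7,23,29,1,1,11], [1,13,1,43,73,67,7,23]]"]) (simp_all add: block_ok_def)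

lemma primes_6510: "prime_count 6510 6870 \<le> 42"
  by (rule prime_count_blocks[of 217 "[[17,7,1,11,61,1,47,13], [31,1,1,1,79,7,1,1], [1,1,1,29,7,11,19,1], [7,1,11,17,13,1,37,7], [19,1,29,7,17,61,1,1], [1,59,7,1,11,1,41,1], [1,37,1,1,19,1,7,1], [11,7,53,1,1,23,11,17], [43,29,1,1,67,7,13,1], [1,11,1,1,7,13,1,11], [7,17,19,1,1,1,1,7], [1,41,13,7,1,19,1,1]]"]) (simp_all add: block_ok_def)

lemma primes_6870: "prime_count 6870 7230 \<le> 40"
  by (rule prime_count_blocks[of 229 "[[1,13,7,1,71,83,61,1], [67,1,1,31,1,11,7,13], [29,7,11,53,1,1,17,1], [1,1,1,19,1,7,1,29], [1,1,1,47,7,43,1,1], [7,1,79,13,31,1,1,7], [11,1,23,7,37,1,11,1], [73,19,7,41,47,31,1,1], [13,11,1,17,1,1,7,11], [37,7,1,23,17,1,13,67], [71,1,43,11,1,7,1,23], [19,1,1,1,7,1,31,1]]"]) (simp_all add: block_ok_def)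

lemma primes_7230: "prime_count 7230 7590 \<le> 40"
  by (rule prime_count_blocks[of 241 "[[7,1,13,1,1,11,1,7], [53,13,11,7,19,29,1,37], [23,1,7,67,1,1,71,13], [1,17,1,1,11,41,7,1], [1,7,17,37,53,1,73,47], [11,83,19,1,13,7,11,31], [1,1,41,13,7,17,1,43], [7,11,1,29,1,1,17,7], [31,1,1,7,1,1,59,1], [13,1,7,11,1,73,1,1], [17,1,1,19,1,1,7,1], [1,7,67,1,1,11,1,1]]"]) (simp_all add: block_ok_def)

lemma primes_7590: "prime_count 7590 7950 \<le> 40"
  by (rule prime_count_blocks[of 253 "[[1,71,11,1,1,7,23,19], [1,29,13,17,7,1,1,1], [7,13,47,79,11,1,1,7], [1,1,1,7,43,1,1,13], [11,1,7,1,1,59,11,71], [1,61,23,1,1,1,7,17], [19,7,31,43,13,1,1,11], [29,37,73,13,1,7,1,1], [41,17,1,11,7,47,1,29], [7,1,17,1,1,1,1,7], [13,53,1,7,1,11,41,1], [89,1,7,1,1,17,13,1]]"]) (simp_all add: block_ok_def)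

lemma primes_7950: "prime_count 7950 8310 \<le> 38"
  by (rule prime_count_blocks[of 265 "[[1,73,19,1,31,13,7,79], [23,7,61,1,11,19,53,1], [1,1,13,71,23,7,29,1], [11,13,83,1,7,1,11,1], [7,41,1,59,1,1,1,7], [1,11,1,7,1,23,1,11], [47,79,7,17,1,29,31,41], [1,1,1,11,13,1,7,19], [1,7,59,13,29,1,43,1], [1,19,1,1,1,7,1,73], [37,23,11,1,7,1,1,17], [7,1,1,1,1,43,19,7]]"]) (simp_all add: block_ok_def)

lemma primes_8310: "prime_count 8310 8640 \<le> 33"
  by (rule prime_count_blocks[of 277 "[[1,1,53,7,11,1,13,31], [19,17,7,1,61,13,1,1], [11,1,17,83,1,1,7,37], [31,7,13,47,19,1,1,1], [1,11,23,1,1,7,79,11], [1,1,43,37,7,61,17,13], [7,29,1,11,47,67,1,7], [1,1,19,7,1,1,1,83], [17,43,7,1,13,11,1,23], [1,31,11,13,1,1,7,1], [79,7,37,1,1,1,89,53]]"]) (simp_all add: block_ok_def)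

lemmas primes_blocks = 
  primes_30 primes_60 primes_90 primes_120 primes_150 primes_180 primes_210 primes_240 primes_270 primes_300
  primes_330 primes_360 primes_390 primes_420 primes_450 primes_480 primes_510 primes_540 primes_570 primes_600
  primes_630 primes_660 primes_690 primes_720 primes_750 primes_780 primes_810 primes_840 primes_870 primes_930
  primes_990 primes_1050 primes_1110 primes_1170 primes_1230 primes_1290 primes_1380 primes_1470 primes_1560 primes_1650
  primes_1740 primes_1860 primes_1980 primes_2100 primes_2220 primes_2370 primes_2520 primes_2670 primes_2850 primes_3030
  primes_3240 primes_3450 primes_3690 primes_3930 primes_4200 primes_4470 primes_4770 primes_5100 primes_5430 primes_5790
  primes_6150 primes_6510 primes_6870 primes_7230 primes_7590 primes_7950 primes_8310

text \<open>A row holds the end of a block in units of 30, the number of its primes, a smooth code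
  above the running count and one below the start of the block. Blocks can become longer as the
  slack in \<open>K ln K < n\<close> grows.\<close>

definition chain_table :: "(nat \<times> nat \<times> (nat \<times> nat \<times> nat) \<times> (nat \<times> nat \<times> nat)) list" where
  "chain_table = [
   (2, 7, (1,2,0), (1,1,1)), (3, 7, (3,1,0), (2,1,1)), (4, 6, (1,1,1), (1,2,1)), (5, 5, (2,2,0), (3,1,1)),
   (6, 6, (0,2,1), (1,1,2)), (7, 5, (4,1,0), (2,2,1)), (8, 6, (1,3,0), (3,0,2)), (9, 5, (2,1,1), (4,1,1)),
   (10, 5, (6,0,0), (1,3,1)), (11, 4, (3,2,0), (2,1,2)), (12, 6, (3,2,0), (2,4,0)), (13, 5, (4,0,1), (3,2,1)),
   (14, 4, (0,4,0), (7,1,0)), (15, 6, (1,2,1), (0,4,1)), (16, 5, (5,1,0), (1,2,2)), (17, 5, (2,0,2), (5,1,1)),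
   (18, 2, (2,0,2), (2,0,3)), (19, 5, (2,3,0), (2,3,1)), (20, 5, (3,1,1), (2,3,1)), (21, 5, (3,1,1), (3,1,2)),
   (22, 6, (3,1,1), (0,0,4)), (23, 4, (0,0,3), (3,4,0)), (24, 4, (7,0,0), (0,3,2)), (25, 4, (0,3,1), (4,2,1)),
   (26, 5, (4,2,0), (1,1,3)), (27, 3, (4,2,0), (8,1,0)), (28, 6, (1,1,2), (1,4,1)), (29, 4, (1,1,2), (1,4,1)),
   (31, 8, (5,0,1), (5,3,0)), (33, 8, (2,2,1), (2,2,2)), (35, 10, (2,2,1), (2,5,0)), (37, 10, (6,1,0), (10,0,0)),
   (39, 6, (6,1,0), (3,3,1)), (41, 9, (3,3,0), (7,2,0)), (43, 8, (3,3,0), (0,5,1)), (46, 11, (0,2,2), (8,0,1)),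
   (49, 12, (4,1,1), (1,3,2)), (52, 14, (1,0,3), (1,6,0)), (55, 13, (1,3,1), (9,1,0)), (58, 11, (1,3,1), (2,4,1)),
   (62, 13, (5,2,0), (6,3,0)), (66, 16, (2,1,2), (3,2,2)), (70, 18, (6,0,1), (3,5,0)), (74, 13, (3,2,1), (11,0,0)),
   (79, 20, (3,2,1), (0,7,0)), (84, 18, (0,1,3), (8,2,0)), (89, 18, (4,0,2), (2,0,4)), (95, 27, (4,3,0), (5,4,0)),
   (101, 21, (1,2,2), (2,3,2)), (108, 23, (5,1,1), (3,1,3)), (115, 25, (1,5,0), (3,4,1)), (123, 32, (2,3,1), (0,3,3)),
   (131, 31, (6,2,0), (0,6,1)), (140, 29, (6,2,0), (4,5,0)), (149, 33, (0,0,4), (12,0,0)), (159, 34, (3,4,0), (1,7,0)),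
   (170, 40, (4,2,1), (9,2,0)), (181, 35, (4,2,1), (3,0,4)), (193, 43, (8,1,0), (3,3,2)), (205, 42, (1,4,1), (7,2,1)),
   (217, 41, (5,3,0), (11,1,0)), (229, 42, (2,2,2), (4,4,1)), (241, 40, (6,1,1), (1,3,3)), (253, 40, (2,5,0), (5,2,2)),
   (265, 40, (10,0,0), (2,1,4)), (277, 38, (3,3,1), (5,5,0)), (288, 33, (3,3,1), (13,0,0))]"

lemma chain_table: "chain_ok 1 10 chain_table"
  by (simp add: chain_table_def primes_blocks smooth_def smooth_ln_def smooth_ln'_def)

lemma chain_table_end: "chain_end 1 chain_table = 288"
  by (simp add: chain_table_def)

lemma chain_table_weight: "chain_weight chain_table \<le> 144"
  by (simp add: chain_table_def smooth_ln_def smooth_ln'_def)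

definition small_table :: "(nat \<times> nat \<times> nat \<times> nat) list" where
  "small_table = [(1, (0,0,0)), (1, (1,0,0)), (2, (0,0,0)), (1, (0,1,0)), (2, (0,0,0)), (1, (2,0,0)), (2, (0,0,0)), (3, (0,0,0)), (2, (0,0,0)), (1, (0,0,1)), (2, (0,0,0)), (1, (1,1,0)), (2, (0,0,0)), (3, (0,0,0)), (2, (0,0,0)), (1, (3,0,0)), (2, (0,0,0)), (1, (3,0,0)), (2, (0,0,0)), (3, (0,0,0)), (2, (0,0,0)), (1, (0,2,0)), (2, (0,0,0)), (5, (0,0,0)), (2, (0,0,0)), (3, (0,0,0)), (2, (0,0,0)), (1, (1,0,1)), (2, (0,0,0)), (1, (2,1,0)), (2, (0,0,0)), (3, (0,0,0)), (2, (0,0,0)), (5, (0,0,0)), (2, (0,0,0)), (1, (2,1,0)), (2, (0,0,0)), (3, (0,0,0)), (2, (0,0,0)), (1, (0,1,1)), (2, (0,0,0)), (1, (0,1,1)), (2, (0,0,0)), (3, (0,0,0)), (2, (0,0,0)), (1, (0,1,1)), (2, (0,0,0)), (7, (0,0,0)), (2, (0,0,0)), (3, (0,0,0)), (2, (0,0,0)), (1, (4,0,0)), (2, (0,0,0)), (5, (0,0,0)), (2, (0,0,0)), (3, (0,0,0)), (2, (0,0,0)), (1, (1,2,0)), (2, (0,0,0)), (1, (1,2,0)), (2, (0,0,0)), (3, (0,0,0)), (2, (0,0,0)), (5, (0,0,0)), (2, (0,0,0)), (1, (2,0,1)), (2, (0,0,0)), (3, (0,0,0)), (2, (0,0,0)),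 (1, (2,0,1)), (2, (0,0,0)), (1, (3,1,0)), (2, (0,0,0)), (3, (0,0,0)), (2, (0,0,0)), (7, (0,0,0)), (2, (0,0,0)), (1, (3,1,0)), (2, (0,0,0)), (3, (0,0,0)), (2, (0,0,0)), (1, (3,1,0)), (2, (0,0,0)), (5, (0,0,0)), (2, (0,0,0)), (3, (0,0,0)), (2, (0,0,0)), (1, (3,1,0)), (2, (0,0,0)), (7, (0,0,0)), (2, (0,0,0)), (3, (0,0,0)), (2, (0,0,0)), (5, (0,0,0)), (2, (0,0,0)), (1, (0,0,2)), (2, (0,0,0)), (3, (0,0,0)), (2, (0,0,0)), (1, (0,3,0)), (2, (0,0,0)), (1, (0,3,0)), (2, (0,0,0)), (3, (0,0,0)), (2, (0,0,0)), (1, (1,1,1)), (2, (0,0,0)), (1, (1,1,1)), (2, (0,0,0)), (3, (0,0,0)), (2, (0,0,0)), (1, (1,1,1)), (2, (0,0,0)), (5, (0,0,0)), (2, (0,0,0)), (3, (0,0,0)), (2, (0,0,0)), (7, (0,0,0)), (2, (0,0,0)), (11, (0,0,0)), (2, (0,0,0)), (3, (0,0,0)), (2, (0,0,0)), (5, (0,0,0)), (2, (0,0,0)), (1, (5,0,0)), (2, (0,0,0)), (3, (0,0,0)), (2, (0,0,0)), (1, (5,0,0)), (2, (0,0,0)), (7, (0,0,0)), (2, (0,0,0)), (3, (0,0,0)), (2, (0,0,0)), (1, (2,2,0)), (2, (0,0,0)), (1, (2,2,0)), (2, (0,0,0)), (3, (0,0,0)), (2, (0,0,0)), (11, (0,0,0)),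 (2, (0,0,0)), (5, (0,0,0)), (2, (0,0,0)), (3, (0,0,0)), (2, (0,0,0)), (1, (2,2,0)), (2, (0,0,0)), (1, (2,2,0)), (2, (0,0,0)), (3, (0,0,0)), (2, (0,0,0)), (5, (0,0,0)), (2, (0,0,0)), (1, (3,0,1)), (2, (0,0,0)), (3, (0,0,0)), (2, (0,0,0)), (7, (0,0,0)), (2, (0,0,0)), (1, (3,0,1)), (2, (0,0,0)), (3, (0,0,0)), (2, (0,0,0)), (1, (3,0,1)), (2, (0,0,0)), (13, (0,0,0)), (2, (0,0,0)), (3, (0,0,0)), (2, (0,0,0)), (1, (3,0,1)), (2, (0,0,0)), (5, (0,0,0)), (2, (0,0,0)), (3, (0,0,0)), (2, (0,0,0)), (1, (0,2,1)), (2, (0,0,0)), (1, (0,2,1)), (2, (0,0,0)), (3, (0,0,0)), (2, (0,0,0)), (5, (0,0,0)), (2, (0,0,0)), (11, (0,0,0)), (2, (0,0,0)), (3, (0,0,0)), (2, (0,0,0)), (1, (0,2,1)), (2, (0,0,0)), (1, (0,2,1)), (2, (0,0,0)), (3, (0,0,0)), (2, (0,0,0)), (1, (0,2,1)), (2, (0,0,0)), (1, (4,1,0)), (2, (0,0,0)), (3, (0,0,0)), (2, (0,0,0)), (7, (0,0,0)), (2, (0,0,0)), (5, (0,0,0)), (2, (0,0,0)), (3, (0,0,0)), (2, (0,0,0)), (11, (0,0,0)), (2, (0,0,0)), (1, (4,1,0)), (2, (0,0,0)), (3, (0,0,0)), (2, (0,0,0)), (5, (0,0,0)), (2, (0,0,0)),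 (7, (0,0,0)), (2, (0,0,0)), (3, (0,0,0)), (2, (0,0,0)), (13, (0,0,0)), (2, (0,0,0)), (1, (4,1,0)), (2, (0,0,0)), (3, (0,0,0)), (2, (0,0,0)), (1, (1,0,2)), (2, (0,0,0)), (1, (1,0,2)), (2, (0,0,0)), (3, (0,0,0)), (2, (0,0,0)), (1, (1,3,0)), (2, (0,0,0)), (5, (0,0,0)), (2, (0,0,0)), (3, (0,0,0)), (2, (0,0,0)), (1, (1,3,0)), (2, (0,0,0))]"

lemma small_table: "small_ok 2 0 small_table" "length small_table = 239"
  by (simp_all add: small_table_def smooth_def smooth_ln_def)

lemma prime_count_30: "prime_count 0 30 \<le> 10"
proof -
  have "{p::nat. prime p \<and> 0 < p \<and> p \<le> 30} \<subseteq> {2, 3, 5, 7, 11, 13, 17, 19, 23, 29}"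
  proof
    fix p :: nat assume "p \<in> {p. prime p \<and> 0 < p \<and> p \<le> 30}"
    then have p: "prime p" "2 \<le> p" "p \<le> 30" by (auto simp: prime_ge_2_nat)
    have nd: "\<not> d dvd p \<or> p = d" if "d \<in> {2, 3, 5}" for d
      using p(1) that by (auto simp: prime_nat_iff)
    then have "\<not> 2 dvd p \<or> p = 2" "\<not> 3 dvd p \<or> p = 3" "\<not> 5 dvd p \<or> p = 5" by auto
    then show "p \<in> {2, 3, 5, 7, 11, 13, 17, 19, 23, 29}" using p(2,3) by simp presburger
  qed
  then have "card {p::nat. prime p \<and> 0 < p \<and> p \<le> 30} \<le> card {2, 3, 5, 7, 11, 13, 17, 19, 23, 29 :: nat}"
    by (intro card_mono) auto
  then show ?thesis by (simp add: prime_count_def)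
qed

text \<open>The primes up to 30 have excess at most 10 and the others at most 144 by the table. The
  total 154 just fits under \<open>1.104 * hfun 8640\<close>, which is about 154.5.\<close>

lemma prime_count_8640: "real (prime_count 0 8640) \<le> thetan 8640 / ln 8640 + 1104/1000 * hfun 8640"
proof -
  define u :: real where "u = smooth_ln (6, 3, 1)"
  have u: "u = 906456/100000" by (simp add: u_def smooth_ln_def)
  have u0: "u > 0" by (simp add: u)
  have l: "0 < ln (8640::real)" "ln (8640::real) \<le> u" using ln_8640 by (auto simp: u_def)
  have "excess 0 30 \<le> (\<Sum>p::nat | prime p \<and> 0 < p \<and> p \<le> 30. 1)"
    unfolding excess_def using l by (intro sum_mono) auto
  also have "\<dots> = real (prime_count 0 30)" by (simp add: prime_count_def)
  finally have "excess 0 30 \<le> 10" using prime_count_30 by linarith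
  moreover have "excess 30 8640 \<le> 144" using chain_weight[OF chain_table] chain_table_weight unfolding chain_table_end by simp
  moreover have "excess 0 8640 = excess 0 30 + excess 30 8640" by (rule excess_split) auto
  ultimately have e: "excess 0 8640 \<le> 154" by linarith
  have "154 \<le> 1104/1000 * (8640 / u ^ 2 + 3 * 8640 / u ^ 3)" by (simp add: u power_divide)
  also have "\<dots> \<le> 1104/1000 * hfun 8640"
    unfolding hfun_def using l u0 by (intro mult_left_mono add_mono divide_left_mono power_mono mult_pos_pos zero_less_power) auto
  finally have h: "154 \<le> 1104/1000 * hfun 8640" .
  have "excess 0 8640 = real (prime_count 0 8640) - thetan 8640 / ln 8640"
    by (simp add: excess_def sum_subtractf prime_count_def thetan_def sum_divide_distrib)
  then show ?thesis using e h by linarith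
qed

lemma psi_bound_1: "psi_bound (1133/125) (13/125)"
  unfolding psi_bound_def
proof (intro allI impI)
  fix L :: real assume L: "1133/125 \<le> L"
  have "ln (8100::real) \<le> L" using ln_smooth_le[of "(2, 4, 2)"] L by (simp add: smooth_def smooth_ln_def)
  then have "exp (ln 8100) \<le> exp L" by (simp only: exp_le_cancel_iff)
  then show "psi (exp L) \<le> exp L * (1 + 13/125)" using psi_le_8100[of "exp L"] by simp
qed

lemma psi_bound_2: "psi_bound 12 (223/2500)"
  unfolding psi_bound_def
proof (intro allI impI)
  fix L :: real assume L: "12 \<le> L"
  have "ln (162000::real) \<le> L" using ln_smooth_le[of "(4, 4, 3)"] L by (simp add: smooth_def smooth_ln_def)
  then have "exp (ln 162000) \<le> exp L" by (simp only: exp_le_cancel_iff)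
  then show "psi (exp L) \<le> exp L * (1 + 223/2500)" using psi_le_162000[of "exp L"] by simp
qed

lemma psi_bound_3: "psi_bound 24 (1927/25000)"
  using psi_le_full_cert[OF row_1] by (simp add: psi_bound_def)

lemma psi_bound_4: "psi_bound 32 (6561/100000)"
  using psi_le_full_cert[OF row_2] by (simp add: psi_bound_def)

lemma psi_bound_5: "psi_bound 41 (5613/100000)"
  using psi_le_full_cert[OF row_3] by (simp add: psi_bound_def)

lemma psi_bound_6: "psi_bound 52 (4829/100000)"
  using psi_le_full_cert[OF row_4] by (simp add: psi_bound_def)

lemma psi_bound_7: "psi_bound 65 (791/20000)"
  using psi_le_full_cert[OF row_5] by (simp add: psi_bound_def)

lemma psi_bound_8: "psi_bound 86 (63/2000)"
  using psi_le_full_cert[OF row_6] by (simp add: psi_bound_def)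

lemma psi_bound_9: "psi_bound 117 (307/12500)"
  using psi_le_full_cert[OF row_7] by (simp add: psi_bound_def)

lemma psi_bound_10: "psi_bound 162 (429/25000)"
  using psi_le_full_cert[OF row_8] by (simp add: psi_bound_def)

lemma psi_bound_11: "psi_bound 257 (63/6250)"
  using psi_le_full_cert[OF row_9] by (simp add: psi_bound_def)

lemma psi_bound_12: "psi_bound 499 (371/100000)"
  using psi_le_full_cert[OF row_10] by (simp add: psi_bound_def)

lemma psi_bound_13: "psi_bound 1664 (61/100000)"
  using psi_le_full_cert[OF row_11] by (simp add: psi_bound_def)

lemmas psi_bounds = psi_bound_1 psi_bound_2 psi_bound_3 psi_bound_4 psi_bound_5 psi_bound_6 psi_bound_7 psi_bound_8
  psi_bound_9 psi_bound_10 psi_bound_11 psi_bound_12 psi_bound_13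

text \<open>Rows \<open>(l', c', L0, \<epsilon>)\<close>, starting at 1133/125, slightly below ln
  8640. The steps are arranged to end at the points 12, 24, 32, ... where the next bound for \<psi>
  becomes available, and at 4000, where the generic bound takes over.\<close>

definition step_table :: "(real \<times> real \<times> real \<times> real) list" where
  "step_table = [
   (467/50, 223419/100000, 1133/125, 13/125), (243/25, 113703/50000, 1133/125, 13/125), (1021/100, 232323/100000, 1133/125, 13/125), (1083/100, 29777/12500, 1133/125, 13/125),
   (287/25, 122021/50000, 1133/125, 13/125), (12, 248471/100000, 1133/125, 13/125), (72/5, 66663/25000, 12, 223/2500), (432/25, 284833/100000, 12, 223/2500),
   (497/25, 149413/50000, 12, 223/2500), (2187/100, 154179/50000, 12, 223/2500), (2319/100, 39277/12500, 12, 223/2500), (24, 19853/6250, 12, 223/2500),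
   (138/5, 331601/100000, 24, 1927/25000), (759/25, 85281/25000, 24, 1927/25000), (797/25, 43251/12500, 24, 1927/25000), (32, 346383/100000, 24, 1927/25000),
   (184/5, 22521/6250, 32, 6561/100000), (159/4, 368043/100000, 32, 6561/100000), (41, 185569/50000, 32, 6561/100000), (943/20, 385091/100000, 41, 5613/100000),
   (5093/100, 196399/50000, 41, 5613/100000), (52, 394877/100000, 41, 5613/100000), (299/5, 40883/10000, 52, 4829/100000), (6459/100, 416531/100000, 52, 4829/100000),
   (65, 417163/100000, 52, 4829/100000), (78, 27209/6250, 65, 791/20000), (2106/25, 110759/25000, 65, 791/20000), (86, 445103/100000, 65, 791/20000),
   (516/5, 115821/25000, 86, 63/2000), (11559/100, 474609/100000, 86, 63/2000), (117, 475821/100000, 86, 63/2000), (702/5, 247001/50000, 117, 307/12500),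
   (629/4, 126331/25000, 117, 307/12500), (162, 508299/100000, 117, 307/12500), (1134/5, 16926/3125, 162, 429/25000), (12701/50, 276477/50000, 162, 429/25000),
   (257, 13853/2500, 162, 429/25000), (1799/5, 587453/100000, 257, 63/6250), (10794/25, 302817/50000, 257, 63/6250), (49653/100, 154897/25000, 257, 63/6250),
   (499, 155021/25000, 257, 63/6250), (3493/5, 653417/100000, 499, 371/100000), (24451/25, 2747/400, 499, 371/100000), (68463/50, 720083/100000, 499, 371/100000),
   (41078/25, 147653/20000, 499, 371/100000), (1664, 739527/100000, 499, 371/100000), (11648/5, 38643/5000, 1664, 61/100000), (81536/25, 806193/100000, 1664, 61/100000),
   (4000, 413267/50000, 1664, 61/100000)]"

lemma step_table: "steps_ok (1133/125) (11021/5000) step_table"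
  by (simp add: step_table_def psi_bounds)

section \<open>Assembly of the ranges\<close>

lemma pi_ok:
  assumes "n \<ge> 1"
  shows "pi_ok n"
proof -
  consider "n = 1" | "2 \<le> n" "n \<le> 240" | "240 < n" "n \<le> 8640" | "8640 \<le> n" using assms by linarith
  then show ?thesis
  proof cases
    case 1
    have "prime_count 0 1 = 0" using prime_count_Suc[of 0] prime_count_0 by simp
    then show ?thesis unfolding pi_ok_def 1 by (intro exI[of _ 0]) simp
  next
    case 2
    have pc: "prime_count 0 (2 - 1) \<le> 0" using prime_count_Suc[of 0] prime_count_0 by simp
    show ?thesis by (rule small_ok[OF small_table(1) _ pc]) (use 2 small_table(2) in auto)
  next
    case 3
    show ?thesis by (rule chain_ok[OF chain_table]) (use 3 prime_count_30 in \<open>simp_all add: chain_table_end[unfolded One_nat_def]\<close>)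
  next
    case 4
    define L where "L = ln (real n)"
    have eL: "exp L = real n" using 4 by (simp add: L_def)
    show ?thesis
    proof (cases "L \<le> 4000")
      case True
      have "ln (8640::real) \<le> L" unfolding L_def using 4 by (subst ln_le_cancel_iff) auto
      then have l: "1133/125 \<le> L" using ln_smooth_ge[of "(6, 3, 1)"] by (simp add: smooth_def smooth_ln'_def)
      have c: "11021/5000 \<le> ln (1133/125 :: real)"
        using ln_ratio_ge[of 9 "1133/125"] ln_realpow[of 3 2] ln_3_ge by simp
      show ?thesis
        by (rule steps_ok[OF prime_count_8640 4 L_def step_table _ c l]) (use True in \<open>auto simp: step_table_def\<close>)
    next
      case False
      then have "L \<ge> 4000" by simp
      from pi_ok_generic[OF prime_count_8640 4 L_def this psi_le_generic[OF this] ln_4000_bounds] show ?thesis .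
    qed
  qed
qed

theorem theorem1:
  fixes x :: real
  assumes "x \<ge> 0"
  shows "(x > 0 \<longrightarrow> real (primes_pi x) < x / lambert_W x \<and> x / lambert_W x = exp (lambert_W x)) \<and>
         (x = 0 \<longrightarrow> real (primes_pi x) < exp (lambert_W x) \<and> exp (lambert_W x) = 1)"
  by (rule theorem1_if_pi_ok[OF pi_ok assms])

end
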